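(* Let $n\le N$ be positive integers. (First part.) Let $X=(X_{ij})_{1\le i\le n,1\le j\le N}$ be a matrix of independent random variables whose laws belong to $\mathcal{L}(c_1,c_2)$ for some finite $c_1,c_2$, and let $A=N^{-1}XX^t$. Let $\lambda$ be the largest eigenvalue of $A$. Let $f(z)=\sum_{m=0}^\infty b_mz^m$ be an entire function and let $f_1(z)=\sum_{m=1}^\infty m|b_m|z^{m-1}$, $f_2(z)=\sum_{m=2}^\infty m(m-1)|b_m|z^{m-2}$. Let $$a=(\mathbb{E}(f_1(\lambda)^4\lambda^2))^{1/4},\qquad b=\bigl(\mathbb{E}(f_1(\lambda)+2n^{-1/2}f_2(\lambda)\lambda)^4\bigr)^{1/4}.$$ Suppose $W=\operatorname{Re}\operatorname{Tr}f(A)$ has finite fourth moment and let $\sigma^2=\mathrm{Var}(W)$. Let $Z$ be a normal random variable with the same mean and variance as $W$. Then $$d_{TV}(W,Z)\le\frac{8\sqrt5}{\sigma^2}\biggl(\frac{c_1c_2a^2\sqrt n}{N}+\frac{c_1^3abn}{N^{3/2}}\biggr).$$ (Second part.) If instead the entries of $X$ are jointly gaussian with mean $0$ and $nN\times nN$ covariance matrix $\Sigma$, all other notation and assumptions being the same, then $$d_{TV}(W,Z)\le\frac{8\sqrt5\,\|\Sigma\|^{3/2}abn}{\sigma^2N^{3/2}}.$$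
   Context: For $c_1,c_2>0$, $\mathcal{L}(c_1,c_2)$ is the class of probability measures on $\mathbb{R}$ that are laws of random variables $u(Z_0)$, where $Z_0$ is standard gaussian and $u:\mathbb{R}\to\mathbb{R}$ is twice continuously differentiable with $|u'|\le c_1$ and $|u''|\le c_2$ everywhere. $X^t$ is the transpose of $X$. $d_{TV}(W,Z)=\sup_B|\mathbb{P}(W\in B)-\mathbb{P}(Z\in B)|$ over Borel sets $B$. $\|\Sigma\|$ is the operator norm. *)

theory Defs
  imports "HOL-Probability.Probability"
begin

definition law_class :: "real \<Rightarrow> real \<Rightarrow> real measure set" where
  "law_class c1 c2 = {distr std_normal_distribution borel u | u.
     \<exists>u' u''. (\<forall>x. (u has_real_derivative u' x) (at x)) \<and>
              (\<forall>x. (u' has_real_derivative u'' x) (at x)) \<and>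
              continuous_on UNIV u'' \<and>
              (\<forall>x. \<bar>u' x\<bar> \<le> c1) \<and> (\<forall>x. \<bar>u'' x\<bar> \<le> c2)}"

text \<open>Normal law with mean \<open>\<mu>\<close> and variance \<open>v\<close>. The degenerate case \<open>v = 0\<close>, where there is no
  density, is the point mass at \<open>\<mu>\<close>.\<close>

definition normal_law :: "real \<Rightarrow> real \<Rightarrow> real measure" where
  "normal_law \<mu> v =
     (if v = 0 then return borel \<mu> else density lborel (normal_density \<mu> (sqrt v)))"

definition normal_rv :: "'a measure \<Rightarrow> ('a \<Rightarrow> real) \<Rightarrow> bool" where
  "normal_rv M Y \<longleftrightarrow> Y \<in> borel_measurable M \<and> (\<exists>\<mu> v. v \<ge> 0 \<and> distr M borel Y = normal_law \<mu> v)"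

text \<open>Degenerate normal combinations are allowed, so the covariance matrix may be singular.\<close>

definition jointly_gaussian :: "'a measure \<Rightarrow> ('i::finite \<Rightarrow> 'a \<Rightarrow> real) \<Rightarrow> bool" where
  "jointly_gaussian M Y \<longleftrightarrow> (\<forall>t :: 'i \<Rightarrow> real. normal_rv M (\<lambda>\<omega>. \<Sum>i\<in>UNIV. t i * Y i \<omega>))"

definition covariance :: "'a measure \<Rightarrow> ('a \<Rightarrow> real) \<Rightarrow> ('a \<Rightarrow> real) \<Rightarrow> real" where
  "covariance M Y Z =
     (\<integral>\<omega>. (Y \<omega> - (\<integral>\<omega>'. Y \<omega>' \<partial>M)) * (Z \<omega> - (\<integral>\<omega>'. Z \<omega>' \<partial>M)) \<partial>M)"

definition d_TV :: "'a measure \<Rightarrow> ('a \<Rightarrow> real) \<Rightarrow> 'b measure \<Rightarrow> ('b \<Rightarrow> real) \<Rightarrow> real" where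
  "d_TV M W M' Z = (SUP B\<in>sets (borel :: real measure).
     \<bar>measure M (W -` B \<inter> space M) - measure M' (Z -` B \<inter> space M')\<bar>)"

text \<open>\<open>Max\<close> is meaningful for symmetric matrices, whose set of real eigenvalues is nonempty.\<close>

definition largest_eigenvalue :: "real^'n^'n \<Rightarrow> real" where
  "largest_eigenvalue A = Max {k. \<exists>v. v \<noteq> 0 \<and> A *v v = k *\<^sub>R v}"

definition matrix_power :: "'a::semiring_1^'n^'n \<Rightarrow> nat \<Rightarrow> 'a^'n^'n" where
  "matrix_power A m = (((**) A) ^^ m) (mat 1)"

text \<open>\<open>f(A)\<close> for the power series \<open>f\<close> with coefficients \<open>b\<close>; the left factor \<open>mat (b m)\<close> is
  multiplication by the scalar \<open>b m\<close>.\<close>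

definition matrix_series :: "(nat \<Rightarrow> complex) \<Rightarrow> complex^'n^'n \<Rightarrow> complex^'n^'n" where
  "matrix_series b A = (\<Sum>m. mat (b m) ** matrix_power A m)"

text \<open>The terms with \<open>m = 0\<close> (and \<open>m = 1\<close> for the second series) vanish because of the leading
  factor, so the truncated subtraction in the exponent is harmless.\<close>

definition abs_series1 :: "(nat \<Rightarrow> complex) \<Rightarrow> real \<Rightarrow> real" where
  "abs_series1 b x = (\<Sum>m. real m * cmod (b m) * x ^ (m - 1))"

definition abs_series2 :: "(nat \<Rightarrow> complex) \<Rightarrow> real \<Rightarrow> real" where
  "abs_series2 b x = (\<Sum>m. real m * (real m - 1) * cmod (b m) * x ^ (m - 2))"

text \<open>\<open>(\<E> Y\<^sup>4)\<^bsup>1/4\<^esup>\<close> for a random variable \<open>Y\<^sup>4 = G \<ge> 0\<close>, with value \<open>\<infinity>\<close> if the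
  expectation is infinite.\<close>

definition fourth_root_expectation :: "'a measure \<Rightarrow> ('a \<Rightarrow> real) \<Rightarrow> ennreal" where
  "fourth_root_expectation M G =
     (let E = \<integral>\<^sup>+\<omega>. ennreal (G \<omega>) \<partial>M in if E = \<infinity> then \<infinity> else ennreal (root 4 (enn2real E)))"

end

(*
  Both random matrices have the law of Psi(G) for a standard gaussian matrix G, where Psi is an
  entrywise C^2 map or a linear map.  For h = Re Tr f(Psi) and a solution g of the Stein equation,
  E g(h) (h - E h) is rewritten by gaussian interpolation along G_t = cos t G + sin t G', which
  produces the integral over t of sin t E g'(h(G)) <grad h(G), grad h(G_t)>.  Hence the distance to
  the normal law is controlled by the mean absolute deviations of these inner products, and the
  Poincare inequality reduces them to the gradient and Hessian of h.  A compactly supported cutoff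
  makes every function bounded; its error vanishes in the limit, thanks to the finite fourth
  moments.  The derivatives of Re Tr f(A) in the entries of X are estimated by f_1 and f_2 at the
  largest eigenvalue of A.  The argument yields the constant 16, which is at most 8 sqrt 5.
*)
theory Submission
  imports Defs
begin

section \<open>Characteristic functions on Euclidean spaces\<close>

text \<open>The difficulty is integrability: only fourth moments in the largest eigenvalue are at
  hand, while the Hessian and the gradient enter at two correlated points, \<open>x\<close> and
  \<open>fst (rot \<theta> z)\<close>. The square of their pairing is therefore never bounded by a
  product. Weighted arithmetic-geometric means split it into a function of one point plus a function
  of the other, each integrated against the law of \<open>G\<close>; three free weights, optimised
  only at the end, restore the products \<open>a^2\<close> and \<open>a * b\<close>.

  The variance is itself an interpolation, of \<open>h\<close> with itself, so the whole Stein error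
  is one interpolation of a centred inner product.

  The two summands of the first bound mirror the Hessian after an entrywise map: its diagonal part
  is \<open>u''\<close> times the gradient and pairs gradient with gradient, the rest pairs Hessian
  with gradient. A linear map has no diagonal part, hence the single summand of the second bound.

  The constant 16 is 2 (bound on \<open>f'\<close>) times 2 (the inner product has two arguments,
  each contributing to its gradient) times 4 (the factor 2 from differentiating
  \<open>X ** transpose X\<close>, once in each paired term).\<close>

lemma borel_measurable_cis [measurable]: "(cis :: real \<Rightarrow> complex) \<in> borel_measurable borel"
  by (intro borel_measurable_continuous_onI continuous_intros)

lemma integrable_cis [simp]:
  fixes g :: "'a \<Rightarrow> real"
  assumes "finite_measure M" and [measurable]: "g \<in> borel_measurable M"
  shows "integrable M (\<lambda>x. cis (g x))"
proof -
  interpret finite_measure M by fact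
  show ?thesis by (rule integrable_const_bound[where B=1]) auto
qed

text \<open>The masses agree at \<open>t = 0\<close>. Zero mass is trivial; otherwise both measures
  are divided by the common mass and Levy uniqueness for probability measures applies.\<close>

lemma finite_Levy_uniqueness:
  assumes "finite_measure M1" "finite_measure M2"
    and s1: "sets M1 = sets (borel :: real measure)" and s2: "sets M2 = sets (borel :: real measure)"
    and eq: "\<And>t. (\<integral>x. cis (t * x) \<partial>M1) = (\<integral>x. cis (t * x) \<partial>M2)"
  shows "M1 = M2"
proof -
  interpret A: finite_measure M1 by fact
  interpret B: finite_measure M2 by fact
  have sp: "space M1 = UNIV" "space M2 = UNIV"
    using sets_eq_imp_space_eq[OF s1] sets_eq_imp_space_eq[OF s2] by auto
  note [measurable_cong] = s1 s2
  define c where "c = measure M1 UNIV"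
  have c2: "c = measure M2 UNIV"
    using eq[of 0] by (simp add: c_def sp)
  show ?thesis
  proof (cases "c = 0")
    case True
    have "emeasure M1 UNIV = 0" "emeasure M2 UNIV = 0"
      using True c2 A.emeasure_eq_measure[of UNIV] B.emeasure_eq_measure[of UNIV] by (auto simp: c_def)
    then show ?thesis
      by (intro measure_eqI) (auto simp: s1 s2 emeasure_eq_0[of UNIV])
  next
    case False
    then have c: "c > 0" by (simp add: c_def zero_less_measure_iff)
    define d where "d = ennreal (1/c)"
    have iff: "1 / c * c = 1" using c by simp
    have p1: "prob_space (scale_measure d M1)"
      by (rule prob_spaceI) (use c in \<open>simp add: sp space_scale_measure A.emeasure_eq_measure d_def c_def[symmetric] ennreal_mult[symmetric] del: ennreal_1 flip: ennreal_1\<close>)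
    have p2: "prob_space (scale_measure d M2)"
      by (rule prob_spaceI) (use c in \<open>simp add: sp space_scale_measure B.emeasure_eq_measure d_def c2[symmetric] ennreal_mult[symmetric] del: ennreal_1 flip: ennreal_1\<close>)
    have sc: "scale_measure d M = density M (\<lambda>_. d)" for M :: "real measure"
      by (intro measure_eqI) (auto simp: emeasure_density nn_integral_cmult)
    have "char (scale_measure d M1) = char (scale_measure d M2)"
    proof
      fix t
      have "char (scale_measure d M1) t = (1/c) *\<^sub>R (\<integral>x. cis (t * x) \<partial>M1)"
        unfolding char_def sc unfolding d_def using c
        by (subst integral_density) (auto simp: cis_conv_exp[symmetric] mult_ac simp flip: of_real_mult)
      moreover have "char (scale_measure d M2) t = (1/c) *\<^sub>R (\<integral>x. cis (t * x) \<partial>M2)"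
        unfolding char_def sc unfolding d_def using c
        by (subst integral_density) (auto simp: cis_conv_exp[symmetric] mult_ac simp flip: of_real_mult)
      ultimately show "char (scale_measure d M1) t = char (scale_measure d M2) t"
        using eq by simp
    qed
    then have "scale_measure d M1 = scale_measure d M2"
      using p1 p2 by (intro Levy_uniqueness) (auto simp: real_distribution_def real_distribution_axioms_def s1 s2 sp)
    then have "scale_measure (ennreal c) (scale_measure d M1) = scale_measure (ennreal c) (scale_measure d M2)"
      by simp
    moreover have "ennreal c * d = 1"
      using c by (simp add: d_def ennreal_mult[symmetric])
    ultimately show ?thesis
      by simp
  qed
qed

text \<open>Reduction to the line, one coordinate at a time. The induction over \<open>J\<close>
  inserts indicators of arbitrary Borel sets for the coordinates in \<open>J\<close> while the
  character in all coordinates is kept, so that the next coordinate can still be tested. With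
  \<open>J = Basis\<close> and \<open>t = 0\<close>, boxes get equal measure.\<close>

lemma char_fun_unique:
  fixes M1 M2 :: "'a::euclidean_space measure"
  assumes "finite_measure M1" "finite_measure M2" and s1: "sets M1 = sets borel" and s2: "sets M2 = sets borel"
    and eq: "\<And>t. (\<integral>x. cis (t \<bullet> x) \<partial>M1) = (\<integral>x. cis (t \<bullet> x) \<partial>M2)"
  shows "M1 = M2"
proof -
  interpret A: finite_measure M1 by fact
  interpret B: finite_measure M2 by fact
  have sp: "space M1 = UNIV" "space M2 = UNIV"
    using sets_eq_imp_space_eq[OF s1] sets_eq_imp_space_eq[OF s2] by auto
  have [measurable_cong]: "sets M1 = sets borel" "sets M2 = sets borel" by fact+
  define ind where "ind J B x = (\<Prod>j\<in>J. indicator (B j) (x \<bullet> j) :: real)" for J :: "'a set" and B :: "'a \<Rightarrow> real set" and x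
  have ind_m: "(\<And>j. B j \<in> sets borel) \<Longrightarrow> ind J B \<in> borel_measurable borel" for J B
    unfolding ind_def[abs_def] by (intro borel_measurable_prod borel_measurable_indicator' measurable_sets_borel) auto
  have ind_01: "0 \<le> ind J B x" "ind J B x \<le> 1" for J B x
    unfolding ind_def by (auto intro!: prod_nonneg prod_le_1 simp: indicator_def)
  have main: "(\<integral>x. ind J B x *\<^sub>R cis (t \<bullet> x) \<partial>M1) = (\<integral>x. ind J B x *\<^sub>R cis (t \<bullet> x) \<partial>M2)"
    if "finite J" "\<And>j. B j \<in> sets borel" for J B t
    using that(1)
  proof (induction J arbitrary: t)
    case empty
    then show ?case using eq by (simp add: ind_def)
  next
    case (insert k J)
    note [measurable] = that(2)
    have [measurable]: "ind J B \<in> borel_measurable borel" by (rule ind_m) (rule that)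
    \<comment> \<open>A density must be nonnegative, but the weights of interest are
      \<open>cos (t \<bullet> x)\<close> and \<open>sin (t \<bullet> x)\<close>. Adding 1 repairs
      this; the summand 1 is removed afterwards by the case \<open>g = 0\<close>.\<close>
    have step: "(\<integral>x. (ind J B x * (1 + g x)) * indicator (B k) (x \<bullet> k) \<partial>M1) = (\<integral>x. (ind J B x * (1 + g x)) * indicator (B k) (x \<bullet> k) \<partial>M2)"
      (is "?l = ?r")
      if g [measurable]: "g \<in> borel_measurable borel" and gb: "\<And>x. \<bar>g x\<bar> \<le> 1"
        and ge: "\<And>s. (\<integral>x. (ind J B x * g x) *\<^sub>R cis (s * (x \<bullet> k)) \<partial>M1) = (\<integral>x. (ind J B x * g x) *\<^sub>R cis (s * (x \<bullet> k)) \<partial>M2)" for g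
    proof -
      define w where "w x = ind J B x * (1 + g x)" for x
      have w0: "0 \<le> w x" "\<bar>w x\<bar> \<le> 2" for x
      proof -
        show "0 \<le> w x" using gb[of x] ind_01[of J B x] by (auto simp: w_def abs_le_iff)
        moreover have "w x \<le> 1 * 2"
          unfolding w_def using gb[of x] ind_01[of J B x] by (intro mult_mono) (auto simp: abs_le_iff)
        ultimately show "\<bar>w x\<bar> \<le> 2" by simp
      qed
      have [measurable]: "w \<in> borel_measurable borel" unfolding w_def[abs_def] by measurable
      define L where "L M = distr (density M (\<lambda>x. ennreal (w x))) borel (\<lambda>x. x \<bullet> k)" for M :: "'a measure"
      have fin: "finite_measure (L M)" if "finite_measure M" and [measurable_cong]: "sets M = sets borel" for M
      proof -
        interpret finite_measure M by fact
        have "emeasure (L M) UNIV = (\<integral>\<^sup>+x. ennreal (w x) \<partial>M)"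
          unfolding L_def by (subst emeasure_distr) (auto simp: emeasure_density sets_eq_imp_space_eq[OF that(2)])
        also have "\<dots> \<le> (\<integral>\<^sup>+x. ennreal 2 \<partial>M)" using w0 by (intro nn_integral_mono ennreal_leI) (auto simp: abs_le_iff)
        also have "\<dots> < \<infinity>" by (simp add: ennreal_mult_less_top emeasure_eq_measure)
        finally show ?thesis by (intro finite_measureI) (auto simp: L_def)
      qed
      have intL: "(\<integral>y. h y \<partial>L M) = (\<integral>x. w x *\<^sub>R h (x \<bullet> k) \<partial>M)"
        if [measurable_cong]: "sets M = sets borel" and [measurable]: "h \<in> borel_measurable borel"
        for M and h :: "real \<Rightarrow> 'c::{banach,second_countable_topology}"
        unfolding L_def using w0
        by (subst integral_distr) (auto simp: integral_density)
      have "L M1 = L M2"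
      proof (rule finite_Levy_uniqueness)
        fix s :: real
        have "(\<integral>x. w x *\<^sub>R cis (s * (x \<bullet> k)) \<partial>M) = (\<integral>x. ind J B x *\<^sub>R cis ((s *\<^sub>R k) \<bullet> x) \<partial>M)
            + (\<integral>x. (ind J B x * g x) *\<^sub>R cis (s * (x \<bullet> k)) \<partial>M)" if "finite_measure M" and [measurable_cong]: "sets M = sets borel" for M
        proof -
          interpret finite_measure M by fact
          have "\<bar>ind J B x * g x\<bar> \<le> 1" for x
            using gb[of x] ind_01[of J B x] by (simp add: abs_mult mult_le_one)
          then show ?thesis
            using ind_01[of J B]
            by (subst Bochner_Integration.integral_add[symmetric])
              (auto intro!: integrable_const_bound[where B=1] Bochner_Integration.integral_cong simp: w_def algebra_simps inner_commute)
        qed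
        then show "(\<integral>x. cis (s * x) \<partial>L M1) = (\<integral>x. cis (s * x) \<partial>L M2)"
          using insert.IH[of "s *\<^sub>R k"] ge[of s] by (simp add: intL s1 s2 assms)
      qed (auto intro!: fin assms, simp_all add: L_def)
      then have "(\<integral>y. indicator (B k) y \<partial>L M1) = (\<integral>y. indicator (B k) y \<partial>L M2 :: real)" by (rule arg_cong)
      then show ?thesis by (simp add: intL s1 s2 w_def del: Bochner_Integration.integral_indicator)
    qed
    have split: "(\<integral>x. (ind J B x * (1 + g x)) * indicator (B k) (x \<bullet> k) \<partial>M) =
       (\<integral>x. ind J B x * indicator (B k) (x \<bullet> k) \<partial>M) + (\<integral>x. ind J B x * g x * indicator (B k) (x \<bullet> k) \<partial>M)"
      if g [measurable]: "g \<in> borel_measurable borel" and gb: "\<And>x. \<bar>g x\<bar> \<le> 1"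
        and "finite_measure M" and [measurable_cong]: "sets M = sets borel" for M g
    proof -
      interpret finite_measure M by fact
      have "\<bar>ind J B x * g x * indicator (B k) (x \<bullet> k)\<bar> \<le> 1" "\<bar>ind J B x * indicator (B k) (x \<bullet> k)\<bar> \<le> 1" for x
        using gb[of x] ind_01[of J B x] by (auto simp: abs_mult mult_le_one indicator_def)
      then show ?thesis
        by (subst Bochner_Integration.integral_add[symmetric])
           (auto intro!: integrable_const_bound[where B=1] Bochner_Integration.integral_cong simp: algebra_simps)
    qed
    have z: "(\<integral>x. ind J B x * indicator (B k) (x \<bullet> k) \<partial>M1) = (\<integral>x. ind J B x * indicator (B k) (x \<bullet> k) \<partial>M2)"
      using step[of "\<lambda>_. 0"] by simp
    have gen: "(\<integral>x. ind J B x * g x * indicator (B k) (x \<bullet> k) \<partial>M1) = (\<integral>x. ind J B x * g x * indicator (B k) (x \<bullet> k) \<partial>M2)"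
      if g: "g \<in> borel_measurable borel" "\<And>x. \<bar>g x\<bar> \<le> 1"
        "\<And>s. (\<integral>x. (ind J B x * g x) *\<^sub>R cis (s * (x \<bullet> k)) \<partial>M1) = (\<integral>x. (ind J B x * g x) *\<^sub>R cis (s * (x \<bullet> k)) \<partial>M2)" for g
      using step[OF g] z by (simp add: split g assms)
    have bi: "integrable M (\<lambda>x. ind J B x *\<^sub>R cis (u \<bullet> x))" if "finite_measure M" and [measurable_cong]: "sets M = sets borel" for M u
    proof -
      interpret finite_measure M by fact
      show ?thesis using ind_01[of J B] by (intro integrable_const_bound[where B=1]) auto
    qed
    \<comment> \<open>Product-to-sum: multiplying by \<open>cos (t \<bullet> x)\<close> turns a
      character in direction \<open>k\<close> into two characters at \<open>s k + t\<close> and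
      \<open>s k - t\<close>, to which the induction hypothesis applies. The sine is treated
      alike.\<close>
    have cosp: "(\<integral>x. (ind J B x * cos (t \<bullet> x)) *\<^sub>R cis (s * (x \<bullet> k)) \<partial>M) =
        (1/2) *\<^sub>R ((\<integral>x. ind J B x *\<^sub>R cis ((t + s *\<^sub>R k) \<bullet> x) \<partial>M) + (\<integral>x. ind J B x *\<^sub>R cis ((s *\<^sub>R k - t) \<bullet> x) \<partial>M))"
      if "finite_measure M" and [measurable_cong]: "sets M = sets borel" for M s
    proof -
      have "(\<integral>x. (ind J B x * cos (t \<bullet> x)) *\<^sub>R cis (s * (x \<bullet> k)) \<partial>M) =
        (\<integral>x. (1/2) *\<^sub>R (ind J B x *\<^sub>R cis ((t + s *\<^sub>R k) \<bullet> x) + ind J B x *\<^sub>R cis ((s *\<^sub>R k - t) \<bullet> x)) \<partial>M)"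
        by (intro Bochner_Integration.integral_cong)
           (auto simp: complex_eq_iff inner_simps cos_add sin_add cos_diff sin_diff inner_commute algebra_simps)
      then show ?thesis using that by (simp only: integral_scaleR_right Bochner_Integration.integral_add bi)
    qed
    have sinp: "(\<integral>x. (ind J B x * sin (t \<bullet> x)) *\<^sub>R cis (s * (x \<bullet> k)) \<partial>M) =
        (- \<i>/2) * ((\<integral>x. ind J B x *\<^sub>R cis ((t + s *\<^sub>R k) \<bullet> x) \<partial>M) - (\<integral>x. ind J B x *\<^sub>R cis ((s *\<^sub>R k - t) \<bullet> x) \<partial>M))"
      if "finite_measure M" and [measurable_cong]: "sets M = sets borel" for M s
    proof -
      have "(\<integral>x. (ind J B x * sin (t \<bullet> x)) *\<^sub>R cis (s * (x \<bullet> k)) \<partial>M) =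
        (\<integral>x. (- \<i>/2) * (ind J B x *\<^sub>R cis ((t + s *\<^sub>R k) \<bullet> x) - ind J B x *\<^sub>R cis ((s *\<^sub>R k - t) \<bullet> x)) \<partial>M)"
        by (intro Bochner_Integration.integral_cong)
           (auto simp: complex_eq_iff inner_simps cos_add sin_add cos_diff sin_diff inner_commute field_simps)
      then show ?thesis using that by (simp only: integral_mult_right_zero Bochner_Integration.integral_diff bi)
    qed
    have c: "(\<integral>x. ind J B x * cos (t \<bullet> x) * indicator (B k) (x \<bullet> k) \<partial>M1) = (\<integral>x. ind J B x * cos (t \<bullet> x) * indicator (B k) (x \<bullet> k) \<partial>M2)"
      by (rule gen) (simp_all add: cosp assms insert.IH)
    have s: "(\<integral>x. ind J B x * sin (t \<bullet> x) * indicator (B k) (x \<bullet> k) \<partial>M1) = (\<integral>x. ind J B x * sin (t \<bullet> x) * indicator (B k) (x \<bullet> k) \<partial>M2)"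
      by (rule gen) (simp_all add: sinp assms insert.IH)
    have fi: "(\<integral>x. ind (insert k J) B x *\<^sub>R cis (t \<bullet> x) \<partial>M) =
      Complex (\<integral>x. ind J B x * cos (t \<bullet> x) * indicator (B k) (x \<bullet> k) \<partial>M) (\<integral>x. ind J B x * sin (t \<bullet> x) * indicator (B k) (x \<bullet> k) \<partial>M)"
      if "finite_measure M" and [measurable_cong]: "sets M = sets borel" for M
    proof -
      interpret finite_measure M by fact
      have [measurable]: "ind (insert k J) B \<in> borel_measurable borel" by (rule ind_m) (rule \<open>\<And>j. B j \<in> sets borel\<close>)
      have i: "integrable M (\<lambda>x. ind (insert k J) B x *\<^sub>R cis (t \<bullet> x))"
        using ind_01[of "insert k J" B] by (intro integrable_const_bound[where B=1]) auto
      have e: "ind (insert k J) B x = ind J B x * indicator (B k) (x \<bullet> k)" for x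
        using insert by (simp add: ind_def)
      show ?thesis
        by (rule complex_eqI) (simp_all add: i flip: integral_Re integral_Im, simp_all add: e mult_ac)
    qed
    show ?case using c s by (simp add: fi assms)
  qed
  show ?thesis
  proof (rule measure_eqI_generator_eq)
    let ?E = "range (\<lambda>(a, b). box a b::'a set)"
    show "Int_stable ?E" by (auto simp: Int_stable_def box_Int_box)
    show "?E \<subseteq> Pow UNIV" "sets M1 = sigma_sets UNIV ?E" "sets M2 = sigma_sets UNIV ?E"
      by (simp_all add: borel_eq_box s1 s2)
    let ?A = "\<lambda>n::nat. box (- (real n *\<^sub>R One)) (real n *\<^sub>R One) :: 'a set"
    show "range ?A \<subseteq> ?E" "(\<Union>i. ?A i) = UNIV" unfolding UN_box_eq_UNIV by auto
    show "emeasure M1 (?A i) \<noteq> \<infinity>" for i by simp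
    show "emeasure M1 X = emeasure M2 X" if "X \<in> ?E" for X
    proof -
      from that obtain a b where X: "X = box a b" by auto
      define B where "B j = {a \<bullet> j<..<b \<bullet> j}" for j
      have i: "indicator X x = ind Basis B x" for x
        by (auto simp: X ind_def B_def box_def indicator_def)
      have "measure M X = Re (\<integral>x. ind Basis B x *\<^sub>R cis (0 \<bullet> x) \<partial>M)" if "finite_measure M" and [measurable_cong]: "sets M = sets borel" for M
      proof -
        interpret finite_measure M by fact
        have "X \<in> sets M" by (simp add: X that)
        then have "measure M X = (\<integral>x. indicator X x \<partial>M)"
          by simp
        also have "\<dots> = (\<integral>x. ind Basis B x \<partial>M)" by (simp add: i)
        finally show ?thesis by (simp add: of_real_def[symmetric])
      qed
      from this[OF assms(1) s1] this[OF assms(2) s2] main[of Basis B 0]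
      show ?thesis by (simp add: A.emeasure_eq_measure B.emeasure_eq_measure B_def)
    qed
  qed
qed

section \<open>Standard gaussian measures\<close>

text \<open>Defined on every Euclidean space, so that matrices, and pairs of matrices under
  \<open>rot\<close>, carry it without a change of notation.\<close>

definition std_gauss :: "'a::euclidean_space measure" where
  "std_gauss = distr (PiM Basis (\<lambda>_. std_normal_distribution)) borel (\<lambda>x. \<Sum>b\<in>Basis. x b *\<^sub>R b)"

lemma std_gauss_map_measurable [measurable]:
  "(\<lambda>x. \<Sum>b\<in>Basis. x b *\<^sub>R b) \<in> PiM Basis (\<lambda>_. std_normal_distribution) \<rightarrow>\<^sub>M (borel :: 'a::euclidean_space measure)"
  by (intro borel_measurable_sum borel_measurable_scaleR) (auto intro!: measurable_component_singleton simp: )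

lemma sets_std_gauss [simp, measurable_cong]: "sets std_gauss = sets borel"
  and space_std_gauss [simp]: "space std_gauss = UNIV"
  by (auto simp: std_gauss_def)

lemma prob_space_std_gauss: "prob_space std_gauss"
proof -
  interpret P: prob_space "PiM Basis (\<lambda>_. std_normal_distribution)"
    by (intro prob_space_PiM prob_space_normal_density) simp
  show ?thesis unfolding std_gauss_def by (rule P.prob_space_distr) measurable
qed

interpretation std_gauss: prob_space std_gauss
  by (rule prob_space_std_gauss)

lemma integral_std_gauss_prod:
  fixes g :: "'a::euclidean_space \<Rightarrow> real \<Rightarrow> 'b::{real_normed_field,banach,second_countable_topology}"
  assumes g: "\<And>b. b \<in> Basis \<Longrightarrow> integrable std_normal_distribution (g b)"
  shows "(\<integral>x. (\<Prod>b\<in>Basis. g b (x \<bullet> b)) \<partial>std_gauss) = (\<Prod>b\<in>Basis. \<integral>y. g b y \<partial>std_normal_distribution)"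
proof -
  interpret std_normal: product_prob_space "\<lambda>_::'a. std_normal_distribution"
    by (intro product_prob_spaceI prob_space_normal_density) simp
  have [measurable]: "\<And>b. b \<in> Basis \<Longrightarrow> g b \<in> borel_measurable borel"
    using borel_measurable_integrable[OF g] by (simp cong: measurable_cong_sets)
  have "(\<integral>x. (\<Prod>b\<in>Basis. g b (x \<bullet> b)) \<partial>std_gauss) =
    (\<integral>x. (\<Prod>b\<in>Basis. g b (x b)) \<partial>PiM Basis (\<lambda>_. std_normal_distribution))"
    unfolding std_gauss_def
    by (subst integral_distr) (auto intro!: Bochner_Integration.integral_cong prod.cong simp: inner_sum_left inner_Basis if_distrib cong: if_cong)
  also have "\<dots> = (\<Prod>b\<in>Basis. \<integral>y. g b y \<partial>std_normal_distribution)"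
    by (rule std_normal.product_integral_prod) (auto simp: g)
  finally show ?thesis .
qed

lemma cis_sum: "finite A \<Longrightarrow> cis (\<Sum>i\<in>A. f i) = (\<Prod>i\<in>A. cis (f i))"
  by (induction A rule: finite_induct) (auto simp: cis_mult[symmetric])

lemma integral_cis_std_gauss:
  "(\<integral>x. cis (t \<bullet> x) \<partial>std_gauss) = of_real (exp (- (norm t)\<^sup>2 / 2))"
proof -
  have n: "(\<integral>y. cis (s * y) \<partial>std_normal_distribution) = of_real (exp (- s\<^sup>2 / 2))" for s
    using char_std_normal_distribution by (auto simp: char_def cis_conv_exp mult_ac dest!: fun_cong[of _ _ s])
  have "(\<integral>x. cis (t \<bullet> x) \<partial>std_gauss) = (\<integral>x. (\<Prod>b\<in>Basis. cis ((t \<bullet> b) * (x \<bullet> b))) \<partial>std_gauss)"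
    by (subst euclidean_inner) (simp add: cis_sum)
  also have "\<dots> = (\<Prod>b\<in>Basis. \<integral>y. cis ((t \<bullet> b) * y) \<partial>std_normal_distribution)"
    by (rule integral_std_gauss_prod[where g="\<lambda>b y. cis ((t \<bullet> b) * y)"])
       (auto intro!: integrable_cis prob_space.finite_measure prob_space_normal_density)
  also have "\<dots> = of_real (exp (- (norm t)\<^sup>2 / 2))"
    unfolding n of_real_prod[symmetric] 
    by (simp add: exp_sum[symmetric] power2_norm_eq_inner sum_negf sum_divide_distrib[symmetric])
      (metis (no_types, lifting) euclidean_inner power2_eq_square sum.cong)
  finally show ?thesis .
qed

lemma sets_pair_std_gauss: "sets (std_gauss \<Otimes>\<^sub>M std_gauss) = sets (borel :: ('a::euclidean_space \<times> 'b::euclidean_space) measure)"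
proof -
  have "sets (std_gauss \<Otimes>\<^sub>M std_gauss) = sets ((borel :: 'a measure) \<Otimes>\<^sub>M (borel :: 'b measure))"
    by (rule sets_pair_measure_cong) simp_all
  then show ?thesis by (simp only: borel_prod)
qed

interpretation std_gauss_pair: pair_prob_space std_gauss std_gauss ..

lemma integral_cis_pair:
  "(\<integral>z. cis (t \<bullet> z) \<partial>(std_gauss \<Otimes>\<^sub>M std_gauss)) = of_real (exp (- (norm t)\<^sup>2 / 2))"
proof -
  note [measurable_cong] = sets_pair_std_gauss
  have i: "integrable (std_gauss \<Otimes>\<^sub>M std_gauss) (\<lambda>z. cis (t \<bullet> z))"
    by (intro integrable_cis std_gauss_pair.P.finite_measure_axioms) measurable
  then have "(\<integral>z. cis (t \<bullet> z) \<partial>(std_gauss \<Otimes>\<^sub>M std_gauss)) = (\<integral>x. (\<integral>y. cis (t \<bullet> (x, y)) \<partial>std_gauss) \<partial>std_gauss)"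
    by (subst std_gauss_pair.integral_fst'[symmetric]) auto
  also have "\<dots> = (\<integral>x. (\<integral>y. cis (fst t \<bullet> x) * cis (snd t \<bullet> y) \<partial>std_gauss) \<partial>std_gauss)"
    by (simp add: inner_prod_def cis_mult)
  also have "\<dots> = of_real (exp (- (norm (fst t))\<^sup>2 / 2)) * of_real (exp (- (norm (snd t))\<^sup>2 / 2))"
    by (simp add: integral_cis_std_gauss)
  also have "\<dots> = of_real (exp (- (norm t)\<^sup>2 / 2))"
    by (simp add: norm_prod_def exp_add[symmetric] field_simps flip: of_real_mult)
  finally show ?thesis .
qed

text \<open>Both sides have the characteristic function \<open>exp (- (norm t)^2 / 2)\<close>. The
  left side is the form in which rotation invariance is proved, the right side the form to which
  Fubini applies.\<close>

lemma std_gauss_prod: "(std_gauss :: ('a::euclidean_space \<times> 'b::euclidean_space) measure) = std_gauss \<Otimes>\<^sub>M std_gauss"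
  by (rule char_fun_unique)
    (simp_all only: integral_cis_pair integral_cis_std_gauss sets_pair_std_gauss sets_std_gauss
      std_gauss.finite_measure_axioms std_gauss_pair.P.finite_measure_axioms)

text \<open>The characteristic function depends on \<open>t\<close> only through its norm, and
  taking the image under \<open>T\<close> replaces \<open>t\<close> by
  \<open>adjoint T t\<close>.\<close>

lemma std_gauss_isometry:
  fixes T :: "'a::euclidean_space \<Rightarrow> 'b::euclidean_space"
  assumes T: "linear T" and i: "\<And>y. norm (adjoint T y) = norm y"
  shows "distr std_gauss borel T = std_gauss"
proof -
  have [measurable]: "T \<in> borel_measurable borel"
    using T by (intro borel_measurable_continuous_onI linear_continuous_on linear_conv_bounded_linear[THEN iffD1])
  show ?thesis
  proof (rule char_fun_unique)
    fix t
    have "(\<integral>x. cis (t \<bullet> x) \<partial>distr std_gauss borel T) = (\<integral>x. cis (adjoint T t \<bullet> x) \<partial>std_gauss)"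
      by (subst integral_distr) (auto simp: adjoint_works[OF T] inner_commute)
    then show "(\<integral>x. cis (t \<bullet> x) \<partial>distr std_gauss borel T) = (\<integral>x. cis (t \<bullet> x) \<partial>std_gauss)"
      by (simp add: integral_cis_std_gauss i)
  qed (auto intro!: prob_space.finite_measure std_gauss.prob_space_distr std_gauss.prob_space_axioms)
qed

text \<open>Rotating a pair of independent gaussian vectors by \<open>\<theta>\<close> interpolates between the vector and an
  independent copy: the first component of \<open>rot \<theta>\<close> is \<open>cos \<theta> X + sin \<theta> X'\<close>.\<close>

definition rot :: "real \<Rightarrow> 'a::euclidean_space \<times> 'a \<Rightarrow> 'a \<times> 'a" where
  "rot \<theta> z = (cos \<theta> *\<^sub>R fst z + sin \<theta> *\<^sub>R snd z, cos \<theta> *\<^sub>R snd z - sin \<theta> *\<^sub>R fst z)"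

lemma linear_rot: "linear (rot \<theta>)"
  by (rule linearI) (auto simp: rot_def algebra_simps)

lemma norm_rot: "norm (rot \<theta> z) = norm z"
proof -
  have "(norm (rot \<theta> z))\<^sup>2 = ((cos \<theta>)\<^sup>2 + (sin \<theta>)\<^sup>2) * (fst z \<bullet> fst z + snd z \<bullet> snd z)"
    unfolding power2_norm_eq_inner by (simp add: rot_def inner_prod_def inner_simps inner_commute power2_eq_square algebra_simps del: sin_cos_squared_add sin_cos_squared_add2 sin_cos_squared_add3)
  also have "\<dots> = (norm z)\<^sup>2" by (simp add: power2_norm_eq_inner inner_prod_def)
  finally show ?thesis by simp
qed

lemma adjoint_rot: "adjoint (rot \<theta>) = rot (- \<theta>)"
  by (rule adjoint_unique) (simp add: rot_def inner_prod_def inner_simps inner_commute algebra_simps)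

lemma std_gauss_rot: "distr std_gauss borel (rot \<theta>) = std_gauss"
  by (rule std_gauss_isometry) (auto simp: linear_rot adjoint_rot norm_rot)

section \<open>Gaussian integration by parts\<close>

lemma std_normal_density_DERIV:
  "(std_normal_density has_real_derivative - x * std_normal_density x) (at x)"
  unfolding std_normal_density_def[abs_def]
  by (auto intro!: derivative_eq_intros simp: field_simps power2_eq_square)

lemma tendsto_std_normal_density:
  "(std_normal_density \<longlongrightarrow> 0) at_top" "(std_normal_density \<longlongrightarrow> 0) at_bot"
proof -
  have e: "((\<lambda>x::real. exp (- (x / 2))) \<longlongrightarrow> 0) at_top"
    by (rule filterlim_compose[OF exp_at_bot]) (use filterlim_tendsto_pos_mult_at_top[OF tendsto_const[of "1/2"] _ filterlim_ident] in \<open>simp add: filterlim_uminus_at_bot\<close>)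
  have a: "((\<lambda>x::real. exp (- x\<^sup>2 / 2)) \<longlongrightarrow> 0) at_top"
  proof (rule tendsto_sandwich[OF _ _ tendsto_const e])
    show "\<forall>\<^sub>F x in at_top. exp (- x\<^sup>2 / 2) \<le> exp (- (x / 2) :: real)"
      using eventually_ge_at_top[of "1::real"]
      by eventually_elim (simp add: power2_eq_square mult_right_le_one_le)
  qed auto
  have b: "((\<lambda>x::real. exp (- x\<^sup>2 / 2)) \<longlongrightarrow> 0) at_bot"
    using a by (simp add: filterlim_at_bot_mirror)
  show "(std_normal_density \<longlongrightarrow> 0) at_top" "(std_normal_density \<longlongrightarrow> 0) at_bot"
    using tendsto_mult_left[OF a, of "1 / sqrt (2 * pi)"] tendsto_mult_left[OF b, of "1 / sqrt (2 * pi)"]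
    by (simp_all add: std_normal_density_def[abs_def])
qed

text \<open>\<open>std_normal_density x * (\<phi>' x - x * \<phi> x)\<close> is the derivative of
  \<open>std_normal_density x * \<phi> x\<close>, which vanishes at both ends because \<phi> is
  bounded.\<close>

lemma std_normal_stein_1:
  fixes \<phi> \<phi>' :: "real \<Rightarrow> real"
  assumes d: "\<And>x. (\<phi> has_real_derivative \<phi>' x) (at x)" and c: "continuous_on UNIV \<phi>'"
    and b: "\<And>x. \<bar>\<phi> x\<bar> \<le> B" "\<And>x. \<bar>\<phi>' x\<bar> \<le> B'"
  shows "(\<integral>x. x * \<phi> x \<partial>std_normal_distribution) = (\<integral>x. \<phi>' x \<partial>std_normal_distribution)"
proof -
  have c\<phi>: "continuous_on UNIV \<phi>" using d by (meson DERIV_continuous_on DERIV_subset subset_UNIV)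
  have [measurable]: "\<phi> \<in> borel_measurable borel" "\<phi>' \<in> borel_measurable borel"
    using c c\<phi> by (auto intro: borel_measurable_continuous_onI)
  interpret N: prob_space std_normal_distribution by (intro prob_space_normal_density) simp
  have i1: "integrable std_normal_distribution \<phi>'"
    by (rule N.integrable_const_bound[where B=B']) (auto simp: b)
  have i2: "integrable std_normal_distribution (\<lambda>x. x * \<phi> x)"
  proof (rule Bochner_Integration.integrable_bound)
    show "integrable std_normal_distribution (\<lambda>x. B * x ^ 1)"
      by (intro integrable_mult_right integrable_std_normal_distribution_moment)
    have "0 \<le> B" using b(1)[of 0] by simp
    then show "AE x in std_normal_distribution. norm (x * \<phi> x) \<le> norm (B * x ^ 1)"
      using b(1) by (intro AE_I2) (simp, simp add: abs_mult, metis abs_ge_zero mult.commute mult_left_mono)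
  qed auto
  let ?f = "\<lambda>x. std_normal_density x * (\<phi>' x - x * \<phi> x)"
  have i3: "integrable std_normal_distribution (\<lambda>x. \<phi>' x - x * \<phi> x)" using i1 i2 by simp
  then have il: "integrable lborel ?f"
    by (subst (asm) integrable_density) auto
  have "(LBINT x=-\<infinity>..\<infinity>. ?f x) = 0 - 0"
  proof (rule interval_integral_FTC_integrable[where F="\<lambda>x. std_normal_density x * \<phi> x"])
    fix x :: real
    have "((\<lambda>x. std_normal_density x * \<phi> x) has_real_derivative ?f x) (at x)"
      by (rule derivative_eq_intros std_normal_density_DERIV d refl)+ (simp add: algebra_simps)
    then show "((\<lambda>x. std_normal_density x * \<phi> x) has_vector_derivative ?f x) (at x)"
      by (simp add: has_real_derivative_iff_has_vector_derivative)
    show "isCont ?f x"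
      using c c\<phi> std_normal_density_DERIV[THEN DERIV_isCont]
      by (auto intro!: continuous_intros simp: continuous_on_eq_continuous_at)
  next
    show "set_integrable lborel (einterval (-\<infinity>) \<infinity>) ?f"
      using il by (simp add: set_integrable_def einterval_def)
    have z: "((\<lambda>x. std_normal_density x * \<phi> x) \<longlongrightarrow> 0) F" if "(std_normal_density \<longlongrightarrow> 0) F" for F
    proof (rule Lim_null_comparison)
      show "\<forall>\<^sub>F x in F. norm (std_normal_density x * \<phi> x) \<le> std_normal_density x * B"
        using b(1) by (auto simp: abs_mult intro!: mult_left_mono always_eventually)
      show "((\<lambda>x. std_normal_density x * B) \<longlongrightarrow> 0) F" using tendsto_mult_right[OF that, of B] by simp
    qed
    show "(((\<lambda>x. std_normal_density x * \<phi> x) \<circ> real_of_ereal) \<longlongrightarrow> 0) (at_right (- \<infinity>))"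
      "(((\<lambda>x. std_normal_density x * \<phi> x) \<circ> real_of_ereal) \<longlongrightarrow> 0) (at_left \<infinity>)"
      using z[OF tendsto_std_normal_density(1)] z[OF tendsto_std_normal_density(2)]
      by (simp_all add: ereal_tendsto_simps1)
  qed auto
  then have "(\<integral>x. ?f x \<partial>lborel) = 0"
    by (simp add: interval_lebesgue_integral_def set_lebesgue_integral_def einterval_def)
  then have "(\<integral>x. \<phi>' x - x * \<phi> x \<partial>std_normal_distribution) = 0"
    by (subst integral_density) auto
  then show ?thesis using i1 i2 by simp
qed

lemma distr_std_gauss_inner:
  assumes b: "b \<in> (Basis :: 'a::euclidean_space set)"
  shows "distr std_gauss borel (\<lambda>x. x \<bullet> b) = std_normal_distribution"
proof -
  have "distr std_gauss borel (\<lambda>x. x \<bullet> b) = distr (PiM Basis (\<lambda>_::'a. std_normal_distribution)) std_normal_distribution (\<lambda>x. x b)"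
    unfolding std_gauss_def using b
    by (subst distr_distr) (auto intro!: distr_cong simp: inner_sum_left inner_Basis if_distrib o_def cong: if_cong)
  also have "\<dots> = std_normal_distribution"
    using b by (intro distr_PiM_component prob_space_normal_density) simp_all
  finally show ?thesis .
qed

lemma integrable_std_gauss_inner:
  assumes b: "b \<in> (Basis :: 'a::euclidean_space set)"
  shows "integrable std_gauss (\<lambda>x. x \<bullet> b)"
proof -
  have "integrable (distr std_gauss borel (\<lambda>x. x \<bullet> b)) (\<lambda>x. x ^ 1)"
    unfolding distr_std_gauss_inner[OF b] by (rule integrable_std_normal_distribution_moment)
  then show ?thesis by (subst (asm) integrable_distr_eq) auto
qed

lemma integrable_std_gauss_norm: "integrable std_gauss (norm :: 'a::euclidean_space \<Rightarrow> real)"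
proof (rule Bochner_Integration.integrable_bound)
  show "integrable std_gauss (\<lambda>x::'a. \<Sum>b\<in>Basis. \<bar>x \<bullet> b\<bar>)"
    by (intro Bochner_Integration.integrable_sum integrable_abs integrable_std_gauss_inner)
  show "AE x::'a in std_gauss. norm (norm x) \<le> norm (\<Sum>b\<in>Basis. \<bar>x \<bullet> b\<bar>)"
    using norm_le_l1 by (auto simp: sum_nonneg)
qed auto

text \<open>The gradient is carried as an explicit vector field. Boundedness of the function and of
  its gradient makes every integral and every interchange of limits elementary; the cutoff supplies
  it later.\<close>

definition C1_bounded :: "('a::euclidean_space \<Rightarrow> real) \<Rightarrow> ('a \<Rightarrow> 'a) \<Rightarrow> bool" where
  "C1_bounded F p \<longleftrightarrow> (\<forall>x. (F has_derivative (\<lambda>v. p x \<bullet> v)) (at x)) \<and> continuous_on UNIV p \<and>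
     bounded (range F) \<and> bounded (range p)"

lemma C1_boundedD:
  assumes "C1_bounded F p"
  shows "(F has_derivative (\<lambda>v. p x \<bullet> v)) (at x)" "continuous_on UNIV p" "continuous_on UNIV F"
    "F \<in> borel_measurable borel" "p \<in> borel_measurable borel"
    "\<exists>B. \<forall>x. \<bar>F x\<bar> \<le> B" "\<exists>B. \<forall>x. norm (p x) \<le> B"
proof -
  show d: "(F has_derivative (\<lambda>v. p x \<bullet> v)) (at x)" and c: "continuous_on UNIV p" for x
    using assms by (auto simp: C1_bounded_def)
  show c2: "continuous_on UNIV F"
    using d by (meson continuous_at_imp_continuous_on has_derivative_continuous)
  show "F \<in> borel_measurable borel" "p \<in> borel_measurable borel"
    using c c2 by (auto intro: borel_measurable_continuous_onI)
  show "\<exists>B. \<forall>x. \<bar>F x\<bar> \<le> B" "\<exists>B. \<forall>x. norm (p x) \<le> B"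
    using assms by (auto simp: C1_bounded_def bounded_iff)
qed

text \<open>Fubini isolates the coordinate \<open>b\<close>; along each line in direction
  \<open>b\<close> the one-dimensional formula applies to \<open>F\<close>.\<close>

lemma std_gauss_stein_Basis:
  fixes F :: "'a::euclidean_space \<Rightarrow> real"
  assumes F: "C1_bounded F p" and b: "b \<in> Basis"
  shows "(\<integral>x. (x \<bullet> b) * F x \<partial>std_gauss) = (\<integral>x. p x \<bullet> b \<partial>std_gauss)"
proof -
  note [measurable] = C1_boundedD(4,5)[OF F]
  interpret std_normal: product_prob_space "\<lambda>_::'a. std_normal_distribution"
    by (intro product_prob_spaceI prob_space_normal_density) simp
  obtain B1 where B1: "\<And>x. \<bar>F x\<bar> \<le> B1" using C1_boundedD(6)[OF F] by auto
  obtain B2 where B2: "\<And>x. norm (p x) \<le> B2" using C1_boundedD(7)[OF F] by auto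
  define s where "s x = (\<Sum>c\<in>Basis. x c *\<^sub>R c :: 'a)" for x
  let ?P = "PiM Basis (\<lambda>_::'a. std_normal_distribution)"
  let ?Q = "PiM (Basis - {b}) (\<lambda>_::'a. std_normal_distribution)"
  have ib: "insert b (Basis - {b}) = Basis" using b by auto
  have eq: "(\<integral>x. h x \<partial>std_gauss) = (\<integral>x. (\<integral>y. h (s (x(b := y))) \<partial>std_normal_distribution) \<partial>?Q)"
    if i: "integrable std_gauss h" for h :: "'a \<Rightarrow> real"
  proof -
    have [measurable]: "h \<in> borel_measurable borel" using borel_measurable_integrable[OF i] by simp
    have "integrable ?P (\<lambda>x. h (s x))"
      using i unfolding std_gauss_def s_def by (subst (asm) integrable_distr_eq) auto
    moreover have "(\<integral>x. h x \<partial>std_gauss) = (\<integral>x. h (s x) \<partial>?P)"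
      unfolding std_gauss_def s_def by (subst integral_distr) auto
    ultimately show ?thesis
      using std_normal.product_integral_insert[of "Basis - {b}" b "\<lambda>x. h (s x)", unfolded ib] by simp
  qed
  define s0 where "s0 x = s (x(b := 0))" for x
  have s_upd: "s (x(b := y)) = s0 x + y *\<^sub>R b" for x y
    using b unfolding s0_def s_def by (subst (1 2) sum.remove[of Basis b]) (auto intro!: sum.cong simp: algebra_simps)
  have s_b: "s (x(b := y)) \<bullet> b = y" for x y
    using b unfolding s_def by (subst sum.remove[of Basis b]) (auto simp: inner_add_left inner_sum_left inner_Basis intro!: sum.neutral)
  have i1: "integrable std_gauss (\<lambda>x. (x \<bullet> b) * F x)"
  proof (rule Bochner_Integration.integrable_bound)
    show "integrable std_gauss (\<lambda>x. B1 * (x \<bullet> b))"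
      by (intro integrable_mult_right integrable_std_gauss_inner b)
    have "0 \<le> B1" using B1[of 0] by simp
    then show "AE x in std_gauss. norm ((x \<bullet> b) * F x) \<le> norm (B1 * (x \<bullet> b))"
      using B1 by (auto simp: abs_mult mult.commute intro!: mult_right_mono)
  qed auto
  have pb: "\<bar>p x \<bullet> b\<bar> \<le> B2" for x
    using norm_bound_Basis_le[OF b B2[of x]] by (simp add: inner_commute)
  have i2: "integrable std_gauss (\<lambda>x. p x \<bullet> b)"
    by (rule std_gauss.integrable_const_bound[where B=B2]) (auto simp: pb)
  have "(\<integral>y. y * F (s0 x + y *\<^sub>R b) \<partial>std_normal_distribution) =
      (\<integral>y. p (s0 x + y *\<^sub>R b) \<bullet> b \<partial>std_normal_distribution)" for x
  proof (rule std_normal_stein_1)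
    fix y
    let ?g = "\<lambda>y. s0 x + y *\<^sub>R b"
    have "((\<lambda>y. F (?g y)) has_derivative (\<lambda>v. p (?g y) \<bullet> (v *\<^sub>R b))) (at y)"
      by (rule has_derivative_compose[OF _ C1_boundedD(1)[OF F]]) (auto intro!: derivative_eq_intros)
    then show "((\<lambda>y. F (?g y)) has_real_derivative p (?g y) \<bullet> b) (at y)"
      by (simp add: has_field_derivative_def mult.commute[of _ "p (?g y) \<bullet> b"])
    show "continuous_on UNIV (\<lambda>y. p (?g y) \<bullet> b)"
      by (intro continuous_intros continuous_on_compose2[OF C1_boundedD(2)[OF F]]) auto
    show "\<bar>F (?g y)\<bar> \<le> B1" "\<bar>p (?g y) \<bullet> b\<bar> \<le> B2" by (rule B1 pb)+
  qed
  then show ?thesis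
    unfolding eq[OF i1] eq[OF i2] by (simp add: s_b) (simp add: s_upd)
qed

lemma std_gauss_stein:
  fixes F :: "'a::euclidean_space \<Rightarrow> real"
  assumes F: "C1_bounded F p"
  shows "(\<integral>x. F x * (w \<bullet> x) \<partial>std_gauss) = (\<integral>x. p x \<bullet> w \<partial>std_gauss)"
proof -
  note [measurable] = C1_boundedD(4,5)[OF F]
  obtain B1 where B1: "\<And>x. \<bar>F x\<bar> \<le> B1" using C1_boundedD(6)[OF F] by auto
  obtain B2 where B2: "\<And>x. norm (p x) \<le> B2" using C1_boundedD(7)[OF F] by auto
  have i1: "integrable std_gauss (\<lambda>x. (x \<bullet> b) * F x)" if b: "b \<in> Basis" for b
  proof (rule Bochner_Integration.integrable_bound)
    show "integrable std_gauss (\<lambda>x. B1 * (x \<bullet> b))"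
      by (intro integrable_mult_right integrable_std_gauss_inner b)
    have "0 \<le> B1" using B1[of 0] by simp
    then show "AE x in std_gauss. norm ((x \<bullet> b) * F x) \<le> norm (B1 * (x \<bullet> b))"
      using B1 by (auto simp: abs_mult mult.commute intro!: mult_right_mono)
  qed auto
  have i2: "integrable std_gauss (\<lambda>x. p x \<bullet> b)" if b: "b \<in> Basis" for b
    by (rule std_gauss.integrable_const_bound[where B=B2])
       (use norm_bound_Basis_le[OF b B2] in \<open>auto simp: inner_commute\<close>)
  have "(\<integral>x. F x * (w \<bullet> x) \<partial>std_gauss) = (\<integral>x. (\<Sum>b\<in>Basis. (w \<bullet> b) * ((x \<bullet> b) * F x)) \<partial>std_gauss)"
    by (subst euclidean_inner[of w]) (simp add: sum_distrib_left mult_ac)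
  also have "\<dots> = (\<Sum>b\<in>Basis. (w \<bullet> b) * (\<integral>x. p x \<bullet> b \<partial>std_gauss))"
    using i1 by (simp add: std_gauss_stein_Basis[OF F])
  also have "\<dots> = (\<integral>x. (\<Sum>b\<in>Basis. (w \<bullet> b) * (p x \<bullet> b)) \<partial>std_gauss)"
    using i2 by simp
  also have "\<dots> = (\<integral>x. p x \<bullet> w \<partial>std_gauss)"
    by (subst euclidean_inner[of "p _"]) (simp add: mult_ac)
  finally show ?thesis .
qed

section \<open>Gaussian interpolation and the Poincare inequality\<close>

lemma integral_rot:
  fixes h :: "'a::euclidean_space \<times> 'a \<Rightarrow> real"
  assumes [measurable]: "h \<in> borel_measurable borel"
  shows "(\<integral>z. h (rot \<theta> z) \<partial>std_gauss) = (\<integral>z. h z \<partial>std_gauss)"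
proof -
  have [measurable]: "rot \<theta> \<in> (borel :: ('a \<times> 'a) measure) \<rightarrow>\<^sub>M borel"
    by (intro borel_measurable_continuous_onI linear_continuous_on linear_conv_bounded_linear[THEN iffD1] linear_rot)
  have "(\<integral>z. h z \<partial>distr std_gauss borel (rot \<theta>)) = (\<integral>z. h (rot \<theta> z) \<partial>std_gauss)"
    by (subst integral_distr) auto
  then show ?thesis by (simp add: std_gauss_rot)
qed

lemma rot_inverse: "rot (- \<theta>) (rot \<theta> z) = z"
proof -
  have "cos \<theta> *\<^sub>R cos \<theta> *\<^sub>R x + sin \<theta> *\<^sub>R sin \<theta> *\<^sub>R x = ((cos \<theta>)\<^sup>2 + (sin \<theta>)\<^sup>2) *\<^sub>R x" for x :: 'a
    unfolding power2_eq_square scaleR_left_distrib by simp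
  then have *: "cos \<theta> *\<^sub>R cos \<theta> *\<^sub>R x + sin \<theta> *\<^sub>R sin \<theta> *\<^sub>R x = x" for x :: 'a by simp
  have "rot (- \<theta>) (rot \<theta> z) = (cos \<theta> *\<^sub>R cos \<theta> *\<^sub>R fst z + sin \<theta> *\<^sub>R sin \<theta> *\<^sub>R fst z,
      cos \<theta> *\<^sub>R cos \<theta> *\<^sub>R snd z + sin \<theta> *\<^sub>R sin \<theta> *\<^sub>R snd z)"
    by (simp add: rot_def scaleR_right_diff_distrib scaleR_add_right scaleR_left_commute[of "sin \<theta>" "cos \<theta>"])
  then show ?thesis by (simp only: * prod.collapse)
qed

lemma integral_std_gauss_fst_snd:
  fixes h :: "'a::euclidean_space \<times> 'b::euclidean_space \<Rightarrow> real"
  assumes "integrable std_gauss h"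
  shows "(\<integral>z. h z \<partial>std_gauss) = (\<integral>x. (\<integral>y. h (x, y) \<partial>std_gauss) \<partial>std_gauss)"
  using std_gauss_pair.integral_fst'[of h] assms by (simp add: std_gauss_prod)

lemma borel_measurable_fst_snd [measurable]:
  "fst \<in> (borel :: ('a::euclidean_space \<times> 'b::euclidean_space) measure) \<rightarrow>\<^sub>M borel"
  "snd \<in> (borel :: ('a::euclidean_space \<times> 'b::euclidean_space) measure) \<rightarrow>\<^sub>M borel"
  by (intro borel_measurable_continuous_onI continuous_intros)+

lemma distr_std_gauss_fst: "distr (std_gauss :: ('a::euclidean_space \<times> 'b::euclidean_space) measure) borel fst = std_gauss"
proof (rule char_fun_unique)
  fix t :: 'a
  have "(\<integral>x. cis (t \<bullet> x) \<partial>distr (std_gauss :: ('a \<times> 'b) measure) borel fst) = (\<integral>z. cis ((t, 0) \<bullet> z) \<partial>(std_gauss :: ('a \<times> 'b) measure))"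
    by (subst integral_distr) (auto simp: inner_prod_def)
  then show "(\<integral>x. cis (t \<bullet> x) \<partial>distr (std_gauss :: ('a \<times> 'b) measure) borel fst) = (\<integral>x. cis (t \<bullet> x) \<partial>std_gauss)"
    by (simp add: integral_cis_std_gauss norm_prod_def)
qed (auto intro!: prob_space.finite_measure std_gauss.prob_space_distr std_gauss.prob_space_axioms)

lemma integral_std_gauss_fst:
  fixes h :: "'a::euclidean_space \<Rightarrow> 'c::{banach, second_countable_topology}"
  assumes [measurable]: "h \<in> borel_measurable borel"
  shows "(\<integral>z. h (fst z) \<partial>(std_gauss :: ('a \<times> 'b::euclidean_space) measure)) = (\<integral>x. h x \<partial>std_gauss)"
  by (subst distr_std_gauss_fst[symmetric, where 'b='b], subst integral_distr) auto

lemma integrable_std_gauss_fst: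
  fixes h :: "'a::euclidean_space \<Rightarrow> 'c::{banach, second_countable_topology}"
  assumes [measurable]: "h \<in> borel_measurable borel"
  shows "integrable (std_gauss :: ('a \<times> 'b::euclidean_space) measure) (\<lambda>z. h (fst z)) \<longleftrightarrow> integrable std_gauss h"
  by (subst (2) distr_std_gauss_fst[symmetric, where 'b='b], subst integrable_distr_eq) auto

lemma integrable_rot_iff:
  fixes h :: "'a::euclidean_space \<times> 'a \<Rightarrow> real"
  assumes [measurable]: "h \<in> borel_measurable borel"
  shows "integrable std_gauss (\<lambda>z. h (rot \<theta> z)) \<longleftrightarrow> integrable std_gauss h"
proof -
  have [measurable]: "rot \<theta> \<in> (borel :: ('a \<times> 'a) measure) \<rightarrow>\<^sub>M borel"
    by (intro borel_measurable_continuous_onI linear_continuous_on linear_conv_bounded_linear[THEN iffD1] linear_rot)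
  show ?thesis
    by (subst (2) std_gauss_rot[symmetric, of \<theta>], subst integrable_distr_eq) auto
qed

lemma integrable_bounded_std_gauss:
  fixes h :: "'a::euclidean_space \<Rightarrow> 'b::{banach,second_countable_topology}"
  assumes "h \<in> borel_measurable borel" "\<And>x. norm (h x) \<le> B"
  shows "integrable std_gauss h"
  using assms by (intro std_gauss.integrable_const_bound[where B=B]) auto

lemma prob_std_gauss_UNIV [simp]: "measure std_gauss UNIV = 1"
  using std_gauss.prob_space by simp

lemma borel_measurable_rot [measurable]: "rot \<theta> \<in> (borel :: ('a::euclidean_space \<times> 'a) measure) \<rightarrow>\<^sub>M borel"
  by (intro borel_measurable_continuous_onI linear_continuous_on linear_conv_bounded_linear[THEN iffD1] linear_rot)

lemma integrable_std_gauss_norm_fst_snd: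
  "integrable (std_gauss :: ('a::euclidean_space \<times> 'b::euclidean_space) measure) (\<lambda>z. norm (fst z) + norm (snd z))"
proof (rule Bochner_Integration.integrable_bound)
  show "integrable std_gauss (\<lambda>z::'a \<times> 'b. 2 * norm z)"
    by (intro integrable_mult_right integrable_std_gauss_norm)
  have "norm (fst z) + norm (snd z) \<le> 2 * norm z" for z :: "'a \<times> 'b"
    using norm_fst_le[of "fst z" "snd z"] norm_snd_le[of "snd z" "fst z"] by simp
  then show "AE z::'a\<times>'b in std_gauss. norm (norm (fst z) + norm (snd z)) \<le> norm (2 * norm z)"
    by (intro AE_I2) auto
qed auto

text \<open>The derivative of the first component in the angle is the second component, which is the
  reason for letting \<open>rot\<close> keep both.\<close>

lemma DERIV_fst_rot:
  assumes G: "C1_bounded G p"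
  shows "((\<lambda>\<theta>. G (fst (rot \<theta> z))) has_real_derivative p (fst (rot \<theta> z)) \<bullet> snd (rot \<theta> z)) (at \<theta>)"
proof -
  have "((\<lambda>\<theta>. fst (rot \<theta> z)) has_vector_derivative snd (rot \<theta> z)) (at \<theta>)"
    unfolding rot_def by (auto intro!: derivative_eq_intros simp: has_real_derivative_iff_has_vector_derivative[symmetric])
  then have "((\<lambda>\<theta>. G (fst (rot \<theta> z))) has_derivative (\<lambda>v. p (fst (rot \<theta> z)) \<bullet> (v *\<^sub>R snd (rot \<theta> z)))) (at \<theta>)"
    unfolding has_vector_derivative_def by (rule has_derivative_compose[OF _ C1_boundedD(1)[OF G]])
  then show ?thesis
    by (simp add: has_field_derivative_def mult.commute[of _ "p _ \<bullet> _"])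
qed

lemma norm_snd_rot: "norm (snd (rot \<theta> z)) \<le> norm (fst z) + norm (snd z)"
proof -
  have "norm (snd (rot \<theta> z)) \<le> norm (cos \<theta> *\<^sub>R snd z) + norm (sin \<theta> *\<^sub>R fst z)"
    unfolding rot_def snd_conv by (rule norm_triangle_ineq4)
  also have "\<dots> \<le> 1 * norm (snd z) + 1 * norm (fst z)"
    unfolding norm_scaleR by (intro add_mono mult_right_mono) (auto simp: abs_le_iff)
  finally show ?thesis by simp
qed

lemma C1_bounded_affine:
  assumes F: "C1_bounded F p"
  shows "C1_bounded (\<lambda>y. F (a + s *\<^sub>R y)) (\<lambda>y. s *\<^sub>R p (a + s *\<^sub>R y))"
  unfolding C1_bounded_def
proof (intro conjI allI)
  fix y
  have "((\<lambda>y. F (a + s *\<^sub>R y)) has_derivative (\<lambda>v. p (a + s *\<^sub>R y) \<bullet> (s *\<^sub>R v))) (at y)"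
    by (rule has_derivative_compose[OF _ C1_boundedD(1)[OF F]]) (auto intro!: derivative_eq_intros)
  then show "((\<lambda>y. F (a + s *\<^sub>R y)) has_derivative (\<lambda>v. (s *\<^sub>R p (a + s *\<^sub>R y)) \<bullet> v)) (at y)"
    by simp
  show "continuous_on UNIV (\<lambda>y. s *\<^sub>R p (a + s *\<^sub>R y))"
    by (intro continuous_intros continuous_on_compose2[OF C1_boundedD(2)[OF F]]) auto
  obtain B1 B2 where B: "\<And>x. \<bar>F x\<bar> \<le> B1" "\<And>x. norm (p x) \<le> B2" using C1_boundedD(6,7)[OF F] by auto
  show "bounded (range (\<lambda>y. F (a + s *\<^sub>R y)))"
    unfolding bounded_iff using B(1) by (intro exI[of _ B1]) auto
  show "bounded (range (\<lambda>y. s *\<^sub>R p (a + s *\<^sub>R y)))"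
    unfolding bounded_iff using B(2) by (intro exI[of _ "\<bar>s\<bar> * B2"]) (auto intro!: mult_left_mono)
qed

text \<open>In rotated coordinates \<open>pG\<close> sits at \<open>x\<close> and \<open>F\<close>
  at \<open>cos \<theta> x - sin \<theta> y\<close>, with \<open>x\<close> and \<open>y\<close>
  independent. Integrating by parts in \<open>y\<close> differentiates \<open>F\<close> only and
  produces the factor \<open>- sin \<theta>\<close>; rotating back gives the statement.\<close>

lemma interpolation_by_parts:
  assumes F: "C1_bounded F pF" and G: "C1_bounded G pG"
  shows "(\<integral>z. F (fst z) * (pG (fst (rot \<theta> z)) \<bullet> snd (rot \<theta> z)) \<partial>std_gauss) =
    - sin \<theta> * (\<integral>z. pF (fst z) \<bullet> pG (fst (rot \<theta> z)) \<partial>std_gauss)"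
proof -
  note [measurable] = C1_boundedD(4,5)[OF F] C1_boundedD(4,5)[OF G]
  obtain B1 B2 where B: "\<And>x. \<bar>F x\<bar> \<le> B1" "\<And>x. norm (pF x) \<le> B2" using C1_boundedD(6,7)[OF F] by auto
  obtain B3 where B3: "\<And>x. norm (pG x) \<le> B3" using C1_boundedD(7)[OF G] by auto
  have B0: "0 \<le> B1" "0 \<le> B2" "0 \<le> B3" using order_trans[OF abs_ge_zero B(1)] order_trans[OF norm_ge_zero B(2)] order_trans[OF norm_ge_zero B3] by simp_all
  define k where "k w = F (fst (rot (- \<theta>) w)) * (pG (fst w) \<bullet> snd w)" for w
  define l where "l w = pF (fst (rot (- \<theta>) w)) \<bullet> pG (fst w)" for w
  have [measurable]: "k \<in> borel_measurable borel" "l \<in> borel_measurable borel"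
    unfolding k_def[abs_def] l_def[abs_def] by measurable
  have ik: "integrable std_gauss k"
  proof (rule Bochner_Integration.integrable_bound)
    show "integrable std_gauss (\<lambda>z::'a\<times>'a. (B1 * B3) * (norm (fst z) + norm (snd z)))"
      by (intro integrable_mult_right integrable_std_gauss_norm_fst_snd)
    have "\<bar>k w\<bar> \<le> B1 * B3 * (norm (fst w) + norm (snd w))" for w
    proof -
      have "\<bar>pG (fst w) \<bullet> snd w\<bar> \<le> B3 * norm (snd w)"
        using Cauchy_Schwarz_ineq2[of "pG (fst w)" "snd w"] mult_right_mono[OF B3[of "fst w"], of "norm (snd w)"] by simp
      then have "\<bar>k w\<bar> \<le> B1 * (B3 * norm (snd w))"
        unfolding k_def abs_mult using B B0 by (intro mult_mono) auto
      also have "\<dots> \<le> B1 * B3 * (norm (fst w) + norm (snd w))" using B0 by (simp add: distrib_left)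
      finally show ?thesis .
    qed
    then show "AE w in std_gauss. norm (k w) \<le> norm (B1 * B3 * (norm (fst w) + norm (snd w)))"
      using B0 by (intro AE_I2) (auto simp: abs_mult)
  qed auto
  have lb: "\<bar>l w\<bar> \<le> B2 * B3" for w
    unfolding l_def by (rule order_trans[OF Cauchy_Schwarz_ineq2], rule mult_mono) (auto simp: B(2) B3 B0)
  have il: "integrable std_gauss l"
    by (rule integrable_bounded_std_gauss[where B="B2*B3"]) (auto simp: lb)
  have "(\<integral>z. F (fst z) * (pG (fst (rot \<theta> z)) \<bullet> snd (rot \<theta> z)) \<partial>std_gauss) = (\<integral>z. k (rot \<theta> z) \<partial>std_gauss)"
    by (simp add: k_def rot_inverse)
  also have "\<dots> = (\<integral>z. k z \<partial>std_gauss)" by (rule integral_rot) measurable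
  also have "\<dots> = (\<integral>x. (\<integral>y. F (cos \<theta> *\<^sub>R x + (- sin \<theta>) *\<^sub>R y) * (pG x \<bullet> y) \<partial>std_gauss) \<partial>std_gauss)"
    by (subst integral_std_gauss_fst_snd[OF ik]) (simp add: k_def rot_def)
  also have "\<dots> = (\<integral>x. (\<integral>y. ((- sin \<theta>) *\<^sub>R pF (cos \<theta> *\<^sub>R x + (- sin \<theta>) *\<^sub>R y)) \<bullet> pG x \<partial>std_gauss) \<partial>std_gauss)"
    by (simp only: std_gauss_stein[OF C1_bounded_affine[OF F]])
  also have "\<dots> = (\<integral>x. - sin \<theta> * (\<integral>y. l (x, y) \<partial>std_gauss) \<partial>std_gauss)"
    by (simp add: l_def rot_def)
  also have "\<dots> = - sin \<theta> * (\<integral>z. l z \<partial>std_gauss)"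
    by (subst integral_mult_right_zero) (simp only: integral_std_gauss_fst_snd[OF il])
  also have "(\<integral>z. l z \<partial>std_gauss) = (\<integral>z. l (rot \<theta> z) \<partial>std_gauss)"
    by (rule integral_rot[symmetric]) measurable
  finally show ?thesis by (simp add: l_def rot_inverse)
qed

text \<open>Differentiation under the integral pairs \<open>pG\<close> with the second component of
  \<open>rot\<close>; integration by parts against that component turns this into a pairing of the
  two gradients.\<close>

lemma interpolation_DERIV:
  fixes F G :: "'a::euclidean_space \<Rightarrow> real"
  assumes F: "C1_bounded F pF" and G: "C1_bounded G pG"
  shows "((\<lambda>\<theta>. \<integral>z. F (fst z) * G (fst (rot \<theta> z)) \<partial>std_gauss) has_real_derivative
    - sin \<theta> * (\<integral>z. pF (fst z) \<bullet> pG (fst (rot \<theta> z)) \<partial>std_gauss)) (at \<theta>)"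
proof -
  note [measurable] = C1_boundedD(4,5)[OF F] C1_boundedD(4,5)[OF G]
  obtain B1 where B1: "\<And>x. \<bar>F x\<bar> \<le> B1" using C1_boundedD(6)[OF F] by auto
  obtain B2 where B2: "\<And>x. \<bar>G x\<bar> \<le> B2" using C1_boundedD(6)[OF G] by auto
  obtain B3 where B3: "\<And>x. norm (pG x) \<le> B3" using C1_boundedD(7)[OF G] by auto
  have B0: "0 \<le> B1" "0 \<le> B2" "0 \<le> B3" using order_trans[OF abs_ge_zero B1] order_trans[OF abs_ge_zero B2] order_trans[OF norm_ge_zero B3] by simp_all
  define D where "D \<theta> z = pG (fst (rot \<theta> z)) \<bullet> snd (rot \<theta> z)" for \<theta> z
  have D: "((\<lambda>\<theta>. G (fst (rot \<theta> z))) has_real_derivative D \<theta> z) (at \<theta>)" for \<theta> z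
    unfolding D_def by (rule DERIV_fst_rot[OF G])
  have Db: "\<bar>D \<theta> z\<bar> \<le> B3 * (norm (fst z) + norm (snd z))" for \<theta> z
    unfolding D_def by (rule order_trans[OF Cauchy_Schwarz_ineq2], rule mult_mono) (auto simp: B3 B0 norm_snd_rot)
  \<comment> \<open>The Lipschitz bound in the angle dominates all difference quotients by an
    integrable function of \<open>z\<close>.\<close>
  have lip: "\<bar>G (fst (rot t z)) - G (fst (rot \<theta> z))\<bar> \<le> B3 * (norm (fst z) + norm (snd z)) * \<bar>t - \<theta>\<bar>" for t z
    using field_differentiable_bound[of UNIV "\<lambda>\<theta>. G (fst (rot \<theta> z))" "\<lambda>\<theta>. D \<theta> z" "B3 * (norm (fst z) + norm (snd z))" \<theta> t]
    D[THEN has_field_derivative_at_within] Db by (simp add: abs_minus_commute)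
  define \<Phi> where "\<Phi> \<theta> = (\<integral>z. F (fst z) * G (fst (rot \<theta> z)) \<partial>std_gauss)" for \<theta>
  have ii: "integrable std_gauss (\<lambda>z. F (fst z) * G (fst (rot t z)))" for t
    by (rule integrable_bounded_std_gauss[where B="B1*B2"])
       (auto simp: abs_mult B0 intro!: mult_mono B1 B2)
  have "((\<lambda>t. (\<Phi> t - \<Phi> \<theta>) / (t - \<theta>)) \<longlongrightarrow> (\<integral>z. F (fst z) * D \<theta> z \<partial>std_gauss)) (at \<theta>)"
    unfolding tendsto_at_iff_sequentially
  proof (intro allI impI)
    fix X assume X: "\<forall>i. X i \<in> UNIV - {\<theta>}" "X \<longlonglongrightarrow> \<theta>"
    let ?q = "\<lambda>i z. F (fst z) * ((G (fst (rot (X i) z)) - G (fst (rot \<theta> z))) / (X i - \<theta>))"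
    have "(\<lambda>i. \<integral>z. ?q i z \<partial>std_gauss) \<longlonglongrightarrow> (\<integral>z. F (fst z) * D \<theta> z \<partial>std_gauss)"
    proof (rule integral_dominated_convergence)
      show "integrable std_gauss (\<lambda>z. B1 * (B3 * (norm (fst z) + norm (snd z :: 'a)) :: real))"
        by (intro integrable_mult_right integrable_std_gauss_norm_fst_snd)
      show "AE z in std_gauss. (\<lambda>i. ?q i z) \<longlonglongrightarrow> F (fst z) * D \<theta> z"
      proof (intro AE_I2 tendsto_mult tendsto_const)
        fix z
        show "(\<lambda>i. (G (fst (rot (X i) z)) - G (fst (rot \<theta> z))) / (X i - \<theta>)) \<longlonglongrightarrow> D \<theta> z"
          using D[of z \<theta>] X unfolding has_field_derivative_iff tendsto_at_iff_sequentially by (auto simp: o_def)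
      qed
      fix i
      have "\<bar>(G (fst (rot (X i) z)) - G (fst (rot \<theta> z))) / (X i - \<theta>)\<bar> \<le> B3 * (norm (fst z) + norm (snd z))" for z
      proof -
        have "0 < \<bar>X i - \<theta>\<bar>" using X by auto
        then show ?thesis using lip[of "X i" z] by (simp add: divide_le_eq)
      qed
      then show "AE z in std_gauss. norm (?q i z) \<le> B1 * (B3 * (norm (fst z) + norm (snd z)))"
        using B0 by (intro AE_I2) (simp only: real_norm_def abs_mult, intro mult_mono B1, auto)
      show "?q i \<in> borel_measurable std_gauss" by measurable
    next
      show "(\<lambda>z. F (fst z) * D \<theta> z) \<in> borel_measurable std_gauss" unfolding D_def by measurable
    qed
    moreover have "(\<integral>z. ?q i z \<partial>std_gauss) = (\<Phi> (X i) - \<Phi> \<theta>) / (X i - \<theta>)" for i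
      unfolding \<Phi>_def by (subst Bochner_Integration.integral_diff[symmetric, OF ii ii])
        (simp add: right_diff_distrib flip: Bochner_Integration.integral_divide_zero)
    ultimately show "((\<lambda>t. (\<Phi> t - \<Phi> \<theta>) / (t - \<theta>)) \<circ> X) \<longlonglongrightarrow> (\<integral>z. F (fst z) * D \<theta> z \<partial>std_gauss)"
      by (simp only: o_def)
  qed
  then have "(\<Phi> has_real_derivative (\<integral>z. F (fst z) * D \<theta> z \<partial>std_gauss)) (at \<theta>)"
    by (simp add: has_field_derivative_iff)
  then show ?thesis
    unfolding \<Phi>_def D_def interpolation_by_parts[OF F G] .
qed

text \<open>Comparison with \<open>E * cos\<close>: the difference is nondecreasing between 0 and
  \<open>pi/2\<close>, as the sine is nonnegative there. This stands in for integrating over the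
  angle, and since the sine has integral 1 over this range no constant is lost.\<close>

lemma DERIV_sin_bound:
  fixes D :: "real \<Rightarrow> real"
  assumes D: "\<And>\<theta>. (D has_real_derivative - sin \<theta> * e \<theta>) (at \<theta>)" and e: "\<And>\<theta>. e \<theta> \<le> E"
  shows "D 0 - D (pi/2) \<le> E"
proof -
  define g where "g \<theta> = D \<theta> - E * cos \<theta>" for \<theta>
  have "g 0 \<le> g (pi/2)"
  proof (rule DERIV_nonneg_imp_nondecreasing[where f=g and a=0 and b="pi/2"])
    fix x :: real assume x: "0 \<le> x" "x \<le> pi/2"
    have "(g has_real_derivative sin x * (E - e x)) (at x)"
      unfolding g_def[abs_def] by (auto intro!: derivative_eq_intros D simp: algebra_simps)
    moreover have "0 \<le> sin x * (E - e x)" using x e[of x] by (auto intro!: mult_nonneg_nonneg sin_ge_zero)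
    ultimately show "\<exists>y. (g has_real_derivative y) (at x) \<and> 0 \<le> y" by blast
  qed simp
  then show ?thesis by (simp add: g_def)
qed

text \<open>Angle 0 gives equal arguments and \<open>pi/2\<close> independent ones, so the change
  along the path is a covariance.\<close>

lemma integral_interpolation:
  fixes F G :: "'a::euclidean_space \<Rightarrow> real"
  assumes F: "C1_bounded F pF" and G: "C1_bounded G pG"
  shows "(\<integral>z. F (fst z) * G (fst (rot 0 z)) \<partial>std_gauss) = (\<integral>x. F x * G x \<partial>std_gauss)"
    "(\<integral>z. F (fst z) * G (fst (rot (pi/2) z)) \<partial>std_gauss) = (\<integral>x. F x \<partial>std_gauss) * (\<integral>x. G x \<partial>std_gauss)"
proof -
  note [measurable] = C1_boundedD(4,5)[OF F] C1_boundedD(4,5)[OF G]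
  obtain B1 where B1: "\<And>x. \<bar>F x\<bar> \<le> B1" using C1_boundedD(6)[OF F] by auto
  obtain B2 where B2: "\<And>x. \<bar>G x\<bar> \<le> B2" using C1_boundedD(6)[OF G] by auto
  have B0: "0 \<le> B1" "0 \<le> B2" using B1[of 0] B2[of 0] by auto
  show "(\<integral>z. F (fst z) * G (fst (rot 0 z)) \<partial>std_gauss) = (\<integral>x. F x * G x \<partial>std_gauss)"
    by (simp add: rot_def integral_std_gauss_fst[of "\<lambda>x. F x * G x"])
  have "integrable std_gauss (\<lambda>z. F (fst z) * G (snd z))"
    by (rule integrable_bounded_std_gauss[where B="B1*B2"])
       (auto simp: abs_mult B0 intro!: mult_mono B1 B2)
  then show "(\<integral>z. F (fst z) * G (fst (rot (pi/2) z)) \<partial>std_gauss) = (\<integral>x. F x \<partial>std_gauss) * (\<integral>x. G x \<partial>std_gauss)"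
    by (simp add: rot_def integral_std_gauss_fst_snd)
qed

lemma inner_le_half_squares: "x \<bullet> y \<le> ((norm x)\<^sup>2 + (norm y)\<^sup>2) / 2"
proof -
  have "0 \<le> (norm (x - y))\<^sup>2" by simp
  then show ?thesis by (simp add: power2_norm_eq_inner inner_simps inner_commute)
qed

text \<open>Interpolation of \<open>G\<close> with itself: the variance is governed by pairings of
  the gradient at two points with the same law, and each pairing is at most the mean squared norm at
  one of them.\<close>

lemma Poincare_bounded:
  fixes G :: "'a::euclidean_space \<Rightarrow> real"
  assumes G: "C1_bounded G p"
  shows "(\<integral>x. G x * G x \<partial>std_gauss) - (\<integral>x. G x \<partial>std_gauss) * (\<integral>x. G x \<partial>std_gauss) \<le> (\<integral>x. (norm (p x))\<^sup>2 \<partial>std_gauss)"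
proof -
  note [measurable] = C1_boundedD(4,5)[OF G]
  obtain B where B: "\<And>x. norm (p x) \<le> B" using C1_boundedD(7)[OF G] by auto
  have B0: "0 \<le> B" using B[of 0] norm_ge_zero order_trans by blast
  let ?V = "\<integral>x. (norm (p x))\<^sup>2 \<partial>std_gauss"
  have b2: "(norm (p x))\<^sup>2 \<le> B\<^sup>2" for x using B[of x] by (intro power_mono) auto
  have "(\<integral>z. p (fst z) \<bullet> p (fst (rot \<theta> z)) \<partial>std_gauss) \<le> ?V" for \<theta>
  proof -
    have "(\<integral>z. p (fst z) \<bullet> p (fst (rot \<theta> z)) \<partial>std_gauss) \<le>
      (\<integral>z. ((norm (p (fst z)))\<^sup>2 + (norm (p (fst (rot \<theta> z))))\<^sup>2) / 2 \<partial>std_gauss)"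
    proof (rule integral_mono)
      show "integrable std_gauss (\<lambda>z. p (fst z) \<bullet> p (fst (rot \<theta> z)))"
        using B B0 by (intro integrable_bounded_std_gauss[where B="B*B"])
          (auto intro!: order_trans[OF Cauchy_Schwarz_ineq2] mult_mono)
      show "integrable std_gauss (\<lambda>z. ((norm (p (fst z)))\<^sup>2 + (norm (p (fst (rot \<theta> z))))\<^sup>2) / 2)"
        using b2 by (intro integrable_bounded_std_gauss[where B="B\<^sup>2"]) (auto, smt (verit))
    qed (rule inner_le_half_squares)
    also have "\<dots> = ((\<integral>z. (norm (p (fst (z::'a\<times>'a))))\<^sup>2 \<partial>std_gauss) + (\<integral>z. (norm (p (fst (rot \<theta> z))))\<^sup>2 \<partial>std_gauss)) / 2"
      using b2 by (simp, subst Bochner_Integration.integral_add)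
        (auto intro!: integrable_bounded_std_gauss[where B="B\<^sup>2"])
    also have "(\<integral>z. (norm (p (fst (rot \<theta> z))))\<^sup>2 \<partial>std_gauss) = (\<integral>z. (norm (p (fst (z::'a\<times>'a))))\<^sup>2 \<partial>std_gauss)"
      by (rule integral_rot) measurable
    also have "(\<integral>z. (norm (p (fst (z::'a\<times>'a))))\<^sup>2 \<partial>std_gauss) = ?V"
      by (rule integral_std_gauss_fst) measurable
    finally show ?thesis by simp
  qed
  from DERIV_sin_bound[OF interpolation_DERIV[OF G G] this]
  show ?thesis by (simp only: integral_interpolation[OF G G])
qed

text \<open>The mean absolute deviation is at most the standard deviation, which the Poincare
  inequality bounds. The absolute deviation is the right quantity because it will be multiplied by a
  bounded \<open>f'\<close>.\<close>

lemma std_gauss_mean_abs_dev: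
  fixes G :: "'a::euclidean_space \<Rightarrow> real"
  assumes G: "C1_bounded G p"
  shows "(\<integral>x. \<bar>G x - (\<integral>x. G x \<partial>std_gauss)\<bar> \<partial>std_gauss) \<le> sqrt (\<integral>x. (norm (p x))\<^sup>2 \<partial>std_gauss)"
proof -
  note [measurable] = C1_boundedD(4,5)[OF G]
  obtain B where B: "\<And>x. \<bar>G x\<bar> \<le> B" using C1_boundedD(6)[OF G] by auto
  let ?m = "\<integral>x. G x \<partial>std_gauss"
  define Y where "Y x = \<bar>G x - ?m\<bar>" for x
  have [measurable]: "Y \<in> borel_measurable borel" unfolding Y_def[abs_def] by measurable
  have yb: "\<bar>Y x\<bar> \<le> B + \<bar>?m\<bar>" for x using B[of x] by (auto simp: Y_def)
  have iG: "integrable std_gauss G" by (rule integrable_bounded_std_gauss[where B=B]) (auto simp: B)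
  have iG2: "integrable std_gauss (\<lambda>x. (G x)\<^sup>2)"
    by (rule integrable_bounded_std_gauss[where B="B\<^sup>2"]) (use B in \<open>auto simp: abs_le_square_iff[symmetric] intro: order_trans[OF _ abs_ge_self]\<close>)
  have iY: "integrable std_gauss Y" by (rule integrable_bounded_std_gauss[where B="B + \<bar>?m\<bar>"]) (auto simp: yb)
  have Y2: "(Y x)\<^sup>2 = (G x)\<^sup>2 - 2 * ?m * G x + ?m\<^sup>2" for x by (simp add: Y_def power2_eq_square algebra_simps)
  have iY2: "integrable std_gauss (\<lambda>x. (Y x)\<^sup>2)"
    unfolding Y2 using iG iG2 by (intro Bochner_Integration.integrable_add Bochner_Integration.integrable_diff integrable_mult_right) auto
  have "(\<integral>x. Y x \<partial>std_gauss)\<^sup>2 \<le> (\<integral>x. (Y x)\<^sup>2 \<partial>std_gauss)"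
    using std_gauss.variance_positive[of Y] std_gauss.variance_eq[OF iY iY2] by simp
  also have "(\<integral>x. (Y x)\<^sup>2 \<partial>std_gauss) = (\<integral>x. G x * G x \<partial>std_gauss) - ?m * ?m"
    unfolding Y2 using iG iG2 by (simp add: power2_eq_square)
  also have "\<dots> \<le> (\<integral>x. (norm (p x))\<^sup>2 \<partial>std_gauss)" by (rule Poincare_bounded[OF G])
  finally have "\<bar>\<integral>x. Y x \<partial>std_gauss\<bar> \<le> sqrt (\<integral>x. (norm (p x))\<^sup>2 \<partial>std_gauss)"
    using real_le_rsqrt by force
  then show ?thesis by (simp add: Y_def)
qed

lemma linear_as_inner:
  fixes f :: "'a::euclidean_space \<Rightarrow> real"
  assumes "linear f"
  shows "(\<Sum>b\<in>Basis. f b *\<^sub>R b) \<bullet> v = f v"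
proof -
  have "f v = f (\<Sum>b\<in>Basis. (v \<bullet> b) *\<^sub>R b)" by (simp add: euclidean_representation)
  also have "\<dots> = (\<Sum>b\<in>Basis. (v \<bullet> b) * f b)"
    using assms by (simp add: linear_sum linear_cmul)
  finally show ?thesis by (simp add: inner_sum_left inner_commute[of v] mult.commute)
qed

lemma integral_fst_rot:
  fixes h :: "'a::euclidean_space \<Rightarrow> real"
  assumes [measurable]: "h \<in> borel_measurable borel"
  shows "(\<integral>z. h (fst (rot \<theta> z)) \<partial>std_gauss) = (\<integral>x. h x \<partial>std_gauss)"
    and "integrable std_gauss (\<lambda>z. h (fst (rot \<theta> z))) \<longleftrightarrow> integrable std_gauss h"
proof -
  show "(\<integral>z. h (fst (rot \<theta> z)) \<partial>std_gauss) = (\<integral>x. h x \<partial>std_gauss)"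
    using integral_rot[of "\<lambda>z. h (fst z)" \<theta>] integral_std_gauss_fst[OF assms, where 'b='a] by simp
  show "integrable std_gauss (\<lambda>z. h (fst (rot \<theta> z))) \<longleftrightarrow> integrable std_gauss h"
    using integrable_rot_iff[of "\<lambda>z. h (fst z)" \<theta>] integrable_std_gauss_fst[OF assms, where 'b='a] by simp
qed

lemma sqrt_sum_sq_bound:
  fixes q a b :: real
  assumes "q\<^sup>2 \<le> sqrt a * q + sqrt b * q" "0 \<le> q" "0 \<le> a" "0 \<le> b"
  shows "q\<^sup>2 \<le> 2 * (a + b)"
proof (cases "q = 0")
  case False
  then have "0 < q" using assms by simp
  moreover have "q * q \<le> (sqrt a + sqrt b) * q" using assms(1) by (simp add: power2_eq_square algebra_simps)
  ultimately have "q \<le> sqrt a + sqrt b" by simp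
  then have "q\<^sup>2 \<le> (sqrt a + sqrt b)\<^sup>2" using assms by (intro power_mono) auto
  also have "\<dots> \<le> 2 * (a + b)"
    using sum_squares_bound[of "sqrt a" "sqrt b"] assms by (simp add: power2_sum)
  finally show ?thesis .
qed (use assms in auto)

text \<open>The Poincare inequality is applied on the space of pairs to
  \<open>\<zeta> \<theta>\<close>, whose gradient \<open>q\<close> has one summand for each
  argument. Hypothesis \<open>R\<close> has the form \<open>r1 x + r2 y\<close> instead of a product
  because the correlated points \<open>fst z\<close> and \<open>fst (rot \<theta> z)\<close> are
  inserted: of a sum only the two marginal laws matter.\<close>

lemma gradient_inner_mean_abs_dev:
  fixes h :: "'a::euclidean_space \<Rightarrow> real"
  assumes h: "C1_bounded h p" and dp: "\<And>x. (p has_derivative H x) (at x)"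
    and cont: "\<And>v. continuous_on UNIV (\<lambda>x. H x v)" and Hb: "\<And>x v. norm (H x v) \<le> B * norm v"
    and R: "\<And>x y v. (H x v \<bullet> p y)\<^sup>2 \<le> (r1 x + r2 y) * (norm v)\<^sup>2"
    and r: "r1 \<in> borel_measurable borel" "r2 \<in> borel_measurable borel" "integrable std_gauss r1" "integrable std_gauss r2"
    and r0: "\<And>x. 0 \<le> r1 x" "\<And>x. 0 \<le> r2 x"
  defines "\<zeta> \<equiv> \<lambda>\<theta> z. p (fst z) \<bullet> p (fst (rot \<theta> z))"
  shows "(\<integral>z. \<bar>\<zeta> \<theta> z - (\<integral>w. \<zeta> \<theta> w \<partial>std_gauss)\<bar> \<partial>std_gauss) \<le> 2 * sqrt ((\<integral>x. r1 x \<partial>std_gauss) + (\<integral>x. r2 x \<partial>std_gauss))"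
proof -
  note [measurable] = C1_boundedD(4,5)[OF h] r(1,2)
  obtain P where P: "\<And>x. norm (p x) \<le> P" using C1_boundedD(7)[OF h] by auto
  have P0: "0 \<le> P" using order_trans[OF norm_ge_zero P] .
  obtain b0 :: 'a where b0: "b0 \<in> Basis" using nonempty_Basis by blast
  have B0: "0 \<le> B" using order_trans[OF norm_ge_zero Hb[of 0 b0]] b0 by simp
  define L where "L z v = H (fst z) (fst v) \<bullet> p (fst (rot \<theta> z)) + p (fst z) \<bullet> H (fst (rot \<theta> z)) (fst (rot \<theta> v))" for z v
  define q where "q z = (\<Sum>b\<in>Basis. L z b *\<^sub>R b)" for z
  have rot_d: "((\<lambda>z::'a\<times>'a. fst (rot \<theta> z)) has_derivative (\<lambda>v. fst (rot \<theta> v))) (at z)" for z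
    unfolding rot_def fst_conv by (intro derivative_intros)
  have dz: "(\<zeta> \<theta> has_derivative L z) (at z)" for z
    unfolding \<zeta>_def L_def[abs_def]
    using has_derivative_inner[OF has_derivative_compose[OF has_derivative_fst[OF has_derivative_ident] dp]
        has_derivative_compose[OF rot_d dp]]
    by (simp add: add.commute)
  have lin: "linear (L z)" for z using dz has_derivative_linear by blast
  have qL: "q z \<bullet> v = L z v" for z v unfolding q_def by (rule linear_as_inner[OF lin])
  have nr: "norm (fst (rot \<theta> v)) \<le> norm v" for v :: "'a \<times> 'a"
    using norm_fst_le[of "fst (rot \<theta> v)" "snd (rot \<theta> v)"] by (simp add: norm_rot)
  have nf: "norm (fst v) \<le> norm v" for v :: "'a \<times> 'a"
    using norm_fst_le[of "fst v" "snd v"] by simp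
  have Lb: "L z v \<le> 2 * B * P * norm v" for z v
  proof -
    have "H (fst z) (fst v) \<bullet> p (fst (rot \<theta> z)) \<le> (B * norm v) * P"
      using P0 B0 by (intro order_trans[OF norm_cauchy_schwarz] mult_mono P order_trans[OF Hb] mult_left_mono nf) auto
    moreover have "p (fst z) \<bullet> H (fst (rot \<theta> z)) (fst (rot \<theta> v)) \<le> P * (B * norm v)"
      using P0 B0 by (intro order_trans[OF norm_cauchy_schwarz] mult_mono P order_trans[OF Hb] mult_left_mono nr) auto
    moreover have "2 * B * P * norm v = B * norm v * P + P * (B * norm v)" by (simp add: algebra_simps)
    ultimately show ?thesis unfolding L_def by linarith
  qed
  have qb: "norm (q z) \<le> 2 * B * P" for z
  proof (cases "q z = 0")
    case False
    have "norm (q z) * norm (q z) \<le> (2 * B * P) * norm (q z)"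
      using Lb[of z "q z"] by (simp add: qL[symmetric] power2_norm_eq_inner[symmetric] power2_eq_square[symmetric])
    then show ?thesis using False by simp
  qed (use B0 P0 in simp)
  have cp: "continuous_on UNIV (\<lambda>z. p (f z))" if "continuous_on UNIV f" for f :: "'a \<times> 'a \<Rightarrow> 'a"
    by (rule continuous_on_compose2[OF C1_boundedD(2)[OF h] that]) auto
  have cH: "continuous_on UNIV (\<lambda>z. H (f z) v)" if "continuous_on UNIV f" for f :: "'a \<times> 'a \<Rightarrow> 'a" and v
    by (rule continuous_on_compose2[OF cont that]) auto
  have cr: "continuous_on UNIV (\<lambda>z::'a\<times>'a. fst (rot \<theta> z))"
    unfolding rot_def by (auto intro!: continuous_intros)
  have \<zeta>b: "\<bar>\<zeta> \<theta> z\<bar> \<le> P * P" for z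
    unfolding \<zeta>_def using P0 by (intro order_trans[OF Cauchy_Schwarz_ineq2] mult_mono P) auto
  have C: "C1_bounded (\<zeta> \<theta>) q"
    unfolding C1_bounded_def
  proof (intro conjI allI)
    show "(\<zeta> \<theta> has_derivative (\<lambda>v. q z \<bullet> v)) (at z)" for z unfolding qL using dz by (simp add: eta_contract_eq)
    show "continuous_on UNIV q"
      unfolding q_def[abs_def] L_def by (intro continuous_intros cp cH cr)
    show "bounded (range (\<zeta> \<theta>))" unfolding bounded_iff using \<zeta>b by (intro exI[of _ "P*P"]) auto
    show "bounded (range q)" unfolding bounded_iff using qb by (intro exI[of _ "2*B*P"]) auto
  qed
  note [measurable] = C1_boundedD(5)[OF C]
  define al where "al z = r1 (fst z) + r2 (fst (rot \<theta> z))" for z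
  define be where "be z = r1 (fst (rot \<theta> z)) + r2 (fst z)" for z
  \<comment> \<open>The gradient is tested against itself:
    \<open>q z \<bullet> q z = L z (q z)\<close>, and each of the two summands of \<open>L\<close>
    is bounded by \<open>R\<close>, with the roles of the two points exchanged in the
    second.\<close>
  have q2: "(norm (q z))\<^sup>2 \<le> 2 * (al z + be z)" for z
  proof (rule sqrt_sum_sq_bound)
    have "H (fst z) (fst (q z)) \<bullet> p (fst (rot \<theta> z)) \<le> sqrt (al z) * norm (q z)"
    proof -
      have "(H (fst z) (fst (q z)) \<bullet> p (fst (rot \<theta> z)))\<^sup>2 \<le> al z * (norm (q z))\<^sup>2"
        using r0 by (intro order_trans[OF R]) (auto simp: al_def intro!: mult_left_mono power_mono nf)
      then show ?thesis using real_le_rsqrt by (fastforce simp: real_sqrt_mult)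
    qed
    moreover have "p (fst z) \<bullet> H (fst (rot \<theta> z)) (fst (rot \<theta> (q z))) \<le> sqrt (be z) * norm (q z)"
    proof -
      have "(H (fst (rot \<theta> z)) (fst (rot \<theta> (q z))) \<bullet> p (fst z))\<^sup>2 \<le> be z * (norm (q z))\<^sup>2"
        using r0 by (intro order_trans[OF R]) (auto simp: be_def intro!: mult_left_mono power_mono nr)
      then show ?thesis using real_le_rsqrt by (fastforce simp: real_sqrt_mult inner_commute)
    qed
    ultimately show "(norm (q z))\<^sup>2 \<le> sqrt (al z) * norm (q z) + sqrt (be z) * norm (q z)"
      using qL[of z "q z"] by (simp add: power2_norm_eq_inner L_def)
  qed (use r0 in \<open>auto simp: al_def be_def\<close>)
  have i1: "integrable std_gauss (\<lambda>z::'a\<times>'a. r1 (fst z))" "integrable std_gauss (\<lambda>z::'a\<times>'a. r2 (fst z))"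
    using r by (auto simp: integrable_std_gauss_fst)
  have i2: "integrable std_gauss (\<lambda>z::'a\<times>'a. r1 (fst (rot \<theta> z)))" "integrable std_gauss (\<lambda>z::'a\<times>'a. r2 (fst (rot \<theta> z)))"
    using r by (auto simp: integral_fst_rot)
  have "(\<integral>z. (norm (q z))\<^sup>2 \<partial>std_gauss) \<le> (\<integral>z. 2 * (al z + be z) \<partial>std_gauss)"
  proof (rule integral_mono)
    show "integrable std_gauss (\<lambda>z. (norm (q z))\<^sup>2)"
      using qb by (intro integrable_bounded_std_gauss[where B="(2*B*P)\<^sup>2"]) (auto intro!: power_mono simp del: power_mult_distrib)
    show "integrable std_gauss (\<lambda>z. 2 * (al z + be z))"
      unfolding al_def be_def by (intro integrable_mult_right Bochner_Integration.integrable_add i1 i2)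
  qed (rule q2)
  \<comment> \<open>Both points are standard gaussian, so \<open>al\<close> and \<open>be\<close>
    each integrate to the sum of the integrals of \<open>r1\<close> and \<open>r2\<close>. With the
    factor 2 this gives 4, hence 2 after the square root.\<close>
  also have "\<dots> = 4 * ((\<integral>x. r1 x \<partial>std_gauss) + (\<integral>x. r2 x \<partial>std_gauss))"
    unfolding al_def be_def using i1 i2
    by (simp add: integral_fst_rot integral_std_gauss_fst)
  finally have "sqrt (\<integral>z. (norm (q z))\<^sup>2 \<partial>std_gauss) \<le> sqrt (4 * ((\<integral>x. r1 x \<partial>std_gauss) + (\<integral>x. r2 x \<partial>std_gauss)))"
    by simp
  then show ?thesis
    using std_gauss_mean_abs_dev[OF C] by (simp only: real_sqrt_mult) simp
qed

text \<open>With \<open>c\<close> the mean of \<open>f' (h x)\<close>, the left side is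
  \<open>c\<close> times the variance of \<open>h\<close> minus the covariance of
  \<open>f (h x)\<close> and \<open>h x\<close>. Both are interpolations with second function
  \<open>h\<close>; in the difference of their derivatives \<open>\<zeta> \<theta>\<close> occurs
  only minus its mean, so its mean absolute deviation is all that remains.\<close>

lemma stein_gap:
  fixes h :: "'a::euclidean_space \<Rightarrow> real"
  assumes h: "C1_bounded h p" and dp: "\<And>x. (p has_derivative H x) (at x)"
    and cont: "\<And>v. continuous_on UNIV (\<lambda>x. H x v)" and Hb: "\<And>x v. norm (H x v) \<le> B * norm v"
    and R: "\<And>x y v. (H x v \<bullet> p y)\<^sup>2 \<le> (r1 x + r2 y) * (norm v)\<^sup>2"
    and r: "r1 \<in> borel_measurable borel" "r2 \<in> borel_measurable borel" "integrable std_gauss r1" "integrable std_gauss r2"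
    and r0: "\<And>x. 0 \<le> r1 x" "\<And>x. 0 \<le> r2 x"
    and f: "\<And>w. (f has_real_derivative f' w) (at w)" "continuous_on UNIV f'" "\<And>w. \<bar>f w\<bar> \<le> C" "\<And>w. \<bar>f' w\<bar> \<le> K"
  shows "(\<integral>x. f' (h x) \<partial>std_gauss) * ((\<integral>x. h x * h x \<partial>std_gauss) - (\<integral>x. h x \<partial>std_gauss)\<^sup>2)
     - ((\<integral>x. f (h x) * h x \<partial>std_gauss) - (\<integral>x. f (h x) \<partial>std_gauss) * (\<integral>x. h x \<partial>std_gauss))
     \<le> 2 * K * sqrt ((\<integral>x. r1 x \<partial>std_gauss) + (\<integral>x. r2 x \<partial>std_gauss))"
proof -
  note [measurable] = C1_boundedD(4,5)[OF h]
  let ?S = "sqrt ((\<integral>x. r1 x \<partial>std_gauss) + (\<integral>x. r2 x \<partial>std_gauss))"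
  have [measurable]: "f' \<in> borel_measurable borel" using f(2) by (rule borel_measurable_continuous_onI)
  obtain P where P: "\<And>x. norm (p x) \<le> P" using C1_boundedD(7)[OF h] by auto
  have P0: "0 \<le> P" using order_trans[OF norm_ge_zero P] .
  have K0: "0 \<le> K" using order_trans[OF abs_ge_zero f(4)] .
  define c where "c = (\<integral>x. f' (h x) \<partial>std_gauss)"
  define F where "F x = f (h x)" for x
  define pF where "pF x = f' (h x) *\<^sub>R p x" for x
  have cF: "C1_bounded F pF"
    unfolding C1_bounded_def
  proof (intro conjI allI)
    fix x
    have "(F has_derivative (\<lambda>v. f' (h x) * (p x \<bullet> v))) (at x)"
      unfolding F_def[abs_def]
      by (rule has_derivative_compose[OF C1_boundedD(1)[OF h] f(1)[unfolded has_field_derivative_def]])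
    then show "(F has_derivative (\<lambda>v. pF x \<bullet> v)) (at x)" by (simp add: pF_def)
    show "continuous_on UNIV pF"
      unfolding pF_def[abs_def]
      by (intro continuous_intros C1_boundedD(2)[OF h] continuous_on_compose2[OF f(2) C1_boundedD(3)[OF h]]) auto
    show "bounded (range F)" unfolding bounded_iff F_def using f(3) by (intro exI[of _ C]) auto
    have "norm (pF x) \<le> K * P" for x unfolding pF_def norm_scaleR using f(4) P K0 by (intro mult_mono) auto
    then show "bounded (range pF)" unfolding bounded_iff by (intro exI[of _ "K*P"]) auto
  qed
  note [measurable] = C1_boundedD(4,5)[OF cF]
  define \<zeta> where "\<zeta> \<theta> z = p (fst z) \<bullet> p (fst (rot \<theta> z))" for \<theta> z
  have [measurable]: "\<zeta> \<theta> \<in> borel_measurable borel" for \<theta> unfolding \<zeta>_def[abs_def] by measurable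
  define m where "m \<theta> = (\<integral>z. \<zeta> \<theta> z \<partial>std_gauss)" for \<theta>
  have \<zeta>b: "\<bar>\<zeta> \<theta> z\<bar> \<le> P * P" for z \<theta>
    unfolding \<zeta>_def using P0 by (intro order_trans[OF Cauchy_Schwarz_ineq2] mult_mono P) auto
  have i\<zeta>: "integrable std_gauss (\<zeta> \<theta>)" for \<theta>
    by (rule integrable_bounded_std_gauss[where B="P*P"]) (auto simp: \<zeta>b)
  have i1: "integrable std_gauss (\<lambda>z. f' (h (fst z)) * \<zeta> \<theta> z)" for \<theta>
    by (rule integrable_bounded_std_gauss[where B="K*(P*P)"]) (auto simp: abs_mult \<zeta>b f(4) K0 intro!: mult_mono)
  have i2: "integrable std_gauss (\<lambda>z::'a\<times>'a. f' (h (fst z)))"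
    by (rule integrable_bounded_std_gauss[where B=K]) (auto simp: f(4))
  have c2: "(\<integral>z. f' (h (fst (z::'a\<times>'a))) \<partial>std_gauss) = c"
    unfolding c_def by (rule integral_std_gauss_fst) measurable
  \<comment> \<open>As \<open>c\<close> is the mean of \<open>f' (h (fst z))\<close>, the product
    \<open>c * m \<theta>\<close> can be moved under the integral, which centres
    \<open>\<zeta> \<theta>\<close>.\<close>
  define e where "e \<theta> = c * m \<theta> - (\<integral>z. f' (h (fst z)) * \<zeta> \<theta> z \<partial>std_gauss)" for \<theta>
  have eb: "e \<theta> \<le> 2 * K * ?S" for \<theta>
  proof -
    have "e \<theta> = (\<integral>z. f' (h (fst z)) * (m \<theta> - \<zeta> \<theta> z) \<partial>std_gauss)"
      unfolding e_def c2[symmetric] right_diff_distrib using i1 i2 by simp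
    also have "\<dots> \<le> (\<integral>z. K * \<bar>\<zeta> \<theta> z - m \<theta>\<bar> \<partial>std_gauss)"
    proof (rule integral_mono)
      show "integrable std_gauss (\<lambda>z. f' (h (fst z)) * (m \<theta> - \<zeta> \<theta> z))"
        unfolding right_diff_distrib using i1 i2 by simp
      show "integrable std_gauss (\<lambda>z. K * \<bar>\<zeta> \<theta> z - m \<theta>\<bar>)"
        using i\<zeta> by (intro integrable_mult_right integrable_abs Bochner_Integration.integrable_diff) auto
      have "\<bar>f' (h (fst z)) * (m \<theta> - \<zeta> \<theta> z)\<bar> \<le> K * \<bar>\<zeta> \<theta> z - m \<theta>\<bar>" for z
        unfolding abs_mult using f(4) K0 by (intro mult_mono) auto
      then show "f' (h (fst z)) * (m \<theta> - \<zeta> \<theta> z) \<le> K * \<bar>\<zeta> \<theta> z - m \<theta>\<bar>" for z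
        using abs_le_D1 by blast
    qed
    also have "\<dots> = K * (\<integral>z. \<bar>\<zeta> \<theta> z - m \<theta>\<bar> \<partial>std_gauss)" by simp
    also have "\<dots> \<le> K * (2 * ?S)"
      unfolding m_def \<zeta>_def
      by (intro mult_left_mono K0 gradient_inner_mean_abs_dev[OF h dp cont Hb R r r0])
    finally show ?thesis by simp
  qed
  \<comment> \<open>Variance and covariance are kept in one function of the angle, so that the
    comparison with the cosine acts on their difference.\<close>
  define D where "D \<theta> = c * (\<integral>z. h (fst z) * h (fst (rot \<theta> z)) \<partial>std_gauss) - (\<integral>z. F (fst z) * h (fst (rot \<theta> z)) \<partial>std_gauss)" for \<theta>
  have "D 0 - D (pi/2) \<le> 2 * K * ?S"
  proof (rule DERIV_sin_bound[OF _ eb])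
    fix \<theta>
    show "(D has_real_derivative - sin \<theta> * e \<theta>) (at \<theta>)"
      unfolding D_def[abs_def]
      by (auto intro!: derivative_eq_intros interpolation_DERIV[OF h h] interpolation_DERIV[OF cF h] simp: e_def m_def \<zeta>_def pF_def algebra_simps)
  qed
  then show ?thesis
    unfolding D_def integral_interpolation[OF h h] integral_interpolation[OF cF h]
    by (simp add: c_def F_def[abs_def] power2_eq_square algebra_simps)
qed

section \<open>The Stein equation\<close>

text \<open>Up to sign and division by the density this is the Stein solution for the right-hand
  side \<open>g\<close>, in the form that is directly estimated for
  \<open>x \<ge> 0\<close>.\<close>

definition upper_tail :: "(real \<Rightarrow> real) \<Rightarrow> real \<Rightarrow> real" where
  "upper_tail g x = (\<integral>t. indicator {x..} t * (g t * std_normal_density t) \<partial>lborel)"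

text \<open>On the tail \<open>x \<le> t\<close>, so \<open>x\<close> may be replaced by
  \<open>t\<close> under the integral, and \<open>t * std_normal_density t\<close> has the primitive
  \<open>- std_normal_density t\<close>.\<close>

lemma Mills_ratio_bound:
  fixes g :: "real \<Rightarrow> real"
  assumes [measurable]: "g \<in> borel_measurable borel" and g: "\<And>t. \<bar>g t\<bar> \<le> 1" and x: "0 \<le> x"
  shows "\<bar>x * upper_tail g x\<bar> \<le> std_normal_density x"
proof -
  have nn: "(\<integral>\<^sup>+t. ennreal (t * std_normal_density t) * indicator {x..} t \<partial>lborel) = ennreal (0 - (- std_normal_density x))"
  proof (rule nn_integral_FTC_atLeast)
    fix t assume "x \<le> t"
    show "((\<lambda>t. - std_normal_density t) has_real_derivative t * std_normal_density t) (at t)"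
      by (auto intro!: derivative_eq_intros std_normal_density_DERIV)
    show "0 \<le> t * std_normal_density t" using x \<open>x \<le> t\<close> by simp
  next
    show "((\<lambda>t. - std_normal_density t) \<longlongrightarrow> 0) at_top"
      using tendsto_minus[OF tendsto_std_normal_density(1)] by simp
  qed auto
  have hb: "has_bochner_integral lborel (\<lambda>t. indicator {x..} t * (t * std_normal_density t)) (std_normal_density x)"
  proof (rule has_bochner_integral_nn_integral)
    show "AE t in lborel. 0 \<le> indicator {x..} t * (t * std_normal_density t)"
      using x by (intro AE_I2) (auto simp: indicator_def)
    have e: "ennreal (indicator {x..} t * (t * std_normal_density t)) = ennreal (t * std_normal_density t) * indicator {x..} t" for t
      by (auto simp: indicator_def)
    show "(\<integral>\<^sup>+t. ennreal (indicator {x..} t * (t * std_normal_density t)) \<partial>lborel) = ennreal (std_normal_density x)"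
      unfolding e nn by simp
  qed auto
  have "x * upper_tail g x = (\<integral>t. x * (indicator {x..} t * (g t * std_normal_density t)) \<partial>lborel)"
    by (simp add: upper_tail_def)
  also have "\<bar>\<dots>\<bar> \<le> (\<integral>t. indicator {x..} t * (t * std_normal_density t) \<partial>lborel)"
  proof (rule integral_abs_bound_integral)
    have b: "\<bar>x * (indicator {x..} t * (g t * std_normal_density t))\<bar> \<le> indicator {x..} t * (t * std_normal_density t)" for t
    proof (cases "x \<le> t")
      case True
      then have "x * (\<bar>g t\<bar> * std_normal_density t) \<le> t * (1 * std_normal_density t)"
        using x g by (intro mult_mono) auto
      then show ?thesis using True x by (simp add: abs_mult)
    qed simp
    then show "\<And>t. t \<in> space lborel \<Longrightarrow> \<bar>x * (indicator {x..} t * (g t * std_normal_density t))\<bar> \<le> indicator {x..} t * (t * std_normal_density t)" .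
    show "integrable lborel (\<lambda>t. x * (indicator {x..} t * (g t * std_normal_density t)))"
      by (rule Bochner_Integration.integrable_bound[OF integrable.intros[OF hb]])
         (auto intro!: AE_I2 order_trans[OF b abs_ge_self] simp del: abs_mult)
    show "integrable lborel (\<lambda>t. indicator {x..} t * (t * std_normal_density t))" by (rule integrable.intros[OF hb])
  qed
  also have "\<dots> = std_normal_density x" by (rule has_bochner_integral_integral_eq[OF hb])
  finally show ?thesis .
qed

lemma integrable_bounded_std_normal_density:
  fixes g :: "real \<Rightarrow> real"
  assumes [measurable]: "g \<in> borel_measurable borel" and g: "\<And>t. \<bar>g t\<bar> \<le> 1" and [measurable]: "A \<in> sets borel"
  shows "integrable lborel (\<lambda>t. indicator A t * (g t * std_normal_density t))"
proof (rule Bochner_Integration.integrable_bound)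
  show "integrable lborel std_normal_density" by (rule integrable_normal_density) simp
  have "\<bar>indicator A t * (g t * std_normal_density t)\<bar> \<le> std_normal_density t" for t
    using mult_mono[OF g[of t] order_refl, of "std_normal_density t"] by (auto simp: indicator_def abs_mult)
  then show "AE t in lborel. norm (indicator A t * (g t * std_normal_density t)) \<le> norm (std_normal_density t)"
    by (intro AE_I2) auto
qed auto

lemma upper_tail_DERIV:
  fixes g :: "real \<Rightarrow> real"
  assumes c: "continuous_on UNIV g" and g: "\<And>t. \<bar>g t\<bar> \<le> 1"
  shows "(upper_tail g has_real_derivative - (g x * std_normal_density x)) (at x)"
proof -
  have [measurable]: "g \<in> borel_measurable borel" using c by (rule borel_measurable_continuous_onI)
  let ?k = "\<lambda>t. g t * std_normal_density t"
  have ck: "continuous_on A ?k" for A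
    by (intro continuous_on_mult continuous_on_subset[OF c] continuous_at_imp_continuous_on ballI DERIV_isCont[OF std_normal_density_DERIV]) auto
  \<comment> \<open>Reduces the half-line to a compact interval. The base point \<open>x - 1\<close>
    puts \<open>x\<close> in its interior, so the fundamental theorem gives a two-sided
    derivative.\<close>
  have eq: "upper_tail g y = upper_tail g (x - 1) - integral {x - 1..y} ?k" if y: "y \<in> {x - 1..x + 1}" for y
  proof -
    have i: "integrable lborel (\<lambda>t. indicator A t * ?k t)" if "A \<in> sets borel" for A
      by (rule integrable_bounded_std_normal_density) (use g that in auto)
    have "upper_tail g (x - 1) = (\<integral>t. indicator {x - 1..<y} t * ?k t + indicator {y..} t * ?k t \<partial>lborel)"
      unfolding upper_tail_def using y by (intro Bochner_Integration.integral_cong) (auto simp: indicator_def)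
    also have "\<dots> = (\<integral>t. indicator {x - 1..<y} t * ?k t \<partial>lborel) + upper_tail g y"
      unfolding upper_tail_def by (rule Bochner_Integration.integral_add) (auto intro!: i)
    also have "(\<integral>t. indicator {x - 1..<y} t * ?k t \<partial>lborel) = (\<integral>t. indicator {x - 1..y} t * ?k t \<partial>lborel)"
    proof (rule integral_cong_AE)
      show "AE t in lborel. indicator {x - 1..<y} t * ?k t = indicator {x - 1..y} t * ?k t"
        using AE_lborel_singleton[of y] by eventually_elim (auto simp: indicator_def)
    qed auto
    also have "\<dots> = (LINT t:{x - 1..y}|lborel. ?k t)" by (simp add: set_lebesgue_integral_def)
    also have "\<dots> = integral {x - 1..y} ?k"
      using i[of "{x - 1..y}"] by (intro set_borel_integral_eq_integral) (simp add: set_integrable_def)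
    finally show ?thesis by simp
  qed
  have "((\<lambda>y. integral {x - 1..y} ?k) has_real_derivative ?k x) (at x within {x - 1..x + 1})"
    by (rule integral_has_real_derivative[OF ck]) auto
  then have "((\<lambda>y. integral {x - 1..y} ?k) has_real_derivative ?k x) (at x)"
    by (simp add: at_within_Icc_at)
  from DERIV_diff[OF DERIV_const this]
  have "((\<lambda>y. upper_tail g (x - 1) - integral {x - 1..y} ?k) has_real_derivative - ?k x) (at x)"
    by simp
  then show ?thesis
  proof (rule has_field_derivative_transform_within_open[where S="{x - 1<..<x + 1}"])
    fix y assume "y \<in> {x - 1<..<x + 1}"
    then show "upper_tail g (x - 1) - integral {x - 1..y} ?k = upper_tail g y"
      by (subst eq[of y]) auto
  qed auto
qed

text \<open>Mean zero makes the upper and the lower tail integrals cancel. Reflecting the lower one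
  carries the bound for \<open>x \<ge> 0\<close> over to negative \<open>x\<close>.\<close>

lemma upper_tail_reflect:
  fixes g :: "real \<Rightarrow> real"
  assumes [measurable]: "g \<in> borel_measurable borel" and g: "\<And>t. \<bar>g t\<bar> \<le> 1"
    and z: "(\<integral>t. g t \<partial>std_normal_distribution) = 0"
  shows "upper_tail g x = - upper_tail (\<lambda>t. g (- t)) (- x)"
proof -
  let ?k = "\<lambda>t. g t * std_normal_density t"
  have i: "integrable lborel (\<lambda>t. indicator A t * ?k t)" if "A \<in> sets borel" for A
    by (rule integrable_bounded_std_normal_density) (use g that in auto)
  have "upper_tail (\<lambda>t. g (- t)) (- x) = (\<integral>t. indicator {..x} t * ?k t \<partial>lborel)"
    unfolding upper_tail_def
    by (subst lborel_integral_real_affine[where c="-1" and t=0])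
       (auto intro!: Bochner_Integration.integral_cong simp: indicator_def std_normal_density_def)
  also have "\<dots> = (\<integral>t. indicator {..<x} t * ?k t \<partial>lborel)"
  proof (rule integral_cong_AE)
    show "AE t in lborel. indicator {..x} t * ?k t = indicator {..<x} t * ?k t"
      using AE_lborel_singleton[of x] by eventually_elim (auto simp: indicator_def)
  qed auto
  finally have "upper_tail (\<lambda>t. g (- t)) (- x) + upper_tail g x = (\<integral>t. indicator {..<x} t * ?k t \<partial>lborel) + (\<integral>t. indicator {x..} t * ?k t \<partial>lborel)"
    by (simp add: upper_tail_def)
  also have "\<dots> = (\<integral>t. indicator {..<x} t * ?k t + indicator {x..} t * ?k t \<partial>lborel)"
    by (rule Bochner_Integration.integral_add[symmetric]) (auto intro!: i)
  also have "\<dots> = (\<integral>t. std_normal_density t * g t \<partial>lborel)"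
    by (intro Bochner_Integration.integral_cong) (auto simp: indicator_def)
  also have "\<dots> = 0"
    using z by (subst (asm) integral_density) auto
  finally show ?thesis by simp
qed

text \<open>The solution is minus the upper tail of \<open>g\<close>, the centred \<phi>, divided by
  the density. In \<open>f' = g + x f\<close> both summands are at most 1 in absolute value, whence
  the bound 2. The bound \<open>C\<close> on \<open>f\<close> itself comes from compactness on
  \<open>{-1..1}\<close> and from \<open>x f\<close> outside; it serves integrability and does not
  enter the final estimate.\<close>

lemma Stein_solution:
  fixes \<phi> :: "real \<Rightarrow> real"
  assumes c: "continuous_on UNIV \<phi>" and b: "\<And>x. 0 \<le> \<phi> x" "\<And>x. \<phi> x \<le> 1"
  obtains f f' C where "\<And>w. (f has_real_derivative f' w) (at w)" "continuous_on UNIV f'" "\<And>w. \<bar>f w\<bar> \<le> C" "\<And>w. \<bar>f' w\<bar> \<le> 2"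
    "\<And>w. f' w - w * f w = \<phi> w - (\<integral>t. \<phi> t \<partial>std_normal_distribution)"
proof -
  interpret N: prob_space std_normal_distribution by (intro prob_space_normal_density) simp
  have [measurable]: "\<phi> \<in> borel_measurable borel" using c by (rule borel_measurable_continuous_onI)
  have pu: "measure std_normal_distribution UNIV = 1" using N.prob_space by simp
  define m where "m = (\<integral>t. \<phi> t \<partial>std_normal_distribution)"
  have i: "integrable std_normal_distribution \<phi>"
    by (rule N.integrable_const_bound[where B=1]) (auto simp: b abs_le_iff intro: order_trans[OF _ b(1)])
  have m: "0 \<le> m" "m \<le> 1"
  proof -
    show "0 \<le> m" unfolding m_def by (rule Bochner_Integration.integral_nonneg) (rule b)
    have "m \<le> (\<integral>t. 1 \<partial>std_normal_distribution)" unfolding m_def by (intro integral_mono i) (auto simp: b)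
    then show "m \<le> 1" by (simp add: pu)
  qed
  define g where "g t = \<phi> t - m" for t
  have g1: "\<bar>g t\<bar> \<le> 1" for t using b[of t] m by (auto simp: g_def abs_le_iff)
  have cg: "continuous_on UNIV g" unfolding g_def[abs_def] by (intro continuous_intros c)
  have [measurable]: "g \<in> borel_measurable borel" using cg by (rule borel_measurable_continuous_onI)
  have g0: "(\<integral>t. g t \<partial>std_normal_distribution) = 0"
    unfolding g_def using i by (simp add: pu m_def[symmetric])
  have n0: "std_normal_density x > 0" for x by (rule normal_density_pos) simp
  define f where "f x = - upper_tail g x / std_normal_density x" for x
  define f' where "f' x = g x + x * f x" for x
  have df: "(f has_real_derivative f' x) (at x)" for x
  proof -
    have "(f has_real_derivative ((g x * std_normal_density x) * std_normal_density x - (- upper_tail g x) * (- x * std_normal_density x)) / (std_normal_density x * std_normal_density x)) (at x)"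
      unfolding f_def[abs_def] using n0[of x]
      using DERIV_divide[OF DERIV_minus[OF upper_tail_DERIV[OF cg g1]] std_normal_density_DERIV, of x] by simp
    also have "((g x * std_normal_density x) * std_normal_density x - (- upper_tail g x) * (- x * std_normal_density x)) / (std_normal_density x * std_normal_density x) = f' x"
      using n0[of x] by (simp add: f'_def f_def field_simps)
    finally show ?thesis .
  qed
  have cf: "continuous_on A f" for A using df by (meson DERIV_isCont continuous_at_imp_continuous_on)
  have xf: "\<bar>x * f x\<bar> \<le> 1" for x
  proof -
    have "\<bar>x * upper_tail g x\<bar> \<le> std_normal_density x"
    proof (cases "0 \<le> x")
      case True
      then show ?thesis by (intro Mills_ratio_bound g1) auto
    next
      case False
      then have "\<bar>(- x) * upper_tail (\<lambda>t. g (- t)) (- x)\<bar> \<le> std_normal_density (- x)"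
        by (intro Mills_ratio_bound g1) auto
      then show ?thesis by (subst upper_tail_reflect[OF _ g1 g0]) (auto simp: std_normal_density_def)
    qed
    then show ?thesis using n0[of x] by (simp add: f_def abs_mult)
  qed
  have "compact (f ` {-1..1})" by (intro compact_continuous_image cf) auto
  then obtain C0 where C0: "\<And>x. x \<in> {-1..1} \<Longrightarrow> \<bar>f x\<bar> \<le> C0"
    using compact_imp_bounded[of "f ` {-1..1}"] unfolding bounded_iff by (metis imageI real_norm_def)
  have fb: "\<bar>f x\<bar> \<le> max C0 1" for x
  proof (cases "x \<in> {-1..1}")
    case False
    then have "1 * \<bar>f x\<bar> \<le> \<bar>x\<bar> * \<bar>f x\<bar>" by (intro mult_right_mono) auto
    then show ?thesis using xf[of x] by (simp add: abs_mult)
  qed (use C0 in \<open>auto simp: le_max_iff_disj\<close>)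
  show ?thesis
  proof (rule that[of f f' "max C0 1"])
    show "continuous_on UNIV f'" unfolding f'_def[abs_def] by (intro continuous_intros cg cf)
    show "\<bar>f' w\<bar> \<le> 2" for w using g1[of w] xf[of w] by (simp add: f'_def)
    show "f' w - w * f w = \<phi> w - (\<integral>t. \<phi> t \<partial>std_normal_distribution)" for w by (simp add: f'_def g_def m_def)
  qed (use df fb in auto)
qed

text \<open>The Stein equation is solved for the test function \<open>\<phi> (m + s * t)\<close> and
  evaluated at the standardised \<open>w = (h - m) / s\<close>. Rescaling makes the derivative bound
  \<open>2 / s\<close>, so \<open>stein_gap\<close> gives \<open>4 / s\<close> times the square
  root, and dividing by \<open>s\<close> once more yields \<open>s^2\<close>. Only one side is
  estimated; complements of sets supply the other.\<close>

lemma stein_bound_bounded: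
  fixes h :: "'a::euclidean_space \<Rightarrow> real" and \<phi> :: "real \<Rightarrow> real"
  assumes h: "C1_bounded h p" and dp: "\<And>x. (p has_derivative H x) (at x)"
    and cont: "\<And>v. continuous_on UNIV (\<lambda>x. H x v)" and Hb: "\<And>x v. norm (H x v) \<le> B * norm v"
    and R: "\<And>x y v. (H x v \<bullet> p y)\<^sup>2 \<le> (r1 x + r2 y) * (norm v)\<^sup>2"
    and r: "r1 \<in> borel_measurable borel" "r2 \<in> borel_measurable borel" "integrable std_gauss r1" "integrable std_gauss r2"
    and r0: "\<And>x. 0 \<le> r1 x" "\<And>x. 0 \<le> r2 x"
    and m: "m = (\<integral>x. h x \<partial>std_gauss)" and s: "s\<^sup>2 = (\<integral>x. h x * h x \<partial>std_gauss) - m\<^sup>2" "0 < s"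
    and \<phi>: "continuous_on UNIV \<phi>" "\<And>x. 0 \<le> \<phi> x" "\<And>x. \<phi> x \<le> 1"
  shows "(\<integral>x. \<phi> (h x) \<partial>std_gauss) - (\<integral>t. \<phi> (m + s * t) \<partial>std_normal_distribution)
     \<le> 4 * sqrt ((\<integral>x. r1 x \<partial>std_gauss) + (\<integral>x. r2 x \<partial>std_gauss)) / s\<^sup>2"
proof -
  note [measurable] = C1_boundedD(4,5)[OF h]
  let ?S = "sqrt ((\<integral>x. r1 x \<partial>std_gauss) + (\<integral>x. r2 x \<partial>std_gauss))"
  let ?m = "(\<integral>t. \<phi> (m + s * t) \<partial>std_normal_distribution)"
  have [measurable]: "\<phi> \<in> borel_measurable borel" using \<phi>(1) by (rule borel_measurable_continuous_onI)
  obtain Bh where Bh: "\<And>x. \<bar>h x\<bar> \<le> Bh" using C1_boundedD(6)[OF h] by auto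
  have cc: "continuous_on UNIV (\<lambda>t. \<phi> (m + s * t))"
    by (intro continuous_on_compose2[OF \<phi>(1)] continuous_intros) auto
  obtain f f' C where f: "\<And>w. (f has_real_derivative f' w) (at w)" "continuous_on UNIV f'" "\<And>w. \<bar>f w\<bar> \<le> C" "\<And>w. \<bar>f' w\<bar> \<le> 2"
    and fe: "\<And>w. f' w - w * f w = \<phi> (m + s * w) - ?m"
    using Stein_solution[OF cc] \<phi>(2,3) by metis
  have cf: "continuous_on UNIV f" using f(1) by (meson DERIV_isCont continuous_at_imp_continuous_on)
  have [measurable]: "f \<in> borel_measurable borel" "f' \<in> borel_measurable borel"
    using cf f(2) by (auto intro: borel_measurable_continuous_onI)
  define w where "w x = (h x - m) / s" for x
  have [measurable]: "w \<in> borel_measurable borel" unfolding w_def[abs_def] by measurable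
  have hw: "h x = m + s * w x" for x using s by (simp add: w_def)
  have C0: "0 \<le> C" using order_trans[OF abs_ge_zero f(3)] .
  have ifh: "integrable std_gauss (\<lambda>x. f (w x) * h x)"
    by (rule integrable_bounded_std_gauss[where B="C*Bh"]) (auto simp: abs_mult f(3) Bh C0 intro!: mult_mono)
  have iff: "integrable std_gauss (\<lambda>x. f (w x))"
    by (rule integrable_bounded_std_gauss[where B=C]) (auto simp: f(3))
  have if': "integrable std_gauss (\<lambda>x. f' (w x))"
    by (rule integrable_bounded_std_gauss[where B=2]) (auto simp: f(4))
  have i\<phi>: "integrable std_gauss (\<lambda>x. \<phi> (h x))"
    by (rule integrable_bounded_std_gauss[where B=1]) (auto simp: \<phi> abs_le_iff intro: order_trans[OF _ \<phi>(2)])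
  have gap: "(\<integral>x. f' (w x) / s \<partial>std_gauss) * ((\<integral>x. h x * h x \<partial>std_gauss) - (\<integral>x. h x \<partial>std_gauss)\<^sup>2)
     - ((\<integral>x. f (w x) * h x \<partial>std_gauss) - (\<integral>x. f (w x) \<partial>std_gauss) * (\<integral>x. h x \<partial>std_gauss))
     \<le> 2 * (2 / s) * ?S"
    unfolding w_def
  proof (rule stein_gap[OF h dp cont Hb R r r0, where f="\<lambda>u. f ((u - m) / s)" and f'="\<lambda>u. f' ((u - m) / s) / s" and C=C])
    fix u
    have "((\<lambda>u. f ((u - m) / s)) has_real_derivative f' ((u - m) / s) * (1 / s)) (at u)"
      by (rule DERIV_chain2[OF f(1)]) (use s in \<open>auto intro!: derivative_eq_intros\<close>)
    then show "((\<lambda>u. f ((u - m) / s)) has_real_derivative f' ((u - m) / s) / s) (at u)" by simp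
    show "continuous_on UNIV (\<lambda>u. f' ((u - m) / s) / s)"
      using s by (intro continuous_intros continuous_on_compose2[OF f(2)]) auto
    show "\<bar>f' ((u - m) / s) / s\<bar> \<le> 2 / s"
      using f(4)[of "(u - m) / s"] s by (simp add: divide_right_mono)
  qed (rule f(3))
  have "(\<integral>x. f (w x) * h x \<partial>std_gauss) - (\<integral>x. f (w x) \<partial>std_gauss) * m = (\<integral>x. f (w x) * h x - f (w x) * m \<partial>std_gauss)"
    using ifh iff by simp
  also have "\<dots> = (\<integral>x. s * (w x * f (w x)) \<partial>std_gauss)"
    by (intro Bochner_Integration.integral_cong) (auto simp: hw algebra_simps)
  also have "\<dots> = s * (\<integral>x. w x * f (w x) \<partial>std_gauss)" by simp
  finally have e1: "(\<integral>x. f (w x) * h x \<partial>std_gauss) - (\<integral>x. f (w x) \<partial>std_gauss) * m = s * (\<integral>x. w x * f (w x) \<partial>std_gauss)" .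
  have iw: "integrable std_gauss (\<lambda>x. w x * f (w x))"
  proof -
    have "(\<lambda>x. w x * f (w x)) = (\<lambda>x. (f (w x) * h x - m * f (w x)) / s)"
      using s by (auto simp: hw field_simps)
    then show ?thesis using ifh iff by simp
  qed
  have "(\<integral>x. \<phi> (h x) \<partial>std_gauss) - ?m = (\<integral>x. \<phi> (h x) - ?m \<partial>std_gauss)"
    using i\<phi> by simp
  also have "\<dots> = (\<integral>x. f' (w x) - w x * f (w x) \<partial>std_gauss)"
    by (simp only: fe hw[symmetric])
  also have "\<dots> = (\<integral>x. f' (w x) \<partial>std_gauss) - (\<integral>x. w x * f (w x) \<partial>std_gauss)"
    using if' iw by simp
  finally have e2: "(\<integral>x. \<phi> (h x) \<partial>std_gauss) - ?m = (\<integral>x. f' (w x) \<partial>std_gauss) - (\<integral>x. w x * f (w x) \<partial>std_gauss)" .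
  have "(\<integral>x. f' (w x) / s \<partial>std_gauss) * s\<^sup>2 = s * (\<integral>x. f' (w x) \<partial>std_gauss)"
    using s(2) by (simp add: power2_eq_square)
  moreover have "(\<integral>x. f' (w x) / s \<partial>std_gauss) * s\<^sup>2 - ((\<integral>x. f (w x) * h x \<partial>std_gauss) - (\<integral>x. f (w x) \<partial>std_gauss) * m) \<le> 2 * (2 / s) * ?S"
    using gap by (simp only: s(1)) (simp only: m)
  ultimately have "s * (\<integral>x. f' (w x) \<partial>std_gauss) - s * (\<integral>x. w x * f (w x) \<partial>std_gauss) \<le> 2 * (2 / s) * ?S"
    unfolding e1 by (simp only:)
  then have "s * ((\<integral>x. f' (w x) \<partial>std_gauss) - (\<integral>x. w x * f (w x) \<partial>std_gauss)) \<le> 2 * (2 / s) * ?S"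
    by (simp only: right_diff_distrib)
  then have "s * ((\<integral>x. \<phi> (h x) \<partial>std_gauss) - ?m) \<le> 2 * (2 / s) * ?S" by (simp only: e2)
  then have "(\<integral>x. \<phi> (h x) \<partial>std_gauss) - ?m \<le> (2 * (2 / s) * ?S) / s"
    using s(2) by (simp add: pos_le_divide_eq mult.commute)
  then show ?thesis by (simp add: power2_eq_square)
qed

section \<open>Truncation of unbounded functions\<close>

text \<open>The only point at issue is 0, where the difference quotient is dominated by the positive
  part to the power \<open>Suc n\<close>. That this exponent is positive is why the powers start at
  2.\<close>

lemma DERIV_pos_part_power:
  "((\<lambda>y. max 0 y ^ Suc (Suc n)) has_real_derivative real (Suc (Suc n)) * max 0 y ^ Suc n) (at y)"
proof -
  consider "0 < y" | "y < 0" | "y = 0" by linarith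
  then show ?thesis
  proof cases
    case 1
    have "((\<lambda>y. y ^ Suc (Suc n)) has_real_derivative real (Suc (Suc n)) * max 0 y ^ Suc n) (at y)"
      using 1 DERIV_power[OF DERIV_ident, of "Suc (Suc n)" y] by (simp add: max_def)
    then show ?thesis
      by (rule has_field_derivative_transform_within_open[where S="{0<..}"]) (use 1 in auto)
  next
    case 2
    have "((\<lambda>y. 0) has_real_derivative real (Suc (Suc n)) * max 0 y ^ Suc n) (at y)"
      using 2 by simp
    then show ?thesis
      by (rule has_field_derivative_transform_within_open[where S="{..<0}"]) (use 2 in auto)
  next
    case 3
    have "((\<lambda>h. max 0 h ^ Suc (Suc n) / h) \<longlongrightarrow> 0) (at (0::real))"
    proof (rule Lim_null_comparison)
      have "norm (max 0 h ^ Suc (Suc n) / h) \<le> max 0 h ^ Suc n" for h :: real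
        by (cases "0 < h") (auto simp: max_def)
      then show "\<forall>\<^sub>F h in at 0. norm (max 0 h ^ Suc (Suc n) / h) \<le> max 0 h ^ Suc n" by simp
      have "((\<lambda>h. max 0 h ^ Suc n) \<longlongrightarrow> max 0 0 ^ Suc n) (at (0::real))"
        by (intro tendsto_intros)
      then show "((\<lambda>h. max 0 h ^ Suc n) \<longlongrightarrow> 0) (at (0::real))" by simp
    qed
    then show ?thesis using 3 by (simp add: DERIV_def)
  qed
qed

definition pos_cut :: "real \<Rightarrow> 'a::euclidean_space \<Rightarrow> real" where
  "pos_cut R x = max 0 (1 - (x \<bullet> x) / R\<^sup>2)"

text \<open>The cube is the least integer power of the positive part with a continuous second
  derivative, and inside the ball it is a polynomial in \<open>x \<bullet> x\<close>, so all
  derivatives are explicit.\<close>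

definition cutoff :: "real \<Rightarrow> 'a::euclidean_space \<Rightarrow> real" where
  "cutoff R x = pos_cut R x ^ 3"

definition cutoff_grad :: "real \<Rightarrow> 'a::euclidean_space \<Rightarrow> 'a" where
  "cutoff_grad R x = (- 6 / R\<^sup>2 * (pos_cut R x)\<^sup>2) *\<^sub>R x"

definition cutoff_hess :: "real \<Rightarrow> 'a::euclidean_space \<Rightarrow> 'a \<Rightarrow> 'a" where
  "cutoff_hess R x v = (- 6 / R\<^sup>2 * (pos_cut R x)\<^sup>2) *\<^sub>R v + (24 / R ^ 4 * pos_cut R x * (x \<bullet> v)) *\<^sub>R x"

lemma pos_cut_power_derivative:
  "((\<lambda>x. pos_cut R x ^ Suc (Suc n)) has_derivative
     (\<lambda>v. real (Suc (Suc n)) * pos_cut R x ^ Suc n * (- (2 * (x \<bullet> v)) / R\<^sup>2))) (at x)"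
proof -
  have 1: "((\<lambda>x. 1 - (x \<bullet> x) / R\<^sup>2) has_derivative (\<lambda>v. - (2 * (x \<bullet> v)) / R\<^sup>2)) (at x)"
  proof -
    have "((\<lambda>x. 1 - (x \<bullet> x) * inverse (R\<^sup>2)) has_derivative (\<lambda>v. 0 - (x \<bullet> v + v \<bullet> x) * inverse (R\<^sup>2))) (at x)"
      by (intro derivative_intros)
    moreover have "(\<lambda>v. 0 - (x \<bullet> v + v \<bullet> x) * inverse (R\<^sup>2)) = (\<lambda>v. - (2 * (x \<bullet> v)) / R\<^sup>2)"
      by (simp add: inner_commute divide_inverse)
    ultimately show ?thesis by (simp only: divide_inverse)
  qed
  show ?thesis
    unfolding pos_cut_def
    by (rule has_derivative_compose[OF 1 DERIV_pos_part_power[unfolded has_field_derivative_def]])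
qed

lemma cutoff_derivative: "(cutoff R has_derivative (\<lambda>v. cutoff_grad R x \<bullet> v)) (at x)"
proof -
  have "(\<lambda>v. real (Suc (Suc 1)) * pos_cut R x ^ Suc 1 * (- (2 * (x \<bullet> v)) / R\<^sup>2)) = (\<lambda>v. cutoff_grad R x \<bullet> v)"
    by (rule ext) (simp add: cutoff_grad_def power2_eq_square)
  note d = has_derivative_eq_rhs[OF pos_cut_power_derivative[of R 1 x] this]
  have e: "(\<lambda>x. pos_cut R x ^ Suc (Suc 1)) = cutoff R" by (rule ext) (simp add: cutoff_def numeral_3_eq_3)
  show ?thesis using d unfolding e .
qed

lemma cutoff_grad_derivative: "(cutoff_grad R has_derivative cutoff_hess R x) (at x)"
proof -
  have d2: "((\<lambda>x. (pos_cut R x)\<^sup>2) has_derivative (\<lambda>v. 2 * pos_cut R x * (- (2 * (x \<bullet> v)) / R\<^sup>2))) (at x)"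
    using pos_cut_power_derivative[of R 0 x] by (simp add: power2_eq_square)
  have "((\<lambda>x. (- 6 / R\<^sup>2 * (pos_cut R x)\<^sup>2) *\<^sub>R x) has_derivative
    (\<lambda>v. (- 6 / R\<^sup>2 * (pos_cut R x)\<^sup>2) *\<^sub>R v + (- 6 / R\<^sup>2 * (2 * pos_cut R x * (- (2 * (x \<bullet> v)) / R\<^sup>2))) *\<^sub>R x)) (at x)"
    by (rule has_derivative_scaleR[OF has_derivative_mult_right[OF d2] has_derivative_ident])
  moreover have "(\<lambda>v. (- 6 / R\<^sup>2 * (pos_cut R x)\<^sup>2) *\<^sub>R v + (- 6 / R\<^sup>2 * (2 * pos_cut R x * (- (2 * (x \<bullet> v)) / R\<^sup>2))) *\<^sub>R x) = cutoff_hess R x"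
    by (rule ext) (simp add: cutoff_hess_def power2_eq_square power4_eq_xxxx)
  ultimately show ?thesis by (simp add: cutoff_grad_def[abs_def])
qed

lemma pos_cut_bounds: "0 \<le> pos_cut R x" "pos_cut R x \<le> 1"
  by (auto simp: pos_cut_def)

lemma pos_cut_outside:
  assumes "0 < R" "R \<le> norm x"
  shows "pos_cut R x = 0"
proof -
  have "R\<^sup>2 \<le> x \<bullet> x" using assms power_mono[of R "norm x" 2] by (simp add: dot_square_norm)
  then show ?thesis using assms by (simp add: pos_cut_def max_def field_simps)
qed

lemma cutoff_bounds: "0 \<le> cutoff R x" "cutoff R x \<le> 1"
  using pos_cut_bounds[of R x] by (auto simp: cutoff_def power_le_one)

lemma cutoff_outside:
  assumes "0 < R" "R \<le> norm x"
  shows "cutoff R x = 0" "cutoff_grad R x = 0" "cutoff_hess R x v = 0"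
  using pos_cut_outside[OF assms] by (auto simp: cutoff_def cutoff_grad_def cutoff_hess_def)

lemma cutoff_grad_bound:
  assumes "1 \<le> R"
  shows "norm (cutoff_grad R x) \<le> 30 / R"
proof (cases "R \<le> norm x")
  case True
  then show ?thesis using cutoff_outside[of R x] assms by simp
next
  case False
  have "(pos_cut R x)\<^sup>2 \<le> 1" using pos_cut_bounds[of R x] by (simp add: power_le_one)
  then have "norm (cutoff_grad R x) \<le> (6 / R\<^sup>2 * 1) * R"
    using False assms unfolding cutoff_grad_def norm_scaleR
    by (intro mult_mono) (auto simp: abs_mult divide_right_mono)
  also have "\<dots> \<le> 30 / R" using assms by (simp add: power2_eq_square divide_right_mono)
  finally show ?thesis .
qed

text \<open>Inside the ball the two summands contribute 6 and 24 over \<open>R^2\<close>, whence 30.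
  The decay is weakened to \<open>1 / R\<close>, so that the same bound serves gradient and
  Hessian.\<close>

lemma cutoff_hess_bound:
  assumes "1 \<le> R"
  shows "norm (cutoff_hess R x v) \<le> 30 / R * norm v"
proof (cases "R \<le> norm x")
  case True
  then show ?thesis using cutoff_outside[of R x] assms by simp
next
  case False
  have p2: "(pos_cut R x)\<^sup>2 \<le> 1" using pos_cut_bounds[of R x] by (simp add: power_le_one)
  have "norm ((- 6 / R\<^sup>2 * (pos_cut R x)\<^sup>2) *\<^sub>R v) \<le> (6 / R\<^sup>2 * 1) * norm v"
    using assms p2 unfolding norm_scaleR by (intro mult_mono) (auto simp: abs_mult divide_right_mono)
  moreover have "norm ((24 / R ^ 4 * pos_cut R x * (x \<bullet> v)) *\<^sub>R x) \<le> (24 / R ^ 4 * 1 * (R * norm v)) * R"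
  proof -
    have "\<bar>x \<bullet> v\<bar> \<le> R * norm v"
      using False by (intro order_trans[OF Cauchy_Schwarz_ineq2] mult_right_mono) auto
    then show ?thesis
      unfolding norm_scaleR real_norm_def abs_mult using False assms pos_cut_bounds[of R x]
      by (intro mult_mono) (simp_all add: mult_nonneg_nonneg)
  qed
  moreover have "(24 / R ^ 4 * 1 * (R * norm v)) * R = 24 / R\<^sup>2 * norm v"
    using assms by (simp add: power4_eq_xxxx power2_eq_square)
  ultimately have "norm (cutoff_hess R x v) \<le> 6 / R\<^sup>2 * norm v + 24 / R\<^sup>2 * norm v"
    unfolding cutoff_hess_def by (intro order_trans[OF norm_triangle_ineq] add_mono) simp_all
  also have "\<dots> = 30 / R\<^sup>2 * norm v" by (simp add: add_divide_distrib[symmetric] distrib_right[symmetric])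
  also have "\<dots> \<le> 30 / R * norm v"
  proof (rule mult_right_mono)
    have "R \<le> R\<^sup>2" using assms by (simp add: power2_eq_square)
    then show "30 / R\<^sup>2 \<le> 30 / R" using assms by (intro divide_left_mono) auto
  qed simp
  finally show ?thesis .
qed

lemma cutoff_tendsto: "(\<lambda>n. cutoff (real (Suc n)) x) \<longlonglongrightarrow> 1"
proof -
  have "(\<lambda>n. max 0 (1 - (x \<bullet> x) * (inverse (real (Suc n)))\<^sup>2) ^ 3) \<longlonglongrightarrow> max 0 (1 - (x \<bullet> x) * 0\<^sup>2) ^ 3"
    by (intro tendsto_power tendsto_max tendsto_diff tendsto_mult tendsto_const LIMSEQ_inverse_real_of_nat)
  then show ?thesis by (simp add: cutoff_def pos_cut_def divide_inverse power_inverse)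
qed

lemma bounded_range_compact_support:
  fixes f :: "'a::euclidean_space \<Rightarrow> 'b::real_normed_vector"
  assumes c: "continuous_on UNIV f" and z: "\<And>x. R \<le> norm x \<Longrightarrow> f x = 0"
  shows "bounded (range f)"
proof -
  have "compact (f ` cball 0 R)"
    by (rule compact_continuous_image[OF continuous_on_subset[OF c subset_UNIV] compact_cball])
  then have "bounded (insert 0 (f ` cball 0 R))" by (simp add: compact_imp_bounded)
  moreover have "f x \<in> insert 0 (f ` cball 0 R)" for x
  proof (cases "R \<le> norm x")
    case False
    then have "x \<in> cball 0 R" by simp
    then show ?thesis by (intro insertI2 imageI)
  qed (simp add: z)
  then have "range f \<subseteq> insert 0 (f ` cball 0 R)" by blast
  ultimately show ?thesis by (rule bounded_subset)
qed

section \<open>Splitting squared pairings into fourth powers\<close>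

lemma weighted_square_sum:
  fixes a b s :: real
  assumes "0 < s"
  shows "(a + b)\<^sup>2 \<le> (1 + s) * a\<^sup>2 + (1 + 1/s) * b\<^sup>2"
proof -
  have "0 \<le> (s * a - b)\<^sup>2 / s" using assms by simp
  also have "\<dots> = s * a\<^sup>2 + b\<^sup>2 / s - 2 * (a * b)"
    using assms by (simp add: power2_eq_square field_simps)
  finally show ?thesis by (simp add: power2_sum algebra_simps)
qed

lemma weighted_AM_GM:
  fixes a b t :: real
  assumes "0 < t"
  shows "a\<^sup>2 * b\<^sup>2 \<le> (t * a ^ 4 + b ^ 4 / t) / 2"
proof -
  have "0 \<le> (t * a\<^sup>2 - b\<^sup>2)\<^sup>2 / t" using assms by simp
  also have "\<dots> = t * a ^ 4 + b ^ 4 / t - 2 * (a\<^sup>2 * b\<^sup>2)"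
    using assms by (simp add: power2_eq_square power4_eq_xxxx field_simps)
  finally show ?thesis by simp
qed

text \<open>In the application \<open>d\<close> and \<open>k\<close> belong to the Hessian at one
  point and \<open>w\<close> is the gradient at another, so the bound must not mix them.
  Cauchy-Schwarz removes \<open>v\<close>, the weight \<open>s\<close> separates the diagonal part
  from the rest, and \<open>t\<close> and \<open>u\<close> balance the arithmetic-geometric mean
  within each part.\<close>

lemma quartic_form_bound:
  fixes d :: "'a::euclidean_space \<Rightarrow> real" and v w :: 'a
  assumes L: "\<bar>l\<bar> \<le> (\<Sum>b\<in>Basis. d b * \<bar>v \<bullet> b\<bar> * \<bar>w \<bullet> b\<bar>) + k * norm v * norm w"
    and k: "0 \<le> k" and p: "0 < s" "0 < t" "0 < u"
  shows "l\<^sup>2 \<le> ((1 + s) * t / 2 * (\<Sum>b\<in>Basis. d b ^ 4) + (1 + 1/s) * u / 2 * k ^ 4 +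
     ((1 + s) / (2 * t) * (\<Sum>b\<in>Basis. (w \<bullet> b) ^ 4) + (1 + 1/s) / (2 * u) * norm w ^ 4)) * (norm v)\<^sup>2"
proof -
  define q where "q = (\<Sum>b\<in>Basis. (d b * \<bar>w \<bullet> b\<bar>) *\<^sub>R b)"
  define v' where "v' = (\<Sum>b\<in>Basis. \<bar>v \<bullet> b\<bar> *\<^sub>R b)"
  have cq: "q \<bullet> b = d b * \<bar>w \<bullet> b\<bar>" "v' \<bullet> b = \<bar>v \<bullet> b\<bar>" if "b \<in> Basis" for b
    using that by (auto simp: q_def v'_def inner_sum_left_Basis)
  have nv: "norm v' = norm v"
    unfolding norm_eq_sqrt_inner euclidean_inner[of v' v'] euclidean_inner[of v v] by (simp add: cq)
  have "(\<Sum>b\<in>Basis. d b * \<bar>v \<bullet> b\<bar> * \<bar>w \<bullet> b\<bar>) = v' \<bullet> q"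
    unfolding euclidean_inner[of v' q] by (auto simp: cq intro!: sum.cong)
  also have "\<dots> \<le> norm v * norm q" using norm_cauchy_schwarz[of v' q] by (simp add: nv)
  finally have "\<bar>l\<bar> \<le> norm v * (norm q + k * norm w)" using L by (simp add: algebra_simps)
  then have "l\<^sup>2 \<le> (norm v * (norm q + k * norm w))\<^sup>2"
    using power_mono[of "\<bar>l\<bar>" _ 2] by simp
  also have "\<dots> = (norm q + k * norm w)\<^sup>2 * (norm v)\<^sup>2" by (simp add: power_mult_distrib)
  also have "\<dots> \<le> ((1 + s) * (norm q)\<^sup>2 + (1 + 1/s) * (k * norm w)\<^sup>2) * (norm v)\<^sup>2"
    by (intro mult_right_mono weighted_square_sum p) simp
  also have "\<dots> \<le> ((1 + s) * (\<Sum>b\<in>Basis. (t * d b ^ 4 + (w \<bullet> b) ^ 4 / t) / 2) + (1 + 1/s) * ((u * k ^ 4 + norm w ^ 4 / u) / 2)) * (norm v)\<^sup>2"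
  proof (intro mult_right_mono add_mono mult_left_mono)
    have "(norm q)\<^sup>2 = (\<Sum>b\<in>Basis. (d b)\<^sup>2 * (w \<bullet> b)\<^sup>2)"
      unfolding power2_norm_eq_inner euclidean_inner[of q q]
      by (auto simp: cq power2_eq_square intro!: sum.cong)
    also have "\<dots> \<le> (\<Sum>b\<in>Basis. (t * d b ^ 4 + (w \<bullet> b) ^ 4 / t) / 2)"
      by (intro sum_mono weighted_AM_GM p)
    finally show "(norm q)\<^sup>2 \<le> (\<Sum>b\<in>Basis. (t * d b ^ 4 + (w \<bullet> b) ^ 4 / t) / 2)" .
    show "(k * norm w)\<^sup>2 \<le> (u * k ^ 4 + norm w ^ 4 / u) / 2"
      unfolding power_mult_distrib by (intro weighted_AM_GM p)
  qed (use p in auto)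
  also have "(1 + s) * (\<Sum>b\<in>Basis. (t * d b ^ 4 + (w \<bullet> b) ^ 4 / t) / 2) + (1 + 1/s) * ((u * k ^ 4 + norm w ^ 4 / u) / 2)
    = (1 + s) * t / 2 * (\<Sum>b\<in>Basis. d b ^ 4) + (1 + 1/s) * u / 2 * k ^ 4 +
     ((1 + s) / (2 * t) * (\<Sum>b\<in>Basis. (w \<bullet> b) ^ 4) + (1 + 1/s) / (2 * u) * norm w ^ 4)"
    unfolding sum_divide_distrib[symmetric] sum.distrib sum_distrib_left[symmetric]
    using p by (simp add: field_simps)
  finally show ?thesis .
qed

lemma power4_add_le: "(a + b) ^ 4 \<le> 8 * (a ^ 4 + b ^ 4)" for a b :: real
proof -
  have sq: "(c + d)\<^sup>2 \<le> 2 * (c\<^sup>2 + d\<^sup>2)" for c d :: real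
    using sum_squares_bound[of c d] unfolding power2_sum distrib_left by linarith
  have "((a + b)\<^sup>2)\<^sup>2 \<le> (2 * (a\<^sup>2 + b\<^sup>2))\<^sup>2"
    by (intro power_mono sq zero_le_power2)
  also have "\<dots> = 4 * (a\<^sup>2 + b\<^sup>2)\<^sup>2" unfolding power_mult_distrib by simp
  also have "\<dots> \<le> 4 * (2 * ((a\<^sup>2)\<^sup>2 + (b\<^sup>2)\<^sup>2))"
    by (intro mult_left_mono sq) simp
  finally show ?thesis by (simp add: power_mult[symmetric])
qed

lemma abs_le_1_power4: "\<bar>a\<bar> \<le> 1 + a ^ 4" for a :: real
proof (cases "\<bar>a\<bar> \<le> 1")
  case False
  then have "\<bar>a\<bar> ^ 1 \<le> \<bar>a\<bar> ^ 4" by (intro power_increasing) auto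
  then show ?thesis by simp
qed (simp add: add_increasing2)

lemma square_le_1_power4: "a\<^sup>2 \<le> 1 + a ^ 4" for a :: real
proof -
  have "a\<^sup>2 \<le> 1 + (a\<^sup>2)\<^sup>2" using abs_le_1_power4[of a] sum_squares_bound[of "a\<^sup>2" 1] by (simp add: power2_eq_square[symmetric])
  then show ?thesis by (simp add: power_mult[symmetric])
qed

lemma integrable_power4_add:
  fixes f g :: "'a \<Rightarrow> real"
  assumes [measurable]: "f \<in> borel_measurable M" "g \<in> borel_measurable M"
    and "integrable M (\<lambda>x. f x ^ 4)" "integrable M (\<lambda>x. g x ^ 4)"
  shows "integrable M (\<lambda>x. (f x + g x) ^ 4)"
proof (rule Bochner_Integration.integrable_bound)
  show "integrable M (\<lambda>x. 8 * (f x ^ 4 + g x ^ 4))" using assms by simp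
  show "AE x in M. norm ((f x + g x) ^ 4) \<le> norm (8 * (f x ^ 4 + g x ^ 4))"
    using power4_add_le[of "f _" "g _"] by (intro AE_I2) (simp add: abs_mult)
qed measurable

text \<open>Dominated convergence with majorant \<open>(f + g)^4\<close>. It is meant for
  \<open>g\<close> the cutoff error \<open>e\<close> and \<open>f\<close> any of the quantities that
  the cutoff perturbs.\<close>

lemma power4_perturbation_limit:
  fixes f g :: "'a \<Rightarrow> real"
  assumes [measurable]: "f \<in> borel_measurable M" "g \<in> borel_measurable M"
    and i: "integrable M (\<lambda>x. f x ^ 4)" "integrable M (\<lambda>x. g x ^ 4)"
    and nn: "\<And>x. 0 \<le> f x" "\<And>x. 0 \<le> g x"
  shows "(\<lambda>n. \<integral>x. (f x + g x / real (Suc n)) ^ 4 \<partial>M) \<longlonglongrightarrow> (\<integral>x. f x ^ 4 \<partial>M)"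
    and "integrable M (\<lambda>x. (f x + g x / real (Suc n)) ^ 4)"
proof -
  have b: "(f x + g x / real (Suc n)) ^ 4 \<le> (f x + g x) ^ 4" for n x
    using nn[of x] by (intro power_mono add_left_mono) (auto simp: divide_le_eq mult_le_cancel_left1)
  have nb: "norm ((f x + g x / real (Suc n)) ^ 4) \<le> (f x + g x) ^ 4" for n x
    using b[of x n] by simp
  show "(\<lambda>n. \<integral>x. (f x + g x / real (Suc n)) ^ 4 \<partial>M) \<longlonglongrightarrow> (\<integral>x. f x ^ 4 \<partial>M)"
  proof (rule integral_dominated_convergence)
    show "integrable M (\<lambda>x. (f x + g x) ^ 4)" by (rule integrable_power4_add) (use i in auto)
    show "AE x in M. (\<lambda>n. (f x + g x / real (Suc n)) ^ 4) \<longlonglongrightarrow> f x ^ 4"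
    proof (rule AE_I2)
      fix x
      have "(\<lambda>n. (f x + g x * inverse (real (Suc n))) ^ 4) \<longlonglongrightarrow> (f x + g x * 0) ^ 4"
        by (intro tendsto_power tendsto_add tendsto_mult tendsto_const LIMSEQ_inverse_real_of_nat)
      then show "(\<lambda>n. (f x + g x / real (Suc n)) ^ 4) \<longlonglongrightarrow> f x ^ 4" by (simp add: divide_inverse)
    qed
    show "AE x in M. norm ((f x + g x / real (Suc n)) ^ 4) \<le> (f x + g x) ^ 4" for n
      by (intro AE_I2 nb)
  qed measurable
  show "integrable M (\<lambda>x. (f x + g x / real (Suc n)) ^ 4)"
  proof (rule Bochner_Integration.integrable_bound)
    show "integrable M (\<lambda>x. (f x + g x) ^ 4)" by (rule integrable_power4_add) (use i in auto)
    show "AE x in M. norm ((f x + g x / real (Suc n)) ^ 4) \<le> norm ((f x + g x) ^ 4)"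
      using nb by (intro AE_I2) simp
  qed measurable
qed

text \<open>\<open>p\<close> and \<open>H\<close> are the gradient and the Hessian of \<open>h\<close>. The Hessian form is split into a diagonal
  part \<open>D\<close>, which for entrywise transformations carries the second derivatives \<open>u''\<close>, and a part
  controlled by its operator norm \<open>k\<close>.\<close>

locale C2_function =
  fixes h :: "'a::euclidean_space \<Rightarrow> real" and p :: "'a \<Rightarrow> 'a" and H :: "'a \<Rightarrow> 'a \<Rightarrow> 'a"
    and D :: "'a \<Rightarrow> 'a \<Rightarrow> real" and k :: "'a \<Rightarrow> real"
  assumes dh: "\<And>x. (h has_derivative (\<lambda>v. p x \<bullet> v)) (at x)"
    and dp: "\<And>x. (p has_derivative H x) (at x)"
    and cH: "\<And>v. continuous_on UNIV (\<lambda>x. H x v)"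
    and HB: "\<And>x v w. \<bar>H x v \<bullet> w\<bar> \<le> (\<Sum>b\<in>Basis. D b x * \<bar>v \<bullet> b\<bar> * \<bar>w \<bullet> b\<bar>) + k x * norm v * norm w"
    and k0: "\<And>x. 0 \<le> k x" and D0: "\<And>b x. 0 \<le> D b x"
    and mk [measurable]: "k \<in> borel_measurable borel" and mD [measurable]: "\<And>b. D b \<in> borel_measurable borel"
begin

lemma continuous_h: "continuous_on UNIV h" and continuous_p: "continuous_on UNIV p"
  using dh dp by (meson continuous_at_imp_continuous_on has_derivative_continuous)+

lemma borel_measurable_h [measurable]: "h \<in> borel_measurable borel" and borel_measurable_p [measurable]: "p \<in> borel_measurable borel"
  using continuous_h continuous_p by (auto intro: borel_measurable_continuous_onI)

definition hR where "hR R x = cutoff R x * h x"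
definition pR where "pR R x = cutoff R x *\<^sub>R p x + h x *\<^sub>R cutoff_grad R x"
definition HR where "HR R x v = cutoff R x *\<^sub>R H x v + (cutoff_grad R x \<bullet> v) *\<^sub>R p x
    + (h x *\<^sub>R cutoff_hess R x v + (p x \<bullet> v) *\<^sub>R cutoff_grad R x)"
text \<open>Multiplying by the cutoff at radius \<open>R\<close> costs at most \<open>e x / R\<close> in the first two derivatives.\<close>

definition e where "e x = 60 * (norm (p x) + \<bar>h x\<bar>)"

lemma e_nonneg: "0 \<le> e x" by (simp add: e_def)

lemma borel_measurable_e [measurable]: "e \<in> borel_measurable borel"
  unfolding e_def[abs_def] by measurable

lemma hR_derivative: "(hR R has_derivative (\<lambda>v. pR R x \<bullet> v)) (at x)"
proof -
  have "((\<lambda>x. cutoff R x * h x) has_derivative (\<lambda>v. cutoff R x * (p x \<bullet> v) + (cutoff_grad R x \<bullet> v) * h x)) (at x)"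
    by (rule has_derivative_mult[OF cutoff_derivative dh])
  moreover have "(\<lambda>v. cutoff R x * (p x \<bullet> v) + (cutoff_grad R x \<bullet> v) * h x) = (\<lambda>v. pR R x \<bullet> v)"
    by (simp add: pR_def inner_add_left mult.commute)
  ultimately show ?thesis by (simp add: hR_def[abs_def])
qed

lemma pR_derivative: "(pR R has_derivative HR R x) (at x)"
proof -
  have "((\<lambda>x. cutoff R x *\<^sub>R p x + h x *\<^sub>R cutoff_grad R x) has_derivative
    (\<lambda>v. (cutoff R x *\<^sub>R H x v + (cutoff_grad R x \<bullet> v) *\<^sub>R p x) +
      (h x *\<^sub>R cutoff_hess R x v + (p x \<bullet> v) *\<^sub>R cutoff_grad R x))) (at x)"
    by (intro has_derivative_add has_derivative_scaleR cutoff_derivative cutoff_grad_derivative dh dp)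
  then show ?thesis by (simp add: pR_def[abs_def] HR_def[abs_def])
qed

lemma continuous_cutoff: "continuous_on UNIV (cutoff R)" "continuous_on UNIV (cutoff_grad R)"
  "continuous_on UNIV (\<lambda>x. cutoff_hess R x v)"
proof -
  show "continuous_on UNIV (cutoff R)" "continuous_on UNIV (cutoff_grad R)"
    using cutoff_derivative cutoff_grad_derivative
    by (meson continuous_at_imp_continuous_on has_derivative_continuous)+
  show "continuous_on UNIV (\<lambda>x. cutoff_hess R x v)"
    unfolding cutoff_hess_def pos_cut_def divide_inverse by (intro continuous_intros)
qed

lemma C1_bounded_hR:
  assumes "0 < R"
  shows "C1_bounded (hR R) (pR R)"
  unfolding C1_bounded_def
proof (intro conjI allI hR_derivative)
  show c: "continuous_on UNIV (pR R)"
    unfolding pR_def[abs_def] by (intro continuous_intros continuous_cutoff continuous_h continuous_p)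
  have c2: "continuous_on UNIV (hR R)"
    unfolding hR_def[abs_def] by (intro continuous_intros continuous_cutoff continuous_h continuous_p)
  show "bounded (range (hR R))"
    by (rule bounded_range_compact_support[OF c2, of R]) (use assms in \<open>simp add: hR_def cutoff_outside\<close>)
  show "bounded (range (pR R))"
    by (rule bounded_range_compact_support[OF c, of R]) (use assms in \<open>simp add: pR_def cutoff_outside\<close>)
qed

lemma continuous_HR: "continuous_on UNIV (\<lambda>x. HR R x v)"
  unfolding HR_def by (intro continuous_intros continuous_cutoff continuous_h continuous_p cH)

lemma linear_HR: "linear (HR R x)"
  using pR_derivative has_derivative_linear by blast

text \<open>Compact support bounds \<open>HR R x b\<close> for each basis vector \<open>b\<close>,
  and linearity in \<open>v\<close> combines these finitely many bounds.\<close>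

lemma HR_bounded:
  assumes "0 < R"
  obtains B where "\<And>x v. norm (HR R x v) \<le> B * norm v"
proof -
  have "\<exists>B. \<forall>x. norm (HR R x b) \<le> B" for b
  proof -
    have "bounded (range (\<lambda>x. HR R x b))"
      by (rule bounded_range_compact_support[OF continuous_HR, of R]) (use assms in \<open>simp add: HR_def cutoff_outside\<close>)
    then show ?thesis unfolding bounded_iff by blast
  qed
  then obtain B where B: "\<And>b x. norm (HR R x b) \<le> B b" by metis
  have "norm (HR R x v) \<le> (\<Sum>b\<in>Basis. B b) * norm v" for x v
  proof -
    have "HR R x v = HR R x (\<Sum>b\<in>Basis. (v \<bullet> b) *\<^sub>R b)" by (simp only: euclidean_representation)
    also have "\<dots> = (\<Sum>b\<in>Basis. (v \<bullet> b) *\<^sub>R HR R x b)"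
      using linear_HR[of R x] by (simp only: linear_sum linear_cmul)
    also have "norm \<dots> \<le> (\<Sum>b\<in>Basis. norm v * B b)"
      unfolding norm_scaleR[symmetric]
    proof (rule sum_norm_le)
      fix b :: 'a assume "b \<in> Basis"
      then show "norm ((v \<bullet> b) *\<^sub>R HR R x b) \<le> norm v * B b"
        unfolding norm_scaleR by (intro mult_mono Basis_le_norm B) auto
    qed
    finally show ?thesis by (simp add: sum_distrib_left mult.commute)
  qed
  then show ?thesis by (rule that)
qed

text \<open>Of the four terms of the product rule only one contains \<open>H\<close>, and there the
  cutoff is at most 1, so the diagonal part \<open>D\<close> survives unchanged. The other three
  carry derivatives of the cutoff, in total \<open>60 * norm (p x) + 30 * \<bar>h x\<bar>\<close>
  over \<open>R\<close>, and are absorbed into \<open>k\<close>.\<close>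

lemma HR_form_bound:
  assumes "1 \<le> R"
  shows "\<bar>HR R x v \<bullet> w\<bar> \<le> (\<Sum>b\<in>Basis. D b x * \<bar>v \<bullet> b\<bar> * \<bar>w \<bullet> b\<bar>) + (k x + e x / R) * norm v * norm w"
proof -
  have 1: "\<bar>cutoff R x * (H x v \<bullet> w)\<bar> \<le> (\<Sum>b\<in>Basis. D b x * \<bar>v \<bullet> b\<bar> * \<bar>w \<bullet> b\<bar>) + k x * norm v * norm w"
  proof -
    have "\<bar>cutoff R x * (H x v \<bullet> w)\<bar> \<le> 1 * \<bar>H x v \<bullet> w\<bar>"
      unfolding abs_mult using cutoff_bounds[of R x] by (intro mult_right_mono) auto
    then show ?thesis using HB[of x v w] by simp
  qed
  have g: "\<bar>cutoff_grad R x \<bullet> y\<bar> \<le> 30 / R * norm y" for y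
    by (rule order_trans[OF Cauchy_Schwarz_ineq2]) (intro mult_right_mono cutoff_grad_bound assms norm_ge_zero)
  have 2: "\<bar>(cutoff_grad R x \<bullet> v) * (p x \<bullet> w)\<bar> \<le> (30 / R * norm v) * (norm (p x) * norm w)"
    unfolding abs_mult using assms by (intro mult_mono g Cauchy_Schwarz_ineq2) auto
  have 3: "\<bar>h x * (cutoff_hess R x v \<bullet> w)\<bar> \<le> \<bar>h x\<bar> * ((30 / R * norm v) * norm w)"
    unfolding abs_mult
    by (intro mult_left_mono order_trans[OF Cauchy_Schwarz_ineq2] mult_right_mono cutoff_hess_bound assms) auto
  have 4: "\<bar>(p x \<bullet> v) * (cutoff_grad R x \<bullet> w)\<bar> \<le> (norm (p x) * norm v) * (30 / R * norm w)"
    unfolding abs_mult using assms by (intro mult_mono g Cauchy_Schwarz_ineq2) auto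
  have "HR R x v \<bullet> w = cutoff R x * (H x v \<bullet> w) + (cutoff_grad R x \<bullet> v) * (p x \<bullet> w)
    + h x * (cutoff_hess R x v \<bullet> w) + (p x \<bullet> v) * (cutoff_grad R x \<bullet> w)"
    by (simp add: HR_def inner_add_left)
  then have "\<bar>HR R x v \<bullet> w\<bar> \<le> (\<Sum>b\<in>Basis. D b x * \<bar>v \<bullet> b\<bar> * \<bar>w \<bullet> b\<bar>) + k x * norm v * norm w
    + (30 / R * norm v) * (norm (p x) * norm w) + \<bar>h x\<bar> * ((30 / R * norm v) * norm w) + (norm (p x) * norm v) * (30 / R * norm w)"
    using 1 2 3 4 by linarith
  also have "\<dots> = (\<Sum>b\<in>Basis. D b x * \<bar>v \<bullet> b\<bar> * \<bar>w \<bullet> b\<bar>) + (k x + (60 * norm (p x) + 30 * \<bar>h x\<bar>) / R) * norm v * norm w"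
    by (simp add: algebra_simps add_divide_distrib)
  also have "\<dots> \<le> (\<Sum>b\<in>Basis. D b x * \<bar>v \<bullet> b\<bar> * \<bar>w \<bullet> b\<bar>) + (k x + e x / R) * norm v * norm w"
    using assms unfolding e_def by (intro add_left_mono mult_right_mono divide_right_mono) auto
  finally show ?thesis .
qed

text \<open>Coordinates are bounded separately from the norm, since the limit estimate contains the
  sum of fourth powers of the coordinates as well as the fourth power of the norm.\<close>

lemma pR_bounds:
  assumes "1 \<le> R"
  shows "norm (pR R x) \<le> norm (p x) + e x / R" "b \<in> Basis \<Longrightarrow> \<bar>pR R x \<bullet> b\<bar> \<le> \<bar>p x \<bullet> b\<bar> + e x / R"
proof -
  have "\<bar>h x\<bar> * norm (cutoff_grad R x) \<le> \<bar>h x\<bar> * (30 / R)"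
    by (intro mult_left_mono cutoff_grad_bound assms) auto
  also have "\<dots> \<le> e x / R" using assms by (simp add: e_def divide_right_mono)
  finally have g: "norm (h x *\<^sub>R cutoff_grad R x) \<le> e x / R" by simp
  have "norm (cutoff R x *\<^sub>R p x) \<le> norm (p x)" using cutoff_bounds[of R x] by (simp add: mult_left_le_one_le)
  then show "norm (pR R x) \<le> norm (p x) + e x / R"
    unfolding pR_def using g by (intro order_trans[OF norm_triangle_ineq] add_mono)
  assume b: "b \<in> Basis"
  have "\<bar>(h x *\<^sub>R cutoff_grad R x) \<bullet> b\<bar> \<le> e x / R" by (rule order_trans[OF Basis_le_norm[OF b] g])
  moreover have "\<bar>(cutoff R x *\<^sub>R p x) \<bullet> b\<bar> \<le> \<bar>p x \<bullet> b\<bar>"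
    using cutoff_bounds[of R x] by (simp add: abs_mult mult_left_le_one_le)
  ultimately show "\<bar>pR R x \<bullet> b\<bar> \<le> \<bar>p x \<bullet> b\<bar> + e x / R"
    unfolding pR_def inner_add_left by linarith
qed

lemma borel_measurable_hR [measurable]: "hR R \<in> borel_measurable borel"
proof -
  have "continuous_on UNIV (hR R)"
    unfolding hR_def[abs_def] by (intro continuous_intros continuous_cutoff continuous_h)
  then show ?thesis by (rule borel_measurable_continuous_onI)
qed

lemma hR_tendsto: "(\<lambda>n. hR (real (Suc n)) x) \<longlonglongrightarrow> h x"
  using tendsto_mult[OF cutoff_tendsto[of x] tendsto_const[of "h x"]] by (simp add: hR_def)

lemma hR_le: "\<bar>hR R x\<bar> \<le> \<bar>h x\<bar>"
  using cutoff_bounds[of R x] by (simp add: hR_def abs_mult mult_left_le_one_le)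

text \<open>The bounded estimate is applied to \<open>hR\<close> at radius \<open>n + 1\<close>. The
  normal law it compares with also depends on \<open>n\<close>, through the mean and variance of the
  truncated function; both converge, and continuity of \<phi> carries the comparison to the limit.
  The weights \<open>s\<close>, \<open>t\<close>, \<open>u\<close> stay free.\<close>

lemma stein_bound:
  fixes \<phi> :: "real \<Rightarrow> real"
  assumes ih: "integrable std_gauss (\<lambda>x. h x ^ 4)" and ip: "integrable std_gauss (\<lambda>x. norm (p x) ^ 4)"
    and iD: "\<And>b. b \<in> Basis \<Longrightarrow> integrable std_gauss (\<lambda>x. D b x ^ 4)" and ik: "integrable std_gauss (\<lambda>x. k x ^ 4)"
    and pos: "0 < s" "0 < t" "0 < u"
    and m: "m = (\<integral>x. h x \<partial>std_gauss)" and sg: "sg\<^sup>2 = (\<integral>x. h x * h x \<partial>std_gauss) - m\<^sup>2" "0 < sg"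
    and \<phi>: "continuous_on UNIV \<phi>" "\<And>x. 0 \<le> \<phi> x" "\<And>x. \<phi> x \<le> 1"
  shows "(\<integral>x. \<phi> (h x) \<partial>std_gauss) - (\<integral>y. \<phi> (m + sg * y) \<partial>std_normal_distribution) \<le>
    4 * sqrt ((1 + s) * t / 2 * (\<integral>x. (\<Sum>b\<in>Basis. D b x ^ 4) \<partial>std_gauss) + (1 + 1/s) * u / 2 * (\<integral>x. k x ^ 4 \<partial>std_gauss) +
      ((1 + s) / (2 * t) * (\<integral>x. (\<Sum>b\<in>Basis. (p x \<bullet> b) ^ 4) \<partial>std_gauss) + (1 + 1/s) / (2 * u) * (\<integral>x. norm (p x) ^ 4 \<partial>std_gauss))) / sg\<^sup>2"
proof -
  have [measurable]: "\<phi> \<in> borel_measurable borel" using \<phi>(1) by (rule borel_measurable_continuous_onI)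
  interpret N: prob_space std_normal_distribution by (intro prob_space_normal_density) simp
  define R where "R n = real (Suc n)" for n
  have R1: "1 \<le> R n" "0 < R n" for n by (auto simp: R_def)
  have ie: "integrable std_gauss (\<lambda>x. e x ^ 4)"
  proof -
    have "integrable std_gauss (\<lambda>x. (60 * norm (p x) + 60 * \<bar>h x\<bar>) ^ 4)"
      by (rule integrable_power4_add) (use ih ip in \<open>auto simp: power_mult_distrib\<close>)
    then show ?thesis by (simp add: e_def distrib_left)
  qed
  have ipb: "integrable std_gauss (\<lambda>x. \<bar>p x \<bullet> b\<bar> ^ 4)" if b: "b \<in> Basis" for b
  proof (rule Bochner_Integration.integrable_bound[OF ip])
    have "\<bar>p x \<bullet> b\<bar> ^ 4 \<le> norm (p x) ^ 4" for x by (intro power_mono Basis_le_norm b) auto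
    then show "AE x in std_gauss. norm (\<bar>p x \<bullet> b\<bar> ^ 4) \<le> norm (norm (p x) ^ 4)" by (intro AE_I2) simp
  qed measurable
  \<comment> \<open>The weights are fixed before the limit, so only the error
    \<open>e x / real (Suc n)\<close> depends on \<open>n\<close>.\<close>
  define r1 where "r1 n x = (1 + s) * t / 2 * (\<Sum>b\<in>Basis. D b x ^ 4) + (1 + 1/s) * u / 2 * (k x + e x / real (Suc n)) ^ 4" for n x
  define r2 where "r2 n x = (1 + s) / (2 * t) * (\<Sum>b\<in>Basis. (\<bar>p x \<bullet> b\<bar> + e x / real (Suc n)) ^ 4) + (1 + 1/s) / (2 * u) * (norm (p x) + e x / real (Suc n)) ^ 4" for n x
  have mr [measurable]: "r1 n \<in> borel_measurable borel" "r2 n \<in> borel_measurable borel" for n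
    unfolding r1_def[abs_def] r2_def[abs_def] by measurable
  have r0: "0 \<le> r1 n x" "0 \<le> r2 n x" for n x
    unfolding r1_def r2_def using pos by (intro add_nonneg_nonneg mult_nonneg_nonneg sum_nonneg; simp)+
  have lp: "(\<lambda>n. \<integral>x. (norm (p x) + e x / real (Suc n)) ^ 4 \<partial>std_gauss) \<longlonglongrightarrow> (\<integral>x. norm (p x) ^ 4 \<partial>std_gauss)"
    "\<And>n. integrable std_gauss (\<lambda>x. (norm (p x) + e x / real (Suc n)) ^ 4)"
    by (rule power4_perturbation_limit[OF _ _ ip ie _ e_nonneg]; simp)+
  have lk: "(\<lambda>n. \<integral>x. (k x + e x / real (Suc n)) ^ 4 \<partial>std_gauss) \<longlonglongrightarrow> (\<integral>x. k x ^ 4 \<partial>std_gauss)"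
    "\<And>n. integrable std_gauss (\<lambda>x. (k x + e x / real (Suc n)) ^ 4)"
    by (rule power4_perturbation_limit[OF _ _ ik ie k0 e_nonneg]; simp)+
  have lb: "(\<lambda>n. \<integral>x. (\<bar>p x \<bullet> b\<bar> + e x / real (Suc n)) ^ 4 \<partial>std_gauss) \<longlonglongrightarrow> (\<integral>x. \<bar>p x \<bullet> b\<bar> ^ 4 \<partial>std_gauss)"
    "\<And>n. integrable std_gauss (\<lambda>x. (\<bar>p x \<bullet> b\<bar> + e x / real (Suc n)) ^ 4)" if b: "b \<in> Basis" for b
    by (rule power4_perturbation_limit[OF _ _ ipb[OF b] ie _ e_nonneg]; simp)+
  have ir: "integrable std_gauss (r1 n)" "integrable std_gauss (r2 n)" for n
    unfolding r1_def[abs_def] r2_def[abs_def]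
    by (intro Bochner_Integration.integrable_add integrable_mult_right Bochner_Integration.integrable_sum iD lk lp lb; assumption)+
  have i1: "integrable std_gauss (\<lambda>x. (1 + s) * t / 2 * (\<Sum>b\<in>Basis. D b x ^ 4))" "integrable std_gauss (\<lambda>x. (1 + 1/s) * u / 2 * (k x + e x / real (Suc n)) ^ 4)" for n
    by (intro integrable_mult_right Bochner_Integration.integrable_sum iD lk; assumption)+
  have i2: "integrable std_gauss (\<lambda>x. (1 + s) / (2 * t) * (\<Sum>b\<in>Basis. (\<bar>p x \<bullet> b\<bar> + e x / real (Suc n)) ^ 4))"
     "integrable std_gauss (\<lambda>x. (1 + 1/s) / (2 * u) * (norm (p x) + e x / real (Suc n)) ^ 4)" for n
    by (intro integrable_mult_right Bochner_Integration.integrable_sum lb lp; assumption)+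
  have I1: "(\<integral>x. r1 n x \<partial>std_gauss) = (1 + s) * t / 2 * (\<integral>x. (\<Sum>b\<in>Basis. D b x ^ 4) \<partial>std_gauss) + (1 + 1/s) * u / 2 * (\<integral>x. (k x + e x / real (Suc n)) ^ 4 \<partial>std_gauss)" for n
    unfolding r1_def
    by (simp only: Bochner_Integration.integral_add[OF i1] integral_mult_right_zero)
  have I2: "(\<integral>x. r2 n x \<partial>std_gauss) = (1 + s) / (2 * t) * (\<Sum>b\<in>Basis. \<integral>x. (\<bar>p x \<bullet> b\<bar> + e x / real (Suc n)) ^ 4 \<partial>std_gauss) + (1 + 1/s) / (2 * u) * (\<integral>x. (norm (p x) + e x / real (Suc n)) ^ 4 \<partial>std_gauss)" for n
    unfolding r2_def
    by (simp only: Bochner_Integration.integral_add[OF i2] integral_mult_right_zero Bochner_Integration.integral_sum[OF lb(2)])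
  have Ip: "(\<integral>x. (\<Sum>b\<in>Basis. (p x \<bullet> b) ^ 4) \<partial>std_gauss) = (\<Sum>b\<in>Basis. \<integral>x. \<bar>p x \<bullet> b\<bar> ^ 4 \<partial>std_gauss)"
    using ipb by (subst Bochner_Integration.integral_sum) auto
  let ?A = "(1 + s) * t / 2 * (\<integral>x. (\<Sum>b\<in>Basis. D b x ^ 4) \<partial>std_gauss) + (1 + 1/s) * u / 2 * (\<integral>x. k x ^ 4 \<partial>std_gauss) +
      ((1 + s) / (2 * t) * (\<integral>x. (\<Sum>b\<in>Basis. (p x \<bullet> b) ^ 4) \<partial>std_gauss) + (1 + 1/s) / (2 * u) * (\<integral>x. norm (p x) ^ 4 \<partial>std_gauss))"
  have limA: "(\<lambda>n. (\<integral>x. r1 n x \<partial>std_gauss) + (\<integral>x. r2 n x \<partial>std_gauss)) \<longlonglongrightarrow> ?A"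
    unfolding I1 I2 Ip by (intro tendsto_add tendsto_mult tendsto_const tendsto_sum lk lp lb)
  have Rn: "(HR (R n) x v \<bullet> pR (R n) y)\<^sup>2 \<le> (r1 n x + r2 n y) * (norm v)\<^sup>2" for n x y v
  proof -
    have "(HR (R n) x v \<bullet> pR (R n) y)\<^sup>2 \<le> ((1 + s) * t / 2 * (\<Sum>b\<in>Basis. D b x ^ 4) + (1 + 1/s) * u / 2 * (k x + e x / R n) ^ 4 +
     ((1 + s) / (2 * t) * (\<Sum>b\<in>Basis. (pR (R n) y \<bullet> b) ^ 4) + (1 + 1/s) / (2 * u) * norm (pR (R n) y) ^ 4)) * (norm v)\<^sup>2"
      using R1[of n] k0[of x] e_nonneg[of x] by (intro quartic_form_bound HR_form_bound pos) auto
    also have "\<dots> \<le> (r1 n x + r2 n y) * (norm v)\<^sup>2"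
      unfolding r1_def r2_def R_def[symmetric]
    proof (intro mult_right_mono add_mono order_refl mult_left_mono sum_mono)
      show "(pR (R n) y \<bullet> b) ^ 4 \<le> (\<bar>p y \<bullet> b\<bar> + e y / R n) ^ 4" if b: "b \<in> Basis" for b
        using power_mono[OF pR_bounds(2)[OF R1(1)[of n] b, of y] abs_ge_zero, where n=4] by simp
      show "norm (pR (R n) y) ^ 4 \<le> (norm (p y) + e y / R n) ^ 4"
        by (intro power_mono pR_bounds R1) auto
    qed (use pos in \<open>auto intro!: sum_nonneg\<close>)
    finally show ?thesis .
  qed
  \<comment> \<open>One integrable majorant for \<open>h\<close> and for its square, hence for the
    means and variances of all truncations.\<close>
  have ihh: "integrable std_gauss (\<lambda>x. 1 + h x ^ 4)" using ih by simp
  define mn where "mn n = (\<integral>x. hR (R n) x \<partial>std_gauss)" for n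
  define vn where "vn n = (\<integral>x. hR (R n) x * hR (R n) x \<partial>std_gauss) - (mn n)\<^sup>2" for n
  have lm: "mn \<longlonglongrightarrow> m"
    unfolding mn_def[abs_def] m
  proof (rule integral_dominated_convergence[OF _ _ ihh])
    show "AE x in std_gauss. (\<lambda>n. hR (R n) x) \<longlonglongrightarrow> h x" unfolding R_def by (intro AE_I2 hR_tendsto)
    show "AE x in std_gauss. norm (hR (R n) x) \<le> 1 + h x ^ 4" for n
      using order_trans[OF hR_le abs_le_1_power4] by (intro AE_I2) simp
  qed measurable
  have lv: "vn \<longlonglongrightarrow> sg\<^sup>2"
    unfolding vn_def[abs_def] sg(1)
  proof (intro tendsto_diff tendsto_power lm, rule integral_dominated_convergence[OF _ _ ihh])
    show "AE x in std_gauss. (\<lambda>n. hR (R n) x * hR (R n) x) \<longlonglongrightarrow> h x * h x"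
      unfolding R_def by (intro AE_I2 tendsto_mult hR_tendsto)
    have "norm (hR (R n) x * hR (R n) x) \<le> 1 + h x ^ 4" for n x
    proof -
      have "norm (hR (R n) x * hR (R n) x) \<le> \<bar>h x\<bar> * \<bar>h x\<bar>"
        unfolding real_norm_def abs_mult by (intro mult_mono hR_le) auto
      also have "\<dots> = (h x)\<^sup>2" by (simp add: power2_eq_square)
      also have "\<dots> \<le> 1 + h x ^ 4" by (rule square_le_1_power4)
      finally show ?thesis .
    qed
    then show "AE x in std_gauss. norm (hR (R n) x * hR (R n) x) \<le> 1 + h x ^ 4" for n by (intro AE_I2)
  qed measurable
  have sg0: "0 < sg\<^sup>2" using zero_less_power[OF sg(2)] .
  \<comment> \<open>The bounded version needs a positive variance, which for the truncated function
    is certain only for large \<open>n\<close>.\<close>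
  have ev: "\<forall>\<^sub>F n in sequentially. 0 < vn n" using lv sg0 by (rule order_tendstoD)
  have abs\<phi>: "\<bar>\<phi> y\<bar> \<le> 1" for y using \<phi>(2,3)[of y] by simp
  have isc: "isCont \<phi> y" for y using \<phi>(1) by (simp add: continuous_on_eq_continuous_at)
  have l1: "(\<lambda>n. \<integral>x. \<phi> (hR (R n) x) \<partial>std_gauss) \<longlonglongrightarrow> (\<integral>x. \<phi> (h x) \<partial>std_gauss)"
  proof (rule integral_dominated_convergence[where w="\<lambda>_. 1"])
    show "AE x in std_gauss. (\<lambda>n. \<phi> (hR (R n) x)) \<longlonglongrightarrow> \<phi> (h x)"
      unfolding R_def by (intro AE_I2 isCont_tendsto_compose[OF isc] hR_tendsto)
    show "AE x in std_gauss. norm (\<phi> (hR (R n) x)) \<le> 1" for n by (intro AE_I2) (simp add: abs\<phi>)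
  qed auto
  have l2: "(\<lambda>n. \<integral>y. \<phi> (mn n + sqrt (vn n) * y) \<partial>std_normal_distribution) \<longlonglongrightarrow> (\<integral>y. \<phi> (m + sg * y) \<partial>std_normal_distribution)"
  proof (rule integral_dominated_convergence[where w="\<lambda>_. 1"])
    have "(\<lambda>n. sqrt (vn n)) \<longlonglongrightarrow> sqrt (sg\<^sup>2)" by (intro tendsto_real_sqrt lv)
    then have "(\<lambda>n. sqrt (vn n)) \<longlonglongrightarrow> sg" using sg(2) by simp
    then show "AE y in std_normal_distribution. (\<lambda>n. \<phi> (mn n + sqrt (vn n) * y)) \<longlonglongrightarrow> \<phi> (m + sg * y)"
      by (intro AE_I2 isCont_tendsto_compose[OF isc] tendsto_add tendsto_mult tendsto_const lm)
    show "AE y in std_normal_distribution. norm (\<phi> (mn n + sqrt (vn n) * y)) \<le> 1" for n by (intro AE_I2) (simp add: abs\<phi>)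
  qed auto
  have l3: "(\<lambda>n. 4 * sqrt ((\<integral>x. r1 n x \<partial>std_gauss) + (\<integral>x. r2 n x \<partial>std_gauss)) / vn n) \<longlonglongrightarrow> 4 * sqrt ?A / sg\<^sup>2"
    using sg0 by (intro tendsto_divide tendsto_mult tendsto_const tendsto_real_sqrt limA lv) simp
  show ?thesis
  proof (rule tendsto_le[OF _ l3 tendsto_diff[OF l1 l2]])
    show "\<forall>\<^sub>F n in sequentially. (\<integral>x. \<phi> (hR (R n) x) \<partial>std_gauss) - (\<integral>y. \<phi> (mn n + sqrt (vn n) * y) \<partial>std_normal_distribution)
      \<le> 4 * sqrt ((\<integral>x. r1 n x \<partial>std_gauss) + (\<integral>x. r2 n x \<partial>std_gauss)) / vn n"
      using ev
    proof eventually_elim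
      case (elim n)
      obtain B where B: "\<And>x v. norm (HR (R n) x v) \<le> B * norm v" using HR_bounded[OF R1(2)[of n]] by blast
      have sq: "(sqrt (vn n))\<^sup>2 = vn n" using elim by simp
      have "(\<integral>x. \<phi> (hR (R n) x) \<partial>std_gauss) - (\<integral>y. \<phi> (mn n + sqrt (vn n) * y) \<partial>std_normal_distribution)
        \<le> 4 * sqrt ((\<integral>x. r1 n x \<partial>std_gauss) + (\<integral>x. r2 n x \<partial>std_gauss)) / (sqrt (vn n))\<^sup>2"
        by (rule stein_bound_bounded[OF C1_bounded_hR[OF R1(2)] pR_derivative continuous_HR B Rn mr ir r0 mn_def _ _ \<phi>])
           (use elim in \<open>simp_all add: vn_def\<close>)
      then show ?case unfolding sq .
    qed
  qed simp
qed

end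

section \<open>Wishart matrices\<close>

text \<open>First variation: for small \<open>t\<close> the linear term dominates and would change
  sign.\<close>

lemma quadratic_nonneg_linear_zero:
  fixes b c :: real
  assumes "\<And>t. 0 \<le> 2 * t * b + t\<^sup>2 * c" and c: "0 \<le> c"
  shows "b = 0"
proof (rule ccontr)
  assume b: "b \<noteq> 0"
  define d where "d = c + 1"
  have d: "d > 0" "c = d - 1" using c by (auto simp: d_def)
  \<comment> \<open>The witness is \<open>- b / d\<close> with \<open>d = c + 1\<close> in place of
    the minimiser \<open>- b / c\<close>, to allow \<open>c = 0\<close>; the factor
    \<open>d^2\<close> clears denominators.\<close>
  have "0 \<le> (2 * (- b / d) * b + (- b / d)\<^sup>2 * c) * d\<^sup>2"
    by (intro mult_nonneg_nonneg assms(1)) simp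
  also have "\<dots> = - (b\<^sup>2 * (c + 2))"
    using d(1) unfolding d(2) by (simp add: power2_eq_square field_simps)
  finally have "b\<^sup>2 * (c + 2) \<le> 0" by simp
  moreover have "0 < b\<^sup>2 * (c + 2)" using b c by (intro mult_pos_pos) auto
  ultimately show False by simp
qed

lemma inner_matrix_transpose: "x \<bullet> (A *v y) = (transpose A *v x) \<bullet> (y::real^'m)" for A :: "real^'m^'n"
  by (simp add: dot_lmul_matrix[symmetric])

text \<open>Eigenvectors of distinct eigenvalues are orthogonal, hence independent. Finiteness is
  what gives \<open>Max\<close> in \<open>largest_eigenvalue\<close> its meaning.\<close>

lemma finite_eigenvalues_symmetric:
  fixes A :: "real^'n^'n"
  assumes "transpose A = A"
  shows "finite {k. \<exists>v. v \<noteq> 0 \<and> A *v v = k *\<^sub>R v}"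
proof -
  let ?S = "{k. \<exists>v. v \<noteq> 0 \<and> A *v v = k *\<^sub>R v}"
  have "\<forall>k\<in>?S. \<exists>v. v \<noteq> 0 \<and> A *v v = k *\<^sub>R v" by blast
  from bchoice[OF this] obtain v where v: "\<And>k. k \<in> ?S \<Longrightarrow> v k \<noteq> 0 \<and> A *v v k = k *\<^sub>R v k"
    by blast
  have orth: "v k \<bullet> v l = 0" if "k \<in> ?S" "l \<in> ?S" "k \<noteq> l" for k l
  proof -
    have "k * (v k \<bullet> v l) = (A *v v k) \<bullet> v l" using v[OF that(1)] by simp
    also have "\<dots> = v k \<bullet> (A *v v l)" using inner_matrix_transpose[of "v k" A "v l"] assms by simp
    also have "\<dots> = l * (v k \<bullet> v l)" using v[OF that(2)] by simp
    finally show ?thesis using that(3) by simp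
  qed
  have inj: "inj_on v ?S"
    by (rule inj_onI) (metis (no_types, lifting) inner_eq_zero_iff orth v)
  have "independent (v ` ?S)"
  proof (rule pairwise_orthogonal_independent)
    show "pairwise orthogonal (v ` ?S)"
      by (auto simp: pairwise_def orthogonal_def) (metis (mono_tags, lifting) mem_Collect_eq orth)
    show "0 \<notin> v ` ?S" using v by force
  qed
  then have "finite (v ` ?S)" by (rule independent_imp_finite)
  then show ?thesis using inj finite_imageD by blast
qed

text \<open>The Rayleigh quotient attains its maximum \<mu> on the unit sphere; the maximiser is an
  eigenvector, and no eigenvalue exceeds \<mu>.\<close>

lemma largest_eigenvalue_symmetric:
  fixes A :: "real^'n^'n"
  assumes A: "transpose A = A"
  shows "x \<bullet> (A *v x) \<le> largest_eigenvalue A * (norm x)\<^sup>2"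
    and "\<exists>x. norm x = 1 \<and> A *v x = largest_eigenvalue A *\<^sub>R x"
proof -
  let ?S = "{k. \<exists>v. v \<noteq> 0 \<and> A *v v = k *\<^sub>R v}"
  have "\<exists>x0\<in>sphere (0::real^'n) 1. \<forall>x\<in>sphere 0 1. x \<bullet> (A *v x) \<le> x0 \<bullet> (A *v x0)"
  proof (rule continuous_attains_sup)
    have "axis undefined 1 \<in> (Basis :: (real^'n) set)" by (simp add: axis_in_Basis_iff)
    then have "axis undefined 1 \<in> sphere (0::real^'n) 1" by simp
    then show "sphere (0::real^'n) 1 \<noteq> {}" by blast
    show "continuous_on (sphere 0 1) (\<lambda>x. x \<bullet> (A *v x))"
      by (intro continuous_intros linear_continuous_on matrix_vector_mul_bounded_linear)
  qed (rule compact_sphere)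
  then obtain x0 where x0: "norm x0 = 1" and mx: "\<And>x. norm x = 1 \<Longrightarrow> x \<bullet> (A *v x) \<le> x0 \<bullet> (A *v x0)"
    by auto
  define \<mu> where "\<mu> = x0 \<bullet> (A *v x0)"
  have ray: "x \<bullet> (A *v x) \<le> \<mu> * (norm x)\<^sup>2" for x
  proof (cases "x = 0")
    case False
    define y where "y = (1 / norm x) *\<^sub>R x"
    have "norm y = 1" using False by (simp add: y_def)
    have xy: "x = norm x *\<^sub>R y" using False by (simp add: y_def)
    have "x \<bullet> (A *v x) = (norm x)\<^sup>2 * (y \<bullet> (A *v y))"
      by (subst (1 2) xy) (simp add: matrix_vector_mult_scaleR power2_eq_square)
    also have "\<dots> \<le> (norm x)\<^sup>2 * \<mu>" unfolding \<mu>_def by (intro mult_left_mono mx \<open>norm y = 1\<close>) simp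
    finally show ?thesis by (simp add: mult.commute)
  qed simp
  have sym: "x \<bullet> (A *v y) = y \<bullet> (A *v x)" for x y
    using inner_matrix_transpose[of x A y] A by (simp add: inner_commute)
  define z where "z = \<mu> *\<^sub>R x0 - A *v x0"
  \<comment> \<open>The nonnegative form \<open>\<mu> * (norm x)^2 - x \<bullet> (A *v x)\<close> is
    zero at \<open>x0\<close>. Moving in the direction of the residual \<open>z\<close> changes it
    to first order by \<open>2 * t * (z \<bullet> z)\<close>, so the residual vanishes.\<close>
  have "z \<bullet> z = 0"
  proof (rule quadratic_nonneg_linear_zero)
    fix t :: real
    have "0 \<le> \<mu> * (norm (x0 + t *\<^sub>R z))\<^sup>2 - (x0 + t *\<^sub>R z) \<bullet> (A *v (x0 + t *\<^sub>R z))"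
      using ray by simp
    also have "\<dots> = (\<mu> * (x0 \<bullet> x0) - x0 \<bullet> (A *v x0)) + 2 * t * ((\<mu> *\<^sub>R x0 - A *v x0) \<bullet> z) + t\<^sup>2 * (\<mu> * (z \<bullet> z) - z \<bullet> (A *v z))"
      unfolding power2_norm_eq_inner using sym[of x0 z]
      by (simp add: matrix_vector_right_distrib matrix_vector_mult_scaleR inner_simps inner_commute power2_eq_square algebra_simps)
    also have "\<mu> * (x0 \<bullet> x0) - x0 \<bullet> (A *v x0) = 0" using x0 by (simp add: \<mu>_def dot_square_norm)
    finally show "0 \<le> 2 * t * (z \<bullet> z) + t\<^sup>2 * (\<mu> * (z \<bullet> z) - z \<bullet> (A *v z))" by (simp add: z_def)
  next
    show "0 \<le> \<mu> * (z \<bullet> z) - z \<bullet> (A *v z)" using ray[of z] by (simp add: dot_square_norm)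
  qed
  then have ev: "A *v x0 = \<mu> *\<^sub>R x0" by (simp add: z_def)
  have "largest_eigenvalue A = \<mu>"
    unfolding largest_eigenvalue_def
  proof (rule Max_eqI[OF finite_eigenvalues_symmetric[OF A]])
    show "\<mu> \<in> ?S" using ev x0 by (auto intro!: exI[of _ x0])
    fix k assume "k \<in> ?S"
    then obtain v where v: "v \<noteq> 0" "A *v v = k *\<^sub>R v" by auto
    have "k * (norm v)\<^sup>2 \<le> \<mu> * (norm v)\<^sup>2" using ray[of v] v by (simp add: dot_square_norm)
    then show "k \<le> \<mu>" using v by simp
  qed
  then show "x \<bullet> (A *v x) \<le> largest_eigenvalue A * (norm x)\<^sup>2"
    "\<exists>x. norm x = 1 \<and> A *v x = largest_eigenvalue A *\<^sub>R x"
    using ray ev x0 by auto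
qed

section \<open>Operator bounds against the Frobenius norm\<close>

lemma norm_transpose: "norm (transpose (M :: real^'m^'n)) = norm M"
proof -
  have "(norm (transpose M))\<^sup>2 = (norm M)\<^sup>2"
    unfolding power2_norm_eq_inner by (simp add: inner_vec_def transpose_def) (rule sum.swap)
  then show ?thesis by simp
qed

text \<open>\<open>norm\<close> on matrices is the Frobenius norm, while operator norms occur as
  constants \<open>c\<close> in hypotheses. The rows of \<open>M ** B\<close> are the images of the
  rows of \<open>M\<close> under \<open>transpose B\<close>, and the squared norms add up over the
  rows.\<close>

lemma norm_matrix_mult_right:
  fixes M :: "real^'m^'n" and B :: "real^'k^'m"
  assumes B: "\<And>v. norm (transpose B *v v) \<le> c * norm v" and c: "0 \<le> c"
  shows "norm (M ** B) \<le> norm M * c"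
proof -
  have row: "(M ** B) $ i = transpose B *v (M $ i)" for i
    by (simp add: vec_eq_iff matrix_matrix_mult_def matrix_vector_mult_def transpose_def mult.commute)
  have "(norm (M ** B))\<^sup>2 = (\<Sum>i\<in>UNIV. (norm (transpose B *v (M $ i)))\<^sup>2)"
    unfolding power2_norm_eq_inner by (simp add: inner_vec_def[of "M ** B"] row)
  also have "\<dots> \<le> (\<Sum>i\<in>UNIV. (c * norm (M $ i))\<^sup>2)"
    by (intro sum_mono power_mono B) simp
  also have "\<dots> = (c * norm M)\<^sup>2"
    unfolding power_mult_distrib sum_distrib_left[symmetric]
    by (simp add: power2_norm_eq_inner inner_vec_def[of M])
  finally have "norm (M ** B) \<le> c * norm M" using c power2_le_imp_le[of "norm (M ** B)" "c * norm M"] by simp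
  then show ?thesis by (simp add: mult.commute)
qed

lemma norm_matrix_mult_left:
  fixes M :: "real^'m^'n" and B :: "real^'n^'k"
  assumes B: "\<And>v. norm (B *v v) \<le> c * norm v" and c: "0 \<le> c"
  shows "norm (B ** M) \<le> c * norm M"
proof -
  have "norm (B ** M) = norm (transpose M ** transpose B)"
    by (simp add: matrix_transpose_mul[symmetric] norm_transpose)
  also have "\<dots> \<le> norm (transpose M) * c" by (rule norm_matrix_mult_right) (use B c in auto)
  finally show ?thesis by (simp add: norm_transpose mult.commute)
qed

lemma bounded_bilinear_matrix_mult:
  "bounded_bilinear ((**) :: real^'m^'n \<Rightarrow> real^'k^'m \<Rightarrow> real^'k^'n)"
  unfolding bilinear_conv_bounded_bilinear[symmetric] bilinear_def
  by (auto intro!: linearI simp: vec_eq_iff matrix_matrix_mult_def sum_distrib_left algebra_simps sum.distrib)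

lemma bounded_linear_transpose: "bounded_linear (transpose :: real^'m^'n \<Rightarrow> real^'n^'m)"
  unfolding linear_conv_bounded_linear[symmetric]
  by (auto intro!: linearI simp: transpose_def vec_eq_iff)

lemma bounded_linear_trace: "bounded_linear (trace :: real^'n^'n \<Rightarrow> real)"
  unfolding linear_conv_bounded_linear[symmetric]
  by (auto intro!: linearI simp: trace_def sum.distrib sum_distrib_left)

lemma trace_transpose: "trace (transpose M) = trace (M :: real^'n^'n)"
  by (simp add: trace_def transpose_def)

lemma trace_mult_transpose: "trace (M ** transpose K) = M \<bullet> (K :: real^'m^'n)"
  by (simp add: trace_def matrix_matrix_mult_def transpose_def inner_vec_def)

lemma matrix_power_simps: "matrix_power A 0 = mat 1" "matrix_power A (Suc m) = A ** matrix_power A m"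
  by (auto simp: matrix_power_def)

lemma matrix_power_add: "matrix_power A (m + k) = matrix_power A m ** matrix_power A k" for A :: "real^'n^'n"
  by (induction m) (auto simp: matrix_power_simps matrix_mul_assoc)

lemma matrix_power_bound:
  fixes A :: "real^'n^'n"
  assumes "\<And>v. norm (A *v v) \<le> c * norm v" "0 \<le> c"
  shows "norm (matrix_power A m *v v) \<le> c ^ m * norm v"
proof (induction m)
  case (Suc m)
  have "norm (matrix_power A (Suc m) *v v) \<le> c * norm (matrix_power A m *v v)"
    using assms(1) by (simp add: matrix_power_simps matrix_vector_mul_assoc[symmetric])
  also have "\<dots> \<le> c * (c ^ m * norm v)" by (intro mult_left_mono Suc assms)
  finally show ?case by simp
qed (simp add: matrix_power_simps)

lemma transpose_matrix_power: "transpose A = A \<Longrightarrow> transpose (matrix_power A m) = matrix_power A m" for A :: "real^'n^'n"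
proof (induction m)
  case (Suc m)
  have "matrix_power A (Suc m) = matrix_power A m ** A"
    using matrix_power_add[of A m 1] by (simp add: matrix_power_simps)
  then show ?case using Suc by (simp add: matrix_power_simps(2) matrix_transpose_mul)
qed (simp add: matrix_power_simps)

section \<open>The largest eigenvalue of A and the largest singular value of X\<close>

definition wishart :: "real^'N^'n \<Rightarrow> real^'n^'n" where
  "wishart X = (1 / real CARD('N)) *\<^sub>R (X ** transpose X)"

definition top_eig :: "real^'N^'n \<Rightarrow> real" where
  "top_eig X = largest_eigenvalue (wishart X)"

text \<open>The largest singular value of \<open>X\<close>, that is its operator norm: the factor
  \<open>CARD('N)\<close> undoes the normalisation in \<open>wishart\<close>.\<close>

definition top_sv :: "real^'N^'n \<Rightarrow> real" where
  "top_sv X = sqrt (real CARD('N) * top_eig X)"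

lemma transpose_wishart: "transpose (wishart X) = wishart X"
  by (simp add: wishart_def matrix_transpose_mul transpose_scalar)

lemma inner_wishart: "x \<bullet> (wishart X *v x) = (norm (transpose X *v x))\<^sup>2 / real CARD('N)" for X :: "real^'N^'n"
proof -
  have "x \<bullet> ((X ** transpose X) *v x) = (transpose X *v x) \<bullet> (transpose X *v x)"
    by (simp only: matrix_vector_mul_assoc[symmetric] inner_matrix_transpose)
  then show ?thesis
    by (simp add: wishart_def scaleR_matrix_vector_assoc[symmetric] power2_norm_eq_inner)
qed

lemma top_eig_attained:
  fixes X :: "real^'N^'n"
  obtains x where "norm x = 1" "norm (transpose X *v x) = top_sv X" "0 \<le> top_eig X"
proof -
  obtain x where x: "norm x = 1" "wishart X *v x = top_eig X *\<^sub>R x"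
    using largest_eigenvalue_symmetric(2)[OF transpose_wishart[of X]] by (auto simp: top_eig_def)
  have "top_eig X = (norm (transpose X *v x))\<^sup>2 / real CARD('N)"
    using inner_wishart[of x X] x by (simp add: dot_square_norm)
  then have 1: "(norm (transpose X *v x))\<^sup>2 = real CARD('N) * top_eig X" and 2: "0 \<le> top_eig X" by auto
  have "norm (transpose X *v x) = top_sv X"
    unfolding top_sv_def 1[symmetric] by simp
  then show ?thesis using that x 2 by blast
qed

lemma top_eig_nonneg: "0 \<le> top_eig X"
  using top_eig_attained[of X] by blast

lemma top_sv_nonneg: "0 \<le> top_sv X"
  by (simp add: top_sv_def top_eig_nonneg)

lemma top_sv_sq: "(top_sv X)\<^sup>2 = real CARD('N) * top_eig X" for X :: "real^'N^'n"
  by (simp add: top_sv_def top_eig_nonneg)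

lemma top_eig_eq: "top_eig X = (top_sv X)\<^sup>2 / real CARD('N)" for X :: "real^'N^'n"
  by (simp add: top_sv_sq)

lemma norm_transpose_mult_le: "norm (transpose X *v x) \<le> top_sv X * norm x" for X :: "real^'N^'n"
proof -
  have "(norm (transpose X *v x))\<^sup>2 / real CARD('N) \<le> top_eig X * (norm x)\<^sup>2"
    using largest_eigenvalue_symmetric(1)[OF transpose_wishart[of X], of x]
    unfolding inner_wishart top_eig_def[symmetric] .
  then have "(norm (transpose X *v x))\<^sup>2 \<le> top_eig X * (norm x)\<^sup>2 * real CARD('N)"
    by (simp only: pos_divide_le_eq zero_less_card_finite of_nat_0_less_iff)
  also have "\<dots> = (top_sv X * norm x)\<^sup>2"
    unfolding power_mult_distrib top_sv_sq by (simp only: mult_ac)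
  finally show ?thesis
    by (rule power2_le_imp_le) (intro mult_nonneg_nonneg top_sv_nonneg norm_ge_zero)
qed

lemma norm_mult_le: "norm (X *v y) \<le> top_sv X * norm y"
proof (cases "X *v y = 0")
  case False
  have "norm (X *v y) * norm (X *v y) = (transpose X *v (X *v y)) \<bullet> y"
    by (simp only: inner_matrix_transpose[symmetric] power2_norm_eq_inner[symmetric] power2_eq_square[symmetric])
  also have "\<dots> \<le> norm (transpose X *v (X *v y)) * norm y" by (rule norm_cauchy_schwarz)
  also have "\<dots> \<le> (top_sv X * norm (X *v y)) * norm y"
    by (intro mult_right_mono norm_transpose_mult_le) simp
  also have "\<dots> = (top_sv X * norm y) * norm (X *v y)" by simp
  finally show ?thesis using False by simp
qed (simp add: top_sv_nonneg)

lemma norm_wishart_mult_le: "norm (wishart X *v v) \<le> top_eig X * norm v" for X :: "real^'N^'n"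
proof -
  have "norm (wishart X *v v) = norm (X *v (transpose X *v v)) / real CARD('N)"
    by (simp add: wishart_def scaleR_matrix_vector_assoc[symmetric] matrix_vector_mul_assoc[symmetric] del: transpose_matrix_vector)
  also have "\<dots> \<le> (top_sv X * (top_sv X * norm v)) / real CARD('N)"
    by (intro divide_right_mono order_trans[OF norm_mult_le] mult_left_mono norm_transpose_mult_le top_sv_nonneg) simp
  also have "\<dots> = top_eig X * norm v"
    by (simp add: top_eig_eq power2_eq_square)
  finally show ?thesis .
qed

lemma norm_matrix_vector_le: "norm (M *v x) \<le> norm M * norm x" for M :: "real^'m^'n"
proof -
  have c: "(M *v x) $ i = M $ i \<bullet> x" for i
    by (simp add: matrix_vector_mult_def inner_vec_def)
  have "(norm (M *v x))\<^sup>2 = (\<Sum>i\<in>UNIV. (M $ i \<bullet> x)\<^sup>2)"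
    unfolding power2_norm_eq_inner inner_vec_def[of "M *v x"] by (simp add: c power2_eq_square)
  also have "\<dots> \<le> (\<Sum>i\<in>UNIV. (norm (M $ i))\<^sup>2 * (norm x)\<^sup>2)"
  proof (rule sum_mono)
    fix i
    show "(M $ i \<bullet> x)\<^sup>2 \<le> (norm (M $ i))\<^sup>2 * (norm x)\<^sup>2"
      using power_mono[OF Cauchy_Schwarz_ineq2[of "M $ i" x] abs_ge_zero, of 2] by (simp only: power2_abs power_mult_distrib)
  qed
  also have "\<dots> = (norm M * norm x)\<^sup>2"
    unfolding sum_distrib_right[symmetric] power_mult_distrib
    by (simp add: power2_norm_eq_inner inner_vec_def[of M])
  finally show ?thesis by (rule power2_le_imp_le) simp
qed

lemma top_sv_le_norm: "top_sv X \<le> norm X"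
proof -
  obtain x where "norm x = 1" "norm (transpose X *v x) = top_sv X" using top_eig_attained[of X] by blast
  then show ?thesis using norm_matrix_vector_le[of "transpose X" x] by (simp add: norm_transpose)
qed

text \<open>Each of the \<open>CARD('n)\<close> rows is the image of a unit vector under
  \<open>transpose X\<close>. This comparison brings the number of rows into the gradient
  bound.\<close>

lemma norm_le_top_sv: "(norm X)\<^sup>2 \<le> real CARD('n) * (top_sv X)\<^sup>2" for X :: "real^'N^'n"
proof -
  have row: "X $ i = transpose X *v axis i 1" for i
    by (simp add: matrix_vector_mult_basis column_def transpose_def vec_eq_iff del: transpose_matrix_vector)
  have "(norm X)\<^sup>2 = (\<Sum>i\<in>UNIV. (norm (X $ i))\<^sup>2)"
    by (simp add: power2_norm_eq_inner inner_vec_def[of X])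
  also have "\<dots> \<le> (\<Sum>i\<in>(UNIV::'n set). (top_sv X)\<^sup>2)"
  proof (intro sum_mono power_mono)
    fix i :: 'n
    have "axis i (1::real) \<in> Basis" by (simp add: axis_in_Basis_iff)
    then show "norm (X $ i) \<le> top_sv X" unfolding row using norm_transpose_mult_le[of X "axis i 1"] by simp
  qed simp
  finally show ?thesis by simp
qed

text \<open>Comparison at a unit vector that is maximal for \<open>X\<close>. The resulting
  continuity gives measurability of the largest eigenvalue, which its definition by
  \<open>Max\<close> does not show.\<close>

lemma top_sv_lipschitz: "top_sv X \<le> top_sv Y + norm (X - Y)"
proof -
  obtain x where x: "norm x = 1" "norm (transpose X *v x) = top_sv X" using top_eig_attained[of X] by blast
  have "transpose X *v x = transpose Y *v x + transpose (X - Y) *v x"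
    by (simp add: transpose_def vec_eq_iff matrix_vector_mult_def sum.distrib[symmetric] algebra_simps del: transpose_matrix_vector)
  then have "top_sv X \<le> norm (transpose Y *v x) + norm (transpose (X - Y) *v x)"
    unfolding x(2)[symmetric] by (metis norm_triangle_ineq)
  also have "\<dots> \<le> top_sv Y * norm x + norm (transpose (X - Y)) * norm x"
    by (intro add_mono norm_transpose_mult_le norm_matrix_vector_le)
  finally show ?thesis using x by (simp add: norm_transpose)
qed

lemma continuous_top_sv: "continuous_on UNIV (top_sv :: real^'N^'n \<Rightarrow> real)"
proof -
  have "\<bar>top_sv X - top_sv Y\<bar> \<le> 1 * norm (X - Y)" for X Y :: "real^'N^'n"
    using top_sv_lipschitz[of X Y] top_sv_lipschitz[of Y X] by (simp add: norm_minus_commute abs_le_iff)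
  then have "1-lipschitz_on UNIV (top_sv :: real^'N^'n \<Rightarrow> real)"
    by (intro lipschitz_onI) (auto simp: dist_norm)
  then show ?thesis by (rule lipschitz_on_continuous_on)
qed

lemma borel_measurable_top_eig [measurable]: "(top_eig :: real^'N^'n \<Rightarrow> real) \<in> borel_measurable borel"
proof -
  have "(\<lambda>X::real^'N^'n. (top_sv X)\<^sup>2 / real CARD('N)) \<in> borel_measurable borel"
    by (intro borel_measurable_divide borel_measurable_power borel_measurable_const
        borel_measurable_continuous_onI[OF continuous_top_sv])
  then show ?thesis by (simp only: top_eig_eq[symmetric])
qed

lemma norm_wishart_power_mult_le: "norm (matrix_power (wishart X) m *v v) \<le> top_eig X ^ m * norm v"
  by (rule matrix_power_bound[OF norm_wishart_mult_le top_eig_nonneg])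

lemma norm_power_mult_le: "norm (matrix_power (wishart X) m ** M) \<le> top_eig X ^ m * norm M"
  by (rule norm_matrix_mult_left[OF norm_wishart_power_mult_le zero_le_power[OF top_eig_nonneg]])

lemma norm_mult_power_le: "norm (M ** matrix_power (wishart X) m) \<le> norm M * top_eig X ^ m"
  by (rule norm_matrix_mult_right[OF _ zero_le_power[OF top_eig_nonneg]])
     (simp only: transpose_matrix_power[OF transpose_wishart] norm_wishart_power_mult_le)

section \<open>Derivatives of powers of A and of their traces\<close>

definition d_wishart :: "real^'N^'n \<Rightarrow> real^'N^'n \<Rightarrow> real^'n^'n" where
  "d_wishart X V = (1 / real CARD('N)) *\<^sub>R (X ** transpose V + V ** transpose X)"

text \<open>The derivative of a power in direction \<open>V\<close>. The recursion follows
  \<open>A ** matrix_power A m\<close>, so that noncommuting factors keep their order.\<close>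

fun d_power :: "nat \<Rightarrow> real^'N^'n \<Rightarrow> real^'N^'n \<Rightarrow> real^'n^'n" where
  "d_power 0 X V = 0"
| "d_power (Suc m) X V = wishart X ** d_power m X V + d_wishart X V ** matrix_power (wishart X) m"

lemma wishart_derivative: "(wishart has_derivative d_wishart X) (at X)" for X :: "real^'N^'n"
proof -
  have "((\<lambda>X. (1 / real CARD('N)) *\<^sub>R (X ** transpose X)) has_derivative
    (\<lambda>V. (1 / real CARD('N)) *\<^sub>R (X ** transpose V + V ** transpose X))) (at X)"
    by (intro has_derivative_scaleR_right bounded_bilinear.FDERIV[OF bounded_bilinear_matrix_mult]
        has_derivative_ident bounded_linear_imp_has_derivative bounded_linear_transpose)
  then show ?thesis by (simp add: wishart_def[abs_def] d_wishart_def[abs_def])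
qed

lemma power_derivative: "((\<lambda>X. matrix_power (wishart X) m) has_derivative d_power m X) (at X)"
proof (induction m)
  case 0
  then show ?case by (simp add: matrix_power_simps d_power.simps[abs_def])
next
  case (Suc m)
  have "((\<lambda>X. wishart X ** matrix_power (wishart X) m) has_derivative
    (\<lambda>V. wishart X ** d_power m X V + d_wishart X V ** matrix_power (wishart X) m)) (at X)"
    by (rule bounded_bilinear.FDERIV[OF bounded_bilinear_matrix_mult wishart_derivative Suc])
  then show ?case by (simp add: matrix_power_simps d_power.simps(2)[abs_def])
qed

lemma norm_d_wishart: "norm (d_wishart X V) \<le> 2 / real CARD('N) * top_sv X * norm V" for X :: "real^'N^'n"
proof -
  have "norm (X ** transpose V) \<le> top_sv X * norm V"
    using norm_matrix_mult_left[of X "top_sv X" "transpose V"] norm_mult_le[of X] top_sv_nonneg[of X] by (simp add: norm_transpose)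
  moreover have "norm (V ** transpose X) \<le> norm V * top_sv X"
    using norm_matrix_mult_right[of "transpose X" "top_sv X" V] norm_mult_le[of X] top_sv_nonneg[of X] by simp
  ultimately have "norm (X ** transpose V + V ** transpose X) \<le> 2 * (top_sv X * norm V)"
    using norm_triangle_ineq[of "X ** transpose V" "V ** transpose X"] mult.commute[of "norm V" "top_sv X"] by linarith
  then show ?thesis by (simp add: d_wishart_def divide_right_mono mult_ac)
qed

lemma norm_d_power: "norm (d_power m X V) \<le> real m * top_eig X ^ (m - 1) * norm (d_wishart X V)"
proof (induction m)
  case (Suc m)
  have "norm (d_power (Suc m) X V) \<le> norm (matrix_power (wishart X) 1 ** d_power m X V) + norm (d_wishart X V ** matrix_power (wishart X) m)"
    by (simp add: matrix_power_simps norm_triangle_ineq)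
  also have "\<dots> \<le> top_eig X ^ 1 * norm (d_power m X V) + norm (d_wishart X V) * top_eig X ^ m"
    by (intro add_mono norm_power_mult_le norm_mult_power_le)
  also have "\<dots> \<le> top_eig X * (real m * top_eig X ^ (m - 1) * norm (d_wishart X V)) + norm (d_wishart X V) * top_eig X ^ m"
    using Suc top_eig_nonneg[of X] by (simp add: mult_left_mono)
  also have "top_eig X * (real m * top_eig X ^ (m - 1) * norm (d_wishart X V)) = real m * top_eig X ^ m * norm (d_wishart X V)"
    by (cases m) auto
  finally show ?case by (simp add: algebra_simps)
qed simp

text \<open>Cyclicity makes all summands of the derivative of a power equal under the trace, whence
  the factor \<open>m\<close>. The extra power \<open>j\<close> is what the induction needs, since
  each step moves one factor \<open>wishart X\<close> to the front. For \<open>m = 0\<close> both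
  sides vanish, so the truncated exponent is harmless.\<close>

lemma trace_d_power: "trace (matrix_power (wishart X) j ** d_power m X V) = real m * trace (matrix_power (wishart X) (j + m - 1) ** d_wishart X V)"
proof (induction m arbitrary: j)
  case 0
  then show ?case by (simp add: trace_def)
next
  case (Suc m)
  let ?A = "matrix_power (wishart X)"
  have "trace (?A j ** d_power (Suc m) X V) = trace (?A j ** (wishart X ** d_power m X V)) + trace (?A j ** (d_wishart X V ** ?A m))"
    by (simp add: matrix_add_ldistrib trace_add)
  also have "?A j ** (wishart X ** d_power m X V) = ?A (Suc j) ** d_power m X V"
    using matrix_power_add[of "wishart X" j 1] by (simp add: matrix_mul_assoc matrix_power_simps)
  also have "trace (?A j ** (d_wishart X V ** ?A m)) = trace (?A (j + m) ** d_wishart X V)"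
    by (metis add.commute matrix_mul_assoc matrix_power_add trace_mul_sym)
  also have "trace (?A (Suc j) ** d_power m X V) = real m * trace (?A (j + m) ** d_wishart X V)"
    using Suc.IH[of "Suc j"] by simp
  finally show ?case by (simp add: algebra_simps)
qed

lemma trace_scaleR: "trace (c *\<^sub>R M) = c * trace M" for M :: "real^'n^'n"
  by (simp add: trace_def sum_distrib_left)

text \<open>Transposing and cycling one summand of \<open>d_wishart\<close> under the trace gives
  the other, because powers of \<open>wishart X\<close> are symmetric; hence the factor 2. The
  gradient of a trace of powers is thus a multiple of a power times \<open>X\<close>.\<close>

lemma trace_power_d_wishart:
  "trace (matrix_power (wishart X) m ** d_wishart X V) = 2 / real CARD('N) * ((matrix_power (wishart X) m ** X) \<bullet> V)" for X :: "real^'N^'n"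
proof -
  let ?A = "matrix_power (wishart X) m"
  have t1: "trace (?A ** (X ** transpose V)) = (?A ** X) \<bullet> V"
    by (simp add: matrix_mul_assoc trace_mult_transpose)
  have "trace (?A ** (V ** transpose X)) = trace (transpose (?A ** (V ** transpose X)))" by (simp add: trace_transpose)
  also have "transpose (?A ** (V ** transpose X)) = (X ** transpose V) ** ?A"
    by (simp add: matrix_transpose_mul transpose_matrix_power transpose_wishart)
  also have "trace \<dots> = trace (?A ** (X ** transpose V))" by (rule trace_mul_sym)
  finally have t2: "trace (?A ** (V ** transpose X)) = (?A ** X) \<bullet> V" using t1 by simp
  have "?A ** d_wishart X V = (1 / real CARD('N)) *\<^sub>R (?A ** (X ** transpose V) + ?A ** (V ** transpose X))"
    unfolding d_wishart_def by (simp add: bounded_bilinear.scaleR_right[OF bounded_bilinear_matrix_mult] matrix_add_ldistrib)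
  then have "trace (?A ** d_wishart X V) = (1 / real CARD('N)) * ((?A ** X) \<bullet> V + (?A ** X) \<bullet> V)"
    using t1 t2 by (simp only: trace_scaleR trace_add)
  then show ?thesis by simp
qed

lemma trace_power_derivative:
  fixes X :: "real^'N^'n"
  shows "((\<lambda>X. trace (matrix_power (wishart X) m)) has_derivative
    (\<lambda>V. ((2 * real m / real CARD('N)) *\<^sub>R (matrix_power (wishart X) (m - 1) ** X)) \<bullet> V)) (at X)"
proof -
  have "((\<lambda>X. trace (matrix_power (wishart X) m)) has_derivative (\<lambda>V. trace (d_power m X V))) (at X)"
    by (rule bounded_linear.has_derivative[OF bounded_linear_trace power_derivative])
  moreover have "trace (d_power m X V) = ((2 * real m / real CARD('N)) *\<^sub>R (matrix_power (wishart X) (m - 1) ** X)) \<bullet> V" for V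
    using trace_d_power[of X 0 m V] trace_power_d_wishart[of X "m - 1" V] by (simp add: matrix_power_simps)
  ultimately show ?thesis by simp
qed

text \<open>Up to the factor \<open>2 * (m + 1) / CARD('N)\<close> this is the Hessian of the trace
  of the power \<open>m + 1\<close>, applied to \<open>V\<close>.\<close>

definition grad_hess :: "nat \<Rightarrow> real^'N^'n \<Rightarrow> real^'N^'n \<Rightarrow> real^'N^'n" where
  "grad_hess m X V = matrix_power (wishart X) m ** V + d_power m X V ** X"

lemma grad_derivative: "((\<lambda>X. matrix_power (wishart X) m ** X) has_derivative grad_hess m X) (at X)"
  unfolding grad_hess_def[abs_def]
  by (rule bounded_bilinear.FDERIV[OF bounded_bilinear_matrix_mult power_derivative has_derivative_ident])

text \<open>One \<open>top_sv X\<close> comes from \<open>d_wishart\<close> and one from the factor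
  \<open>X\<close>; their product over \<open>CARD('N)\<close> is \<open>top_eig X\<close>. It is
  kept apart from the power \<open>m - 1\<close>, so that summation over \<open>m\<close> produces
  the second series times the eigenvalue.\<close>

lemma norm_grad_hess: "norm (grad_hess m X V) \<le> (top_eig X ^ m + 2 * real m * top_eig X ^ (m - 1) * top_eig X) * norm V"
  for X :: "real^'N^'n"
proof -
  have "norm (d_power m X V ** X) \<le> norm (d_power m X V) * top_sv X"
    using norm_matrix_mult_right[of X "top_sv X" "d_power m X V"] norm_transpose_mult_le[of X] top_sv_nonneg[of X] by simp
  also have "\<dots> \<le> (real m * top_eig X ^ (m - 1) * (2 / real CARD('N) * top_sv X * norm V)) * top_sv X"
    by (intro mult_right_mono order_trans[OF norm_d_power] mult_left_mono norm_d_wishart mult_nonneg_nonneg zero_le_power top_eig_nonneg top_sv_nonneg) simp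
  also have "\<dots> = 2 * real m * top_eig X ^ (m - 1) * ((top_sv X)\<^sup>2 / real CARD('N)) * norm V"
    by (simp add: power2_eq_square mult_ac)
  finally have "norm (d_power m X V ** X) \<le> 2 * real m * top_eig X ^ (m - 1) * top_eig X * norm V"
    by (simp add: top_eig_eq[symmetric])
  then show ?thesis
    unfolding grad_hess_def distrib_right
    by (intro order_trans[OF norm_triangle_ineq] add_mono norm_power_mult_le)
qed

lemma continuous_power: "continuous_on UNIV (\<lambda>X. matrix_power (wishart X) m)"
  by (intro continuous_at_imp_continuous_on ballI has_derivative_continuous[OF power_derivative])

lemma continuous_d_power: "continuous_on UNIV (\<lambda>X. d_power m X V)"
proof (induction m)
  case (Suc m)
  have "continuous_on UNIV (\<lambda>X. d_wishart X V)"
    unfolding d_wishart_def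
    by (intro continuous_intros bounded_bilinear.continuous_on[OF bounded_bilinear_matrix_mult]
        linear_continuous_on bounded_linear_transpose)
  moreover have "continuous_on UNIV wishart"
    by (intro continuous_at_imp_continuous_on ballI has_derivative_continuous[OF wishart_derivative])
  ultimately show ?case
    using Suc by (simp, intro continuous_intros bounded_bilinear.continuous_on[OF bounded_bilinear_matrix_mult] continuous_power) auto
qed simp

lemma continuous_grad_hess: "continuous_on UNIV (\<lambda>X. grad_hess m X V)"
  unfolding grad_hess_def
  by (intro continuous_intros bounded_bilinear.continuous_on[OF bounded_bilinear_matrix_mult] continuous_power continuous_d_power)

text \<open>A column of \<open>X\<close> has norm at most \<open>top_sv X\<close>, so a single entry
  is bounded without the number of rows that the Frobenius norm of the whole matrix brings
  in.\<close>

lemma component_grad_le: "\<bar>(matrix_power (wishart X) m ** X) $ i $ j\<bar> \<le> top_eig X ^ m * top_sv X"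
proof -
  have b: "axis j (1::real) \<in> Basis" by (simp add: axis_in_Basis_iff)
  have "(matrix_power (wishart X) m ** X) $ i $ j = (matrix_power (wishart X) m *v (X *v axis j 1)) $ i"
    by (simp add: matrix_vector_mult_basis) (simp add: matrix_matrix_mult_def matrix_vector_mult_def column_def)
  also have "\<bar>\<dots>\<bar> \<le> norm (matrix_power (wishart X) m *v (X *v axis j 1))" by (rule component_le_norm_cart)
  also have "\<dots> \<le> top_eig X ^ m * norm (X *v axis j 1)"
    by (rule norm_wishart_power_mult_le)
  also have "\<dots> \<le> top_eig X ^ m * top_sv X"
    using norm_mult_le[of X "axis j 1"] b by (intro mult_left_mono zero_le_power top_eig_nonneg) simp
  finally show ?thesis .
qed

lemma power_component_le: "\<bar>matrix_power (wishart X) m $ i $ j\<bar> \<le> top_eig X ^ m"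
proof -
  have b: "axis j (1::real) \<in> Basis" by (simp add: axis_in_Basis_iff)
  have "matrix_power (wishart X) m $ i $ j = (matrix_power (wishart X) m *v axis j 1) $ i"
    by (simp add: matrix_vector_mult_basis column_def)
  also have "\<bar>\<dots>\<bar> \<le> norm (matrix_power (wishart X) m *v axis j 1)" by (rule component_le_norm_cart)
  also have "\<dots> \<le> top_eig X ^ m * norm (axis j (1::real))"
    by (rule norm_wishart_power_mult_le)
  finally show ?thesis using b by simp
qed

lemma trace_power_le: "\<bar>trace (matrix_power (wishart X) m)\<bar> \<le> real CARD('n) * top_eig X ^ m" for X :: "real^'N^'n"
proof -
  have "\<bar>trace (matrix_power (wishart X) m)\<bar> \<le> (\<Sum>i\<in>(UNIV::'n set). top_eig X ^ m)"
    unfolding trace_def by (rule order_trans[OF sum_abs]) (intro sum_mono power_component_le)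
  then show ?thesis by simp
qed

section \<open>Traces of power series\<close>

lemma suminf_tail_small:
  fixes M :: "nat \<Rightarrow> real"
  assumes "summable M" "0 < e"
  shows "\<forall>\<^sub>F n in sequentially. (\<Sum>i. M (i + n)) < e"
proof -
  have "(\<lambda>n. suminf M - (\<Sum>i<n. M i)) \<longlonglongrightarrow> suminf M - suminf M"
    by (intro tendsto_intros summable_LIMSEQ assms)
  then have "\<forall>\<^sub>F n in sequentially. suminf M - (\<Sum>i<n. M i) < e"
    using assms(2) by (intro order_tendstoD) auto
  then show ?thesis using suminf_minus_initial_segment[OF assms(1)] by simp
qed

text \<open>The majorant may depend on the ball, since power series converge uniformly only on
  bounded sets. The ball of radius \<open>norm x + 1\<close> is enough for the derivative at
  \<open>x\<close>.\<close>

lemma has_derivative_suminf: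
  fixes f :: "nat \<Rightarrow> 'a::euclidean_space \<Rightarrow> 'b::banach"
  assumes d: "\<And>n x. (f n has_derivative f' n x) (at x)" and s: "\<And>x. summable (\<lambda>n. f n x)"
    and b: "\<And>r. \<exists>M. summable M \<and> (\<forall>n x h. norm x < r \<longrightarrow> norm (f' n x h) \<le> M n * norm h)"
  shows "((\<lambda>x. \<Sum>n. f n x) has_derivative (\<lambda>h. \<Sum>n. f' n x h)) (at x)"
proof -
  define r where "r = norm x + 1"
  obtain M where M: "summable M" "\<And>n x h. norm x < r \<Longrightarrow> norm (f' n x h) \<le> M n * norm h"
    using b[of r] by blast
  have xS: "x \<in> ball 0 r" by (simp add: r_def)
  have "\<exists>g. \<forall>y\<in>ball 0 r. (\<lambda>n. f n y) sums g y \<and> (g has_derivative (\<lambda>h. \<Sum>n. f' n y h)) (at y within ball 0 r)"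
  proof (rule has_derivative_series[OF convex_ball _ _ xS summable_sums[OF s]])
    show "(f n has_derivative f' n y) (at y within ball 0 r)" for n y by (rule has_derivative_at_withinI[OF d])
    fix e :: real assume e: "0 < e"
    show "\<forall>\<^sub>F n in sequentially. \<forall>y\<in>ball 0 r. \<forall>h. norm ((\<Sum>i<n. f' i y h) - (\<Sum>n. f' n y h)) \<le> e * norm h"
      using suminf_tail_small[OF M(1) e]
    proof eventually_elim
      case (elim n)
      show ?case
      proof (intro ballI allI)
        fix y h :: 'a assume y: "y \<in> ball 0 r"
        have sm: "summable (\<lambda>i. M i * norm h)" by (intro summable_mult2 M(1))
        have bd: "norm (f' i y h) \<le> M i * norm h" for i using M(2) y by simp
        have sf: "summable (\<lambda>i. f' i y h)"
          by (rule summable_comparison_test'[OF sm]) (rule bd)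
        have st: "summable (\<lambda>i. M (i + n) * norm h)" by (rule summable_ignore_initial_segment[OF sm])
        have "norm ((\<Sum>i<n. f' i y h) - (\<Sum>i. f' i y h)) = norm (\<Sum>i. f' (i + n) y h)"
          using suminf_minus_initial_segment[OF sf, of n] by (simp add: norm_minus_commute)
        also have "\<dots> \<le> (\<Sum>i. M (i + n) * norm h)"
          by (rule norm_suminf_le[OF bd st])
        also have "\<dots> = (\<Sum>i. M (i + n)) * norm h"
          using summable_ignore_initial_segment[OF M(1), of n] by (rule suminf_mult2[symmetric])
        also have "\<dots> \<le> e * norm h" using elim by (intro mult_right_mono) auto
        finally show "norm ((\<Sum>i<n. f' i y h) - (\<Sum>i. f' i y h)) \<le> e * norm h" .
      qed
    qed
  qed
  then obtain g where g: "\<And>y. y \<in> ball 0 r \<Longrightarrow> (\<lambda>n. f n y) sums g y"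
    "\<And>y. y \<in> ball 0 r \<Longrightarrow> (g has_derivative (\<lambda>h. \<Sum>n. f' n y h)) (at y within ball 0 r)" by blast
  have "(g has_derivative (\<lambda>h. \<Sum>n. f' n x h)) (at x)"
    using g(2)[OF xS] at_within_open[OF xS open_ball] by simp
  then show ?thesis
  proof (rule has_derivative_transform_within_open[OF _ open_ball xS])
    show "g y = (\<Sum>n. f n y)" if "y \<in> ball 0 r" for y using g(1)[OF that] sums_unique by blast
  qed
qed

lemma continuous_on_suminf_ball:
  fixes f :: "nat \<Rightarrow> 'a::euclidean_space \<Rightarrow> 'b::banach"
  assumes c: "\<And>n. continuous_on UNIV (f n)"
    and b: "\<And>r. \<exists>M. summable M \<and> (\<forall>n x. norm x < r \<longrightarrow> norm (f n x) \<le> M n)"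
  shows "continuous_on UNIV (\<lambda>x. \<Sum>n. f n x)"
proof (rule continuous_at_imp_continuous_on, rule ballI)
  fix x :: 'a
  define r where "r = norm x + 1"
  obtain M where M: "summable M" "\<And>n x. norm x < r \<Longrightarrow> norm (f n x) \<le> M n"
    using b[of r] by blast
  have "uniform_limit (ball 0 r) (\<lambda>n x. \<Sum>i<n. f i x) (\<lambda>x. \<Sum>n. f n x) sequentially"
    by (rule Weierstrass_m_test[OF _ M(1)]) (use M(2) in auto)
  then have "continuous_on (ball 0 r) (\<lambda>x. \<Sum>n. f n x)"
    by (rule uniform_limit_theorem[rotated])
       (auto intro!: always_eventually continuous_on_sum continuous_on_subset[OF c])
  then show "isCont (\<lambda>x. \<Sum>n. f n x) x"
    using continuous_on_eq_continuous_at[OF open_ball] by (force simp: r_def)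
qed

text \<open>Bounded sets of matrices have bounded largest eigenvalue, so the series at
  \<open>r^2\<close> is a majorant on the ball of radius \<open>r\<close>.\<close>

lemma top_eig_le_norm: "top_eig X \<le> (norm X)\<^sup>2" for X :: "real^'N^'n"
proof -
  have "top_eig X \<le> (top_sv X)\<^sup>2"
    using mult_right_mono[of 1 "real CARD('N)" "top_eig X"] top_eig_nonneg[of X] by (simp add: top_sv_sq Suc_le_eq)
  also have "\<dots> \<le> (norm X)\<^sup>2" by (intro power_mono top_sv_le_norm top_sv_nonneg)
  finally show ?thesis .
qed

text \<open>The estimates insert the real number \<open>top_eig X\<close>, so being entire is
  recorded as absolute convergence at real points.\<close>

locale entire_coef =
  fixes coef :: "nat \<Rightarrow> complex"
  assumes abs_summable: "\<And>x::real. summable (\<lambda>m. cmod (coef m) * x ^ m)"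
begin

text \<open>The differentiated series is the power series of \<open>diffs\<close>, shifted by one;
  the shift is harmless because the term \<open>m = 0\<close> vanishes.\<close>

lemma summable1: "summable (\<lambda>m. real m * cmod (coef m) * x ^ (m - 1))"
proof -
  have "summable (\<lambda>m. diffs (\<lambda>m. cmod (coef m)) m * x ^ m)"
    by (rule termdiff_converges_all) (rule abs_summable)
  then show ?thesis by (subst summable_Suc_iff[symmetric]) (simp add: diffs_def)
qed

lemma summable2: "summable (\<lambda>m. real m * (real m - 1) * cmod (coef m) * x ^ (m - 2))"
proof -
  have "summable (\<lambda>m. diffs (diffs (\<lambda>m. cmod (coef m))) m * x ^ m)"
    by (intro termdiff_converges_all abs_summable)
  then show ?thesis
    by (subst summable_Suc_iff[symmetric], subst summable_Suc_iff[symmetric]) (simp add: diffs_def algebra_simps)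
qed

lemma abs_series1_nonneg: "0 \<le> x \<Longrightarrow> 0 \<le> abs_series1 coef x"
  unfolding abs_series1_def by (intro suminf_nonneg summable1) auto

lemma abs_series2_nonneg: "0 \<le> x \<Longrightarrow> 0 \<le> abs_series2 coef x"
  unfolding abs_series2_def
proof (intro suminf_nonneg summable2)
  fix m assume "0 \<le> x"
  then show "0 \<le> real m * (real m - 1) * cmod (coef m) * x ^ (m - 2)"
    by (cases m) auto
qed

lemma borel_measurable_abs_series [measurable]:
  "abs_series1 coef \<in> borel_measurable borel" "abs_series2 coef \<in> borel_measurable borel"
  unfolding abs_series1_def[abs_def] abs_series2_def[abs_def] by measurable

text \<open>\<open>wishart X\<close> is a real matrix, so only the real parts of the coefficients
  survive in the real part of the trace.\<close>

definition beta :: "nat \<Rightarrow> real" where "beta m = Re (coef m)"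

lemma beta_le: "\<bar>beta m\<bar> \<le> cmod (coef m)"
  by (simp add: beta_def abs_Re_le_cmod)

definition gterm :: "nat \<Rightarrow> real^'N^'n \<Rightarrow> real" where
  "gterm m X = beta m * trace (matrix_power (wishart X) m)"

definition pterm :: "nat \<Rightarrow> real^'N^'n \<Rightarrow> real^'N^'n" where
  "pterm m X = (2 * real m * beta m / real CARD('N)) *\<^sub>R (matrix_power (wishart X) (m - 1) ** X)"

definition hterm :: "nat \<Rightarrow> real^'N^'n \<Rightarrow> real^'N^'n \<Rightarrow> real^'N^'n" where
  "hterm m X V = (2 * real m * beta m / real CARD('N)) *\<^sub>R grad_hess (m - 1) X V"

definition "trace_fun X = (\<Sum>m. gterm m X)"
definition "trace_grad X = (\<Sum>m. pterm m X)"
definition "trace_hess X V = (\<Sum>m. hterm m X V)"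

lemma gterm_le: "\<bar>gterm m X\<bar> \<le> real CARD('n) * (cmod (coef m) * top_eig X ^ m)" for X :: "real^'N^'n"
proof -
  have "\<bar>gterm m X\<bar> \<le> cmod (coef m) * (real CARD('n) * top_eig X ^ m)"
    unfolding gterm_def abs_mult by (intro mult_mono beta_le trace_power_le) auto
  then show ?thesis by (simp add: mult_ac)
qed

lemma coefficient_le: "\<bar>2 * real m * beta m / real CARD('N)\<bar> \<le> 2 / real CARD('N) * (real m * cmod (coef m))"
  using mult_left_mono[OF beta_le[of m], of "real m"] by (simp add: abs_mult divide_right_mono)

lemma pterm_le: "norm (pterm m X) \<le> 2 / real CARD('N) * norm X * (real m * cmod (coef m) * top_eig X ^ (m - 1))" for X :: "real^'N^'n"
proof -
  have "norm (pterm m X) \<le> (2 / real CARD('N) * (real m * cmod (coef m))) * (top_eig X ^ (m - 1) * norm X)"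
    unfolding pterm_def norm_scaleR real_norm_def by (intro mult_mono coefficient_le norm_power_mult_le) auto
  then show ?thesis by (simp only: mult_ac)
qed

lemma pterm_component_le:
  "\<bar>pterm m X $ i $ j\<bar> \<le> 2 / real CARD('N) * top_sv X * (real m * cmod (coef m) * top_eig X ^ (m - 1))" for X :: "real^'N^'n"
proof -
  have "\<bar>pterm m X $ i $ j\<bar> \<le> (2 / real CARD('N) * (real m * cmod (coef m))) * (top_eig X ^ (m - 1) * top_sv X)"
    unfolding pterm_def vector_scaleR_component real_scaleR_def abs_mult
    by (intro mult_mono coefficient_le[unfolded abs_mult] component_grad_le) auto
  then show ?thesis by (simp only: mult_ac)
qed

text \<open>The gradient of the term of order \<open>m\<close> contains the power
  \<open>m - 1\<close>, so the bound is that of \<open>grad_hess (m - 1)\<close>, and its factor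
  \<open>m - 1\<close> joins \<open>m\<close> to form the coefficients of the second series.\<close>

lemma hterm_le: "norm (hterm m X V) \<le> 2 / real CARD('N) *
    (real m * cmod (coef m) * top_eig X ^ (m - 1) + 2 * top_eig X * (real m * (real m - 1) * cmod (coef m) * top_eig X ^ (m - 2))) * norm V"
  for X :: "real^'N^'n"
proof -
  have "norm (hterm m X V) \<le> (2 / real CARD('N) * (real m * cmod (coef m))) *
    ((top_eig X ^ (m - 1) + 2 * real (m - 1) * top_eig X ^ (m - 1 - 1) * top_eig X) * norm V)"
    unfolding hterm_def norm_scaleR real_norm_def by (intro mult_mono coefficient_le norm_grad_hess) auto
  also have "\<dots> = 2 / real CARD('N) *
    (real m * cmod (coef m) * top_eig X ^ (m - 1) + 2 * top_eig X * (real m * (real m - 1) * cmod (coef m) * top_eig X ^ (m - 2))) * norm V"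
    by (cases m) (simp_all add: algebra_simps numeral_2_eq_2)
  finally show ?thesis .
qed

lemma summable_gterm: "summable (\<lambda>m. gterm m X)"
  by (rule summable_comparison_test'[OF summable_mult[OF abs_summable]]) (unfold real_norm_def, rule gterm_le)

lemma summable_pterm: "summable (\<lambda>m. pterm m X)"
  by (rule summable_comparison_test'[OF summable_mult[OF summable1]]) (rule pterm_le)

lemma summable_h_majorant:
  "summable (\<lambda>m. real m * cmod (coef m) * x ^ (m - 1) + 2 * x * (real m * (real m - 1) * cmod (coef m) * x ^ (m - 2)))"
  by (intro summable_add summable_mult summable1 summable2)

lemma gterm_derivative: "(gterm m has_derivative (\<lambda>V. pterm m X \<bullet> V)) (at X)" for X :: "real^'N^'n"
proof -
  have "(gterm m has_derivative (\<lambda>V. beta m * (((2 * real m / real CARD('N)) *\<^sub>R (matrix_power (wishart X) (m - 1) ** X)) \<bullet> V))) (at X)"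
    unfolding gterm_def[abs_def] by (rule has_derivative_mult_right[OF trace_power_derivative])
  then show ?thesis by (simp add: pterm_def mult_ac)
qed

lemma pterm_derivative: "(pterm m has_derivative hterm m X) (at X)" for X :: "real^'N^'n"
  unfolding pterm_def[abs_def] hterm_def[abs_def] by (rule has_derivative_scaleR_right[OF grad_derivative])

lemma top_eig_ball: "norm X < r \<Longrightarrow> top_eig X \<le> r\<^sup>2" for X :: "real^'N^'n"
  using top_eig_le_norm[of X] power_mono[of "norm X" r 2] by simp

lemma h_majorant_mono:
  assumes "0 \<le> x" "x \<le> y"
  shows "real m * cmod (coef m) * x ^ (m - 1) + 2 * x * (real m * (real m - 1) * cmod (coef m) * x ^ (m - 2))
    \<le> real m * cmod (coef m) * y ^ (m - 1) + 2 * y * (real m * (real m - 1) * cmod (coef m) * y ^ (m - 2))"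
  using assms by (cases m) (auto intro!: add_mono mult_mono power_mono)

lemma trace_fun_derivative: "(trace_fun has_derivative (\<lambda>V. trace_grad X \<bullet> V)) (at X)" for X :: "real^'N^'n"
proof -
  have "((\<lambda>X. \<Sum>m. gterm m X) has_derivative (\<lambda>V. \<Sum>m. pterm m X \<bullet> V)) (at X)"
  proof (rule has_derivative_suminf[OF gterm_derivative summable_gterm])
    fix r :: real
    have "norm (pterm m X \<bullet> V) \<le> 2 / real CARD('N) * r * (real m * cmod (coef m) * (r\<^sup>2) ^ (m - 1)) * norm V"
      if "norm X < r" for m and X V :: "real^'N^'n"
    proof -
      have r: "0 \<le> r" using order_trans[OF norm_ge_zero less_imp_le[OF that]] .
      have "norm (pterm m X \<bullet> V) \<le> norm (pterm m X) * norm V" using Cauchy_Schwarz_ineq2 by simp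
      also have "\<dots> \<le> (2 / real CARD('N) * norm X * (real m * cmod (coef m) * top_eig X ^ (m - 1))) * norm V"
        by (intro mult_right_mono pterm_le) simp
      also have "\<dots> \<le> 2 / real CARD('N) * r * (real m * cmod (coef m) * (r\<^sup>2) ^ (m - 1)) * norm V"
        using that r
        by (intro mult_right_mono mult_mono mult_left_mono power_mono top_eig_ball top_eig_nonneg mult_nonneg_nonneg zero_le_power) auto
      finally show ?thesis .
    qed
    then show "\<exists>M. summable M \<and> (\<forall>m (X::real^'N^'n) V. norm X < r \<longrightarrow> norm (pterm m X \<bullet> V) \<le> M m * norm V)"
      by (intro exI[of _ "\<lambda>m. 2 / real CARD('N) * r * (real m * cmod (coef m) * (r\<^sup>2) ^ (m - 1))"])
         (intro conjI allI impI summable_mult summable1; simp only:)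
  qed
  moreover have "(\<Sum>m. pterm m X \<bullet> V) = trace_grad X \<bullet> V" for V
    unfolding trace_grad_def
    by (rule bounded_linear.suminf[OF bounded_linear_inner_left summable_pterm, symmetric])
  ultimately show ?thesis by (simp add: trace_fun_def[abs_def])
qed

lemma trace_grad_derivative: "(trace_grad has_derivative trace_hess X) (at X)" for X :: "real^'N^'n"
proof -
  have "((\<lambda>X. \<Sum>m. pterm m X) has_derivative (\<lambda>V. \<Sum>m. hterm m X V)) (at X)"
  proof (rule has_derivative_suminf[OF pterm_derivative summable_pterm])
    fix r :: real
    let ?M = "\<lambda>m. real m * cmod (coef m) * (r\<^sup>2) ^ (m - 1) + 2 * r\<^sup>2 * (real m * (real m - 1) * cmod (coef m) * (r\<^sup>2) ^ (m - 2))"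
    have "norm (hterm m X V) \<le> 2 / real CARD('N) * ?M m * norm V"
      if "norm X < r" for m and X V :: "real^'N^'n"
      by (rule order_trans[OF hterm_le])
         (intro mult_right_mono mult_left_mono h_majorant_mono top_eig_nonneg top_eig_ball that; simp)
    then show "\<exists>M. summable M \<and> (\<forall>m (X::real^'N^'n) V. norm X < r \<longrightarrow> norm (hterm m X V) \<le> M m * norm V)"
      by (intro exI[of _ "\<lambda>m. 2 / real CARD('N) * ?M m"]) (intro conjI allI impI summable_mult summable_h_majorant; simp only:)
  qed
  then show ?thesis by (simp add: trace_grad_def[abs_def] trace_hess_def[abs_def])
qed

lemma continuous_trace_hess: "continuous_on UNIV (\<lambda>X::real^'N^'n. trace_hess X V)"
  unfolding trace_hess_def
proof (rule continuous_on_suminf_ball)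
  show "continuous_on UNIV (\<lambda>X::real^'N^'n. hterm m X V)" for m
    unfolding hterm_def by (intro continuous_on_scaleR continuous_on_const continuous_grad_hess)
  fix r :: real
  let ?M = "\<lambda>m. real m * cmod (coef m) * (r\<^sup>2) ^ (m - 1) + 2 * r\<^sup>2 * (real m * (real m - 1) * cmod (coef m) * (r\<^sup>2) ^ (m - 2))"
  have "norm (hterm m X V) \<le> 2 / real CARD('N) * ?M m * norm V"
    if "norm X < r" for m and X :: "real^'N^'n"
    by (rule order_trans[OF hterm_le])
       (intro mult_right_mono mult_left_mono h_majorant_mono top_eig_nonneg top_eig_ball that; simp)
  then show "\<exists>M. summable M \<and> (\<forall>m (X::real^'N^'n). norm X < r \<longrightarrow> norm (hterm m X V) \<le> M m)"
    by (intro exI[of _ "\<lambda>m. 2 / real CARD('N) * ?M m * norm V"]) (intro conjI allI impI summable_mult summable_mult2 summable_h_majorant; simp only:)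
qed

lemma norm_trace_grad_le: "norm (trace_grad X) \<le> 2 / real CARD('N) * norm X * abs_series1 coef (top_eig X)" for X :: "real^'N^'n"
  unfolding trace_grad_def abs_series1_def
  by (subst suminf_mult[OF summable1, symmetric]) (rule norm_suminf_le[OF pterm_le summable_mult[OF summable1]])

lemma trace_grad_component_le:
  "\<bar>trace_grad X $ i $ j\<bar> \<le> 2 / real CARD('N) * top_sv X * abs_series1 coef (top_eig X)" for X :: "real^'N^'n"
proof -
  have "trace_grad X $ i $ j = (\<Sum>m. pterm m X $ i $ j)"
    unfolding trace_grad_def
    by (simp add: bounded_linear.suminf[OF bounded_linear_compose[OF bounded_linear_vec_nth bounded_linear_vec_nth] summable_pterm])
  also have "norm \<dots> \<le> (\<Sum>m. 2 / real CARD('N) * top_sv X * (real m * cmod (coef m) * top_eig X ^ (m - 1)))"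
    by (rule norm_suminf_le[OF _ summable_mult[OF summable1]]) (unfold real_norm_def, rule pterm_component_le)
  also have "\<dots> = 2 / real CARD('N) * top_sv X * abs_series1 coef (top_eig X)"
    unfolding abs_series1_def by (rule suminf_mult[OF summable1])
  finally show ?thesis by simp
qed

lemma norm_trace_hess_le:
  "norm (trace_hess X V) \<le> 2 / real CARD('N) * (abs_series1 coef (top_eig X) + 2 * top_eig X * abs_series2 coef (top_eig X)) * norm V" for X :: "real^'N^'n"
proof -
  have "norm (trace_hess X V) \<le> (\<Sum>m. 2 / real CARD('N) *
    (real m * cmod (coef m) * top_eig X ^ (m - 1) + 2 * top_eig X * (real m * (real m - 1) * cmod (coef m) * top_eig X ^ (m - 2))) * norm V)"
    unfolding trace_hess_def
    by (rule norm_suminf_le[OF hterm_le summable_mult2[OF summable_mult[OF summable_h_majorant]]])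
  also have "\<dots> = 2 / real CARD('N) * (\<Sum>m. real m * cmod (coef m) * top_eig X ^ (m - 1) + 2 * top_eig X * (real m * (real m - 1) * cmod (coef m) * top_eig X ^ (m - 2))) * norm V"
    by (simp only: suminf_mult2[OF summable_mult[OF summable_h_majorant], symmetric] suminf_mult[OF summable_h_majorant])
  also have "(\<Sum>m. real m * cmod (coef m) * top_eig X ^ (m - 1) + 2 * top_eig X * (real m * (real m - 1) * cmod (coef m) * top_eig X ^ (m - 2)))
    = abs_series1 coef (top_eig X) + 2 * top_eig X * abs_series2 coef (top_eig X)"
    unfolding abs_series1_def abs_series2_def
    by (subst suminf_add[symmetric, OF summable1 summable_mult[OF summable2]]) (simp only: suminf_mult[OF summable2])
  finally show ?thesis .
qed

text \<open>For \<open>m \<ge> 1\<close> the power \<open>m\<close> of the eigenvalue is at most the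
  eigenvalue times the corresponding power in the first series. This serves a degenerate case: where
  the integrand of \<open>a\<close> vanishes, the trace takes the constant value
  \<open>CARD('n) * beta 0\<close>.\<close>

lemma trace_fun_constant_bound:
  "\<bar>trace_fun X - real CARD('n) * beta 0\<bar> \<le> real CARD('n) * top_eig X * abs_series1 coef (top_eig X)" for X :: "real^'N^'n"
proof -
  have t0: "gterm 0 X = real CARD('n) * beta 0" by (simp add: gterm_def matrix_power_simps trace_def mat_def)
  have "trace_fun X - real CARD('n) * beta 0 = (\<Sum>m. gterm (Suc m) X)"
    unfolding trace_fun_def using suminf_split_head[OF summable_gterm[of X]] t0 by simp
  also have "\<bar>\<dots>\<bar> \<le> (\<Sum>m. real CARD('n) * top_eig X * (real (Suc m) * cmod (coef (Suc m)) * top_eig X ^ m))"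
  proof -
    have "norm (\<Sum>m. gterm (Suc m) X) \<le> (\<Sum>m. real CARD('n) * top_eig X * (real (Suc m) * cmod (coef (Suc m)) * top_eig X ^ m))"
    proof (rule norm_suminf_le)
      fix m
      have "norm (gterm (Suc m) X) \<le> real CARD('n) * top_eig X * (1 * cmod (coef (Suc m)) * top_eig X ^ m)"
        using gterm_le[of "Suc m" X] by (simp add: mult_ac)
      also have "\<dots> \<le> real CARD('n) * top_eig X * (real (Suc m) * cmod (coef (Suc m)) * top_eig X ^ m)"
        using top_eig_nonneg[of X] by (intro mult_left_mono mult_right_mono) auto
      finally show "norm (gterm (Suc m) X) \<le> real CARD('n) * top_eig X * (real (Suc m) * cmod (coef (Suc m)) * top_eig X ^ m)" .
    next
      show "summable (\<lambda>m. real CARD('n) * top_eig X * (real (Suc m) * cmod (coef (Suc m)) * top_eig X ^ m))"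
        using summable1[of "top_eig X"] by (subst (asm) summable_Suc_iff[symmetric]) (intro summable_mult, simp)
    qed
    then show ?thesis by simp
  qed
  also have "\<dots> = real CARD('n) * top_eig X * abs_series1 coef (top_eig X)"
    unfolding abs_series1_def
    using suminf_split_head[OF summable1[of "top_eig X"]] summable1[of "top_eig X", THEN summable_Suc_iff[THEN iffD2]]
    by (simp add: suminf_mult)
  finally show ?thesis .
qed

lemma matrix_power_complex:
  "matrix_power (map_matrix complex_of_real A) m = map_matrix complex_of_real (matrix_power A m)"
proof (induction m)
  case 0
  then show ?case by (simp add: matrix_power_def vec_eq_iff map_matrix_def mat_def)
next
  case (Suc m)
  then show ?case by (simp add: matrix_power_def vec_eq_iff map_matrix_def matrix_matrix_mult_def)
qed

text \<open>Convergence of the matrix series is checked entry by entry, an entry of a power being at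
  most that power of \<open>top_eig X\<close>. Then real part and trace pass through the
  sum.\<close>

lemma trace_matrix_series:
  "Re (trace (matrix_series coef (map_matrix complex_of_real (wishart X)))) = trace_fun X" for X :: "real^'N^'n"
proof -
  let ?T = "\<lambda>m. mat (coef m) ** matrix_power (map_matrix complex_of_real (wishart X)) m :: complex^'n^'n"
  have c: "?T m $ i $ j = coef m * complex_of_real (matrix_power (wishart X) m $ i $ j)" for m i j
    unfolding matrix_power_complex
    by (simp add: matrix_matrix_mult_def mat_def map_matrix_def if_distrib if_distribR cong: if_cong)
  have s: "summable (\<lambda>m. ?T m $ i $ j)" for i j
    unfolding c
  proof (rule summable_comparison_test'[OF abs_summable[of "top_eig X"]])
    show "norm (coef m * complex_of_real (matrix_power (wishart X) m $ i $ j)) \<le> cmod (coef m) * top_eig X ^ m" for m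
      by (simp add: norm_mult mult_left_mono power_component_le)
  qed
  have "?T sums (\<chi> i j. \<Sum>m. ?T m $ i $ j)"
    unfolding sums_def
  proof (intro vec_tendstoI)
    fix i j
    show "(\<lambda>n. (\<Sum>m<n. ?T m) $ i $ j) \<longlonglongrightarrow> (\<chi> i j. \<Sum>m. ?T m $ i $ j) $ i $ j"
      using summable_LIMSEQ[OF s[of i j]] by simp
  qed
  then have "matrix_series coef (map_matrix complex_of_real (wishart X)) = (\<chi> i j. \<Sum>m. ?T m $ i $ j)"
    unfolding matrix_series_def by (rule sums_unique[symmetric])
  then have "Re (trace (matrix_series coef (map_matrix complex_of_real (wishart X)))) = (\<Sum>i\<in>UNIV. Re (\<Sum>m. ?T m $ i $ i))"
    by (simp add: trace_def)
  also have "\<dots> = (\<Sum>i\<in>UNIV. \<Sum>m. Re (?T m $ i $ i))"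
    using bounded_linear.suminf[OF bounded_linear_Re s] by simp
  also have "\<dots> = (\<Sum>m. \<Sum>i\<in>UNIV. Re (?T m $ i $ i))"
    by (rule suminf_sum[symmetric]) (rule bounded_linear.summable[OF bounded_linear_Re s])
  also have "\<dots> = trace_fun X"
    unfolding trace_fun_def gterm_def c by (simp add: trace_def sum_distrib_left beta_def)
  finally show ?thesis .
qed

end

section \<open>Transfer to the law of a random matrix\<close>

text \<open>Closed sets first: continuous functions decreasing to the indicator bound the
  \<mu>-measure from above, while their \<nu>-integrals converge to the \<nu>-measure. Inner
  regularity of \<mu> passes to Borel sets, and the complement turns the one-sided inequality into
  an absolute value.\<close>

lemma measure_diff_le_of_continuous:
  fixes \<mu> \<nu> :: "real measure"
  assumes p: "prob_space \<mu>" "prob_space \<nu>" and s: "sets \<mu> = sets borel" "sets \<nu> = sets borel"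
    and C: "\<And>\<phi>. continuous_on UNIV \<phi> \<Longrightarrow> (\<And>x. 0 \<le> \<phi> x) \<Longrightarrow> (\<And>x. \<phi> x \<le> 1) \<Longrightarrow> (\<integral>x. \<phi> x \<partial>\<mu>) - (\<integral>x. \<phi> x \<partial>\<nu>) \<le> C"
    and B: "B \<in> sets borel"
  shows "\<bar>measure \<mu> B - measure \<nu> B\<bar> \<le> C"
proof -
  interpret M: prob_space \<mu> by fact
  interpret N: prob_space \<nu> by fact
  have sp: "space \<mu> = UNIV" "space \<nu> = UNIV" using s[THEN sets_eq_imp_space_eq] by auto
  note [measurable_cong] = s
  have C0: "0 \<le> C" using C[of "\<lambda>_. 0"] by simp
  have closed: "measure \<mu> K - measure \<nu> K \<le> C" if K: "closed K" for K :: "real set"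
  proof (cases "K = {}")
    case False
    have [measurable]: "K \<in> sets borel" using K by simp
    define \<phi> where "\<phi> n x = max 0 (1 - real n * infdist x K)" for n x
    have c: "continuous_on UNIV (\<phi> n)" for n
      unfolding \<phi>_def by (intro continuous_intros)
    have [measurable]: "\<phi> n \<in> borel_measurable borel" for n by (rule borel_measurable_continuous_onI[OF c])
    have b: "0 \<le> \<phi> n x" "\<phi> n x \<le> 1" for n x by (auto simp: \<phi>_def infdist_nonneg)
    have i: "integrable \<mu> (\<phi> n)" "integrable \<nu> (\<phi> n)" for n
      using b by (auto intro!: M.integrable_const_bound[where B=1] N.integrable_const_bound[where B=1])
    have ge: "measure \<mu> K \<le> (\<integral>x. \<phi> n x \<partial>\<mu>)" for n
    proof -
      have "measure \<mu> K = (\<integral>x. indicator K x \<partial>\<mu>)" by (simp add: sp)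
      also have "\<dots> \<le> (\<integral>x. \<phi> n x \<partial>\<mu>)"
      proof (rule integral_mono[OF _ i(1)])
        show "integrable \<mu> (indicator K :: real \<Rightarrow> real)"
          by (rule M.integrable_const_bound[where B=1]) (auto simp: indicator_def)
      qed (auto simp: \<phi>_def indicator_def)
      finally show ?thesis .
    qed
    have "(\<lambda>n. \<integral>x. \<phi> n x \<partial>\<nu>) \<longlonglongrightarrow> (\<integral>x. indicator K x \<partial>\<nu>)"
    proof (rule integral_dominated_convergence[where w="\<lambda>_. 1"])
      show "AE x in \<nu>. (\<lambda>n. \<phi> n x) \<longlonglongrightarrow> indicator K x"
      proof (rule AE_I2)
        fix x
        show "(\<lambda>n. \<phi> n x) \<longlonglongrightarrow> indicator K x"
        proof (cases "x \<in> K")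
          case False
          then have d: "0 < infdist x K" using K \<open>K \<noteq> {}\<close> in_closed_iff_infdist_zero[of K x] infdist_nonneg[of x K] by fastforce
          then obtain m where m: "1 < real m * infdist x K" using ex_less_of_nat_mult by blast
          have "\<phi> n x = 0" if "n \<ge> m" for n
          proof -
            have "real m * infdist x K \<le> real n * infdist x K" using that d by (intro mult_right_mono) auto
            then show ?thesis using m by (simp add: \<phi>_def)
          qed
          then have "(\<lambda>n. \<phi> n x) \<longlonglongrightarrow> 0"
            by (intro tendsto_eventually) (auto simp: eventually_sequentially)
          then show ?thesis using False by simp
        qed (simp add: \<phi>_def)
      qed
      show "AE x in \<nu>. norm (\<phi> n x) \<le> 1" for n using b by (intro AE_I2) simp
    qed auto
    then have lim: "(\<lambda>n. C + (\<integral>x. \<phi> n x \<partial>\<nu>)) \<longlonglongrightarrow> C + measure \<nu> K"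
      by (intro tendsto_intros) (simp add: sp)
    have "measure \<mu> K \<le> C + (\<integral>x. \<phi> n x \<partial>\<nu>)" for n
      using ge[of n] C[OF c b, of n] by linarith
    then have "measure \<mu> K \<le> C + measure \<nu> K" using LIMSEQ_le_const[OF lim] by blast
    then show ?thesis by simp
  qed (simp add: C0)
  have one: "measure \<mu> A - measure \<nu> A \<le> C" if A: "A \<in> sets borel" for A
  proof (rule field_le_epsilon)
    fix e :: real assume e: "0 < e"
    show "measure \<mu> A - measure \<nu> A \<le> C + e"
    proof (cases "measure \<mu> A < e")
      case True
      then show ?thesis using C0 measure_nonneg[of \<nu> A] by linarith
    next
      case False
      have "ennreal (measure \<mu> A - e) < emeasure \<mu> A"
        unfolding M.emeasure_eq_measure using e False by (simp add: ennreal_less_iff)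
      also have "emeasure \<mu> A = (SUP K \<in> {K. K \<subseteq> A \<and> compact K}. emeasure \<mu> K)"
        by (rule inner_regular[OF s(1) _ A]) simp
      finally obtain K where K: "K \<subseteq> A" "compact K" "ennreal (measure \<mu> A - e) < emeasure \<mu> K"
        by (auto simp: less_SUP_iff)
      then have "measure \<mu> A - e < measure \<mu> K"
        unfolding M.emeasure_eq_measure using False by (simp add: ennreal_less_iff)
      moreover have "measure \<mu> K - measure \<nu> K \<le> C" using K by (intro closed compact_imp_closed)
      moreover have "measure \<nu> K \<le> measure \<nu> A" using K A by (intro N.finite_measure_mono) (auto simp: s)
      ultimately show ?thesis by linarith
    qed
  qed
  have "measure \<mu> (UNIV - B) = 1 - measure \<mu> B" "measure \<nu> (UNIV - B) = 1 - measure \<nu> B"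
    using M.prob_compl[of B] N.prob_compl[of B] B by (auto simp: sp s)
  then show ?thesis using one[OF B] one[of "UNIV - B"] B by (simp add: abs_le_iff)
qed

text \<open>The free parameters of the two weighted arithmetic-geometric mean inequalities in \<open>stein_bound\<close> are
  chosen so that the expression under the square root is at most \<open>(A1 + A2)\<^sup>2\<close>.\<close>

lemma (in C2_function) stein_bound_quartic:
  assumes ih: "integrable std_gauss (\<lambda>x. h x ^ 4)"
    and iG: "integrable std_gauss Ga" "integrable std_gauss Gb"
    and b1: "\<And>x. (\<Sum>b\<in>Basis. D b x ^ 4) \<le> d4 * Ga x" and b2: "\<And>x. (\<Sum>b\<in>Basis. (p x \<bullet> b) ^ 4) \<le> e4 * Ga x"
    and b3: "\<And>x. norm (p x) ^ 4 \<le> p4 * Ga x" and b4: "\<And>x. k x ^ 4 \<le> k4 * Gb x"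
    and a4: "a4 = (\<integral>x. Ga x \<partial>std_gauss)" "0 < a4" and b4': "b4 = (\<integral>x. Gb x \<partial>std_gauss)" "0 < b4"
    and pos: "0 < d4" "0 < e4" "0 < p4" "0 < k4"
    and A1: "d4 * e4 * a4\<^sup>2 \<le> A1 ^ 4" "0 < A1" and A2: "k4 * p4 * a4 * b4 \<le> A2 ^ 4" "0 < A2"
    and m: "m = (\<integral>x. h x \<partial>std_gauss)" and sg: "sg\<^sup>2 = (\<integral>x. h x * h x \<partial>std_gauss) - m\<^sup>2" "0 < sg"
    and \<phi>: "continuous_on UNIV \<phi>" "\<And>x. 0 \<le> \<phi> x" "\<And>x. \<phi> x \<le> 1"
  shows "(\<integral>x. \<phi> (h x) \<partial>std_gauss) - (\<integral>y. \<phi> (m + sg * y) \<partial>std_normal_distribution) \<le> 4 * (A1 + A2) / sg\<^sup>2"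
proof -
  have iD: "integrable std_gauss (\<lambda>x. D b x ^ 4)" if "b \<in> Basis" for b
  proof (rule Bochner_Integration.integrable_bound)
    show "integrable std_gauss (\<lambda>x. d4 * Ga x)" using iG by simp
    have "D b x ^ 4 \<le> d4 * Ga x" for x
      using member_le_sum[OF that, of "\<lambda>b. D b x ^ 4"] b1[of x] by force
    then show "AE x in std_gauss. norm (D b x ^ 4) \<le> norm (d4 * Ga x)" by (intro AE_I2) (simp add: order_trans[OF _ abs_ge_self])
  qed measurable
  have ip: "integrable std_gauss (\<lambda>x. norm (p x) ^ 4)"
  proof (rule Bochner_Integration.integrable_bound)
    show "integrable std_gauss (\<lambda>x. p4 * Ga x)" using iG by simp
    show "AE x in std_gauss. norm (norm (p x) ^ 4) \<le> norm (p4 * Ga x)" using b3 by (intro AE_I2) (simp add: order_trans[OF _ abs_ge_self])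
  qed measurable
  have ik: "integrable std_gauss (\<lambda>x. k x ^ 4)"
  proof (rule Bochner_Integration.integrable_bound)
    show "integrable std_gauss (\<lambda>x. k4 * Gb x)" using iG by simp
    show "AE x in std_gauss. norm (k x ^ 4) \<le> norm (k4 * Gb x)" using b4 by (intro AE_I2) (simp add: order_trans[OF _ abs_ge_self])
  qed measurable
  define S1 where "S1 = (\<integral>x. (\<Sum>b\<in>Basis. D b x ^ 4) \<partial>std_gauss)"
  define S2 where "S2 = (\<integral>x. (\<Sum>b\<in>Basis. (p x \<bullet> b) ^ 4) \<partial>std_gauss)"
  define S3 where "S3 = (\<integral>x. norm (p x) ^ 4 \<partial>std_gauss)"
  define S4 where "S4 = (\<integral>x. k x ^ 4 \<partial>std_gauss)"
  have ipb: "integrable std_gauss (\<lambda>x. (p x \<bullet> b) ^ 4)" if b: "b \<in> Basis" for b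
  proof (rule Bochner_Integration.integrable_bound[OF ip])
    have "\<bar>p x \<bullet> b\<bar> ^ 4 \<le> norm (p x) ^ 4" for x by (intro power_mono Basis_le_norm b) auto
    then show "AE x in std_gauss. norm ((p x \<bullet> b) ^ 4) \<le> norm (norm (p x) ^ 4)" by (intro AE_I2) (simp add: power_abs[symmetric])
  qed measurable
  have S1: "S1 \<le> d4 * a4"
    unfolding S1_def a4 integral_mult_right_zero[symmetric] using iG iD b1
    by (intro integral_mono Bochner_Integration.integrable_sum integrable_mult_right) auto
  have S2: "S2 \<le> e4 * a4"
    unfolding S2_def a4 integral_mult_right_zero[symmetric] using iG ipb b2
    by (intro integral_mono Bochner_Integration.integrable_sum integrable_mult_right) auto
  have S3: "S3 \<le> p4 * a4"
    unfolding S3_def a4 integral_mult_right_zero[symmetric] using iG ip b3 by (intro integral_mono integrable_mult_right) auto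
  have S4: "S4 \<le> k4 * b4"
    unfolding S4_def b4' integral_mult_right_zero[symmetric] using iG ik b4 by (intro integral_mono integrable_mult_right) auto
  have opt: "\<exists>t>0. c * t / 2 * x + c / (2 * t) * y \<le> c * r\<^sup>2"
    if "0 < x'" "0 < y'" "x \<le> x'" "y \<le> y'" "x' * y' \<le> r ^ 4" "0 < c" for x y x' y' r c :: real
  proof (intro exI conjI)
    \<comment> \<open>The minimiser of \<open>t * x' + y' / t\<close>, at which both summands equal
      \<open>sqrt (x' * y')\<close>.\<close>
    let ?t = "sqrt (y' / x')"
    show t: "0 < ?t" using that by simp
    have "c * ?t / 2 * x + c / (2 * ?t) * y \<le> c * ?t / 2 * x' + c / (2 * ?t) * y'"
      using that t by (intro add_mono mult_left_mono) auto
    also have "\<dots> = c * ((?t * x' + y' / ?t) / 2)" by (simp add: field_simps)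
    also have "?t * x' = sqrt (x' * y')"
      using that real_sqrt_mult[of "y' / x'" "x'\<^sup>2"] by (simp add: power2_eq_square mult.commute)
    also have "y' / ?t = sqrt (x' * y')"
      using that real_sqrt_divide[of "y'\<^sup>2" "y' / x'"] by (simp add: power2_eq_square mult.commute)
    also have "c * ((sqrt (x' * y') + sqrt (x' * y')) / 2) = c * sqrt (x' * y')" by simp
    also have "\<dots> \<le> c * sqrt ((r\<^sup>2)\<^sup>2)"
      using that by (intro mult_left_mono real_sqrt_le_mono) (auto simp: power_mult[symmetric])
    finally show "c * ?t / 2 * x + c / (2 * ?t) * y \<le> c * r\<^sup>2" by (simp only: real_sqrt_abs abs_power2)
  qed
  \<comment> \<open>The minimiser of \<open>(1 + s) * A1^2 + (1 + 1/s) * A2^2\<close>, with value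
    \<open>(A1 + A2)^2\<close>.\<close>
  define s where "s = A2 / A1"
  have s0: "0 < s" using A1 A2 by (simp add: s_def)
  obtain t where t: "0 < t" "(1 + s) * t / 2 * S1 + (1 + s) / (2 * t) * S2 \<le> (1 + s) * A1\<^sup>2"
    using opt[of "d4 * a4" "e4 * a4" S1 S2 A1 "1 + s"] pos a4(2) S1 S2 A1 s0 by (auto simp: power2_eq_square mult_ac)
  obtain u where u: "0 < u" "(1 + 1/s) * u / 2 * S4 + (1 + 1/s) / (2 * u) * S3 \<le> (1 + 1/s) * A2\<^sup>2"
    using opt[of "k4 * b4" "p4 * a4" S4 S3 A2 "1 + 1/s"] pos a4(2) b4'(2) S3 S4 A2 s0 by (auto simp: mult_ac add_pos_pos)
  have "(\<integral>x. \<phi> (h x) \<partial>std_gauss) - (\<integral>y. \<phi> (m + sg * y) \<partial>std_normal_distribution) \<le>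
    4 * sqrt ((1 + s) * t / 2 * S1 + (1 + 1/s) * u / 2 * S4 + ((1 + s) / (2 * t) * S2 + (1 + 1/s) / (2 * u) * S3)) / sg\<^sup>2"
    unfolding S1_def S2_def S3_def S4_def
    by (rule stein_bound[OF ih ip iD ik s0 t(1) u(1) m sg \<phi>])
  also have "\<dots> \<le> 4 * (A1 + A2) / sg\<^sup>2"
  proof (intro divide_right_mono mult_left_mono)
    have "(1 + s) * t / 2 * S1 + (1 + 1/s) * u / 2 * S4 + ((1 + s) / (2 * t) * S2 + (1 + 1/s) / (2 * u) * S3) \<le> (1 + s) * A1\<^sup>2 + (1 + 1/s) * A2\<^sup>2"
      using t(2) u(2) by linarith
    also have "\<dots> = (A1 + A2)\<^sup>2"
      using A1(2) A2(2) by (simp add: s_def power2_eq_square field_simps)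
    finally show "sqrt ((1 + s) * t / 2 * S1 + (1 + 1/s) * u / 2 * S4 + ((1 + s) / (2 * t) * S2 + (1 + 1/s) / (2 * u) * S3)) \<le> A1 + A2"
      using A1(2) A2(2) real_le_lsqrt by (metis add_nonneg_nonneg less_imp_le real_sqrt_le_iff real_sqrt_abs abs_of_nonneg)
  qed simp_all
  finally show ?thesis .
qed

section \<open>Normal laws as affine images of the standard normal law\<close>

lemma std_normal_moments:
  "integrable std_normal_distribution (\<lambda>y. y)" "(\<integral>y. y \<partial>std_normal_distribution) = 0"
  "integrable std_normal_distribution (\<lambda>y. y\<^sup>2)" "(\<integral>y. y\<^sup>2 \<partial>std_normal_distribution) = 1"
  using integrable_std_normal_distribution_moment[of 1] integrable_std_normal_distribution_moment[of 2]
    integral_std_normal_distribution_moment_odd[of 1] std_normal_distribution_even_moments(1)[of 1]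
  by (simp_all add: fact_numeral)

lemma prob_std_normal_UNIV [simp]: "measure std_normal_distribution UNIV = 1"
  using prob_space.prob_space[OF prob_space_normal_density[of 1 0]] by simp

text \<open>For \<open>v = 0\<close> the affine map is constant, so one formula covers the density
  and the point mass.\<close>

lemma normal_law_std:
  assumes "0 \<le> v"
  shows "normal_law \<mu> v = distr std_normal_distribution borel (\<lambda>y. \<mu> + sqrt v * y)"
proof -
  interpret N: prob_space std_normal_distribution by (intro prob_space_normal_density) simp
  show ?thesis
  proof (cases "v = 0")
    case True
    then show ?thesis using N.distr_const[of \<mu> borel] by (simp add: normal_law_def)
  next
    case False
    have "distributed std_normal_distribution lborel (\<lambda>x. x) (normal_density 0 1)"
      by (auto simp: distributed_def distr_id2)
    from N.normal_density_affine[OF this, of "sqrt v" \<mu>] False assms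
    have "distributed std_normal_distribution lborel (\<lambda>x. \<mu> + sqrt v * x) (normal_density \<mu> (sqrt v))" by simp
    then have "distr std_normal_distribution lborel (\<lambda>x. \<mu> + sqrt v * x) = density lborel (normal_density \<mu> (sqrt v))"
      by (simp add: distributed_def)
    moreover have "distr std_normal_distribution lborel (\<lambda>x. \<mu> + sqrt v * x) = distr std_normal_distribution borel (\<lambda>x. \<mu> + sqrt v * x)"
      by (intro distr_cong) auto
    ultimately show ?thesis using False by (simp add: normal_law_def)
  qed
qed

text \<open>The parameters in \<open>normal_rv\<close> are existentially bound. Computing mean and
  variance through the affine image identifies them, so equal mean and variance force equal
  laws.\<close>

lemma normal_rv_law:
  assumes "prob_space M" and Y: "normal_rv M Y"
  shows "distr M borel Y = distr std_normal_distribution borel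
           (\<lambda>y. prob_space.expectation M Y + sqrt (prob_space.variance M Y) * y)"
    and "integrable M Y" and "integrable M (\<lambda>\<omega>. (Y \<omega>)\<^sup>2)" and "0 \<le> prob_space.variance M Y"
proof -
  interpret prob_space M by fact
  from Y obtain \<mu> v where [measurable]: "Y \<in> borel_measurable M" and v: "0 \<le> v" and d: "distr M borel Y = normal_law \<mu> v"
    by (auto simp: normal_rv_def)
  have d': "distr M borel Y = distr std_normal_distribution borel (\<lambda>y. \<mu> + sqrt v * y)"
    unfolding d by (rule normal_law_std[OF v])
  note m = std_normal_moments
  have tr: "(\<integral>\<omega>. g (Y \<omega>) \<partial>M) = (\<integral>y. g (\<mu> + sqrt v * y) \<partial>std_normal_distribution)"
    "integrable M (\<lambda>\<omega>. g (Y \<omega>)) \<longleftrightarrow> integrable std_normal_distribution (\<lambda>y. g (\<mu> + sqrt v * y))"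
    if [measurable]: "g \<in> borel_measurable borel" for g :: "real \<Rightarrow> real"
  proof -
    have "(\<integral>\<omega>. g (Y \<omega>) \<partial>M) = (\<integral>y. g y \<partial>distr M borel Y)" by (subst integral_distr) auto
    also have "\<dots> = (\<integral>y. g (\<mu> + sqrt v * y) \<partial>std_normal_distribution)"
      unfolding d' by (subst integral_distr) auto
    finally show "(\<integral>\<omega>. g (Y \<omega>) \<partial>M) = (\<integral>y. g (\<mu> + sqrt v * y) \<partial>std_normal_distribution)" .
    have "integrable M (\<lambda>\<omega>. g (Y \<omega>)) \<longleftrightarrow> integrable (distr M borel Y) g" by (subst integrable_distr_eq) auto
    also have "\<dots> \<longleftrightarrow> integrable std_normal_distribution (\<lambda>y. g (\<mu> + sqrt v * y))"
      unfolding d' by (subst integrable_distr_eq) auto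
    finally show "integrable M (\<lambda>\<omega>. g (Y \<omega>)) \<longleftrightarrow> integrable std_normal_distribution (\<lambda>y. g (\<mu> + sqrt v * y))" .
  qed
  have ic: "integrable std_normal_distribution (\<lambda>_. c :: real)" for c
    using prob_space.finite_measure[OF prob_space_normal_density[of 1 0]] finite_measure.integrable_const by simp
  have cN: "(\<integral>y. c \<partial>std_normal_distribution) = c" for c :: real by simp
  have i1: "integrable std_normal_distribution (\<lambda>y. \<mu> + sqrt v * y)"
    by (intro Bochner_Integration.integrable_add integrable_mult_right m(1) ic)
  have e1: "(\<integral>y. \<mu> + sqrt v * y \<partial>std_normal_distribution) = \<mu>"
    unfolding Bochner_Integration.integral_add[OF ic integrable_mult_right[OF m(1)]] integral_mult_right_zero m(2) cN by simp
  have e: "expectation Y = \<mu>" using tr(1)[of "\<lambda>y. y"] unfolding e1 by simp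
  have sq: "(\<mu> + sqrt v * y - \<mu>)\<^sup>2 = v * y\<^sup>2" for y using v by (simp add: power_mult_distrib)
  have va: "variance Y = v"
    unfolding e using tr(1)[of "\<lambda>y. (y - \<mu>)\<^sup>2"] unfolding sq integral_mult_right_zero m(4) by simp
  show "distr M borel Y = distr std_normal_distribution borel (\<lambda>y. expectation Y + sqrt (variance Y) * y)"
    unfolding va unfolding e by (rule d')
  show "integrable M Y" using tr(2)[of "\<lambda>y. y", THEN iffD2, OF _ i1] by simp
  have sq2: "(\<mu> + sqrt v * y)\<^sup>2 = \<mu>\<^sup>2 + (2 * \<mu> * sqrt v) * y + v * y\<^sup>2" for y
    using v by (simp add: power2_sum power_mult_distrib)
  have "integrable std_normal_distribution (\<lambda>y. (\<mu> + sqrt v * y)\<^sup>2)"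
    unfolding sq2 by (intro Bochner_Integration.integrable_add integrable_mult_right m(1) m(3) ic)
  from tr(2)[of "\<lambda>y. y\<^sup>2", THEN iffD2, OF _ this] show "integrable M (\<lambda>\<omega>. (Y \<omega>)\<^sup>2)" by simp
  show "0 \<le> variance Y" unfolding va by (rule v)
qed

section \<open>Matrices as Euclidean vectors and the law of X\<close>

lemma bij_betw_Basis_matrix:
  "bij_betw (\<lambda>(i, j). axis i (axis j 1)) UNIV (Basis :: (real^'N^'n) set)"
proof -
  have "inj (\<lambda>(i, j). axis i (axis j 1) :: real^'N^'n)"
    by (rule injI) (auto simp: axis_eq_axis)
  moreover have "range (\<lambda>(i, j). axis i (axis j 1) :: real^'N^'n) = Basis"
    by (auto simp: Basis_vec_def)
  ultimately show ?thesis by (simp add: bij_betw_def)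
qed

lemma sum_Basis_matrix: "(\<Sum>b\<in>Basis. f (b :: real^'N^'n)) = (\<Sum>(i, j)\<in>UNIV. f (axis i (axis j 1)))"
  using sum.reindex_bij_betw[OF bij_betw_Basis_matrix, of f] by (simp add: case_prod_beta')

lemma prod_Basis_matrix: "(\<Prod>b\<in>Basis. f (b :: real^'N^'n)) = (\<Prod>(i, j)\<in>UNIV. f (axis i (axis j 1)))"
  using prod.reindex_bij_betw[OF bij_betw_Basis_matrix, of f] by (simp add: case_prod_beta')

lemma inner_matrix_axis: "x \<bullet> axis i (axis j 1) = x $ i $ j" for x :: "real^'N^'n"
  by (simp add: inner_axis)

lemma inner_matrix_sum: "x \<bullet> y = (\<Sum>(i, j)\<in>UNIV. x $ i $ j * y $ i $ j)" for x y :: "real^'N^'n"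
  unfolding euclidean_inner[of x y] sum_Basis_matrix by (simp add: inner_matrix_axis)

lemma borel_measurable_matrix:
  fixes X :: "'a \<Rightarrow> real^'N^'n"
  assumes "\<And>i j. (\<lambda>\<omega>. X \<omega> $ i $ j) \<in> borel_measurable M"
  shows "X \<in> borel_measurable M"
proof (subst borel_measurable_euclidean_space, rule ballI)
  fix b :: "real^'N^'n" assume "b \<in> Basis"
  then have "b \<in> range (\<lambda>(i, j). axis i (axis j 1) :: real^'N^'n)"
    by (simp only: bij_betw_imp_surj_on[OF bij_betw_Basis_matrix])
  then obtain i j where b: "b = axis i (axis j 1)" by auto
  show "(\<lambda>x. X x \<bullet> b) \<in> borel_measurable M" unfolding b inner_matrix_axis by (rule assms)
qed

text \<open>Both characteristic functions factor into the same one-dimensional integrals: on one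
  side by independence of the entries, on the other by the product structure of the standard
  gaussian measure.\<close>

lemma law_independent_matrix:
  fixes X :: "'a \<Rightarrow> real^'N^'n" and u :: "'n \<Rightarrow> 'N \<Rightarrow> real \<Rightarrow> real"
  assumes "prob_space M"
    and ind: "prob_space.indep_vars M (\<lambda>_. borel) (\<lambda>(i, j) \<omega>. X \<omega> $ i $ j) UNIV"
    and law: "\<And>i j. distr M borel (\<lambda>\<omega>. X \<omega> $ i $ j) = distr std_normal_distribution borel (u i j)"
    and [measurable]: "\<And>i j. u i j \<in> borel_measurable borel"
  shows "X \<in> borel_measurable M"
    and "distr M borel X = distr std_gauss borel (\<lambda>x. \<chi> i j. u i j (x $ i $ j))"
proof -
  interpret prob_space M by fact
  have rv: "(\<lambda>\<omega>. X \<omega> $ i $ j) \<in> borel_measurable M" for i j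
    using ind unfolding indep_vars_def by (auto dest: bspec[of _ _ "(i, j)"])
  show X [measurable]: "X \<in> borel_measurable M" by (rule borel_measurable_matrix) (rule rv)
  have [measurable]: "(\<lambda>x::real^'N^'n. x $ i $ j) \<in> borel_measurable borel" for i j
    by (intro borel_measurable_continuous_onI continuous_intros)
  have \<Psi> [measurable]: "(\<lambda>x. \<chi> i j. u i j (x $ i $ j)) \<in> (borel :: (real^'N^'n) measure) \<rightarrow>\<^sub>M borel"
    by (rule borel_measurable_matrix) simp
  show "distr M borel X = distr std_gauss borel (\<lambda>x. \<chi> i j. u i j (x $ i $ j))"
  proof (rule char_fun_unique)
    fix t :: "real^'N^'n"
    let ?c = "\<lambda>i j. \<integral>y. cis (t $ i $ j * u i j y) \<partial>std_normal_distribution"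
    have fN: "finite_measure std_normal_distribution"
      by (intro prob_space.finite_measure prob_space_normal_density) simp
    have comp: "(\<integral>\<omega>. cis (t $ i $ j * X \<omega> $ i $ j) \<partial>M) = ?c i j" for i j
    proof -
      have "(\<integral>\<omega>. cis (t $ i $ j * X \<omega> $ i $ j) \<partial>M) = (\<integral>y. cis (t $ i $ j * y) \<partial>distr M borel (\<lambda>\<omega>. X \<omega> $ i $ j))"
        using rv by (subst integral_distr) auto
      also have "\<dots> = ?c i j" unfolding law by (subst integral_distr) auto
      finally show ?thesis .
    qed
    have "(\<integral>x. cis (t \<bullet> x) \<partial>distr M borel X) = (\<integral>\<omega>. cis (t \<bullet> X \<omega>) \<partial>M)"
      by (subst integral_distr) auto
    also have "\<dots> = (\<integral>\<omega>. (\<Prod>p\<in>UNIV. cis (t $ fst p $ snd p * X \<omega> $ fst p $ snd p)) \<partial>M)"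
      by (simp add: inner_matrix_sum cis_sum case_prod_beta')
    also have "\<dots> = (\<Prod>p\<in>UNIV. \<integral>\<omega>. cis (t $ fst p $ snd p * X \<omega> $ fst p $ snd p) \<partial>M)"
    proof (rule indep_vars_lebesgue_integral)
      show "indep_vars (\<lambda>_. borel) (\<lambda>p \<omega>. cis (t $ fst p $ snd p * X \<omega> $ fst p $ snd p)) UNIV"
        using indep_vars_compose2[OF ind, of "\<lambda>p y. cis (t $ fst p $ snd p * y)" "\<lambda>_. borel"]
        by (simp add: case_prod_beta')
      show "integrable M (\<lambda>\<omega>. cis (t $ fst p $ snd p * X \<omega> $ fst p $ snd p))" for p
        using rv by (intro integrable_cis finite_measure_axioms) auto
    qed simp
    also have "\<dots> = (\<Prod>p\<in>UNIV. ?c (fst p) (snd p))" by (simp add: comp)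
    finally have L: "(\<integral>x. cis (t \<bullet> x) \<partial>distr M borel X) = (\<Prod>p\<in>UNIV. ?c (fst p) (snd p))" .
    \<comment> \<open>\<open>integral_std_gauss_prod\<close> is indexed by basis vectors and
      \<open>u\<close> by pairs of indices; the sum selects the pair belonging to
      \<open>b\<close>.\<close>
    define ub where "ub b = (\<lambda>y. \<Sum>(i, j)\<in>UNIV. if b = axis i (axis j 1) then u i j y else 0)" for b :: "real^'N^'n"
    have ub: "ub (axis i (axis j 1)) y = u i j y" for i j y
    proof -
      have "ub (axis i (axis j 1)) y = (\<Sum>p\<in>UNIV. if p = (i, j) then u i j y else 0)"
        unfolding ub_def by (intro sum.cong) (auto simp: axis_eq_axis split: if_splits)
      then show ?thesis by simp
    qed
    have "(\<integral>x. cis (t \<bullet> x) \<partial>distr std_gauss borel (\<lambda>x. \<chi> i j. u i j (x $ i $ j))) = (\<integral>x. cis (t \<bullet> (\<chi> i j. u i j (x $ i $ j))) \<partial>std_gauss)"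
      by (subst integral_distr) auto
    also have "\<dots> = (\<integral>x. (\<Prod>b\<in>Basis. cis ((t \<bullet> b) * ub b (x \<bullet> b))) \<partial>std_gauss)"
      unfolding prod_Basis_matrix by (simp add: inner_matrix_sum[of t] cis_sum case_prod_beta' inner_matrix_axis ub)
    also have "\<dots> = (\<Prod>b\<in>Basis. \<integral>y. cis ((t \<bullet> b) * ub b y) \<partial>std_normal_distribution)"
    proof (rule integral_std_gauss_prod[where g="\<lambda>b y. cis ((t \<bullet> b) * ub b y)"])
      fix b :: "real^'N^'n"
      have [measurable]: "ub b \<in> borel_measurable borel"
        unfolding ub_def[abs_def] by (intro borel_measurable_sum) (auto split: prod.split)
      show "integrable std_normal_distribution (\<lambda>y. cis ((t \<bullet> b) * ub b y))"
        by (rule integrable_cis[OF fN]) auto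
    qed
    also have "\<dots> = (\<Prod>p\<in>UNIV. ?c (fst p) (snd p))"
      unfolding prod_Basis_matrix by (simp add: inner_matrix_axis ub case_prod_beta')
    finally show "(\<integral>x. cis (t \<bullet> x) \<partial>distr M borel X) = (\<integral>x. cis (t \<bullet> x) \<partial>distr std_gauss borel (\<lambda>x. \<chi> i j. u i j (x $ i $ j)))"
      using L by simp
  qed (auto intro!: prob_space.finite_measure prob_space_distr std_gauss.prob_space_distr)
qed

text \<open>Cholesky factorisation by induction: split off one index \<open>a\<close> and pass to
  the Schur complement of the pivot \<open>Q a a\<close>. The indices form a finite set inside a
  type, since a set can grow by one element.\<close>

lemma psd_gram:
  fixes Q :: "'i \<Rightarrow> 'i \<Rightarrow> real"
  assumes "finite I" "\<And>i j. i \<in> I \<Longrightarrow> j \<in> I \<Longrightarrow> Q i j = Q j i"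
    and "\<And>x. 0 \<le> (\<Sum>i\<in>I. \<Sum>j\<in>I. x i * x j * Q i j)"
  shows "\<exists>c. \<forall>i\<in>I. \<forall>j\<in>I. Q i j = (\<Sum>k\<in>I. c i k * c j k)"
  using assms
proof (induction I arbitrary: Q rule: finite_induct)
  case (insert a I)
  note sym = insert.prems(1) and psd = insert.prems(2)
  have expand: "(\<Sum>i\<in>insert a I. \<Sum>j\<in>insert a I. x i * x j * Q i j) =
     (x a)\<^sup>2 * Q a a + 2 * x a * (\<Sum>j\<in>I. x j * Q a j) + (\<Sum>i\<in>I. \<Sum>j\<in>I. x i * x j * Q i j)" for x
  proof -
    have "(\<Sum>i\<in>I. x i * x a * Q i a) = x a * (\<Sum>j\<in>I. x j * Q a j)"
      unfolding sum_distrib_left by (intro sum.cong) (auto simp: sym)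
    moreover have "(\<Sum>j\<in>I. x a * x j * Q a j) = x a * (\<Sum>j\<in>I. x j * Q a j)"
      unfolding sum_distrib_left by (intro sum.cong) auto
    ultimately show ?thesis
      using insert.hyps by (simp add: sum.distrib power2_eq_square)
  qed
  \<comment> \<open>Positivity with the value \<open>t\<close> of the new variable left free; each
    case below picks its own \<open>t\<close>.\<close>
  have psd': "0 \<le> t\<^sup>2 * Q a a + 2 * t * (\<Sum>j\<in>I. x j * Q a j) + (\<Sum>i\<in>I. \<Sum>j\<in>I. x i * x j * Q i j)" for x t
  proof -
    have "(\<Sum>j\<in>I. (x(a := t)) j * Q a j) = (\<Sum>j\<in>I. x j * Q a j)"
      "(\<Sum>i\<in>I. \<Sum>j\<in>I. (x(a := t)) i * (x(a := t)) j * Q i j) = (\<Sum>i\<in>I. \<Sum>j\<in>I. x i * x j * Q i j)"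
      using insert.hyps(2) by (intro sum.cong refl; auto)+
    then show ?thesis using psd[of "x(a := t)"] unfolding expand by simp
  qed
  have qa: "0 \<le> Q a a" using psd'[of 1 "\<lambda>_. 0"] by simp
  show ?case
  proof (cases "Q a a = 0")
    case True
    have z: "Q a j = 0" if j: "j \<in> I" for j
    proof (rule ccontr)
      assume n: "Q a j \<noteq> 0"
      define x where "x i = (if i = j then 1 else 0 :: real)" for i
      have s1: "(\<Sum>i\<in>I. x i * Q a i) = Q a j"
        using j insert.hyps(1) by (simp add: x_def if_distrib if_distribR cong: if_cong)
      have s2: "(\<Sum>i\<in>I. \<Sum>k\<in>I. x i * x k * Q i k) = Q j j"
      proof -
        have "(\<Sum>k\<in>I. x i * x k * Q i k) = (if i = j then Q j j else 0)" for i
          using j insert.hyps(1) by (cases "i = j") (simp_all add: x_def if_distrib if_distribR cong: if_cong)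
        then show ?thesis using j insert.hyps(1) by simp
      qed
      \<comment> \<open>With pivot zero the form is affine in the new variable, and this value makes
        it \<open>-1\<close>.\<close>
      have "0 \<le> 2 * (- (Q j j + 1) / (2 * Q a j)) * Q a j + Q j j"
        using psd'[of "- (Q j j + 1) / (2 * Q a j)" x] True s1 s2 by simp
      moreover have "2 * (- (Q j j + 1) / (2 * Q a j)) * Q a j = - (Q j j + 1)" using n by simp
      ultimately show False by linarith
    qed
    have "\<exists>c. \<forall>i\<in>I. \<forall>j\<in>I. Q i j = (\<Sum>k\<in>I. c i k * c j k)"
    proof (rule insert.IH)
      show "0 \<le> (\<Sum>i\<in>I. \<Sum>j\<in>I. x i * x j * Q i j)" for x using psd'[of 0 x] by simp
    qed (use sym in auto)
    then obtain c where c: "\<And>i j. i \<in> I \<Longrightarrow> j \<in> I \<Longrightarrow> Q i j = (\<Sum>k\<in>I. c i k * c j k)" by blast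
    define c' where "c' i k = (if i = a \<or> k = a then 0 else c i k)" for i k
    have "Q i j = (\<Sum>k\<in>insert a I. c' i k * c' j k)" if "i \<in> insert a I" "j \<in> insert a I" for i j
    proof -
      have "(\<Sum>k\<in>insert a I. c' i k * c' j k) = (\<Sum>k\<in>I. c' i k * c' j k)"
        using insert.hyps by (simp add: c'_def)
      also have "\<dots> = Q i j"
      proof (cases "i = a \<or> j = a")
        case True
        then have "Q i j = 0" using z \<open>Q a a = 0\<close> sym[of i j] that by auto
        then show ?thesis using True by (auto simp: c'_def intro!: sum.neutral)
      next
        case False
        have "(\<Sum>k\<in>I. c' i k * c' j k) = (\<Sum>k\<in>I. c i k * c j k)"
          using False insert.hyps(2) by (intro sum.cong) (auto simp: c'_def)
        then show ?thesis using c[of i j] False that by simp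
      qed
      finally show ?thesis by simp
    qed
    then show ?thesis by blast
  next
    case False
    define q where "q = Q a a"
    have q: "0 < q" using qa False by (simp add: q_def)
    \<comment> \<open>The Schur complement is nonnegative because its form is the minimum of the
      full form over the new variable, attained at \<open>- L / q\<close>.\<close>
    have "\<exists>c. \<forall>i\<in>I. \<forall>j\<in>I. Q i j - Q a i * Q a j / q = (\<Sum>k\<in>I. c i k * c j k)"
    proof (rule insert.IH)
      fix x
      define L where "L = (\<Sum>j\<in>I. x j * Q a j)"
      have "(\<Sum>i\<in>I. \<Sum>j\<in>I. x i * x j * (Q a i * Q a j / q)) = L * L / q"
        unfolding L_def sum_product sum_divide_distrib by (intro sum.cong refl) (simp add: mult_ac)
      then have "(\<Sum>i\<in>I. \<Sum>j\<in>I. x i * x j * (Q i j - Q a i * Q a j / q)) = (\<Sum>i\<in>I. \<Sum>j\<in>I. x i * x j * Q i j) - L * L / q"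
        by (simp add: right_diff_distrib sum_subtractf)
      moreover have "0 \<le> (- L / q)\<^sup>2 * q + 2 * (- L / q) * L + (\<Sum>i\<in>I. \<Sum>j\<in>I. x i * x j * Q i j)"
        using psd'[of "- L / q" x] by (simp add: q_def L_def)
      moreover have "(- L / q)\<^sup>2 * q + 2 * (- L / q) * L = - (L * L / q)"
        using q by (simp add: power2_eq_square field_simps)
      ultimately show "0 \<le> (\<Sum>i\<in>I. \<Sum>j\<in>I. x i * x j * (Q i j - Q a i * Q a j / q))" by linarith
    qed (use sym in \<open>auto simp: mult.commute\<close>)
    then obtain c where c: "\<And>i j. i \<in> I \<Longrightarrow> j \<in> I \<Longrightarrow> Q i j - Q a i * Q a j / q = (\<Sum>k\<in>I. c i k * c j k)" by blast
    \<comment> \<open>The new column reproduces the rank-one part \<open>Q a i * Q a j / q\<close>.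
      Row \<open>a\<close> is zero elsewhere, since the Schur complement vanishes there.\<close>
    define c' where "c' i k = (if k = a then Q a i / sqrt q else if i = a then 0 else c i k)" for i k
    have "Q i j = (\<Sum>k\<in>insert a I. c' i k * c' j k)" if "i \<in> insert a I" "j \<in> insert a I" for i j
    proof -
      have "(\<Sum>k\<in>insert a I. c' i k * c' j k) = Q a i * Q a j / q + (\<Sum>k\<in>I. c' i k * c' j k)"
        using insert.hyps q by (simp add: c'_def)
      also have "(\<Sum>k\<in>I. c' i k * c' j k) = Q i j - Q a i * Q a j / q"
      proof (cases "i = a \<or> j = a")
        case True
        then have "Q i j = Q a i * Q a j / q" using q sym[of i j] that by (auto simp: q_def)
        moreover have "(\<Sum>k\<in>I. c' i k * c' j k) = 0"
          using True insert.hyps(2) by (intro sum.neutral) (auto simp: c'_def)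
        ultimately show ?thesis by simp
      next
        case False
        have "(\<Sum>k\<in>I. c' i k * c' j k) = (\<Sum>k\<in>I. c i k * c j k)"
          using False insert.hyps(2) by (intro sum.cong) (auto simp: c'_def)
        then show ?thesis using c[of i j] False that by simp
      qed
      finally show ?thesis by simp
    qed
    then show ?thesis by blast
  qed
qed simp

lemma norm_adjoint_le:
  fixes S :: "'a::euclidean_space \<Rightarrow> 'b::euclidean_space"
  assumes l: "linear S" and S: "\<And>t. norm (S t) \<le> c * norm t" and c: "0 \<le> c"
  shows "norm (adjoint S x) \<le> c * norm x"
proof (cases "adjoint S x = 0")
  case False
  have "norm (adjoint S x) * norm (adjoint S x) = S (adjoint S x) \<bullet> x"
    unfolding adjoint_works[OF l, of "adjoint S x" x, symmetric] dot_square_norm power2_eq_square ..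
  also have "\<dots> \<le> (c * norm (adjoint S x)) * norm x"
    by (rule order_trans[OF norm_cauchy_schwarz]) (intro mult_right_mono S norm_ge_zero)
  also have "\<dots> = (c * norm x) * norm (adjoint S x)" by simp
  finally show ?thesis using False by simp
qed (simp add: c)

text \<open>\<open>T\<close> is the adjoint of the map \<open>S\<close> built from a Gram factor of
  \<Sigma>. The identity is stated for \<open>adjoint T\<close> because the image of the standard
  gaussian under \<open>T\<close> has a characteristic function depending on
  \<open>norm (adjoint T t)\<close>. It also bounds \<open>T\<close>: the squared norm of
  \<open>S t\<close> is a quadratic form in \<Sigma>, and an adjoint obeys the same bound.\<close>

lemma gaussian_factor:
  fixes \<Sigma> :: "real^('n::finite \<times> 'N::finite)^('n \<times> 'N)"
  assumes sym: "\<And>p q. \<Sigma> $ p $ q = \<Sigma> $ q $ p" and psd: "\<And>x. 0 \<le> (\<Sum>p\<in>UNIV. \<Sum>q\<in>UNIV. x p * x q * \<Sigma> $ p $ q)"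
  shows "\<exists>T :: real^'N^'n \<Rightarrow> real^'N^'n. linear T \<and>
    (\<forall>t. (norm (adjoint T t))\<^sup>2 = (\<Sum>p\<in>UNIV. \<Sum>q\<in>UNIV. t $ fst p $ snd p * t $ fst q $ snd q * \<Sigma> $ p $ q)) \<and>
    (\<forall>x. norm (T x) \<le> sqrt (onorm ((*v) \<Sigma>)) * norm x)"
proof -
  have "\<exists>c. \<forall>p\<in>UNIV. \<forall>q\<in>UNIV. \<Sigma> $ p $ q = (\<Sum>k\<in>(UNIV :: ('n \<times> 'N) set). c p k * c q k)"
    by (rule psd_gram) (rule finite sym psd)+
  then obtain c where c: "\<And>p q. \<Sigma> $ p $ q = (\<Sum>k\<in>(UNIV :: ('n \<times> 'N) set). c p k * c q k)"
    by blast
  define S :: "real^'N^'n \<Rightarrow> real^'N^'n" where "S t = (\<chi> i j. \<Sum>p\<in>UNIV. t $ fst p $ snd p * c p (i, j))" for t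
  have lS: "linear S"
    by (rule linearI) (auto simp: S_def vec_eq_iff sum.distrib sum_distrib_left algebra_simps)
  have nS: "(norm (S t))\<^sup>2 = (\<Sum>p\<in>UNIV. \<Sum>q\<in>UNIV. t $ fst p $ snd p * t $ fst q $ snd q * \<Sigma> $ p $ q)" for t
  proof -
    have "(norm (S t))\<^sup>2 = (\<Sum>k\<in>UNIV. (\<Sum>p\<in>UNIV. t $ fst p $ snd p * c p k) * (\<Sum>q\<in>UNIV. t $ fst q $ snd q * c q k))"
      unfolding power2_norm_eq_inner inner_matrix_sum by (simp add: S_def case_prod_beta')
    also have "\<dots> = (\<Sum>k\<in>UNIV. \<Sum>p\<in>UNIV. \<Sum>q\<in>UNIV. t $ fst p $ snd p * t $ fst q $ snd q * (c p k * c q k))"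
      unfolding sum_product by (intro sum.cong refl) (simp add: mult_ac)
    also have "\<dots> = (\<Sum>p\<in>UNIV. \<Sum>q\<in>UNIV. \<Sum>k\<in>UNIV. t $ fst p $ snd p * t $ fst q $ snd q * (c p k * c q k))"
      by (subst sum.swap, rule sum.cong[OF refl], rule sum.swap)
    also have "\<dots> = (\<Sum>p\<in>UNIV. \<Sum>q\<in>UNIV. t $ fst p $ snd p * t $ fst q $ snd q * \<Sigma> $ p $ q)"
      by (simp only: c sum_distrib_left)
    finally show ?thesis .
  qed
  have S_le: "norm (S t) \<le> sqrt (onorm ((*v) \<Sigma>)) * norm t" for t
  proof -
    define w :: "real^('n \<times> 'N)" where "w = (\<chi> p. t $ fst p $ snd p)"
    have nw: "norm w = norm t"
    proof -
      have "(norm w)\<^sup>2 = (norm t)\<^sup>2"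
        unfolding power2_norm_eq_inner inner_matrix_sum inner_vec_def[of w] by (simp add: w_def case_prod_beta')
      then show ?thesis by simp
    qed
    have "(norm (S t))\<^sup>2 = w \<bullet> (\<Sigma> *v w)"
      unfolding nS by (simp add: w_def inner_vec_def matrix_vector_mult_def sum_distrib_left mult_ac)
    also have "\<dots> \<le> norm w * norm (\<Sigma> *v w)" by (rule norm_cauchy_schwarz)
    also have "\<dots> \<le> norm w * (onorm ((*v) \<Sigma>) * norm w)"
      by (intro mult_left_mono onorm matrix_vector_mul_bounded_linear norm_ge_zero)
    also have "\<dots> = (sqrt (onorm ((*v) \<Sigma>)) * norm t)\<^sup>2"
      using onorm_pos_le[OF matrix_vector_mul_bounded_linear[of \<Sigma>]] by (simp add: power_mult_distrib nw power2_eq_square)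
    finally show ?thesis
      by (rule power2_le_imp_le) (simp add: onorm_pos_le[OF matrix_vector_mul_bounded_linear])
  qed
  have T_le: "norm (adjoint S x) \<le> sqrt (onorm ((*v) \<Sigma>)) * norm x" for x
    by (rule norm_adjoint_le[OF lS S_le]) (simp add: onorm_pos_le[OF matrix_vector_mul_bounded_linear])
  show ?thesis
    using adjoint_linear[OF lS] nS T_le by (intro exI[of _ "adjoint S"]) (simp add: adjoint_adjoint[OF lS])
qed

text \<open>Every linear combination of entries is normal with mean 0 and variance the quadratic
  form of \<Sigma>, which is the squared norm of \<open>adjoint T t\<close>; so the characteristic
  functions agree. Singular \<Sigma> is included, as \<open>T\<close> may be singular.\<close>

lemma law_gaussian_matrix:
  fixes X :: "'a \<Rightarrow> real^'N^'n" and \<Sigma> :: "real^('n \<times> 'N)^('n \<times> 'N)"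
  assumes "prob_space M"
    and G: "jointly_gaussian M (\<lambda>(i, j) \<omega>. X \<omega> $ i $ j)"
    and mean: "\<And>i j. prob_space.expectation M (\<lambda>\<omega>. X \<omega> $ i $ j) = 0"
    and cov: "\<And>i j k l. \<Sigma> $ (i, j) $ (k, l) = covariance M (\<lambda>\<omega>. X \<omega> $ i $ j) (\<lambda>\<omega>. X \<omega> $ k $ l)"
  shows "X \<in> borel_measurable M"
    and "\<exists>T :: real^'N^'n \<Rightarrow> real^'N^'n. linear T \<and> distr M borel X = distr std_gauss borel T \<and> (\<forall>x. norm (T x) \<le> sqrt (onorm ((*v) \<Sigma>)) * norm x)"
proof -
  interpret prob_space M by fact
  have rvs: "normal_rv M (\<lambda>\<omega>. \<Sum>p\<in>UNIV. t p * X \<omega> $ fst p $ snd p)" for t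
    using G unfolding jointly_gaussian_def by (simp add: case_prod_beta')
  have rv1: "normal_rv M (\<lambda>\<omega>. X \<omega> $ i $ j)" for i j
  proof -
    have "(\<Sum>p\<in>UNIV. (if p = (i, j) then 1 else 0) * X \<omega> $ fst p $ snd p) = X \<omega> $ i $ j" for \<omega>
      by (simp add: if_distrib if_distribR cong: if_cong)
    then show ?thesis using rvs[of "\<lambda>p. if p = (i, j) then 1 else 0"] by simp
  qed
  have rv: "(\<lambda>\<omega>. X \<omega> $ i $ j) \<in> borel_measurable M" for i j using rv1 by (auto simp: normal_rv_def)
  show X [measurable]: "X \<in> borel_measurable M" by (rule borel_measurable_matrix) (rule rv)
  note i1 = normal_rv_law(2)[OF prob_space_axioms rv1] and i2 = normal_rv_law(3)[OF prob_space_axioms rv1]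
  have ii: "integrable M (\<lambda>\<omega>. X \<omega> $ i $ j * X \<omega> $ k $ l)" for i j k l
  proof (rule Bochner_Integration.integrable_bound)
    show "integrable M (\<lambda>\<omega>. (X \<omega> $ i $ j)\<^sup>2 + (X \<omega> $ k $ l)\<^sup>2)" by (intro Bochner_Integration.integrable_add i2)
    have "\<bar>a * b\<bar> \<le> a\<^sup>2 + b\<^sup>2" for a b :: real
      using sum_squares_bound[of "\<bar>a\<bar>" "\<bar>b\<bar>"] abs_ge_zero[of "a * b"] unfolding abs_mult power2_abs by linarith
    then show "AE \<omega> in M. norm (X \<omega> $ i $ j * X \<omega> $ k $ l) \<le> norm ((X \<omega> $ i $ j)\<^sup>2 + (X \<omega> $ k $ l)\<^sup>2)"
      by (intro AE_I2) simp
  qed (use rv in measurable)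
  have \<Sigma>: "\<Sigma> $ p $ q = (\<integral>\<omega>. X \<omega> $ fst p $ snd p * X \<omega> $ fst q $ snd q \<partial>M)" for p q
    using cov[of "fst p" "snd p" "fst q" "snd q"] by (simp add: covariance_def mean)
  define Y where "Y t \<omega> = (\<Sum>p\<in>UNIV. t p * X \<omega> $ fst p $ snd p)" for t \<omega>
  have EY: "expectation (Y t) = 0" for t
    unfolding Y_def using i1 by (simp add: mean)
  have vY: "variance (Y t) = (\<Sum>p\<in>UNIV. \<Sum>q\<in>UNIV. t p * t q * \<Sigma> $ p $ q)" for t
  proof -
    have "(Y t \<omega>)\<^sup>2 = (\<Sum>p\<in>UNIV. \<Sum>q\<in>UNIV. (t p * t q) * (X \<omega> $ fst p $ snd p * X \<omega> $ fst q $ snd q))" for \<omega>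
      unfolding Y_def power2_eq_square sum_product by (intro sum.cong refl) (simp only: mult_ac)
    then show ?thesis
      unfolding EY \<Sigma> using ii by simp
  qed
  have sym: "\<Sigma> $ p $ q = \<Sigma> $ q $ p" for p q unfolding \<Sigma> by (simp only: mult.commute)
  \<comment> \<open>The quadratic form is a variance, which makes \<Sigma> positive
    semidefinite.\<close>
  have psd: "0 \<le> (\<Sum>p\<in>UNIV. \<Sum>q\<in>UNIV. t p * t q * \<Sigma> $ p $ q)" for t
    unfolding vY[symmetric] by simp
  obtain T :: "real^'N^'n \<Rightarrow> real^'N^'n" where T: "linear T"
    "\<And>t. (norm (adjoint T t))\<^sup>2 = (\<Sum>p\<in>UNIV. \<Sum>q\<in>UNIV. t $ fst p $ snd p * t $ fst q $ snd q * \<Sigma> $ p $ q)"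
    "\<And>x. norm (T x) \<le> sqrt (onorm ((*v) \<Sigma>)) * norm x"
    using gaussian_factor[OF sym psd] by blast
  have [measurable]: "T \<in> borel_measurable borel"
    using T(1) by (intro borel_measurable_continuous_onI linear_continuous_on linear_conv_bounded_linear[THEN iffD1])
  have "distr M borel X = distr std_gauss borel T"
  proof (rule char_fun_unique)
    fix t :: "real^'N^'n"
    let ?t = "\<lambda>p. t $ fst p $ snd p"
    let ?v = "\<Sum>p\<in>UNIV. \<Sum>q\<in>UNIV. ?t p * ?t q * \<Sigma> $ p $ q"
    have tX: "t \<bullet> X \<omega> = Y ?t \<omega>" for \<omega> by (simp add: inner_matrix_sum Y_def case_prod_beta')
    have nY: "normal_rv M (Y ?t)" unfolding Y_def by (rule rvs)
    have [measurable]: "Y ?t \<in> borel_measurable M" using nY by (simp add: normal_rv_def)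
    have "(\<integral>x. cis (t \<bullet> x) \<partial>distr M borel X) = (\<integral>\<omega>. cis (Y ?t \<omega>) \<partial>M)"
      by (subst integral_distr) (auto simp: tX)
    also have "\<dots> = (\<integral>y. cis y \<partial>distr M borel (Y ?t))" by (subst integral_distr) auto
    also have "distr M borel (Y ?t) = distr std_normal_distribution borel (\<lambda>y. 0 + sqrt ?v * y)"
      using normal_rv_law(1)[OF prob_space_axioms nY] by (simp only: EY[of ?t] vY[of ?t, unfolded EY])
    also have "(\<integral>y. cis y \<partial>distr std_normal_distribution borel (\<lambda>y. 0 + sqrt ?v * y)) = (\<integral>y. cis (sqrt ?v * y) \<partial>std_normal_distribution)"
      by (subst integral_distr) auto
    also have "\<dots> = of_real (exp (- (sqrt ?v)\<^sup>2 / 2))"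
      using fun_cong[OF char_std_normal_distribution, of "sqrt ?v"] by (simp only: char_def cis_conv_exp mult_ac of_real_mult)
    also have "(sqrt ?v)\<^sup>2 = (norm (adjoint T t))\<^sup>2" unfolding T(2) using psd[of ?t] by simp
    also have "of_real (exp (- (norm (adjoint T t))\<^sup>2 / 2)) = (\<integral>x. cis (adjoint T t \<bullet> x) \<partial>std_gauss)"
      by (rule integral_cis_std_gauss[symmetric])
    also have "\<dots> = (\<integral>x. cis (t \<bullet> x) \<partial>distr std_gauss borel T)"
      by (subst integral_distr) (auto simp: adjoint_works[OF T(1)] inner_commute)
    finally show "(\<integral>x. cis (t \<bullet> x) \<partial>distr M borel X) = (\<integral>x. cis (t \<bullet> x) \<partial>distr std_gauss borel T)" .
  qed (auto intro!: prob_space.finite_measure prob_space_distr std_gauss.prob_space_distr)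
  with T(1,3) show "\<exists>T :: real^'N^'n \<Rightarrow> real^'N^'n. linear T \<and> distr M borel X = distr std_gauss borel T \<and> (\<forall>x. norm (T x) \<le> sqrt (onorm ((*v) \<Sigma>)) * norm x)"
    by (intro exI[of _ T] conjI allI)
qed

lemma has_derivative_matrix:
  fixes F :: "'a::real_normed_vector \<Rightarrow> real^'N^'n"
  assumes "\<And>i j. ((\<lambda>x. F x $ i $ j) has_derivative (\<lambda>v. F' v $ i $ j)) (at x)"
  shows "(F has_derivative F') (at x)"
proof (subst has_derivative_componentwise_within, rule ballI)
  fix b :: "real^'N^'n" assume "b \<in> Basis"
  then have "b \<in> range (\<lambda>(i, j). axis i (axis j 1) :: real^'N^'n)"
    by (simp only: bij_betw_imp_surj_on[OF bij_betw_Basis_matrix])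
  then obtain i j where b: "b = axis i (axis j 1)" by auto
  show "((\<lambda>x. F x \<bullet> b) has_derivative (\<lambda>v. F' v \<bullet> b)) (at x)"
    unfolding b inner_matrix_axis by (rule assms)
qed

text \<open>The norm of the gradient is controlled by the Frobenius norm of \<open>X\<close>, which
  gives the second power of the number of rows. In the sum of fourth powers one squared coordinate
  is replaced by its maximum, free of that number, and the rest sums to the squared norm, so only
  the first power appears.\<close>

lemma (in entire_coef) trace_grad_power4_le:
  fixes X :: "real^'N^'n"
  shows trace_grad_norm4_le: "norm (trace_grad X) ^ 4 \<le> 16 * (real CARD('n))\<^sup>2 / (real CARD('N))\<^sup>2 * (abs_series1 coef (top_eig X) ^ 4 * (top_eig X)\<^sup>2)"
    and trace_grad_sum4_le: "(\<Sum>b\<in>Basis. (trace_grad X \<bullet> b) ^ 4) \<le> 16 * real CARD('n) / (real CARD('N))\<^sup>2 * (abs_series1 coef (top_eig X) ^ 4 * (top_eig X)\<^sup>2)"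
proof -
  define f where "f = abs_series1 coef (top_eig X)"
  define l where "l = top_eig X"
  define n where "n = real CARD('n)"
  define N where "N = real CARD('N)"
  have pos: "0 \<le> f" "0 \<le> l" "0 < n" "0 < N"
    by (auto simp: f_def l_def n_def N_def top_eig_nonneg abs_series1_nonneg)
  have "(norm (trace_grad X))\<^sup>2 \<le> (2 / N * norm X * f)\<^sup>2"
    unfolding f_def N_def by (intro power_mono norm_trace_grad_le norm_ge_zero)
  also have "\<dots> = (2 / N * f)\<^sup>2 * (norm X)\<^sup>2" by (simp only: power_mult_distrib mult_ac)
  also have "\<dots> \<le> (2 / N * f)\<^sup>2 * (n * (N * l))"
    using norm_le_top_sv[of X] unfolding top_sv_sq n_def N_def l_def by (intro mult_left_mono) auto
  also have "\<dots> = 4 * n / N * f\<^sup>2 * l" using pos by (simp add: power2_eq_square)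
  finally have P2: "(norm (trace_grad X))\<^sup>2 \<le> 4 * n / N * f\<^sup>2 * l" .
  have c2: "(trace_grad X \<bullet> b)\<^sup>2 \<le> 4 / N * f\<^sup>2 * l" if b: "b \<in> Basis" for b
  proof -
    have "b \<in> range (\<lambda>(i, j). axis i (axis j 1) :: real^'N^'n)"
      using b by (simp only: bij_betw_imp_surj_on[OF bij_betw_Basis_matrix])
    then obtain i j where b: "b = axis i (axis j 1)" by auto
    have "\<bar>trace_grad X $ i $ j\<bar>\<^sup>2 \<le> (2 / N * top_sv X * f)\<^sup>2"
      unfolding f_def N_def by (intro power_mono trace_grad_component_le abs_ge_zero)
    also have "\<dots> = (2 / N * f)\<^sup>2 * (top_sv X)\<^sup>2" by (simp only: power_mult_distrib mult_ac)
    also have "\<dots> = 4 / N * f\<^sup>2 * l" using pos unfolding top_sv_sq by (simp add: power2_eq_square N_def l_def)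
    finally show ?thesis by (simp add: b inner_matrix_axis)
  qed
  have "norm (trace_grad X) ^ 4 = ((norm (trace_grad X))\<^sup>2)\<^sup>2" by (simp add: power_mult[symmetric])
  also have "\<dots> \<le> (4 * n / N * f\<^sup>2 * l)\<^sup>2" by (intro power_mono P2) simp
  also have "\<dots> = 16 * n\<^sup>2 / N\<^sup>2 * (f ^ 4 * l\<^sup>2)"
    by (simp add: power2_eq_square power4_eq_xxxx)
  finally show "norm (trace_grad X) ^ 4 \<le> 16 * (real CARD('n))\<^sup>2 / (real CARD('N))\<^sup>2 * (abs_series1 coef (top_eig X) ^ 4 * (top_eig X)\<^sup>2)"
    unfolding f_def l_def n_def N_def .
  have "(\<Sum>b\<in>Basis. (trace_grad X \<bullet> b) ^ 4) \<le> (\<Sum>b\<in>Basis. (4 / N * f\<^sup>2 * l) * (trace_grad X \<bullet> b)\<^sup>2)"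
  proof (rule sum_mono)
    fix b :: "real^'N^'n" assume b: "b \<in> Basis"
    have "(trace_grad X \<bullet> b) ^ 4 = (trace_grad X \<bullet> b)\<^sup>2 * (trace_grad X \<bullet> b)\<^sup>2" by (simp add: power4_eq_xxxx power2_eq_square)
    also have "\<dots> \<le> (4 / N * f\<^sup>2 * l) * (trace_grad X \<bullet> b)\<^sup>2" by (intro mult_right_mono c2 b) simp
    finally show "(trace_grad X \<bullet> b) ^ 4 \<le> (4 / N * f\<^sup>2 * l) * (trace_grad X \<bullet> b)\<^sup>2" .
  qed
  also have "\<dots> = (4 / N * f\<^sup>2 * l) * (norm (trace_grad X))\<^sup>2"
    unfolding sum_distrib_left[symmetric] power2_norm_eq_inner euclidean_inner[of "trace_grad X" "trace_grad X"]
    by (simp only: power2_eq_square)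
  also have "\<dots> \<le> (4 / N * f\<^sup>2 * l) * (4 * n / N * f\<^sup>2 * l)" using pos by (intro mult_left_mono P2) auto
  also have "\<dots> = 16 * n / N\<^sup>2 * (f ^ 4 * l\<^sup>2)" by (simp add: power2_eq_square power4_eq_xxxx)
  finally show "(\<Sum>b\<in>Basis. (trace_grad X \<bullet> b) ^ 4) \<le> 16 * real CARD('n) / (real CARD('N))\<^sup>2 * (abs_series1 coef (top_eig X) ^ 4 * (top_eig X)\<^sup>2)"
    unfolding f_def l_def n_def N_def .
qed

context entire_coef
begin

definition hess_bound :: "real^'N^'n \<Rightarrow> real" where
  "hess_bound X = 2 / real CARD('N) * (abs_series1 coef (top_eig X) + 2 * top_eig X * abs_series2 coef (top_eig X))"

text \<open>\<open>a^4\<close> and \<open>b^4\<close> are the expectations of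
  \<open>weight_a (X \<omega>)\<close> and \<open>weight_b (X \<omega>)\<close> when these are
  finite. As functions of the matrix they can be transported along the law of
  \<open>X\<close>.\<close>

definition weight_a :: "real^'N^'n \<Rightarrow> real" where
  "weight_a X = abs_series1 coef (top_eig X) ^ 4 * (top_eig X)\<^sup>2"

definition weight_b :: "real^'N^'n \<Rightarrow> real" where
  "weight_b X = (abs_series1 coef (top_eig X) + 2 * real CARD('n) powr (-1/2) * abs_series2 coef (top_eig X) * top_eig X) ^ 4"

lemma hess_bound_nonneg: "0 \<le> hess_bound X"
  unfolding hess_bound_def
  by (intro mult_nonneg_nonneg add_nonneg_nonneg abs_series1_nonneg abs_series2_nonneg top_eig_nonneg) auto

lemma weights_nonneg: "0 \<le> weight_a X" "0 \<le> weight_b X"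
  by (auto simp: weight_a_def weight_b_def)

text \<open>Enlarging the first summand by \<open>sqrt n \<ge> 1\<close> lets \<open>sqrt n\<close>
  be taken out of the sum, which leaves \<open>n powr (-1/2)\<close> in front of the second series,
  as in the definition of \<open>b\<close>. The fourth powers of \<open>sqrt n\<close> and
  \<open>2 / N\<close> give the constant.\<close>

lemma hess_bound_power4_le:
  "hess_bound X ^ 4 \<le> 16 * (real CARD('n))\<^sup>2 / real CARD('N) ^ 4 * weight_b X" for X :: "real^'N^'n"
proof -
  define l where "l = top_eig X"
  define f1 f2 n N where "f1 = abs_series1 coef l" and "f2 = abs_series2 coef l" and "n = real CARD('n)" and "N = real CARD('N)"
  note defs = l_def this
  have pos: "0 \<le> f1" "0 \<le> f2" "0 \<le> l" "1 \<le> n" "0 < N"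
    by (auto simp: defs top_eig_nonneg abs_series1_nonneg abs_series2_nonneg Suc_le_eq)
  have sn: "1 \<le> sqrt n" "sqrt n * n powr (-1/2) = 1"
    using pos by (simp_all add: powr_half_sqrt[symmetric] powr_add[symmetric] ge_one_powr_ge_zero)
  have "f1 + 2 * l * f2 \<le> sqrt n * f1 + (sqrt n * n powr (-1/2)) * (2 * l * f2)"
    unfolding sn(2) using mult_right_mono[OF sn(1) pos(1)] by simp
  also have "\<dots> = sqrt n * (f1 + 2 * n powr (-1/2) * f2 * l)" by (simp only: distrib_left mult_ac)
  finally have "hess_bound X \<le> 2 / N * (sqrt n * (f1 + 2 * n powr (-1/2) * f2 * l))"
    unfolding hess_bound_def defs[symmetric] using pos by (intro mult_left_mono) auto
  then have "hess_bound X ^ 4 \<le> (2 / N * (sqrt n * (f1 + 2 * n powr (-1/2) * f2 * l))) ^ 4"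
    by (intro power_mono hess_bound_nonneg)
  also have "\<dots> = 16 / N ^ 4 * (sqrt n ^ 4) * (f1 + 2 * n powr (-1/2) * f2 * l) ^ 4"
    by (simp add: power_mult_distrib power_divide)
  also have "sqrt n ^ 4 = n\<^sup>2"
    using pos power_mult[of "sqrt n" 2 2] by simp
  finally show ?thesis unfolding weight_b_def defs[symmetric] by simp
qed

lemma borel_measurable_weights [measurable]:
  "(weight_a :: real^'N^'n \<Rightarrow> real) \<in> borel_measurable borel" "(weight_b :: real^'N^'n \<Rightarrow> real) \<in> borel_measurable borel"
  "(hess_bound :: real^'N^'n \<Rightarrow> real) \<in> borel_measurable borel"
  unfolding weight_a_def[abs_def] weight_b_def[abs_def] hess_bound_def[abs_def] by measurable

lemma continuous_trace_fun: "continuous_on UNIV (trace_fun :: real^'N^'n \<Rightarrow> real)"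
  and continuous_trace_grad: "continuous_on UNIV (trace_grad :: real^'N^'n \<Rightarrow> real^'N^'n)"
  by (intro continuous_at_imp_continuous_on ballI has_derivative_continuous[OF trace_fun_derivative]
      has_derivative_continuous[OF trace_grad_derivative])+

lemma borel_measurable_trace_fun [measurable]: "(trace_fun :: real^'N^'n \<Rightarrow> real) \<in> borel_measurable borel"
  by (rule borel_measurable_continuous_onI[OF continuous_trace_fun])

lemma hess_inner_le: "\<bar>trace_hess X v \<bullet> w\<bar> \<le> hess_bound X * norm v * norm w"
  by (rule order_trans[OF Cauchy_Schwarz_ineq2])
     (intro mult_right_mono norm_ge_zero, unfold hess_bound_def, rule norm_trace_hess_le)

text \<open>The laws of \<open>W\<close> and \<open>Z\<close> are rewritten as images of standard
  gaussian measures, so that hypothesis \<open>C\<close> is exactly what the passage from continuous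
  functions to Borel sets asks for.\<close>

lemma d_TV_le:
  fixes X :: "'a \<Rightarrow> real^'N^'n" and \<Psi> :: "'c::euclidean_space \<Rightarrow> real^'N^'n"
  assumes M: "prob_space M" "prob_space M'"
    and X: "X \<in> borel_measurable M" and \<Psi>: "\<Psi> \<in> borel_measurable borel"
    and law: "distr M borel X = distr std_gauss borel \<Psi>"
    and W: "W = (\<lambda>\<omega>. trace_fun (X \<omega>))"
    and Z: "normal_rv M' Z" "prob_space.expectation M' Z = prob_space.expectation M W"
      "prob_space.variance M' Z = prob_space.variance M W"
    and C: "\<And>\<phi>. continuous_on UNIV \<phi> \<Longrightarrow> (\<And>x. 0 \<le> \<phi> x) \<Longrightarrow> (\<And>x. \<phi> x \<le> 1) \<Longrightarrow>
       (\<integral>x. \<phi> (trace_fun (\<Psi> x)) \<partial>std_gauss) -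
       (\<integral>y. \<phi> (prob_space.expectation M W + sqrt (prob_space.variance M W) * y) \<partial>std_normal_distribution) \<le> C"
  shows "d_TV M W M' Z \<le> C"
proof -
  interpret M: prob_space M by fact
  interpret M': prob_space M' by fact
  note [measurable] = X \<Psi>
  have [measurable]: "W \<in> borel_measurable M" unfolding W by measurable
  have [measurable]: "Z \<in> borel_measurable M'" using Z(1) by (simp add: normal_rv_def)
  have lW: "distr M borel W = distr std_gauss borel (\<lambda>x. trace_fun (\<Psi> x))"
  proof -
    have "distr M borel W = distr (distr M borel X) borel trace_fun"
      by (subst distr_distr) (auto simp: W o_def)
    also have "\<dots> = distr std_gauss borel (\<lambda>x. trace_fun (\<Psi> x))"
      unfolding law by (subst distr_distr) (auto simp: o_def)
    finally show ?thesis .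
  qed
  have lZ: "distr M' borel Z = distr std_normal_distribution borel (\<lambda>y. M.expectation W + sqrt (M.variance W) * y)"
    using normal_rv_law(1)[OF M(2) Z(1)] unfolding Z(3) unfolding Z(2) .
  have b: "\<bar>measure (distr M borel W) B - measure (distr M' borel Z) B\<bar> \<le> C" if B: "B \<in> sets borel" for B
  proof (rule measure_diff_le_of_continuous[OF _ _ _ _ _ B])
    fix \<phi> :: "real \<Rightarrow> real"
    assume \<phi>: "continuous_on UNIV \<phi>" "\<And>x. 0 \<le> \<phi> x" "\<And>x. \<phi> x \<le> 1"
    have [measurable]: "\<phi> \<in> borel_measurable borel" by (rule borel_measurable_continuous_onI[OF \<phi>(1)])
    show "(\<integral>x. \<phi> x \<partial>distr M borel W) - (\<integral>x. \<phi> x \<partial>distr M' borel Z) \<le> C"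
    proof -
      have "(\<integral>x. \<phi> x \<partial>distr M borel W) = (\<integral>x. \<phi> (trace_fun (\<Psi> x)) \<partial>std_gauss)"
        unfolding lW by (rule integral_distr) measurable
      moreover have "(\<integral>x. \<phi> x \<partial>distr M' borel Z) = (\<integral>y. \<phi> (M.expectation W + sqrt (M.variance W) * y) \<partial>std_normal_distribution)"
        unfolding lZ by (rule integral_distr) measurable
      ultimately show ?thesis using C[OF \<phi>] by (simp only:)
    qed
  qed (auto intro: M.prob_space_distr M'.prob_space_distr)
  show ?thesis
    unfolding d_TV_def
  proof (rule cSUP_least)
    fix B :: "real set" assume B: "B \<in> sets borel"
    show "\<bar>measure M (W -` B \<inter> space M) - measure M' (Z -` B \<inter> space M')\<bar> \<le> C"
      using b[OF B] B by (simp add: measure_distr)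
  qed auto
qed

lemma transfer_law:
  fixes X :: "'a \<Rightarrow> real^'N^'n" and g :: "real^'N^'n \<Rightarrow> real"
  assumes [measurable]: "X \<in> borel_measurable M" "\<Psi> \<in> borel_measurable borel" "g \<in> borel_measurable borel"
    and law: "distr M borel X = distr std_gauss borel \<Psi>"
  shows "(\<integral>x. g (\<Psi> x) \<partial>std_gauss) = (\<integral>\<omega>. g (X \<omega>) \<partial>M)"
    and "integrable std_gauss (\<lambda>x. g (\<Psi> x)) \<longleftrightarrow> integrable M (\<lambda>\<omega>. g (X \<omega>))"
proof -
  have "(\<integral>x. g (\<Psi> x) \<partial>std_gauss) = (\<integral>x. g x \<partial>distr std_gauss borel \<Psi>)" by (subst integral_distr) auto
  also have "\<dots> = (\<integral>\<omega>. g (X \<omega>) \<partial>M)" unfolding law[symmetric] by (subst integral_distr) auto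
  finally show "(\<integral>x. g (\<Psi> x) \<partial>std_gauss) = (\<integral>\<omega>. g (X \<omega>) \<partial>M)" .
  have "integrable std_gauss (\<lambda>x. g (\<Psi> x)) \<longleftrightarrow> integrable (distr std_gauss borel \<Psi>) g" by (subst integrable_distr_eq) auto
  also have "\<dots> \<longleftrightarrow> integrable M (\<lambda>\<omega>. g (X \<omega>))" unfolding law[symmetric] by (subst integrable_distr_eq) auto
  finally show "integrable std_gauss (\<lambda>x. g (\<Psi> x)) \<longleftrightarrow> integrable M (\<lambda>\<omega>. g (X \<omega>))" .
qed

end

section \<open>Total variation bounds\<close>

definition entrywise :: "('n \<Rightarrow> 'N \<Rightarrow> real \<Rightarrow> real) \<Rightarrow> real^'N^'n \<Rightarrow> real^'N^'n" where
  "entrywise u x = (\<chi> i j. u i j (x $ i $ j))"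

definition hadamard :: "real^'N^'n \<Rightarrow> real^'N^'n \<Rightarrow> real^'N^'n" where
  "hadamard x y = (\<chi> i j. x $ i $ j * y $ i $ j)"

lemma hadamard_nth [simp]: "hadamard x y $ i $ j = x $ i $ j * y $ i $ j"
  by (simp add: hadamard_def)

lemma entrywise_nth [simp]: "entrywise u x $ i $ j = u i j (x $ i $ j)"
  by (simp add: entrywise_def)

text \<open>Entrywise multiplication is self-adjoint. This moves \<open>u'\<close> from the
  direction to the gradient, and to the second argument of the Hessian form.\<close>

lemma inner_hadamard: "x \<bullet> hadamard y z = hadamard y x \<bullet> z"
  unfolding inner_matrix_sum by (simp add: mult_ac)

lemma norm_hadamard_le:
  assumes "\<And>i j. \<bar>x $ i $ j\<bar> \<le> c"
  shows "norm (hadamard x y) \<le> c * norm y"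
proof (rule power2_le_imp_le)
  have c: "0 \<le> c" using order_trans[OF abs_ge_zero assms] .
  have "(norm (hadamard x y))\<^sup>2 = (\<Sum>(i, j)\<in>UNIV. (x $ i $ j * y $ i $ j)\<^sup>2)"
    unfolding power2_norm_eq_inner inner_matrix_sum by (simp add: power2_eq_square)
  also have "\<dots> \<le> (\<Sum>(i, j)\<in>UNIV. c\<^sup>2 * (y $ i $ j * y $ i $ j))"
  proof (rule sum_mono, clarify)
    fix i j
    have "(x $ i $ j * y $ i $ j)\<^sup>2 = \<bar>x $ i $ j\<bar>\<^sup>2 * (y $ i $ j * y $ i $ j)"
      by (simp add: power_mult_distrib power2_eq_square)
    also have "\<dots> \<le> c\<^sup>2 * (y $ i $ j * y $ i $ j)"
      by (intro mult_right_mono power_mono assms) auto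
    finally show "(x $ i $ j * y $ i $ j)\<^sup>2 \<le> c\<^sup>2 * (y $ i $ j * y $ i $ j)" .
  qed
  also have "\<dots> = (c * norm y)\<^sup>2"
    unfolding power_mult_distrib power2_norm_eq_inner[of y] inner_matrix_sum sum_distrib_left
    by (simp add: case_prod_beta')
  finally show "(norm (hadamard x y))\<^sup>2 \<le> (c * norm y)\<^sup>2" .
  show "0 \<le> c * norm y" using c by simp
qed

lemma matrix_component_derivative: "((\<lambda>x::real^'N^'n. x $ i $ j) has_derivative (\<lambda>v. v $ i $ j)) (at x)"
  by (intro bounded_linear_imp_has_derivative bounded_linear_compose[OF bounded_linear_vec_nth bounded_linear_vec_nth])

lemma entrywise_derivative:
  assumes "\<And>i j y. (u i j has_real_derivative u' i j y) (at y)"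
  shows "(entrywise u has_derivative hadamard (entrywise u' x)) (at x)"
proof (rule has_derivative_matrix)
  fix i j
  show "((\<lambda>x. entrywise u x $ i $ j) has_derivative (\<lambda>v. hadamard (entrywise u' x) v $ i $ j)) (at x)"
    unfolding entrywise_nth hadamard_nth
    by (rule has_derivative_compose[OF matrix_component_derivative assms[unfolded has_field_derivative_def]])
qed

lemma hadamard_derivative:
  assumes f: "(f has_derivative f') (at x)" and g: "(g has_derivative g') (at x)"
  shows "((\<lambda>x. hadamard (f x) (g x)) has_derivative (\<lambda>v. hadamard (f x) (g' v) + hadamard (f' v) (g x))) (at x)"
proof (rule has_derivative_matrix)
  fix i j
  show "((\<lambda>x. hadamard (f x) (g x) $ i $ j) has_derivative (\<lambda>v. (hadamard (f x) (g' v) + hadamard (f' v) (g x)) $ i $ j)) (at x)"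
    unfolding vector_add_component hadamard_nth
    by (rule has_derivative_mult[OF has_derivative_compose[OF f matrix_component_derivative] has_derivative_compose[OF g matrix_component_derivative]])
qed

lemma continuous_entrywise:
  assumes "\<And>i j. continuous_on UNIV (u i j)"
  shows "continuous_on UNIV (entrywise u)"
  unfolding entrywise_def[abs_def]
  by (intro continuous_on_vec_lambda continuous_on_compose2[OF assms] continuous_intros) auto

lemma continuous_hadamard:
  assumes "continuous_on UNIV f" "continuous_on UNIV g"
  shows "continuous_on UNIV (\<lambda>x. hadamard (f x) (g x))"
  unfolding hadamard_def by (intro continuous_intros assms)

text \<open>Continuity for each fixed vector becomes continuity in both arguments, because the
  vector is a combination of finitely many basis vectors with continuous coefficients.\<close>

lemma continuous_linear_apply:
  fixes L :: "'a::topological_space \<Rightarrow> 'b::euclidean_space \<Rightarrow> 'c::real_normed_vector"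
  assumes c: "\<And>v. continuous_on UNIV (\<lambda>x. L x v)" and l: "\<And>x. linear (L x)"
    and f: "continuous_on UNIV f" and g: "continuous_on UNIV g"
  shows "continuous_on UNIV (\<lambda>x. L (f x) (g x))"
proof -
  have "L (f x) (g x) = (\<Sum>b\<in>Basis. (g x \<bullet> b) *\<^sub>R L (f x) b)" for x
  proof -
    have "L (f x) (g x) = L (f x) (\<Sum>b\<in>Basis. (g x \<bullet> b) *\<^sub>R b)" by (simp only: euclidean_representation)
    also have "\<dots> = (\<Sum>b\<in>Basis. (g x \<bullet> b) *\<^sub>R L (f x) b)" using l[of "f x"] by (simp only: linear_sum linear_cmul)
    finally show ?thesis .
  qed
  moreover have "continuous_on UNIV (\<lambda>x. \<Sum>b\<in>Basis. (g x \<bullet> b) *\<^sub>R L (f x) b)"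
    by (intro continuous_intros g continuous_on_compose2[OF c f]) auto
  ultimately show ?thesis by (simp only:)
qed

lemma Basis_matrix_cases:
  assumes "b \<in> (Basis :: (real^'N^'n) set)"
  obtains i j where "b = axis i (axis j 1)"
proof -
  have "b \<in> range (\<lambda>(i, j). axis i (axis j 1) :: real^'N^'n)"
    using assms by (simp only: bij_betw_imp_surj_on[OF bij_betw_Basis_matrix])
  then show ?thesis using that by auto
qed

lemma powr_three_halves_power4:
  assumes "0 < (x::real)"
  shows "(x powr (3/2)) ^ 4 = x ^ 6"
proof -
  have "(x powr (3/2)) ^ 4 = (x powr (3/2)) powr (real 4)" using assms by (intro powr_realpow[symmetric]) simp
  also have "\<dots> = x powr (3/2 * real 4)" by (rule powr_powr)
  also have "\<dots> = x powr (real 6)" by (rule arg_cong[of _ _ "\<lambda>y. x powr y"]) simp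
  also have "\<dots> = x ^ 6" by (rule powr_realpow[OF assms])
  finally show ?thesis .
qed

context entire_coef
begin

lemma linear_trace_hess: "linear (trace_hess X)"
  using trace_grad_derivative has_derivative_linear by blast

text \<open>By the chain rule the Hessian is multiplied by \<open>u'\<close> on both sides, which
  costs \<open>c1^2\<close>, and gains a diagonal form with entries \<open>u''\<close> times the
  gradient. That second part fills the slot \<open>D\<close> of \<open>C2_function\<close>.\<close>

lemma C2_entrywise:
  fixes u u' u'' :: "'n::finite \<Rightarrow> 'N::finite \<Rightarrow> real \<Rightarrow> real"
  assumes du: "\<And>i j y. (u i j has_real_derivative u' i j y) (at y)" and du': "\<And>i j y. (u' i j has_real_derivative u'' i j y) (at y)"
    and c'': "\<And>i j. continuous_on UNIV (u'' i j)" and b': "\<And>i j y. \<bar>u' i j y\<bar> \<le> c1"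
  shows "C2_function (\<lambda>x. trace_fun (entrywise u x)) (\<lambda>x. hadamard (entrywise u' x) (trace_grad (entrywise u x)))
    (\<lambda>x v. hadamard (entrywise u' x) (trace_hess (entrywise u x) (hadamard (entrywise u' x) v)) +
       hadamard (hadamard (entrywise u'' x) v) (trace_grad (entrywise u x)))
    (\<lambda>b x. \<bar>hadamard (entrywise u'' x) (trace_grad (entrywise u x)) \<bullet> b\<bar>)
    (\<lambda>x. c1\<^sup>2 * hess_bound (entrywise u x))"
proof
  note dE = entrywise_derivative[of u u', OF du] and dE' = entrywise_derivative[of u' u'', OF du']
  have cE: "continuous_on UNIV (entrywise u)" "continuous_on UNIV (entrywise u')"
    by (intro continuous_at_imp_continuous_on ballI has_derivative_continuous[OF dE] has_derivative_continuous[OF dE'])+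
  have cE'': "continuous_on UNIV (entrywise u'')" by (rule continuous_entrywise[OF c''])
  have cG: "continuous_on UNIV (\<lambda>x. trace_grad (entrywise u x))"
    by (rule continuous_on_compose2[OF continuous_trace_grad cE(1)]) auto
  fix x v w :: "real^'N^'n"
  show "((\<lambda>x. trace_fun (entrywise u x)) has_derivative (\<lambda>v. hadamard (entrywise u' x) (trace_grad (entrywise u x)) \<bullet> v)) (at x)"
    using has_derivative_compose[OF dE trace_fun_derivative] by (simp only: inner_hadamard)
  show "((\<lambda>x. hadamard (entrywise u' x) (trace_grad (entrywise u x))) has_derivative
     (\<lambda>v. hadamard (entrywise u' x) (trace_hess (entrywise u x) (hadamard (entrywise u' x) v)) +
       hadamard (hadamard (entrywise u'' x) v) (trace_grad (entrywise u x)))) (at x)"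
    by (rule hadamard_derivative[OF dE' has_derivative_compose[OF dE trace_grad_derivative]])
  show "continuous_on UNIV (\<lambda>x. hadamard (entrywise u' x) (trace_hess (entrywise u x) (hadamard (entrywise u' x) v)) +
       hadamard (hadamard (entrywise u'' x) v) (trace_grad (entrywise u x)))"
  proof -
    have cV: "continuous_on UNIV (\<lambda>x. hadamard (entrywise u' x) v)"
      by (rule continuous_hadamard[OF cE(2) continuous_on_const])
    have "continuous_on UNIV (\<lambda>x. trace_hess (entrywise u x) (hadamard (entrywise u' x) v))"
      by (rule continuous_linear_apply[OF continuous_trace_hess linear_trace_hess cE(1) cV])
    from continuous_on_add[OF continuous_hadamard[OF cE(2) this] continuous_hadamard[OF continuous_hadamard[OF cE'' continuous_on_const] cG]]
    show ?thesis .
  qed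
  show "\<bar>(hadamard (entrywise u' x) (trace_hess (entrywise u x) (hadamard (entrywise u' x) v)) +
       hadamard (hadamard (entrywise u'' x) v) (trace_grad (entrywise u x))) \<bullet> w\<bar>
     \<le> (\<Sum>b\<in>Basis. \<bar>hadamard (entrywise u'' x) (trace_grad (entrywise u x)) \<bullet> b\<bar> * \<bar>v \<bullet> b\<bar> * \<bar>w \<bullet> b\<bar>) +
       c1\<^sup>2 * hess_bound (entrywise u x) * norm v * norm w"
  proof -
    let ?d = "hadamard (entrywise u'' x) (trace_grad (entrywise u x))"
    have c1: "0 \<le> c1" using order_trans[OF abs_ge_zero b'] .
    have n: "norm (hadamard (entrywise u' x) y) \<le> c1 * norm y" for y
      by (rule norm_hadamard_le) (simp add: b')
    have "hadamard (entrywise u' x) (trace_hess (entrywise u x) (hadamard (entrywise u' x) v)) \<bullet> w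
      = trace_hess (entrywise u x) (hadamard (entrywise u' x) v) \<bullet> hadamard (entrywise u' x) w"
      by (simp only: inner_hadamard)
    also have "\<bar>\<dots>\<bar> \<le> hess_bound (entrywise u x) * norm (hadamard (entrywise u' x) v) * norm (hadamard (entrywise u' x) w)"
      by (rule hess_inner_le)
    also have "\<dots> \<le> hess_bound (entrywise u x) * (c1 * norm v) * (c1 * norm w)"
      using c1 by (intro mult_mono n mult_left_mono mult_nonneg_nonneg hess_bound_nonneg) auto
    finally have 1: "\<bar>hadamard (entrywise u' x) (trace_hess (entrywise u x) (hadamard (entrywise u' x) v)) \<bullet> w\<bar> \<le> c1\<^sup>2 * hess_bound (entrywise u x) * norm v * norm w"
      by (simp only: power2_eq_square mult_ac)
    have "hadamard (hadamard (entrywise u'' x) v) (trace_grad (entrywise u x)) \<bullet> w = (\<Sum>b\<in>Basis. (?d \<bullet> b) * (v \<bullet> b) * (w \<bullet> b))"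
      unfolding inner_matrix_sum[of _ w] sum_Basis_matrix inner_matrix_axis by (simp add: mult_ac)
    also have "\<bar>\<dots>\<bar> \<le> (\<Sum>b\<in>Basis. \<bar>?d \<bullet> b\<bar> * \<bar>v \<bullet> b\<bar> * \<bar>w \<bullet> b\<bar>)"
      by (rule order_trans[OF sum_abs]) (simp only: abs_mult order_refl)
    finally show ?thesis using 1 unfolding inner_add_left by linarith
  qed
  show "0 \<le> c1\<^sup>2 * hess_bound (entrywise u x)" by (intro mult_nonneg_nonneg hess_bound_nonneg) simp
  have mE: "entrywise u \<in> borel_measurable borel" by (rule borel_measurable_continuous_onI[OF cE(1)])
  show "(\<lambda>x. c1\<^sup>2 * hess_bound (entrywise u x)) \<in> borel_measurable borel"
    by (intro borel_measurable_times borel_measurable_const measurable_compose[OF mE] borel_measurable_weights)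
  show "(\<lambda>x. \<bar>hadamard (entrywise u'' x) (trace_grad (entrywise u x)) \<bullet> b\<bar>) \<in> borel_measurable borel" for b
    by (intro borel_measurable_continuous_onI continuous_on_rabs continuous_on_inner continuous_on_const continuous_hadamard[OF cE'' cG])
qed simp

text \<open>A linear map has zero second derivative, so \<open>D\<close> vanishes; the Hessian is
  surrounded by \<open>T\<close> and its adjoint, which costs \<open>r^2\<close>.\<close>

lemma C2_linear:
  fixes T :: "real^'N^'n \<Rightarrow> real^'N^'n"
  assumes T: "linear T" and n: "\<And>x. norm (T x) \<le> r * norm x" and r: "0 \<le> r"
  shows "C2_function (\<lambda>x. trace_fun (T x)) (\<lambda>x. adjoint T (trace_grad (T x)))
    (\<lambda>x v. adjoint T (trace_hess (T x) (T v))) (\<lambda>b x. 0) (\<lambda>x. r\<^sup>2 * hess_bound (T x))"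
proof
  have bT: "bounded_linear T" "bounded_linear (adjoint T)"
    using T adjoint_linear[OF T] by (simp_all only: linear_conv_bounded_linear)
  have dT: "(T has_derivative T) (at x)" for x by (rule bounded_linear_imp_has_derivative[OF bT(1)])
  have cT: "continuous_on UNIV T" by (rule linear_continuous_on[OF bT(1)])
  fix x v w :: "real^'N^'n"
  show "((\<lambda>x. trace_fun (T x)) has_derivative (\<lambda>v. adjoint T (trace_grad (T x)) \<bullet> v)) (at x)"
    using has_derivative_compose[OF dT trace_fun_derivative, of x]
    by (simp add: adjoint_works[OF T] inner_commute)
  show "((\<lambda>x. adjoint T (trace_grad (T x))) has_derivative (\<lambda>v. adjoint T (trace_hess (T x) (T v)))) (at x)"
    by (rule bounded_linear.has_derivative[OF bT(2) has_derivative_compose[OF dT trace_grad_derivative]])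
  show "continuous_on UNIV (\<lambda>x. adjoint T (trace_hess (T x) (T v)))"
    by (intro bounded_linear.continuous_on[OF bT(2)] continuous_on_compose2[OF continuous_trace_hess cT]) auto
  have "\<bar>adjoint T (trace_hess (T x) (T v)) \<bullet> w\<bar> = \<bar>trace_hess (T x) (T v) \<bullet> T w\<bar>"
    by (metis adjoint_works[OF T] inner_commute)
  also have "\<dots> \<le> hess_bound (T x) * norm (T v) * norm (T w)" by (rule hess_inner_le)
  also have "\<dots> \<le> hess_bound (T x) * (r * norm v) * (r * norm w)"
    using r by (intro mult_mono n mult_left_mono mult_nonneg_nonneg hess_bound_nonneg) auto
  finally show "\<bar>adjoint T (trace_hess (T x) (T v)) \<bullet> w\<bar> \<le> (\<Sum>b\<in>Basis. 0 * \<bar>v \<bullet> b\<bar> * \<bar>w \<bullet> b\<bar>) + r\<^sup>2 * hess_bound (T x) * norm v * norm w"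
    by (simp add: power2_eq_square mult_ac)
  show "0 \<le> r\<^sup>2 * hess_bound (T x)" by (intro mult_nonneg_nonneg hess_bound_nonneg) simp
  have mT: "T \<in> borel_measurable borel" by (rule borel_measurable_continuous_onI[OF cT])
  show "(\<lambda>x. r\<^sup>2 * hess_bound (T x)) \<in> borel_measurable borel"
    by (intro borel_measurable_times borel_measurable_const measurable_compose[OF mT] borel_measurable_weights)
qed auto

lemma law_moments:
  fixes X :: "'a \<Rightarrow> real^'N^'n" and \<Psi> :: "'c::euclidean_space \<Rightarrow> real^'N^'n"
  assumes "prob_space M" and X: "X \<in> borel_measurable M" and \<Psi>: "\<Psi> \<in> borel_measurable borel"
    and law: "distr M borel X = distr std_gauss borel \<Psi>"
    and W: "W = (\<lambda>\<omega>. trace_fun (X \<omega>))" and W4: "integrable M (\<lambda>\<omega>. W \<omega> ^ 4)"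
  shows "prob_space.expectation M W = (\<integral>x. trace_fun (\<Psi> x) \<partial>std_gauss)"
    and "integrable std_gauss (\<lambda>x. trace_fun (\<Psi> x) ^ 4)"
    and "prob_space.variance M W = (\<integral>x. trace_fun (\<Psi> x) * trace_fun (\<Psi> x) \<partial>std_gauss) - (prob_space.expectation M W)\<^sup>2"
proof -
  interpret prob_space M by fact
  note tr = transfer_law[OF X \<Psi> _ law]
  show "expectation W = (\<integral>x. trace_fun (\<Psi> x) \<partial>std_gauss)"
    unfolding W by (rule tr(1)[symmetric]) measurable
  show "integrable std_gauss (\<lambda>x. trace_fun (\<Psi> x) ^ 4)"
    using tr(2)[of "\<lambda>y. trace_fun y ^ 4"] W4 unfolding W by simp
  have [measurable]: "W \<in> borel_measurable M" unfolding W using X by measurable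
  have i: "integrable M (\<lambda>\<omega>. 1 + W \<omega> ^ 4)" using W4 by simp
  have iW: "integrable M W" "integrable M (\<lambda>\<omega>. (W \<omega>)\<^sup>2)"
    by (rule Bochner_Integration.integrable_bound[OF i]; simp add: abs_le_1_power4 square_le_1_power4)+
  have "variance W = expectation (\<lambda>\<omega>. (W \<omega>)\<^sup>2) - (expectation W)\<^sup>2" by (rule variance_eq[OF iW])
  also have "expectation (\<lambda>\<omega>. (W \<omega>)\<^sup>2) = (\<integral>x. trace_fun (\<Psi> x) * trace_fun (\<Psi> x) \<partial>std_gauss)"
    using tr(1)[of "\<lambda>y. trace_fun y * trace_fun y"] unfolding W power2_eq_square by simp
  finally show "variance W = (\<integral>x. trace_fun (\<Psi> x) * trace_fun (\<Psi> x) \<partial>std_gauss) - (expectation W)\<^sup>2" .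
qed

text \<open>Positive \<open>a\<close> and \<open>b\<close> make the optimal weights, which are
  quotients, well defined; infinite moments and zero variance are settled separately.\<close>

lemma d_TV_independent:
  fixes X :: "'a \<Rightarrow> real^'N^'n"
  assumes M: "prob_space M" "prob_space M'"
    and ind: "prob_space.indep_vars M (\<lambda>_. borel) (\<lambda>(i, j) \<omega>. X \<omega> $ i $ j) UNIV"
    and law: "\<And>i j. distr M borel (\<lambda>\<omega>. X \<omega> $ i $ j) \<in> law_class c1 c2" and c: "0 < c1" "0 < c2"
    and W: "W = (\<lambda>\<omega>. trace_fun (X \<omega>))" and W4: "integrable M (\<lambda>\<omega>. W \<omega> ^ 4)"
    and Z: "normal_rv M' Z" "prob_space.expectation M' Z = prob_space.expectation M W"
      "prob_space.variance M' Z = prob_space.variance M W"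
    and var: "0 < prob_space.variance M W"
    and a: "integrable M (\<lambda>\<omega>. weight_a (X \<omega>))" "(\<integral>\<omega>. weight_a (X \<omega>) \<partial>M) = a ^ 4" "0 < a"
    and b: "integrable M (\<lambda>\<omega>. weight_b (X \<omega>))" "(\<integral>\<omega>. weight_b (X \<omega>) \<partial>M) = b ^ 4" "0 < b"
  shows "d_TV M W M' Z \<le> 16 / prob_space.variance M W *
    (c1 * c2 * a\<^sup>2 * sqrt (real CARD('n)) / real CARD('N) + c1 ^ 3 * a * b * real CARD('n) / real CARD('N) powr (3/2))"
proof -
  interpret prob_space M by fact
  define n N where "n = real CARD('n)" and "N = real CARD('N)"
  have nN: "0 < n" "0 < N" by (auto simp: n_def N_def)
  have "\<exists>u u' u''. distr M borel (\<lambda>\<omega>. X \<omega> $ i $ j) = distr std_normal_distribution borel u \<and>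
      (\<forall>x. (u has_real_derivative u' x) (at x)) \<and> (\<forall>x. (u' has_real_derivative u'' x) (at x)) \<and>
      continuous_on UNIV u'' \<and> (\<forall>x. \<bar>u' x\<bar> \<le> c1) \<and> (\<forall>x. \<bar>u'' x\<bar> \<le> c2)" for i j
    using law[of i j] unfolding law_class_def by blast
  then obtain u u' u'' where u: "\<And>i j. distr M borel (\<lambda>\<omega>. X \<omega> $ i $ j) = distr std_normal_distribution borel (u i j)"
    "\<And>i j x. (u i j has_real_derivative u' i j x) (at x)" "\<And>i j x. (u' i j has_real_derivative u'' i j x) (at x)"
    "\<And>i j. continuous_on UNIV (u'' i j)" "\<And>i j x. \<bar>u' i j x\<bar> \<le> c1" "\<And>i j x. \<bar>u'' i j x\<bar> \<le> c2"
    by metis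
  have mu: "u i j \<in> borel_measurable borel" for i j
    using u(2) by (intro borel_measurable_continuous_onI continuous_at_imp_continuous_on ballI DERIV_isCont)
  note X = law_independent_matrix(1)[OF M(1) ind u(1) mu]
  have lw: "distr M borel X = distr std_gauss borel (entrywise u)"
    using law_independent_matrix(2)[OF M(1) ind u(1) mu] by (simp only: entrywise_def[abs_def])
  have mE: "entrywise u \<in> borel_measurable borel"
    by (intro borel_measurable_continuous_onI continuous_entrywise continuous_at_imp_continuous_on ballI DERIV_isCont[OF u(2)])
  note tr = transfer_law[OF X mE _ lw]
  interpret C: C2_function "\<lambda>x. trace_fun (entrywise u x)" "\<lambda>x. hadamard (entrywise u' x) (trace_grad (entrywise u x))"
    "\<lambda>x v. hadamard (entrywise u' x) (trace_hess (entrywise u x) (hadamard (entrywise u' x) v)) +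
       hadamard (hadamard (entrywise u'' x) v) (trace_grad (entrywise u x))"
    "\<lambda>b x. \<bar>hadamard (entrywise u'' x) (trace_grad (entrywise u x)) \<bullet> b\<bar>"
    "\<lambda>x. c1\<^sup>2 * hess_bound (entrywise u x)"
    by (rule C2_entrywise[OF u(2-5)])
  \<comment> \<open>\<open>A1\<close> and \<open>A2\<close> are the fourth roots of
    \<open>d4 * e4 * a4^2\<close> and \<open>k4 * p4 * a4 * b4\<close> for the constants inserted
    below. Their 4 is the fourth root of \<open>16 * 16\<close>; the 4 of
    \<open>stein_bound_quartic\<close> then makes 16.\<close>
  define A1 where "A1 = 4 * (c1 * c2 * a\<^sup>2 * sqrt n / N)"
  define A2 where "A2 = 4 * (c1 ^ 3 * a * b * n / N powr (3/2))"
  define q where "q = 16 * n / N\<^sup>2"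
  define q' where "q' = 16 * n\<^sup>2 / N\<^sup>2"
  have q: "0 < q" "0 < q'" using nN by (auto simp: q_def q'_def)
  have g4: "(\<Sum>b\<in>Basis. (hadamard y (trace_grad Y) \<bullet> b) ^ 4) \<le> d ^ 4 * q * weight_a Y"
    if y: "\<And>i j. \<bar>y $ i $ j\<bar> \<le> d" for y Y :: "real^'N^'n" and d
  proof -
    have "(\<Sum>b\<in>Basis. (hadamard y (trace_grad Y) \<bullet> b) ^ 4) \<le> (\<Sum>b\<in>Basis. d ^ 4 * (trace_grad Y \<bullet> b) ^ 4)"
    proof (rule sum_mono)
      fix b :: "real^'N^'n" assume "b \<in> Basis"
      then obtain i j where b: "b = axis i (axis j 1)" by (rule Basis_matrix_cases)
      have "(y $ i $ j * trace_grad Y $ i $ j) ^ 4 = \<bar>y $ i $ j\<bar> ^ 4 * (trace_grad Y $ i $ j) ^ 4" by (simp add: power_mult_distrib)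
      also have "\<dots> \<le> d ^ 4 * (trace_grad Y $ i $ j) ^ 4" by (intro mult_right_mono power_mono y) auto
      finally show "(hadamard y (trace_grad Y) \<bullet> b) ^ 4 \<le> d ^ 4 * (trace_grad Y \<bullet> b) ^ 4"
        by (simp add: b inner_matrix_axis)
    qed
    also have "\<dots> = d ^ 4 * (\<Sum>b\<in>Basis. (trace_grad Y \<bullet> b) ^ 4)" by (simp only: sum_distrib_left)
    also have "\<dots> \<le> d ^ 4 * (q * weight_a Y)"
      unfolding q_def n_def N_def weight_a_def by (intro mult_left_mono trace_grad_sum4_le) auto
    finally show ?thesis by (simp only: mult.assoc)
  qed
  note mom = law_moments[OF M(1) X mE lw W W4]
  note m = mom(1) and i4 = mom(2)
  have sg: "(sqrt (variance W))\<^sup>2 = (\<integral>x. trace_fun (entrywise u x) * trace_fun (entrywise u x) \<partial>std_gauss) - (expectation W)\<^sup>2"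
    using mom(3) var by simp
  have Np: "(N powr (3/2)) ^ 4 = N ^ 6" by (rule powr_three_halves_power4[OF nN(2)])
  have "d_TV M W M' Z \<le> 4 * (A1 + A2) / (sqrt (variance W))\<^sup>2"
  proof (rule d_TV_le[OF M X mE lw W Z])
    fix \<phi> :: "real \<Rightarrow> real"
    assume \<phi>: "continuous_on UNIV \<phi>" "\<And>x. 0 \<le> \<phi> x" "\<And>x. \<phi> x \<le> 1"
    show "(\<integral>x. \<phi> (trace_fun (entrywise u x)) \<partial>std_gauss) - (\<integral>y. \<phi> (expectation W + sqrt (variance W) * y) \<partial>std_normal_distribution)
      \<le> 4 * (A1 + A2) / (sqrt (variance W))\<^sup>2"
    proof (rule C.stein_bound_quartic[OF i4, where Ga="\<lambda>x. weight_a (entrywise u x)" and Gb="\<lambda>x. weight_b (entrywise u x)"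
          and ?a4.0="a^4" and ?b4.0="b^4" and ?d4.0="c2 ^ 4 * q" and ?e4.0="c1 ^ 4 * q" and ?p4.0="c1 ^ 4 * q'" and ?k4.0="c1 ^ 8 * (q' / N\<^sup>2)"])
      show "integrable std_gauss (\<lambda>x. weight_a (entrywise u x))" "integrable std_gauss (\<lambda>x. weight_b (entrywise u x))"
        using tr(2)[of weight_a] tr(2)[of weight_b] a(1) b(1) by simp_all
      show "a ^ 4 = (\<integral>x. weight_a (entrywise u x) \<partial>std_gauss)" "b ^ 4 = (\<integral>x. weight_b (entrywise u x) \<partial>std_gauss)"
        using tr(1)[of weight_a] tr(1)[of weight_b] a(2) b(2) by simp_all
      fix x :: "real^'N^'n"
      show "(\<Sum>b\<in>Basis. \<bar>hadamard (entrywise u'' x) (trace_grad (entrywise u x)) \<bullet> b\<bar> ^ 4) \<le> c2 ^ 4 * q * weight_a (entrywise u x)"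
        using g4[of "entrywise u'' x" c2 "entrywise u x"] u(6) by simp
      show "(\<Sum>b\<in>Basis. (hadamard (entrywise u' x) (trace_grad (entrywise u x)) \<bullet> b) ^ 4) \<le> c1 ^ 4 * q * weight_a (entrywise u x)"
        using g4[of "entrywise u' x" c1 "entrywise u x"] u(5) by simp
      have "norm (hadamard (entrywise u' x) (trace_grad (entrywise u x))) ^ 4 \<le> (c1 * norm (trace_grad (entrywise u x))) ^ 4"
        by (intro power_mono norm_hadamard_le) (simp_all add: u(5))
      also have "\<dots> \<le> c1 ^ 4 * (q' * weight_a (entrywise u x))"
        unfolding power_mult_distrib q'_def n_def N_def weight_a_def by (intro mult_left_mono trace_grad_norm4_le) auto
      finally show "norm (hadamard (entrywise u' x) (trace_grad (entrywise u x))) ^ 4 \<le> c1 ^ 4 * q' * weight_a (entrywise u x)"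
        by (simp only: mult.assoc)
      have "(c1\<^sup>2 * hess_bound (entrywise u x)) ^ 4 = c1 ^ 8 * hess_bound (entrywise u x) ^ 4"
        unfolding power_mult_distrib by (simp only: power_mult[symmetric]) simp
      also have "\<dots> \<le> c1 ^ 8 * (16 * n\<^sup>2 / N ^ 4 * weight_b (entrywise u x))"
        unfolding n_def N_def by (intro mult_left_mono hess_bound_power4_le) auto
      also have "16 * n\<^sup>2 / N ^ 4 = q' / N\<^sup>2" by (simp add: q'_def power4_eq_xxxx power2_eq_square)
      finally show "(c1\<^sup>2 * hess_bound (entrywise u x)) ^ 4 \<le> c1 ^ 8 * (q' / N\<^sup>2) * weight_b (entrywise u x)"
        by (simp only: mult.assoc)
    next
      have "A1 ^ 4 = 256 * (c1 ^ 4 * c2 ^ 4 * (a\<^sup>2) ^ 4 * ((sqrt n)\<^sup>2)\<^sup>2 / N ^ 4)"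
      proof -
        have "(4 * (x * y * z * w / r)) ^ 4 = 256 * (x ^ 4 * y ^ 4 * z ^ 4 * (w\<^sup>2)\<^sup>2 / r ^ 4)" for x y z w r :: real
          by (simp add: power2_eq_square power4_eq_xxxx mult_ac)
        then show ?thesis unfolding A1_def .
      qed
      also have "(sqrt n)\<^sup>2 = n" using nN by simp
      also have "256 * (c1 ^ 4 * c2 ^ 4 * (a\<^sup>2) ^ 4 * n\<^sup>2 / N ^ 4) = c2 ^ 4 * q * (c1 ^ 4 * q) * (a ^ 4)\<^sup>2"
        unfolding q_def by (simp add: power2_eq_square power4_eq_xxxx mult_ac)
      finally show "c2 ^ 4 * q * (c1 ^ 4 * q) * (a ^ 4)\<^sup>2 \<le> A1 ^ 4" by simp
      have "A2 ^ 4 = 256 * (c1 ^ 12 * a ^ 4 * b ^ 4 * n ^ 4 / N ^ 6)"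
      proof -
        have "(4 * (x * y * z * w / r)) ^ 4 = 256 * (x ^ 4 * y ^ 4 * z ^ 4 * w ^ 4 / r ^ 4)" for x y z w r :: real
          by (simp add: power_mult_distrib power_divide)
        moreover have "(c1 ^ 3) ^ 4 = c1 ^ 12" by (simp add: power_mult[symmetric])
        ultimately show ?thesis unfolding A2_def by (simp only: Np)
      qed
      also have "c1 ^ 12 * a ^ 4 * b ^ 4 * n ^ 4 / N ^ 6 = (c1 ^ 8 * c1 ^ 4) * a ^ 4 * b ^ 4 * (n\<^sup>2 * n\<^sup>2) / (N\<^sup>2 * (N\<^sup>2 * N\<^sup>2))"
        by (simp add: power_add[symmetric])
      also have "256 * \<dots> = c1 ^ 8 * (q' / N\<^sup>2) * (c1 ^ 4 * q') * a ^ 4 * b ^ 4"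
      proof -
        have "256 * ((x * y) * p * r * (z * z) / (w * (w * w))) = x * (16 * z / w / w) * (y * (16 * z / w)) * p * r" for x y p r z w :: real
          by (simp add: mult_ac)
        then show ?thesis unfolding q'_def .
      qed
      finally show "c1 ^ 8 * (q' / N\<^sup>2) * (c1 ^ 4 * q') * a ^ 4 * b ^ 4 \<le> A2 ^ 4" by simp
      show "0 < A1" "0 < A2" using c a(3) b(3) nN by (auto simp: A1_def A2_def)
      show "0 < c2 ^ 4 * q" "0 < c1 ^ 4 * q" "0 < c1 ^ 4 * q'" "0 < c1 ^ 8 * (q' / N\<^sup>2)" "0 < a ^ 4" "0 < b ^ 4"
        using c q nN a(3) b(3) by auto
      show "0 < sqrt (variance W)" using var by simp
    qed (rule m sg \<phi>)+
  qed
  also have "(sqrt (variance W))\<^sup>2 = variance W" using var by simp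
  also have "4 * (A1 + A2) / variance W = 16 / variance W * (c1 * c2 * a\<^sup>2 * sqrt n / N + c1 ^ 3 * a * b * n / N powr (3/2))"
    unfolding A1_def A2_def by simp
  finally show ?thesis unfolding n_def N_def .
qed

text \<open>Norm zero would make \<open>T\<close> zero, hence the matrix almost surely zero and
  \<open>W\<close> constant, against the positive variance. Positivity permits division by
  \<open>r\<close> and multiplication by infinity later.\<close>

lemma onorm_covariance_pos:
  fixes X :: "'a \<Rightarrow> real^'N^'n" and \<Sigma> :: "real^('n::finite \<times> 'N::finite)^('n \<times> 'N)"
  assumes M: "prob_space M"
    and G: "jointly_gaussian M (\<lambda>(i, j) \<omega>. X \<omega> $ i $ j)"
    and mean: "\<And>i j. prob_space.expectation M (\<lambda>\<omega>. X \<omega> $ i $ j) = 0"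
    and cov: "\<And>i j k l. \<Sigma> $ (i, j) $ (k, l) = covariance M (\<lambda>\<omega>. X \<omega> $ i $ j) (\<lambda>\<omega>. X \<omega> $ k $ l)"
    and W: "W = (\<lambda>\<omega>. trace_fun (X \<omega>))" and W4: "integrable M (\<lambda>\<omega>. W \<omega> ^ 4)"
    and var: "0 < prob_space.variance M W"
  shows "0 < onorm ((*v) \<Sigma>)"
proof -
  interpret prob_space M by fact
  note X = law_gaussian_matrix(1)[OF M G mean cov]
  obtain T :: "real^'N^'n \<Rightarrow> real^'N^'n" where T: "linear T" "distr M borel X = distr std_gauss borel T"
    "\<And>x. norm (T x) \<le> sqrt (onorm ((*v) \<Sigma>)) * norm x"
    using law_gaussian_matrix(2)[OF M G mean cov] by blast
  have mT: "T \<in> borel_measurable borel"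
    using T(1) by (intro borel_measurable_continuous_onI linear_continuous_on linear_conv_bounded_linear[THEN iffD1])
  note mom = law_moments[OF M X mT T(2) W W4]
  have nn: "0 \<le> onorm ((*v) \<Sigma>)" by (rule onorm_pos_le[OF matrix_vector_mul_bounded_linear])
  have "onorm ((*v) \<Sigma>) \<noteq> 0"
  proof
    assume "onorm ((*v) \<Sigma>) = 0"
    then have "T x = 0" for x using T(3)[of x] by simp
    then have "variance W = 0" using mom(1,3) by (simp add: power2_eq_square)
    then show False using var by simp
  qed
  with nn show ?thesis by simp
qed

text \<open>The diagonal part is absent, whereas \<open>stein_bound_quartic\<close> expects a
  positive \<open>A1\<close>. Any positive \<delta> can take this role, and then \<delta> tends to
  0.\<close>

lemma d_TV_gaussian:
  fixes X :: "'a \<Rightarrow> real^'N^'n" and \<Sigma> :: "real^('n::finite \<times> 'N::finite)^('n \<times> 'N)"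
  assumes M: "prob_space M" "prob_space M'"
    and G: "jointly_gaussian M (\<lambda>(i, j) \<omega>. X \<omega> $ i $ j)"
    and mean: "\<And>i j. prob_space.expectation M (\<lambda>\<omega>. X \<omega> $ i $ j) = 0"
    and cov: "\<And>i j k l. \<Sigma> $ (i, j) $ (k, l) = covariance M (\<lambda>\<omega>. X \<omega> $ i $ j) (\<lambda>\<omega>. X \<omega> $ k $ l)"
    and W: "W = (\<lambda>\<omega>. trace_fun (X \<omega>))" and W4: "integrable M (\<lambda>\<omega>. W \<omega> ^ 4)"
    and Z: "normal_rv M' Z" "prob_space.expectation M' Z = prob_space.expectation M W"
      "prob_space.variance M' Z = prob_space.variance M W"
    and var: "0 < prob_space.variance M W"
    and a: "integrable M (\<lambda>\<omega>. weight_a (X \<omega>))" "(\<integral>\<omega>. weight_a (X \<omega>) \<partial>M) = a ^ 4" "0 < a"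
    and b: "integrable M (\<lambda>\<omega>. weight_b (X \<omega>))" "(\<integral>\<omega>. weight_b (X \<omega>) \<partial>M) = b ^ 4" "0 < b"
  shows "d_TV M W M' Z \<le> 16 / prob_space.variance M W *
      (onorm ((*v) \<Sigma>) powr (3/2) * a * b * real CARD('n) / real CARD('N) powr (3/2))"
proof -
  interpret prob_space M by fact
  define n N where "n = real CARD('n)" and "N = real CARD('N)"
  have nN: "0 < n" "0 < N" by (auto simp: n_def N_def)
  note X = law_gaussian_matrix(1)[OF M(1) G mean cov]
  define r where "r = sqrt (onorm ((*v) \<Sigma>))"
  obtain T :: "real^'N^'n \<Rightarrow> real^'N^'n" where T: "linear T" "distr M borel X = distr std_gauss borel T"
    "\<And>x. norm (T x) \<le> r * norm x"
    using law_gaussian_matrix(2)[OF M(1) G mean cov] unfolding r_def by blast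
  have mT: "T \<in> borel_measurable borel"
    using T(1) by (intro borel_measurable_continuous_onI linear_continuous_on linear_conv_bounded_linear[THEN iffD1])
  note tr = transfer_law[OF X mT _ T(2)]
  note mom = law_moments[OF M(1) X mT T(2) W W4]
  have pos: "0 < onorm ((*v) \<Sigma>)" by (rule onorm_covariance_pos[OF M(1) G mean cov W W4 var])
  then have r: "0 < r" and r0: "0 \<le> r" by (simp_all add: r_def)
  interpret C: C2_function "\<lambda>x. trace_fun (T x)" "\<lambda>x. adjoint T (trace_grad (T x))"
    "\<lambda>x v. adjoint T (trace_hess (T x) (T v))" "\<lambda>b x. 0" "\<lambda>x. r\<^sup>2 * hess_bound (T x)"
    by (rule C2_linear[OF T(1,3) r0])
  define A2 where "A2 = 4 * (r ^ 3 * a * b * n / N powr (3/2))"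
  define q where "q = 16 * n\<^sup>2 / N\<^sup>2"
  have q: "0 < q" using nN by (auto simp: q_def)
  have A2: "0 < A2" using r a(3) b(3) nN by (auto simp: A2_def)
  have A24: "r ^ 8 * (q / N\<^sup>2) * (r ^ 4 * q) * a ^ 4 * b ^ 4 \<le> A2 ^ 4"
  proof -
    have "A2 ^ 4 = 256 * (r ^ 12 * a ^ 4 * b ^ 4 * n ^ 4 / N ^ 6)"
    proof -
      have "(4 * (x * y * z * w / u)) ^ 4 = 256 * (x ^ 4 * y ^ 4 * z ^ 4 * w ^ 4 / u ^ 4)" for x y z w u :: real
        by (simp add: power_mult_distrib power_divide)
      moreover have "(r ^ 3) ^ 4 = r ^ 12" by (simp add: power_mult[symmetric])
      ultimately show ?thesis unfolding A2_def by (simp only: powr_three_halves_power4[OF nN(2)])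
    qed
    also have "r ^ 12 * a ^ 4 * b ^ 4 * n ^ 4 / N ^ 6 = (r ^ 8 * r ^ 4) * a ^ 4 * b ^ 4 * (n\<^sup>2 * n\<^sup>2) / (N\<^sup>2 * (N\<^sup>2 * N\<^sup>2))"
      by (simp add: power_add[symmetric])
    also have "256 * \<dots> = r ^ 8 * (q / N\<^sup>2) * (r ^ 4 * q) * a ^ 4 * b ^ 4"
    proof -
      have "256 * ((x * y) * p * u * (z * z) / (w * (w * w))) = x * (16 * z / w / w) * (y * (16 * z / w)) * p * u" for x y p u z w :: real
        by (simp add: mult_ac)
      then show ?thesis unfolding q_def .
    qed
    finally show ?thesis by simp
  qed
  have sg: "(sqrt (variance W))\<^sup>2 = (\<integral>x. trace_fun (T x) * trace_fun (T x) \<partial>std_gauss) - (expectation W)\<^sup>2"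
    using mom(3) var by simp
  have p4: "norm (adjoint T (trace_grad (T x))) ^ 4 \<le> r ^ 4 * q * weight_a (T x)" for x
  proof -
    have "norm (adjoint T (trace_grad (T x))) ^ 4 \<le> (r * norm (trace_grad (T x))) ^ 4"
      by (intro power_mono norm_adjoint_le[OF T(1,3) r0] norm_ge_zero)
    also have "\<dots> \<le> r ^ 4 * (q * weight_a (T x))"
      unfolding power_mult_distrib q_def n_def N_def weight_a_def by (intro mult_left_mono trace_grad_norm4_le) auto
    finally show ?thesis by (simp only: mult.assoc)
  qed
  have s4: "(\<Sum>b\<in>Basis. (y \<bullet> b) ^ 4) \<le> norm y ^ 4" for y :: "real^'N^'n"
  proof -
    have "(\<Sum>b\<in>Basis. (y \<bullet> b) ^ 4) \<le> (\<Sum>b\<in>Basis. (norm y)\<^sup>2 * (y \<bullet> b)\<^sup>2)"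
    proof (rule sum_mono)
      fix b :: "real^'N^'n" assume b: "b \<in> Basis"
      have "(y \<bullet> b) ^ 4 = \<bar>y \<bullet> b\<bar>\<^sup>2 * (y \<bullet> b)\<^sup>2" by (simp add: power4_eq_xxxx power2_eq_square)
      also have "\<dots> \<le> (norm y)\<^sup>2 * (y \<bullet> b)\<^sup>2" by (intro mult_right_mono power_mono Basis_le_norm b) auto
      finally show "(y \<bullet> b) ^ 4 \<le> (norm y)\<^sup>2 * (y \<bullet> b)\<^sup>2" .
    qed
    also have "\<dots> = (norm y)\<^sup>2 * (norm y)\<^sup>2"
      unfolding sum_distrib_left[symmetric] power2_norm_eq_inner euclidean_inner[of y y] by (simp only: power2_eq_square)
    also have "\<dots> = norm y ^ 4" by (simp add: power_add[symmetric])
    finally show ?thesis .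
  qed
  have bound: "d_TV M W M' Z \<le> 4 * (\<delta> + A2) / variance W" if \<delta>: "0 < \<delta>" for \<delta>
  proof -
    have sq: "(sqrt (variance W))\<^sup>2 = variance W" using var by simp
    have "d_TV M W M' Z \<le> 4 * (\<delta> + A2) / (sqrt (variance W))\<^sup>2"
    proof (rule d_TV_le[OF M X mT T(2) W Z])
      fix \<phi> :: "real \<Rightarrow> real"
      assume \<phi>: "continuous_on UNIV \<phi>" "\<And>x. 0 \<le> \<phi> x" "\<And>x. \<phi> x \<le> 1"
      \<comment> \<open>Chosen so that \<open>?d * (r ^ 4 * q) * (a ^ 4)^2\<close> equals
        \<open>\<delta> ^ 4\<close>.\<close>
      let ?d = "\<delta> ^ 4 / ((r ^ 4 * q) * (a ^ 4)\<^sup>2)"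
      show "(\<integral>x. \<phi> (trace_fun (T x)) \<partial>std_gauss) - (\<integral>y. \<phi> (expectation W + sqrt (variance W) * y) \<partial>std_normal_distribution)
        \<le> 4 * (\<delta> + A2) / (sqrt (variance W))\<^sup>2"
      proof (rule C.stein_bound_quartic[OF mom(2), where Ga="\<lambda>x. weight_a (T x)" and Gb="\<lambda>x. weight_b (T x)"
            and ?a4.0="a^4" and ?b4.0="b^4" and ?d4.0="?d" and ?e4.0="r ^ 4 * q" and ?p4.0="r ^ 4 * q" and ?k4.0="r ^ 8 * (q / N\<^sup>2)"])
        show "integrable std_gauss (\<lambda>x. weight_a (T x))" "integrable std_gauss (\<lambda>x. weight_b (T x))"
          using tr(2)[of weight_a] tr(2)[of weight_b] a(1) b(1) by simp_all
        show "a ^ 4 = (\<integral>x. weight_a (T x) \<partial>std_gauss)" "b ^ 4 = (\<integral>x. weight_b (T x) \<partial>std_gauss)"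
          using tr(1)[of weight_a] tr(1)[of weight_b] a(2) b(2) by simp_all
        show d0: "0 < ?d" "0 < r ^ 4 * q" "0 < r ^ 4 * q" "0 < r ^ 8 * (q / N\<^sup>2)" "0 < a ^ 4" "0 < b ^ 4"
          using \<delta> r q nN a(3) b(3) by auto
        fix x :: "real^'N^'n"
        show "(\<Sum>b\<in>Basis. 0 ^ 4) \<le> ?d * weight_a (T x)"
          using mult_nonneg_nonneg[OF less_imp_le[OF d0(1)] weights_nonneg(1)] by simp
        show "(\<Sum>b\<in>Basis. (adjoint T (trace_grad (T x)) \<bullet> b) ^ 4) \<le> r ^ 4 * q * weight_a (T x)"
          by (rule order_trans[OF s4 p4])
        show "norm (adjoint T (trace_grad (T x))) ^ 4 \<le> r ^ 4 * q * weight_a (T x)" by (rule p4)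
        have "(r\<^sup>2 * hess_bound (T x)) ^ 4 = r ^ 8 * hess_bound (T x) ^ 4"
          unfolding power_mult_distrib by (simp only: power_mult[symmetric]) simp
        also have "\<dots> \<le> r ^ 8 * (16 * n\<^sup>2 / N ^ 4 * weight_b (T x))"
          unfolding n_def N_def by (intro mult_left_mono hess_bound_power4_le) auto
        also have "16 * n\<^sup>2 / N ^ 4 = q / N\<^sup>2" by (simp add: q_def power4_eq_xxxx power2_eq_square)
        finally show "(r\<^sup>2 * hess_bound (T x)) ^ 4 \<le> r ^ 8 * (q / N\<^sup>2) * weight_b (T x)"
          by (simp only: mult.assoc)
        show "?d * (r ^ 4 * q) * (a ^ 4)\<^sup>2 \<le> \<delta> ^ 4"
          using r q a(3) by simp
        show "0 < sqrt (variance W)" using var by simp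
      qed (rule mom(1) sg \<phi> A24 A2 \<delta>)+
    qed
    then show ?thesis unfolding sq .
  qed
  have fin: "d_TV M W M' Z \<le> 4 * A2 / variance W"
  proof (rule field_le_epsilon)
    fix \<epsilon> :: real assume "0 < \<epsilon>"
    \<comment> \<open>This value of \<delta> contributes exactly \<epsilon> after multiplication by
      4 and division by the variance.\<close>
    then have "d_TV M W M' Z \<le> 4 * (\<epsilon> * variance W / 4 + A2) / variance W" using var by (intro bound) simp
    also have "\<dots> = 4 * A2 / variance W + \<epsilon>" using var by (simp add: field_simps)
    finally show "d_TV M W M' Z \<le> 4 * A2 / variance W + \<epsilon>" .
  qed
  have r3: "r ^ 3 = onorm ((*v) \<Sigma>) powr (3/2)"
  proof -
    have "r ^ 3 = (onorm ((*v) \<Sigma>) powr (1/2)) powr (real 3)"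
      using pos r by (simp only: powr_realpow r_def powr_half_sqrt[OF less_imp_le[OF pos]])
    also have "\<dots> = onorm ((*v) \<Sigma>) powr (1/2 * real 3)" by (rule powr_powr)
    finally show ?thesis by simp
  qed
  have "4 * A2 / variance W = 16 / variance W * (onorm ((*v) \<Sigma>) powr (3/2) * a * b * n / N powr (3/2))"
    unfolding A2_def r3 by simp
  with fin show "d_TV M W M' Z \<le> 16 / variance W * (onorm ((*v) \<Sigma>) powr (3/2) * a * b * real CARD('n) / real CARD('N) powr (3/2))"
    unfolding n_def N_def by (simp only:)
qed

end

text \<open>Strict positivity matters besides finiteness: in the extended reals zero times infinity
  is zero, so a vanishing factor could hide an infinite one.\<close>

lemma fourth_root_expectation_cases:
  assumes [measurable]: "G \<in> borel_measurable M" and G: "\<And>\<omega>. 0 \<le> G \<omega>" and nz: "\<not> (AE \<omega> in M. G \<omega> = 0)"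
  shows "fourth_root_expectation M G = \<top> \<or>
    (\<exists>r>0. fourth_root_expectation M G = ennreal r \<and> integrable M G \<and> (\<integral>\<omega>. G \<omega> \<partial>M) = r ^ 4)"
proof (cases "(\<integral>\<^sup>+\<omega>. ennreal (G \<omega>) \<partial>M) = \<infinity>")
  case True
  then show ?thesis by (simp add: fourth_root_expectation_def)
next
  case False
  have i: "integrable M G"
    using False G by (intro integrableI_nonneg) (auto simp: less_top)
  have e: "(\<integral>\<^sup>+\<omega>. ennreal (G \<omega>) \<partial>M) = ennreal (\<integral>\<omega>. G \<omega> \<partial>M)"
    by (rule nn_integral_eq_integral[OF i]) (simp add: G)
  have nn: "0 \<le> (\<integral>\<omega>. G \<omega> \<partial>M)" by (simp add: G)
  have "(\<integral>\<omega>. G \<omega> \<partial>M) \<noteq> 0" using integral_nonneg_eq_0_iff_AE[OF i] G nz by simp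
  with nn have pos: "0 < (\<integral>\<omega>. G \<omega> \<partial>M)" by simp
  have "fourth_root_expectation M G = ennreal (root 4 (\<integral>\<omega>. G \<omega> \<partial>M))"
    using False nn by (simp add: fourth_root_expectation_def e)
  moreover have "0 < root 4 (\<integral>\<omega>. G \<omega> \<partial>M)" using pos by simp
  moreover have "(\<integral>\<omega>. G \<omega> \<partial>M) = root 4 (\<integral>\<omega>. G \<omega> \<partial>M) ^ 4" using nn by simp
  ultimately show ?thesis using i by blast
qed

text \<open>Zero variance makes \<open>W\<close> almost surely equal to its mean, and the normal law
  with this mean and variance zero is the same point mass.\<close>

lemma d_TV_eq_0:
  fixes W :: "'a \<Rightarrow> real" and Z :: "'b \<Rightarrow> real"
  assumes M: "prob_space M" "prob_space M'"
    and [measurable]: "W \<in> borel_measurable M" and W4: "integrable M (\<lambda>\<omega>. W \<omega> ^ 4)"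
    and Z: "normal_rv M' Z" "prob_space.expectation M' Z = prob_space.expectation M W"
      "prob_space.variance M' Z = prob_space.variance M W"
    and var: "prob_space.variance M W = 0"
  shows "d_TV M W M' Z = 0"
proof -
  interpret M: prob_space M by fact
  interpret M': prob_space M' by fact
  interpret S: prob_space std_normal_distribution by (rule prob_space_normal_density) simp
  have [measurable]: "Z \<in> borel_measurable M'" using Z(1) by (simp add: normal_rv_def)
  define m where "m = M.expectation W"
  have i2: "integrable M (\<lambda>\<omega>. (W \<omega>)\<^sup>2)"
    by (rule Bochner_Integration.integrable_bound[where f="\<lambda>\<omega>. 1 + W \<omega> ^ 4"])
       (use W4 square_le_1_power4 in \<open>auto intro!: AE_I2\<close>)
  have "integrable M (\<lambda>\<omega>. (W \<omega> - m)\<^sup>2)"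
    using i2 M.square_integrable_imp_integrable[OF _ i2] by (simp add: power2_diff)
  then have "AE \<omega> in M. (W \<omega> - m)\<^sup>2 = 0"
    using var by (subst integral_nonneg_eq_0_iff_AE[symmetric]) (auto simp: m_def)
  then have "AE \<omega> in M. W \<omega> = m" by simp
  then have lW: "distr M borel W = distr M borel (\<lambda>_. m)" by (intro distr_cong_AE) auto
  have lZ: "distr M' borel Z = distr std_normal_distribution borel (\<lambda>_. m)"
    using normal_rv_law(1)[OF M(2) Z(1)] unfolding Z(3) var unfolding Z(2) m_def by simp
  have "\<bar>measure M (W -` B \<inter> space M) - measure M' (Z -` B \<inter> space M')\<bar> = 0" if B: "B \<in> sets borel" for B
  proof -
    have "measure M (W -` B \<inter> space M) = measure (distr M borel W) B" using B by (simp add: measure_distr)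
    also have "\<dots> = indicator B m"
      unfolding lW using B by (subst measure_distr) (auto simp: M.prob_space indicator_def)
    also have "\<dots> = measure (distr std_normal_distribution borel (\<lambda>_. m)) B"
      using B S.prob_space by (subst measure_distr) (auto simp: indicator_def)
    also have "\<dots> = measure M' (Z -` B \<inter> space M')" unfolding lZ[symmetric] using B by (simp add: measure_distr)
    finally show ?thesis by simp
  qed
  then have "d_TV M W M' Z = (SUP B\<in>sets (borel :: real measure). 0)"
    unfolding d_TV_def by (intro SUP_cong) auto
  then show ?thesis using sets.sigma_sets_eq by (simp add: cSUP_const[OF sets.empty_sets[THEN ex_in_conv[THEN iffD1, OF exI]]])
qed

lemma sixteen_le_8_sqrt5: "16 \<le> 8 * sqrt (5::real)"
  using real_le_rsqrt[of 2 5] by simp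

text \<open>If \<open>a\<close> or \<open>b\<close> is infinite the right side is infinite, because
  no other factor is zero. Otherwise the real inequality is read in the extended reals, with 16
  raised to \<open>8 * sqrt 5\<close>.\<close>

lemma ennreal_bound_independent:
  fixes a b :: ennreal
  assumes pos: "0 < v" "0 < c" "0 < k" "0 < p" "0 < q" "0 < n" "0 < m"
    and a: "a = \<top> \<or> (\<exists>r>0. a = ennreal r \<and> A r)" and b: "b = \<top> \<or> (\<exists>s>0. b = ennreal s \<and> B s)"
    and bound: "\<And>r s. 0 < r \<Longrightarrow> 0 < s \<Longrightarrow> A r \<Longrightarrow> B s \<Longrightarrow> d \<le> 16 / v * (c * r\<^sup>2 * p / q + k * r * s * n / m)"
  shows "ennreal d \<le> ennreal (8 * sqrt 5) / ennreal v * (ennreal c * a\<^sup>2 * ennreal p / ennreal q + ennreal k * a * b * ennreal n / ennreal m)"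
proof (cases "a = \<top> \<or> b = \<top>")
  case True
  have nz: "a \<noteq> 0" "b \<noteq> 0" using a b by auto
  have "ennreal c * a\<^sup>2 * ennreal p / ennreal q + ennreal k * a * b * ennreal n / ennreal m = \<top>"
    using True nz pos by (auto simp: ennreal_mult_eq_top_iff ennreal_divide_eq_top_iff power_eq_top_ennreal)
  moreover have "ennreal (8 * sqrt 5) / ennreal v \<noteq> 0" using pos by (simp add: divide_ennreal)
  ultimately show ?thesis by (simp only: ennreal_mult_top) simp
next
  case False
  then obtain r s where r: "0 < r" "a = ennreal r" "A r" and s: "0 < s" "b = ennreal s" "B s" using a b by auto
  have "d \<le> 16 / v * (c * r\<^sup>2 * p / q + k * r * s * n / m)" by (rule bound[OF r(1) s(1) r(3) s(3)])
  also have "\<dots> \<le> 8 * sqrt 5 / v * (c * r\<^sup>2 * p / q + k * r * s * n / m)"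
    using pos r(1) s(1) by (intro mult_right_mono divide_right_mono sixteen_le_8_sqrt5 add_nonneg_nonneg) auto
  finally have "ennreal d \<le> ennreal (8 * sqrt 5 / v * (c * r\<^sup>2 * p / q + k * r * s * n / m))" by (rule ennreal_leI)
  also have "\<dots> = ennreal (8 * sqrt 5) / ennreal v * (ennreal c * a\<^sup>2 * ennreal p / ennreal q + ennreal k * a * b * ennreal n / ennreal m)"
    unfolding r(2) s(2) using pos r(1) s(1)
    by (simp add: divide_ennreal ennreal_mult[symmetric] ennreal_power ennreal_plus[symmetric] del: ennreal_plus)
  finally show ?thesis .
qed

lemma ennreal_bound_gaussian:
  fixes a b :: ennreal
  assumes pos: "0 < v" "0 < k" "0 < n" "0 < m"
    and a: "a = \<top> \<or> (\<exists>r>0. a = ennreal r \<and> A r)" and b: "b = \<top> \<or> (\<exists>s>0. b = ennreal s \<and> B s)"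
    and bound: "\<And>r s. 0 < r \<Longrightarrow> 0 < s \<Longrightarrow> A r \<Longrightarrow> B s \<Longrightarrow> d \<le> 16 / v * (k * r * s * n / m)"
  shows "ennreal d \<le> ennreal (8 * sqrt 5) * ennreal k * a * b * ennreal n / (ennreal v * ennreal m)"
proof (cases "a = \<top> \<or> b = \<top>")
  case True
  have nz: "a \<noteq> 0" "b \<noteq> 0" using a b by auto
  have "ennreal (8 * sqrt 5) * ennreal k * a * b * ennreal n / (ennreal v * ennreal m) = \<top>"
    using True nz pos by (auto simp: ennreal_mult_eq_top_iff ennreal_divide_eq_top_iff ennreal_mult[symmetric])
  then show ?thesis by simp
next
  case False
  then obtain r s where r: "0 < r" "a = ennreal r" "A r" and s: "0 < s" "b = ennreal s" "B s" using a b by auto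
  have "d \<le> 16 / v * (k * r * s * n / m)" by (rule bound[OF r(1) s(1) r(3) s(3)])
  also have "\<dots> \<le> 8 * sqrt 5 / v * (k * r * s * n / m)"
    using pos r(1) s(1) by (intro mult_right_mono divide_right_mono sixteen_le_8_sqrt5) auto
  also have "\<dots> = 8 * sqrt 5 * k * r * s * n / (v * m)" by (simp add: mult_ac)
  finally have "ennreal d \<le> ennreal (8 * sqrt 5 * k * r * s * n / (v * m))" by (rule ennreal_leI)
  also have "\<dots> = ennreal (8 * sqrt 5) * ennreal k * a * b * ennreal n / (ennreal v * ennreal m)"
    unfolding r(2) s(2) using pos r(1) s(1) by (simp add: divide_ennreal ennreal_mult[symmetric])
  finally show ?thesis .
qed

context entire_coef
begin

text \<open>Where \<open>weight_a\<close> vanishes, so does the eigenvalue times the first series,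
  and \<open>trace_fun_constant_bound\<close> fixes the value of \<open>W\<close>; almost surely
  this contradicts the positive variance. Where \<open>weight_b\<close> vanishes, both of its
  nonnegative summands do, in particular the first series, and the first case applies.\<close>

lemma weights_not_AE_0:
  fixes X :: "'a \<Rightarrow> real^'N^'n"
  assumes "prob_space M" and X: "X \<in> borel_measurable M"
    and W: "W = (\<lambda>\<omega>. trace_fun (X \<omega>))" and var: "0 < prob_space.variance M W"
  shows "\<not> (AE \<omega> in M. weight_a (X \<omega>) = 0)" and "\<not> (AE \<omega> in M. weight_b (X \<omega>) = 0)"
proof -
  interpret prob_space M by fact
  show na: "\<not> (AE \<omega> in M. weight_a (X \<omega>) = 0)"
  proof
    assume "AE \<omega> in M. weight_a (X \<omega>) = 0"
    then have c: "AE \<omega> in M. W \<omega> = real CARD('n) * beta 0"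
    proof eventually_elim
      case (elim \<omega>)
      then have "top_eig (X \<omega>) * abs_series1 coef (top_eig (X \<omega>)) = 0" by (auto simp: weight_a_def)
      then have z: "real CARD('n) * top_eig (X \<omega>) * abs_series1 coef (top_eig (X \<omega>)) = 0" by auto
      have "\<bar>trace_fun (X \<omega>) - real CARD('n) * beta 0\<bar> \<le> 0"
        using trace_fun_constant_bound[of "X \<omega>"] unfolding z .
      then show ?case by (simp add: W)
    qed
    have mW: "W \<in> borel_measurable M"
      unfolding W by (rule measurable_compose[OF X borel_measurable_trace_fun])
    have e: "expectation W = expectation (\<lambda>_. real CARD('n) * beta 0)"
      using mW by (intro integral_cong_AE c) auto
    have "variance W = expectation (\<lambda>_. 0)"
    proof (intro integral_cong_AE)
      show "AE \<omega> in M. (W \<omega> - expectation W)\<^sup>2 = 0" using c unfolding e by eventually_elim (simp add: prob_space)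
    qed (use mW in auto)
    then show False using var by simp
  qed
  show "\<not> (AE \<omega> in M. weight_b (X \<omega>) = 0)"
  proof
    assume "AE \<omega> in M. weight_b (X \<omega>) = 0"
    then have "AE \<omega> in M. weight_a (X \<omega>) = 0"
    proof eventually_elim
      case (elim \<omega>)
      have "0 \<le> 2 * real CARD('n) powr (-1/2) * abs_series2 coef (top_eig (X \<omega>)) * top_eig (X \<omega>)"
        by (intro mult_nonneg_nonneg abs_series2_nonneg top_eig_nonneg) auto
      moreover have "0 \<le> abs_series1 coef (top_eig (X \<omega>))" by (intro abs_series1_nonneg top_eig_nonneg)
      moreover have "abs_series1 coef (top_eig (X \<omega>)) + 2 * real CARD('n) powr (-1/2) * abs_series2 coef (top_eig (X \<omega>)) * top_eig (X \<omega>) = 0"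
        using elim by (simp add: weight_b_def)
      ultimately have "abs_series1 coef (top_eig (X \<omega>)) = 0" by linarith
      then show ?case by (simp add: weight_a_def)
    qed
    then show False using na by simp
  qed
qed

end

text \<open>Convergence at the larger modulus \<open>\<bar>x\<bar> + 1\<close> yields absolute
  convergence at \<open>x\<close>.\<close>

lemma entire_coef_of_sums:
  assumes "\<And>z. (\<lambda>m. coef m * z ^ m) sums f z"
  shows "entire_coef coef"
proof
  fix x :: real
  have "summable (\<lambda>m. norm (coef m * complex_of_real x ^ m))"
    by (rule powser_insidea[of coef "complex_of_real (\<bar>x\<bar> + 1)"]) (auto intro: sums_summable[OF assms] simp del: of_real_add)
  then have "summable (\<lambda>m. norm (cmod (coef m) * x ^ m))" by (simp add: norm_mult norm_power abs_mult power_abs)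
  then show "summable (\<lambda>m. cmod (coef m) * x ^ m)" by (rule summable_norm_cancel)
qed

text \<open>\<open>a\<close> and \<open>b\<close> are extended reals so that infinite moments are
  covered. For variance zero the left side is 0, so the convention for division by zero has no
  influence.\<close>

theorem proposition4p6:
  fixes M :: "'a measure" and M' :: "'b measure"
    and X :: "'a \<Rightarrow> real^'N^'n"
    and f :: "complex \<Rightarrow> complex" and coef :: "nat \<Rightarrow> complex"
    and Z :: "'b \<Rightarrow> real"
    and n N \<sigma>2 :: real and A :: "'a \<Rightarrow> real^'n^'n"
    and lam W :: "'a \<Rightarrow> real" and f1 f2 :: "real \<Rightarrow> real" and a b :: ennreal
  defines "n \<equiv> real CARD('n)" and "N \<equiv> real CARD('N)"
    and "A \<equiv> \<lambda>\<omega>. (1 / N) *\<^sub>R (X \<omega> ** transpose (X \<omega>))"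
    and "lam \<equiv> \<lambda>\<omega>. largest_eigenvalue (A \<omega>)"
    and "f1 \<equiv> abs_series1 coef" and "f2 \<equiv> abs_series2 coef"
    and "a \<equiv> fourth_root_expectation M (\<lambda>\<omega>. f1 (lam \<omega>) ^ 4 * (lam \<omega>)\<^sup>2)"
    and "b \<equiv> fourth_root_expectation M
               (\<lambda>\<omega>. (f1 (lam \<omega>) + 2 * n powr (-1/2) * f2 (lam \<omega>) * lam \<omega>) ^ 4)"
    and "W \<equiv> \<lambda>\<omega>. Re (trace (matrix_series coef (map_matrix complex_of_real (A \<omega>))))"
    and "\<sigma>2 \<equiv> prob_space.variance M W"
  assumes "prob_space M" and "prob_space M'"
    and "CARD('n) \<le> CARD('N)"
    and "f holomorphic_on UNIV" and "\<And>z. (\<lambda>m. coef m * z ^ m) sums f z"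
    and "integrable M (\<lambda>\<omega>. W \<omega> ^ 4)"
    and "normal_rv M' Z"
    and "prob_space.expectation M' Z = prob_space.expectation M W"
    and "prob_space.variance M' Z = \<sigma>2"
  shows
    "(\<forall>c1 c2. c1 > 0 \<and> c2 > 0 \<and>
        prob_space.indep_vars M (\<lambda>_. borel) (\<lambda>(i, j) \<omega>. X \<omega> $ i $ j) UNIV \<and>
        (\<forall>i j. distr M borel (\<lambda>\<omega>. X \<omega> $ i $ j) \<in> law_class c1 c2)
      \<longrightarrow> ennreal (d_TV M W M' Z) \<le> ennreal (8 * sqrt 5) / ennreal \<sigma>2 *
            (ennreal (c1 * c2) * a\<^sup>2 * ennreal (sqrt n) / ennreal N +
             ennreal (c1 ^ 3) * a * b * ennreal n / ennreal (N powr (3/2)))) \<and>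
     (\<forall>\<Sigma> :: real^('n \<times> 'N)^('n \<times> 'N).
        jointly_gaussian M (\<lambda>(i, j) \<omega>. X \<omega> $ i $ j) \<and>
        (\<forall>i j. prob_space.expectation M (\<lambda>\<omega>. X \<omega> $ i $ j) = 0) \<and>
        (\<forall>i j k l. \<Sigma> $ (i, j) $ (k, l) =
            covariance M (\<lambda>\<omega>. X \<omega> $ i $ j) (\<lambda>\<omega>. X \<omega> $ k $ l))
      \<longrightarrow> ennreal (d_TV M W M' Z) \<le>
            ennreal (8 * sqrt 5) * ennreal (onorm ((*v) \<Sigma>) powr (3/2)) * a * b * ennreal n
              / (ennreal \<sigma>2 * ennreal (N powr (3/2))))"
proof -
  interpret prob_space M by fact
  interpret entire_coef coef by (rule entire_coef_of_sums) fact
  have Am: "A \<omega> = wishart (X \<omega>)" for \<omega> by (simp only: A_def N_def wishart_def)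
  have W: "W = (\<lambda>\<omega>. trace_fun (X \<omega>))" unfolding W_def Am trace_matrix_series ..
  have ab: "a = fourth_root_expectation M (\<lambda>\<omega>. weight_a (X \<omega>))" "b = fourth_root_expectation M (\<lambda>\<omega>. weight_b (X \<omega>))"
    by (simp_all only: a_def b_def f1_def f2_def lam_def Am n_def weight_a_def weight_b_def top_eig_def)
  have pos: "0 < n" "0 < N" "0 < sqrt n" "0 < N powr (3/2)" by (auto simp: n_def N_def)
  note W4 = \<open>integrable M (\<lambda>\<omega>. W \<omega> ^ 4)\<close>
  note Z = \<open>normal_rv M' Z\<close> \<open>prob_space.expectation M' Z = expectation W\<close>
    \<open>prob_space.variance M' Z = \<sigma>2\<close>[unfolded \<sigma>2_def]
  note M = \<open>prob_space M\<close> \<open>prob_space M'\<close>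
  let ?A = "\<lambda>r. integrable M (\<lambda>\<omega>. weight_a (X \<omega>)) \<and> (\<integral>\<omega>. weight_a (X \<omega>) \<partial>M) = r ^ 4"
  let ?B = "\<lambda>s. integrable M (\<lambda>\<omega>. weight_b (X \<omega>)) \<and> (\<integral>\<omega>. weight_b (X \<omega>) \<partial>M) = s ^ 4"
  let ?H = "0 < variance W \<and> (a = \<top> \<or> (\<exists>r>0. a = ennreal r \<and> ?A r)) \<and> (b = \<top> \<or> (\<exists>s>0. b = ennreal s \<and> ?B s))"
  \<comment> \<open>Either the distance vanishes and the bound is trivial, or the variance is
    positive and \<open>a\<close> and \<open>b\<close> are each infinite or a positive real with the
    moment identity that the real estimates use.\<close>
  have dich: "d_TV M W M' Z = 0 \<or> ?H"
    if X: "X \<in> borel_measurable M"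
  proof (cases "variance W = 0")
    case True
    have "W \<in> borel_measurable M" unfolding W by (rule measurable_compose[OF X borel_measurable_trace_fun])
    then show ?thesis using d_TV_eq_0[OF M _ W4 Z True] by simp
  next
    case False
    moreover have "0 \<le> variance W" by simp
    ultimately have v: "0 < variance W" by linarith
    note m = measurable_compose[OF X borel_measurable_weights(1)] measurable_compose[OF X borel_measurable_weights(2)]
    show ?thesis
      unfolding ab using v fourth_root_expectation_cases[OF m(1) weights_nonneg(1) weights_not_AE_0(1)[OF M(1) X W v]]
        fourth_root_expectation_cases[OF m(2) weights_nonneg(2) weights_not_AE_0(2)[OF M(1) X W v]] by blast
  qed
  show ?thesis
  proof (intro conjI allI impI; elim conjE)
    fix c1 c2 :: real
    assume c: "0 < c1" "0 < c2" and ind: "indep_vars (\<lambda>_. borel) (\<lambda>(i, j) \<omega>. X \<omega> $ i $ j) UNIV"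
      and law: "\<forall>i j. distr M borel (\<lambda>\<omega>. X \<omega> $ i $ j) \<in> law_class c1 c2"
    have X: "X \<in> borel_measurable M"
    proof (rule borel_measurable_matrix)
      show "(\<lambda>\<omega>. X \<omega> $ i $ j) \<in> borel_measurable M" for i j
        using ind unfolding indep_vars_def by (auto dest: bspec[of _ _ "(i, j)"])
    qed
    show "ennreal (d_TV M W M' Z) \<le> ennreal (8 * sqrt 5) / ennreal \<sigma>2 *
            (ennreal (c1 * c2) * a\<^sup>2 * ennreal (sqrt n) / ennreal N +
             ennreal (c1 ^ 3) * a * b * ennreal n / ennreal (N powr (3/2)))"
    proof (rule disjE[OF dich[OF X]])
      assume h: ?H
      have cc: "0 < c1 * c2" "0 < c1 ^ 3" using c by simp_all
      show ?thesis
      proof (rule ennreal_bound_independent[OF _ cc pos(3,2,1,4) h[THEN conjunct2, THEN conjunct1] h[THEN conjunct2, THEN conjunct2]])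
        show "0 < \<sigma>2" using h by (simp only: \<sigma>2_def)
        fix r s :: real
        assume "0 < r" "0 < s" "?A r" "?B s"
        then show "d_TV M W M' Z \<le> 16 / \<sigma>2 * (c1 * c2 * r\<^sup>2 * sqrt n / N + c1 ^ 3 * r * s * n / N powr (3/2))"
          unfolding \<sigma>2_def n_def N_def
          using d_TV_independent[OF M ind law[rule_format] c W W4 Z conjunct1[OF h]] by blast
      qed
    qed simp
  next
    fix \<Sigma> :: "real^('n \<times> 'N)^('n \<times> 'N)"
    assume G: "jointly_gaussian M (\<lambda>(i, j) \<omega>. X \<omega> $ i $ j)"
      and mean: "\<forall>i j. expectation (\<lambda>\<omega>. X \<omega> $ i $ j) = 0"
      and cov: "\<forall>i j k l. \<Sigma> $ (i, j) $ (k, l) = covariance M (\<lambda>\<omega>. X \<omega> $ i $ j) (\<lambda>\<omega>. X \<omega> $ k $ l)"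
    note gauss = M(1) G mean[rule_format] cov[rule_format]
    note X = law_gaussian_matrix(1)[OF gauss]
    show "ennreal (d_TV M W M' Z) \<le> ennreal (8 * sqrt 5) * ennreal (onorm ((*v) \<Sigma>) powr (3/2)) * a * b * ennreal n
              / (ennreal \<sigma>2 * ennreal (N powr (3/2)))"
    proof (rule disjE[OF dich[OF X]])
      assume h: ?H
      have k: "0 < onorm ((*v) \<Sigma>) powr (3/2)"
        using onorm_covariance_pos[OF gauss W W4 conjunct1[OF h]] by simp
      show ?thesis
      proof (rule ennreal_bound_gaussian[OF _ k pos(1,4) h[THEN conjunct2, THEN conjunct1] h[THEN conjunct2, THEN conjunct2]])
        show "0 < \<sigma>2" using h by (simp only: \<sigma>2_def)
        fix r s :: real
        assume "0 < r" "0 < s" "?A r" "?B s"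
        then show "d_TV M W M' Z \<le> 16 / \<sigma>2 * (onorm ((*v) \<Sigma>) powr (3/2) * r * s * n / N powr (3/2))"
          unfolding \<sigma>2_def n_def N_def
          using d_TV_gaussian[OF M gauss(2-4) W W4 Z conjunct1[OF h]] by blast
      qed
    qed simp
  qed
qed

end
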